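(* Let $U,V$ be two Jordan domains of $\mathbf{R}^2$ and let $f:\bar U\to\bar V$ be the homeomorphic extension of a biholomorphic mapping from $U$ to $V$. Then the Dirichlet forms $(\frac12\mathbf{D}_U,H^1(U))$ on $L^2(\bar U)$ and $(\frac12\mathbf{D}_V,H^1(V))$ on $L^2(\bar V)$ of the reflecting Brownian motions on $\bar U$ and $\bar V$ have the same structure of regular subspaces with respect to $f$ and time change: writing $T$ for the spatial transformation by $f$ followed by the time change to Lebesgue measure on $V$, for every regular subspace $(\mathcal{E}'_V,\mathcal{F}'_V)$ of $(\frac12\mathbf{D}_V,H^1(V))$ there exists a unique regular subspace $(\mathcal{E}'_U,\mathcal{F}'_U)$ of $(\frac12\mathbf{D}_U,H^1(U))$ such that $(\mathcal{E}'_V,\mathcal{F}'_V)=T(\mathcal{E}'_U,\mathcal{F}'_U)$. In particular, the associated Dirichlet form of the reflecting Brownian motion on any Jordan domain has a proper regular subspace.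
   Context: A Jordan domain is a simply connected planar domain whose boundary is a non-self-intersecting continuous loop in the plane; a biholomorphic map between Jordan domains extends to a homeomorphism of the closures. For regular Dirichlet forms on the same $L^2$ space, $(\mathcal{E}',\mathcal{F}')$ is a regular subspace of $(\mathcal{E},\mathcal{F})$ if $\mathcal{F}'\subset\mathcal{F}$ and $\mathcal{E}=\mathcal{E}'$ on $\mathcal{F}'\times\mathcal{F}'$; it is proper if $\mathcal{F}'\neq\mathcal{F}$. (Regular: $\mathcal{F}\cap C_\mathrm{c}$ is dense in $\mathcal{F}$ in the norm $(\mathcal{E}(u,u)+\|u\|_{L^2}^2)^{1/2}$ and uniformly dense in $C_\mathrm{c}$.) $H^1(U)=\{u\in L^2(U):\int_U|\nabla u|^2dx<\infty\}$, $\mathbf{D}_U(u,v)=\int_U\nabla u\cdot\nabla v\,dx$. $L^2(\bar U)$ is taken with respect to $m_U:=1_U\,dx$ on $\bar U$; for Jordan domains $(\frac12\mathbf{D}_U,H^1(U))$ is a regular Dirichlet form on $L^2(\bar U)$, whose Hunt process is reflecting Brownian motion on $\bar U$; likewise for $V$. Spatial transformation: for a regular Dirichlet form $(\mathcal{E},\mathcal{F})$ on $L^2(\bar U,m_U)$, $f(\mathcal{E},\mathcal{F})=(\hat{\mathcal{E}},\hat{\mathcal{F}})$ on $L^2(\bar V,\hat m)$, $\hat m=m_U\circ f^{-1}$, is given by $\hat{\mathcal{F}}=\{\hat u\in L^2(\bar V,\hat m):\hat u\circ f\in\mathcal{F}\}$, $\hat{\mathcal{E}}(\hat u,\hat v)=\mathcal{E}(\hat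 u\circ f,\hat v\circ f)$. Time change: $T(\mathcal{E},\mathcal{F})$ is the form on $L^2(\bar V,m_V)$ with domain $\hat{\mathcal{F}}_\mathrm{e}\cap L^2(\bar V,m_V)$ and form $\hat{\mathcal{E}}$, where $\hat{\mathcal{F}}_\mathrm{e}$ is the extended Dirichlet space (a.e. finite functions that are a.e. limits of $\hat{\mathcal{E}}$-Cauchy sequences in $\hat{\mathcal{F}}$, with $\hat{\mathcal{E}}$ extended to it). By conformal invariance, $T(\frac12\mathbf{D}_U,H^1(U))=(\frac12\mathbf{D}_V,H^1(V))$. *)

theory Defs
  imports "HOL-Analysis.Analysis"
begin

text \<open>Boundedness is not imposed: the exterior of a Jordan curve is not simply connected in the
  plane, and a nonempty boundary excludes the empty set and the whole plane.\<close>

definition jordan_domain :: "complex set \<Rightarrow> bool" where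
  "jordan_domain U \<longleftrightarrow>
     open U \<and> connected U \<and> simply_connected U \<and>
     (\<exists>\<gamma>. simple_path \<gamma> \<and> pathfinish \<gamma> = pathstart \<gamma> \<and> path_image \<gamma> = frontier U)"

definition biholomorphic_closure_homeo ::
    "complex set \<Rightarrow> complex set \<Rightarrow> (complex \<Rightarrow> complex) \<Rightarrow> bool" where
  "biholomorphic_closure_homeo U V f \<longleftrightarrow>
     (\<exists>g. homeomorphism (closure U) (closure V) f g \<and> f ` U = V \<and>
          f holomorphic_on U \<and> g holomorphic_on V)"

definition L2 :: "'a measure \<Rightarrow> ('a \<Rightarrow> real) set" where
  "L2 M = {u \<in> borel_measurable M. integrable M (\<lambda>x. (u x)\<^sup>2)}"

definition L2_normsq :: "'a measure \<Rightarrow> ('a \<Rightarrow> real) \<Rightarrow> real" where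
  "L2_normsq M u = (\<integral>x. (u x)\<^sup>2 \<partial>M)"

text \<open>A form is a pair of a bilinear form and its domain.  Elements of \<open>L\<^sup>2\<close> are represented by
  functions, and a domain contains all representatives of its elements (see \<open>ae_invariant\<close> below).
  So that equality of pairs is equality of forms, the bilinear form takes the value
  \<^const>\<open>undefined\<close> off its domain.\<close>

type_synonym 'a form = "(('a \<Rightarrow> real) \<Rightarrow> ('a \<Rightarrow> real) \<Rightarrow> real) \<times> ('a \<Rightarrow> real) set"

definition form_on :: "(('a \<Rightarrow> real) \<Rightarrow> ('a \<Rightarrow> real) \<Rightarrow> real) \<Rightarrow> ('a \<Rightarrow> real) set \<Rightarrow> 'a form" where
  "form_on E F = ((\<lambda>u v. if u \<in> F \<and> v \<in> F then E u v else undefined), F)"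

definition ae_invariant :: "'a measure \<Rightarrow> 'a form \<Rightarrow> bool" where
  "ae_invariant M = (\<lambda>(E, F).
     (\<forall>u\<in>F. \<forall>v\<in>borel_measurable M. (AE x in M. u x = v x) \<longrightarrow>
        v \<in> F \<and> (\<forall>w\<in>F. E u w = E v w)))"

definition symmetric_form :: "'a measure \<Rightarrow> 'a form \<Rightarrow> bool" where
  "symmetric_form M = (\<lambda>(E, F).
     F \<subseteq> L2 M \<and> ae_invariant M (E, F) \<and> form_on E F = (E, F) \<and>
     (\<forall>u\<in>F. \<forall>v\<in>F. \<forall>a b. (\<lambda>x. a * u x + b * v x) \<in> F) \<and>
     (\<forall>u\<in>L2 M. \<forall>\<epsilon>>0. \<exists>v\<in>F. L2_normsq M (\<lambda>x. u x - v x) < \<epsilon>) \<and>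
     (\<forall>u\<in>F. \<forall>v\<in>F. \<forall>w\<in>F. \<forall>a b. E (\<lambda>x. a * u x + b * v x) w = a * E u w + b * E v w) \<and>
     (\<forall>u\<in>F. \<forall>v\<in>F. E u v = E v u) \<and>
     (\<forall>u\<in>F. 0 \<le> E u u))"

definition form1 ::
    "'a measure \<Rightarrow> (('a \<Rightarrow> real) \<Rightarrow> ('a \<Rightarrow> real) \<Rightarrow> real) \<Rightarrow> ('a \<Rightarrow> real) \<Rightarrow> real" where
  "form1 M E u = E u u + L2_normsq M u"

definition seq_Cauchy_for :: "(('a \<Rightarrow> real) \<Rightarrow> real) \<Rightarrow> (nat \<Rightarrow> 'a \<Rightarrow> real) \<Rightarrow> bool" where
  "seq_Cauchy_for Q us \<longleftrightarrow>
     (\<forall>\<epsilon>>0. \<exists>N. \<forall>m\<ge>N. \<forall>n\<ge>N. Q (\<lambda>x. us m x - us n x) < \<epsilon>)"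

definition closed_form :: "'a measure \<Rightarrow> 'a form \<Rightarrow> bool" where
  "closed_form M = (\<lambda>(E, F).
     \<forall>us. (\<forall>n. us n \<in> F) \<and> seq_Cauchy_for (form1 M E) us \<longrightarrow>
       (\<exists>u\<in>F. (\<lambda>n. form1 M E (\<lambda>x. us n x - u x)) \<longlonglongrightarrow> 0))"

definition markovian :: "'a form \<Rightarrow> bool" where
  "markovian = (\<lambda>(E, F).
     \<forall>u\<in>F. let v = (\<lambda>x. min (max 0 (u x)) 1) in v \<in> F \<and> E v v \<le> E u u)"

definition dirichlet_form :: "'a measure \<Rightarrow> 'a form \<Rightarrow> bool" where
  "dirichlet_form M P \<longleftrightarrow> symmetric_form M P \<and> closed_form M P \<and> markovian P"

definition Cc :: "'a::topological_space set \<Rightarrow> ('a \<Rightarrow> real) set" where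
  "Cc X = {u. continuous_on X u \<and> (\<exists>K\<subseteq>X. compact K \<and> (\<forall>x\<in>X - K. u x = 0))}"

text \<open>The state space is \<^term>\<open>space M\<close> with the subspace topology.\<close>

definition regular_dirichlet_form :: "'a::topological_space measure \<Rightarrow> 'a form \<Rightarrow> bool" where
  "regular_dirichlet_form M P \<longleftrightarrow> dirichlet_form M P \<and>
     (case P of (E, F) \<Rightarrow>
       (\<forall>u\<in>F. \<forall>\<epsilon>>0. \<exists>v\<in>F \<inter> Cc (space M). form1 M E (\<lambda>x. u x - v x) < \<epsilon>) \<and>
       (\<forall>w\<in>Cc (space M). \<forall>\<epsilon>>0. \<exists>v\<in>F \<inter> Cc (space M). \<forall>x\<in>space M. \<bar>w x - v x\<bar> < \<epsilon>))"

definition regular_subspace ::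
    "'a::topological_space measure \<Rightarrow> 'a form \<Rightarrow> 'a form \<Rightarrow> bool" where
  "regular_subspace M P' P \<longleftrightarrow>
     regular_dirichlet_form M P' \<and> regular_dirichlet_form M P \<and>
     snd P' \<subseteq> snd P \<and> (\<forall>u\<in>snd P'. \<forall>v\<in>snd P'. fst P u v = fst P' u v)"

definition proper_regular_subspace ::
    "'a::topological_space measure \<Rightarrow> 'a form \<Rightarrow> 'a form \<Rightarrow> bool" where
  "proper_regular_subspace M P' P \<longleftrightarrow> regular_subspace M P' P \<and> snd P' \<noteq> snd P"

text \<open>The measure \<open>N\<close> only supplies the target measurable space; the transformed form lives on
  \<^term>\<open>L2 (distr M N f)\<close>.\<close>

definition spatial_transform ::
    "'a measure \<Rightarrow> 'b measure \<Rightarrow> ('a \<Rightarrow> 'b) \<Rightarrow> 'a form \<Rightarrow> 'b form" where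
  "spatial_transform M N f = (\<lambda>(E, F).
     form_on (\<lambda>u v. E (u \<circ> f) (v \<circ> f)) {u \<in> L2 (distr M N f). u \<circ> f \<in> F})"

definition approximating :: "'a measure \<Rightarrow> 'a form \<Rightarrow> (nat \<Rightarrow> 'a \<Rightarrow> real) \<Rightarrow> ('a \<Rightarrow> real) \<Rightarrow> bool" where
  "approximating M = (\<lambda>(E, F) us u.
     (\<forall>n. us n \<in> F) \<and> seq_Cauchy_for (\<lambda>w. E w w) us \<and>
     (AE x in M. (\<lambda>n. us n x) \<longlonglongrightarrow> u x))"

definition extended_space :: "'a measure \<Rightarrow> 'a form \<Rightarrow> ('a \<Rightarrow> real) set" where
  "extended_space M P = {u \<in> borel_measurable M. \<exists>us. approximating M P us u}"

text \<open>The limit exists and does not depend on the approximating sequences when \<open>P\<close> is a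
  Dirichlet form.\<close>

definition extended_form :: "'a measure \<Rightarrow> 'a form \<Rightarrow> ('a \<Rightarrow> real) \<Rightarrow> ('a \<Rightarrow> real) \<Rightarrow> real" where
  "extended_form M P u v = (THE l. \<forall>us vs. approximating M P us u \<and> approximating M P vs v \<longrightarrow>
     (\<lambda>n. fst P (us n) (vs n)) \<longlonglongrightarrow> l)"

definition time_change :: "'a measure \<Rightarrow> 'a measure \<Rightarrow> 'a form \<Rightarrow> 'a form" where
  "time_change M N P = form_on (extended_form M P) (extended_space M P \<inter> L2 N)"

text \<open>The measure \<open>m\<^sub>U = 1\<^sub>U dx\<close> on the Borel sets of the closure of \<open>U\<close>.  It does not
  charge the boundary, even if the boundary has positive area.\<close>

definition refl_measure :: "complex set \<Rightarrow> complex measure" where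
  "refl_measure U = restrict_space (density lborel (indicator U)) (closure U)"

primrec Ck :: "nat \<Rightarrow> ('a::euclidean_space \<Rightarrow> real) \<Rightarrow> bool" where
  "Ck 0 \<phi> \<longleftrightarrow> continuous_on UNIV \<phi>"
| "Ck (Suc k) \<phi> \<longleftrightarrow> (\<forall>x. \<phi> differentiable (at x)) \<and>
     (\<forall>e\<in>Basis. Ck k (\<lambda>x. frechet_derivative \<phi> (at x) e))"

definition test_function :: "'a::euclidean_space set \<Rightarrow> ('a \<Rightarrow> real) \<Rightarrow> bool" where
  "test_function U \<phi> \<longleftrightarrow>
     (\<forall>k. Ck k \<phi>) \<and> compact (closure {x. \<phi> x \<noteq> 0}) \<and> closure {x. \<phi> x \<noteq> 0} \<subseteq> U"

definition locally_integrable ::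
    "'a::euclidean_space set \<Rightarrow> ('a \<Rightarrow> 'b::euclidean_space) \<Rightarrow> bool" where
  "locally_integrable U g \<longleftrightarrow> (\<forall>K\<subseteq>U. compact K \<longrightarrow> set_integrable lborel K g)"

definition is_weak_gradient ::
    "'a::euclidean_space set \<Rightarrow> ('a \<Rightarrow> real) \<Rightarrow> ('a \<Rightarrow> 'a) \<Rightarrow> bool" where
  "is_weak_gradient U u g \<longleftrightarrow> locally_integrable U u \<and> locally_integrable U g \<and>
     (\<forall>\<phi> e. test_function U \<phi> \<and> e \<in> Basis \<longrightarrow>
        (LBINT x:U. u x * frechet_derivative \<phi> (at x) e) = - (LBINT x:U. (g x \<bullet> e) * \<phi> x))"

text \<open>Weak gradients are unique up to null sets, so the choice does not affect integrals.\<close>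

definition weak_gradient ::
    "'a::euclidean_space set \<Rightarrow> ('a \<Rightarrow> real) \<Rightarrow> 'a \<Rightarrow> 'a" where
  "weak_gradient U u = (SOME g. is_weak_gradient U u g)"

definition H1 :: "complex set \<Rightarrow> (complex \<Rightarrow> real) set" where
  "H1 U = {u \<in> L2 (refl_measure U). \<exists>g. is_weak_gradient U u g \<and>
     set_integrable lborel U (\<lambda>x. (norm (g x))\<^sup>2)}"

definition dirichlet_integral ::
    "complex set \<Rightarrow> (complex \<Rightarrow> real) \<Rightarrow> (complex \<Rightarrow> real) \<Rightarrow> real" where
  "dirichlet_integral U u v = (LBINT x:U. weak_gradient U u x \<bullet> weak_gradient U v x)"

definition refl_BM_form :: "complex set \<Rightarrow> complex form" where
  "refl_BM_form U = form_on (\<lambda>u v. 1/2 * dirichlet_integral U u v) (H1 U)"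

definition conformal_transform ::
    "complex set \<Rightarrow> complex set \<Rightarrow> (complex \<Rightarrow> complex) \<Rightarrow> complex form \<Rightarrow> complex form" where
  "conformal_transform U V f P =
     time_change (distr (refl_measure U) (refl_measure V) f) (refl_measure V)
       (spatial_transform (refl_measure U) (refl_measure V) f P)"

end

theory Submission
  imports Defs "HOL-Complex_Analysis.Complex_Analysis"
begin

text \<open>
  A conformal map preserves Dirichlet integrals, so the transform of a regular subspace is the
  \<open>H\<^sup>1\<close>-closure of the continuous functions on \<^term>\<open>closure V\<close> whose composition with \<^term>\<open>f\<close> lies
  in it: truncations of these functions recover every element of the extended space, by a Mazur
  argument. Transforming back along the inverse map recovers the continuous core of the original
  subspace, hence the subspace itself, so the two transforms are mutually inverse.

  The form on a Jordan domain is regular because the Riemann map onto the disc extends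
  continuously to the boundary (a length-area estimate, with Janiszewski's theorem giving local
  connectivity at boundary points): a bounded Sobolev function is carried to the disc, dilated,
  mollified past the boundary and carried back.

  For a proper regular subspace take an open \<open>G\<close> of small measure containing the rationals and
  the continuous functions whose first partial derivative vanishes where the first coordinate is
  not in \<open>G\<close>. They are uniformly dense by the Stone-Weierstrass theorem, as the primitive of the
  indicator of \<open>G\<close> is strictly increasing, while the first coordinate itself stays at positive
  distance from them.
\<close>

text \<open>On V the image of \<open>m_U\<close> under \<open>f\<close> and Lebesgue measure have
  the same null sets, but the density of one with respect to the other is in general unbounded near
  the boundary, so neither the L2 spaces nor H1 correspond under \<open>f\<close>. What corresponds
  is the Dirichlet integral, almost everywhere convergence, and continuity on the closures; as both
  domains are bounded, continuous functions on the closures are square integrable for either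
  measure. This is why form domains are handled through their continuous functions, and why
  membership in a closure is always reached by one criterion, \<open>clH_AE_limit\<close>: an almost
  everywhere limit of core functions with bounded energy lies in the closure of the core as soon as
  it is square integrable.

  The boundary of a Jordan domain can be so irregular that Sobolev functions do not extend across
  it. On the disc dilation takes the place of an extension, and the continuous map of the closure
  onto the closed disc brings the approximants back as continuous functions.\<close>

abbreviation "sint \<equiv> set_integrable lborel"

abbreviation "null_seq X \<equiv> X \<longlonglongrightarrow> 0"

abbreviation "bm f \<equiv> f \<in> borel_measurable borel"

abbreviation "nnl f \<equiv> nn_integral lborel f"

abbreviation "fd f x \<equiv> frechet_derivative f (at x)"

abbreviation "energy U u \<equiv> dirichlet_integral U u u"

section \<open>Mollifiers\<close>

primrec diff_times :: "nat => (real => real) => bool" where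
 "diff_times 0 f \<longleftrightarrow> True"
| "diff_times (Suc k) f \<longleftrightarrow> (\<forall>x. f field_differentiable (at x)) \<and> diff_times k (deriv f)"

definition smooth1 :: "(real => real) => bool" where
 "smooth1 f \<longleftrightarrow> (\<forall>k. diff_times k f)"

lemma diff_times_SucI:
 assumes "\<And>x. (f has_real_derivative f' x) (at x)" "diff_times k f'"
 shows "diff_times (Suc k) f"
proof -
 have "deriv f = f'" using assms(1) DERIV_imp_deriv by blast
 then show ?thesis using assms by (auto simp: field_differentiable_def)
qed

lemma diff_times_Suc_D: "diff_times (Suc k) f ==> diff_times k f" by (induction k arbitrary: f) auto

lemma diff_times_add:
 "diff_times k f ==> diff_times k g ==> diff_times k (%x. f x + g x)"
proof (induction k arbitrary: f g)
 case (Suc k)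
 show ?case
 proof (rule diff_times_SucI)
  show "((%x. f x + g x) has_real_derivative deriv f x + deriv g x) (at x)" for x
   using Suc.prems by (auto intro!: DERIV_add simp: DERIV_deriv_iff_field_differentiable)
  show "diff_times k (%x. deriv f x + deriv g x)" using Suc by auto
 qed
qed auto

lemma diff_times_mult:
 "diff_times k f ==> diff_times k g ==> diff_times k (%x. f x * g x)"
proof (induction k arbitrary: f g)
 case (Suc k)
 show ?case
 proof (rule diff_times_SucI)
  show "((%x. f x * g x) has_real_derivative f x * deriv g x + deriv f x * g x) (at x)" for x
   using Suc.prems by (auto intro!: DERIV_mult' simp: DERIV_deriv_iff_field_differentiable)
  show "diff_times k (%x. f x * deriv g x + deriv f x * g x)"
   using Suc diff_times_Suc_D[OF Suc.prems(1)] diff_times_Suc_D[OF Suc.prems(2)]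
   by (intro diff_times_add Suc.IH) auto
 qed
qed auto

lemma diff_times_const: "diff_times k (%x. c)"
proof (induction k arbitrary: c)
 case (Suc k)
 show ?case by (rule diff_times_SucI[of _ "%_. 0"]) (auto simp: Suc)
qed auto

lemma diff_times_affine: "diff_times k f ==> diff_times k (%x. f (a * x + b))"
proof (induction k arbitrary: f)
 case (Suc k)
 show ?case
 proof (rule diff_times_SucI)
  show "((%x. f (a * x + b)) has_real_derivative deriv f (a * x + b) * a) (at x)" for x
  proof -
   have "(f has_real_derivative deriv f (a * x + b)) (at (a * x + b))"
    using Suc.prems by (auto simp: DERIV_deriv_iff_field_differentiable)
   moreover have "((%x. a * x + b) has_real_derivative a) (at x)"
    by (auto intro!: derivative_eq_intros)
   ultimately show ?thesis by (rule DERIV_chain2)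
  qed
  show "diff_times k (%x. deriv f (a * x + b) * a)"
   using Suc by (intro diff_times_mult diff_times_const Suc.IH) auto
 qed
qed auto

lemma poly_div_exp_tendsto_0: "((%s::real. poly p s / exp s) \<longlongrightarrow> 0) at_top"
proof -
 \<comment> \<open>The extra power of \<open>s\<close> carries the induction: peeling off a
   coefficient multiplies the remaining polynomial by \<open>s\<close>.\<close>
 have "((%s::real. poly p s * s ^ n / exp s) \<longlongrightarrow> 0) at_top" for n
 proof (induction p arbitrary: n)
  case (pCons a p)
  have "((%s. a * (s ^ n / exp s) + poly p s * s ^ Suc n / exp s) \<longlongrightarrow> a * 0 + 0) at_top"
   by (intro tendsto_intros tendsto_power_div_exp_0 pCons.IH)
  then show ?case by (simp add: field_simps)
 qed auto
 from this[of 0] show ?thesis by simp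
qed

text \<open>For \<open>p = 1\<close> this is the standard function that is flat at 0. The polynomial
  in 1/t is there because all derivatives of that function stay in this class.\<close>

definition flat_fun :: "real poly => real => real" where
 "flat_fun p t = (if t > 0 then poly p (1/t) * exp (- (1/t)) else 0)"

text \<open>Put s = 1/t. Then ds/dt = - s^2, so p(s) exp(- s) has the derivative s^2 (p(s) - p'(s))
  exp(- s); \<open>[:0,0,1:]\<close> is the polynomial s^2.\<close>

lemma flat_fun_deriv:
 "(flat_fun p has_real_derivative flat_fun ([:0,0,1:] * (p - pderiv p)) t) (at t)"
proof -
 consider "t > 0" | "t < 0" | "t = 0" by linarith
 then show ?thesis
 proof cases
  case 1
  have "((%t. poly p (1/t) * exp (- (1/t))) has_real_derivative
    flat_fun ([:0,0,1:] * (p - pderiv p)) t) (at t)"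
   using 1 by (auto intro!: derivative_eq_intros DERIV_chain2[OF poly_DERIV]
     simp: flat_fun_def field_simps power2_eq_square)
  moreover have "\<forall>\<^sub>F s in nhds t. poly p (1/s) * exp (- (1/s)) = flat_fun p s"
   using 1 by (auto simp: eventually_nhds flat_fun_def intro!: exI[of _ "{0<..}"])
  ultimately show ?thesis by (subst (asm) DERIV_cong_ev[OF refl _ refl]) auto
 next
  case 2
  have "((%t. 0) has_real_derivative flat_fun ([:0,0,1:] * (p - pderiv p)) t) (at t)"
   using 2 by (auto simp: flat_fun_def)
  moreover have "\<forall>\<^sub>F s in nhds t. 0 = flat_fun p s"
   using 2 by (auto simp: eventually_nhds flat_fun_def intro!: exI[of _ "{..<0}"])
  ultimately show ?thesis by (subst (asm) DERIV_cong_ev[OF refl _ refl]) auto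
 next
  case 3
  have "((%s. flat_fun p s / s) \<longlongrightarrow> 0) (at_left 0)"
   by (rule tendsto_eventually) (auto simp: eventually_at_left_field flat_fun_def intro!: exI[of _ "-1"])
  \<comment> \<open>Replacing the variable by its inverse moves the right-hand limit at 0 to
    infinity, where the exponential beats the polynomial. The division by the variable becomes a
    factor, which turns \<open>p\<close> into \<open>pCons 0 p\<close>.\<close>
  moreover have "((%s. flat_fun p s / s) \<longlongrightarrow> 0) (at_right 0)"
  proof -
   have "\<forall>\<^sub>F s in at_top. poly (pCons 0 p) s / exp s = flat_fun p (inverse s) / inverse s"
    using eventually_gt_at_top[of 0]
    by eventually_elim (auto simp: flat_fun_def field_simps exp_minus)
   with poly_div_exp_tendsto_0[of "pCons 0 p"] show ?thesis
    unfolding filterlim_at_right_to_top by (rule Lim_transform_eventually)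
  qed
  ultimately have "((%s. flat_fun p s / s) \<longlongrightarrow> 0) (at 0)" by (rule filterlim_split_at)
  then show ?thesis using 3 by (simp add: has_field_derivative_iff flat_fun_def)
 qed
qed

lemma diff_times_flat_fun: "diff_times k (flat_fun p)"
proof (induction k arbitrary: p)
 case (Suc k)
 show ?case by (rule diff_times_SucI[OF flat_fun_deriv Suc])
qed auto

text \<open>The affine arguments are written out in the shape that \<open>diff_times_affine\<close>
  matches.\<close>

definition bump1 :: "real => real" where
 "bump1 t = flat_fun 1 (1 * t + 1) * flat_fun 1 ((-1) * t + 1)"

lemma smooth1_bump1: "smooth1 bump1" unfolding smooth1_def bump1_def[abs_def]
 by (intro allI diff_times_mult diff_times_affine diff_times_flat_fun)

lemma bump1_nonneg: "0 <= bump1 t" by (auto simp: bump1_def flat_fun_def)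

lemma bump1_eq_0: "\<bar>t\<bar> \<ge> 1 ==> bump1 t = 0" by (auto simp: bump1_def flat_fun_def)

lemma bump1_0: "bump1 0 > 0" by (auto simp: bump1_def flat_fun_def)

lemma smooth1_affine: "smooth1 f ==> smooth1 (%x. f (a * x + b))"
 by (auto simp: smooth1_def diff_times_affine)

lemma smooth1_cmult: "smooth1 f ==> smooth1 (%x. c * f x)"
 by (auto simp: smooth1_def diff_times_mult diff_times_const)

lemma smooth1_DERIV: "smooth1 f ==> (f has_real_derivative deriv f x) (at x)"
 using DERIV_deriv_iff_field_differentiable[of f x] unfolding smooth1_def by (metis diff_times.simps(2))

lemma smooth1_deriv: "smooth1 f ==> smooth1 (deriv f)" unfolding smooth1_def by (metis diff_times.simps(2))

lemma smooth_prod_has_derivative: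
 assumes "smooth1 a" "smooth1 b"
 shows "((%z. a (Re z) * b (Im z)) has_derivative
      (%h. Re h * (deriv a (Re z) * b (Im z)) + Im h * (a (Re z) * deriv b (Im z)))) (at z)"
proof -
 have 1: "((%z. a (Re z)) has_derivative (%h. deriv a (Re z) * Re h)) (at z)"
  using has_derivative_compose[OF bounded_linear_imp_has_derivative[OF bounded_linear_Re]
    smooth1_DERIV[OF assms(1), unfolded has_field_derivative_def]] .
 have 2: "((%z. b (Im z)) has_derivative (%h. deriv b (Im z) * Im h)) (at z)"
  using has_derivative_compose[OF bounded_linear_imp_has_derivative[OF bounded_linear_Im]
    smooth1_DERIV[OF assms(2), unfolded has_field_derivative_def]] .
 show ?thesis by (rule has_derivative_eq_rhs[OF has_derivative_mult[OF 1 2]]) (auto simp: algebra_simps)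
qed

text \<open>Each partial derivative of a product of a function of Re and a function of Im is again
  such a product, which closes the induction on the order.\<close>

lemma Ck_smooth_prod:
 "smooth1 a ==> smooth1 b ==> Ck k (%z. a (Re z) * b (Im z))"
proof (induction k arbitrary: a b)
 case 0
 then have "isCont (%z. a (Re z) * b (Im z)) z" for z
  using has_derivative_continuous[OF smooth_prod_has_derivative] by blast
 then show ?case by (simp add: continuous_at_imp_continuous_on)
next
 case (Suc k)
 have "fd (%z. a (Re z) * b (Im z)) z e =
   Re e * (deriv a (Re z) * b (Im z)) + Im e * (a (Re z) * deriv b (Im z))" for z e
  using frechet_derivative_at[OF smooth_prod_has_derivative[OF Suc.prems, of z], symmetric] by simp
 moreover have "(%z. a (Re z) * b (Im z)) differentiable at z" for z
  using smooth_prod_has_derivative[OF Suc.prems] unfolding differentiable_def by blast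
 ultimately show ?case using Suc by (auto simp: Basis_complex_def smooth1_deriv)
qed

section \<open>Continuously differentiable functions with compact support\<close>

definition C1_compact :: "('a::euclidean_space => real) => bool" where
 "C1_compact \<phi> \<longleftrightarrow> (\<forall>x. \<phi> differentiable at x) \<and>
   (\<forall>e. continuous_on UNIV (%x. fd \<phi> x e)) \<and> compact (closure {x. \<phi> x \<noteq> 0})"

lemma frechet_derivative_expand:
 assumes "(\<phi>::'a::euclidean_space => 'b::real_normed_vector) differentiable at x"
 shows "fd \<phi> x h = (\<Sum>e\<in>Basis. (h \<bullet> e) *\<^sub>R fd \<phi> x e)"
proof -
 have l: "linear (fd \<phi> x)" using assms linear_frechet_derivative by blast
 have "fd \<phi> x (\<Sum>e\<in>Basis. (h \<bullet> e) *\<^sub>R e) =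
   (\<Sum>e\<in>Basis. (h \<bullet> e) *\<^sub>R fd \<phi> x e)" by (simp add: linear_sum[OF l] linear_scale[OF l])
 then show ?thesis by (simp add: euclidean_representation)
qed

lemma test_function_C1:
 assumes "test_function U \<phi>" shows "C1_compact \<phi>"
proof -
 have "Ck (Suc 0) \<phi>" using assms unfolding test_function_def by blast
 then have d: "\<And>x. \<phi> differentiable at x" and c: "\<And>e. e \<in> Basis ==> continuous_on UNIV (%x. fd \<phi> x e)"
  by auto
 have "continuous_on UNIV (%x. fd \<phi> x e)" for e
  by (subst frechet_derivative_expand[OF d]) (auto intro!: continuous_intros c)
 then show ?thesis using d assms by (auto simp: C1_compact_def test_function_def)
qed

lemma test_function_subset:
 "test_function U \<phi> ==> closure {x. \<phi> x \<noteq> 0} \<subseteq> V ==> test_function V \<phi>" by (auto simp: test_function_def)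

lemma C1_compact_continuous: "C1_compact \<phi> ==> continuous_on UNIV \<phi>"
 by (simp add: C1_compact_def continuous_at_imp_continuous_on differentiable_imp_continuous_within)

lemma continuous_compact_support_bounded:
 fixes f :: "'a::topological_space => 'b::real_normed_vector"
 assumes "continuous_on UNIV f" "compact K" "\<And>x. x \<notin> K ==> f x = 0"
 obtains B where "B > 0" "\<And>x. norm (f x) <= B"
proof -
 have "compact (f ` K)" using assms by (meson compact_continuous_image continuous_on_subset subset_UNIV)
 then obtain B where "B > 0" "\<forall>x\<in>f ` K. norm x <= B" using compact_imp_bounded bounded_pos by blast
 then show ?thesis
  using that[of B] assms(3) by (metis imageI less_le_not_le linear norm_zero order_refl)
qed

lemma frechet_derivative_eq_0_outside_support:
 assumes "x \<notin> closure {x. \<phi> x \<noteq> 0}"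
 shows "fd \<phi> x = (%h. 0)"
proof -
 have "((%_. 0) has_derivative (%h. 0)) (at x)" by simp
 then have "(\<phi> has_derivative (%h. 0)) (at x)"
  by (rule has_derivative_transform_within_open[where s = "- closure {x. \<phi> x \<noteq> 0}"])
    (use assms closure_subset[of "{x. \<phi> x \<noteq> 0}"] in auto)
 then show ?thesis by (metis frechet_derivative_at)
qed

lemma C1_compact_lipschitz:
 fixes \<phi> :: "'a::euclidean_space => real"
 assumes "C1_compact \<phi>"
 obtains L where "L > 0" "\<And>x y. \<bar>\<phi> x - \<phi> y\<bar> <= L * norm (x - y)"
  "\<And>x h. \<bar>fd \<phi> x h\<bar> <= L * norm h"
proof -
 let ?K = "closure {x. \<phi> x \<noteq> 0}"
 have "\<exists>B>0. \<forall>x. norm (fd \<phi> x e) <= B" for e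
  by (rule continuous_compact_support_bounded[of "%x. fd \<phi> x e" ?K])
   (use assms in \<open>auto simp: C1_compact_def frechet_derivative_eq_0_outside_support\<close>)
 then obtain B where B: "\<And>e. B e > 0" "\<And>e x. norm (fd \<phi> x e) <= B e" by metis
 define L where "L = (\<Sum>e\<in>Basis. B (e::'a))"
 have "L > 0" unfolding L_def by (intro sum_pos) (auto simp: B)
 moreover have bd: "\<bar>fd \<phi> x h\<bar> <= L * norm h" for x h
 proof -
  have "\<phi> differentiable at x" using assms by (auto simp: C1_compact_def)
  then have "\<bar>fd \<phi> x h\<bar> = \<bar>\<Sum>e\<in>Basis. (h \<bullet> e) *\<^sub>R fd \<phi> x e\<bar>" using frechet_derivative_expand by metis
  also have "\<dots> <= (\<Sum>e\<in>Basis. \<bar>h \<bullet> e\<bar> * \<bar>fd \<phi> x e\<bar>)"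
   by (rule order_trans[OF sum_abs]) (simp add: abs_mult)
  also have "\<dots> <= (\<Sum>e\<in>Basis. norm h * B e)" using B by (intro sum_mono mult_mono Basis_le_norm) auto
  finally show ?thesis by (simp add: L_def sum_distrib_left mult.commute)
 qed
 moreover have "\<bar>\<phi> x - \<phi> y\<bar> <= L * norm (x - y)" for x y
 proof -
  have "norm (\<phi> x - \<phi> y) <= L * norm (x - y)"
  proof (rule differentiable_bound[of UNIV])
   show "(\<phi> has_derivative fd \<phi> z) (at z within UNIV)" for z
    using assms by (auto simp: C1_compact_def frechet_derivative_works)
   show "onorm (fd \<phi> z) <= L" for z using bd \<open>L > 0\<close> by (intro onorm_bound) auto
  qed auto
  then show ?thesis by simp
 qed
 ultimately show ?thesis using that by blast
qed

text \<open>Reflected translates are included because they are the test functions in a convolution.\<close>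

definition mollifier :: "real => (complex => real) => bool" where
 "mollifier e \<rho> \<longleftrightarrow> (\<forall>z. 0 <= \<rho> z) \<and> (\<forall>z. norm z \<ge> e --> \<rho> z = 0) \<and> (LINT z|lborel. \<rho> z) = 1 \<and>
   (\<forall>k. Ck k \<rho>) \<and> (\<forall>x k. Ck k (%y. \<rho> (x - y)))"

lemma continuous_compact_support_integrable:
 fixes f :: "'a::euclidean_space => 'b::euclidean_space"
 assumes "continuous_on UNIV f" "compact K" "\<And>x. x \<notin> K ==> f x = 0"
 shows "integrable lborel f"
proof -
 have "integrable lborel (%x. indicator K x *\<^sub>R f x)"
  using assms borel_integrable_compact[of K f] continuous_on_subset by blast
 moreover have "(%x. indicator K x *\<^sub>R f x) = f" using assms(3) by (auto simp: indicator_def fun_eq_iff)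
 ultimately show ?thesis by simp
qed

lemma mollifier_exists:
 assumes "e > 0" shows "\<exists>\<rho>. mollifier e \<rho>"
proof -
 \<comment> \<open>Half-width e/2 in each coordinate: where the norm of z is at least e, one of the
   coordinates is at least e/2 in absolute value.\<close>
 define b where "b = (%t. bump1 ((2/e) * t + 0))"
 have b: "smooth1 b" unfolding b_def by (intro smooth1_affine smooth1_bump1)
 have b0: "b t = 0" if "\<bar>t\<bar> \<ge> e/2" for t
  using that assms unfolding b_def by (intro bump1_eq_0) (auto simp: abs_mult field_simps)
 have bn: "b t \<ge> 0" for t by (simp add: b_def bump1_nonneg)
 define \<sigma> where "\<sigma> = (%z. b (Re z) * b (Im z))"
 have s0: "\<sigma> z = 0" if "norm z \<ge> e" for z
 proof -
  have "\<bar>Re z\<bar> \<ge> e/2 \<or> \<bar>Im z\<bar> \<ge> e/2" using that cmod_le[of z] by linarith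
  then show ?thesis using b0 by (auto simp: \<sigma>_def)
 qed
 have cs: "continuous_on UNIV \<sigma>" using Ck_smooth_prod[OF b b, of 0] by (simp add: \<sigma>_def)
 have int: "integrable lborel \<sigma>"
  by (rule continuous_compact_support_integrable[OF cs compact_cball[of 0 e]]) (auto intro!: s0)
 have sn: "\<sigma> z \<ge> 0" for z by (auto simp: \<sigma>_def bn)
 \<comment> \<open>A nonnegative continuous function with integral zero vanishes almost everywhere,
   but nonempty open sets are not negligible.\<close>
 have pos: "(LINT z|lborel. \<sigma> z) > 0"
 proof (rule ccontr)
  assume "\<not> ?thesis"
  then have "(LINT z|lborel. \<sigma> z) = 0" using integral_nonneg_AE[of \<sigma> lborel] sn by fastforce
  then have ae: "AE z in lborel. \<sigma> z = 0" using integral_nonneg_eq_0_iff_AE[OF int] sn by auto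
  have "\<sigma> 0 > 0" by (auto simp: \<sigma>_def b_def bump1_0)
  have op: "open {z. \<sigma> z > 0}" using open_Collect_less[OF continuous_on_const cs] by simp
  have "AE z in lborel. z \<notin> {z. \<sigma> z > 0}" using ae by eventually_elim auto
  then have "{z. \<sigma> z > 0} \<in> null_sets lborel" using op by (subst AE_iff_null_sets) auto
  then have "negligible {z. \<sigma> z > 0}" using negligible_iff_null_sets null_sets_completionI by blast
  then show False using open_not_negligible[OF op] \<open>\<sigma> 0 > 0\<close> by blast
 qed
 define c where "c = (LINT z|lborel. \<sigma> z)"
 define \<rho> where "\<rho> = (%z. (inverse c * b (Re z)) * b (Im z))"
 have rs: "\<rho> z = inverse c * \<sigma> z" for z by (simp add: \<rho>_def \<sigma>_def)
 have "Ck k \<rho>" for k unfolding \<rho>_def by (intro Ck_smooth_prod smooth1_cmult b)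
 moreover have "Ck k (%y. \<rho> (x - y))" for k x
 proof -
  have "Ck k (%y. (inverse c * b ((-1) * Re y + Re x)) * b ((-1) * Im y + Im x))"
   by (intro Ck_smooth_prod smooth1_cmult smooth1_affine b)
  then show ?thesis by (simp add: \<rho>_def)
 qed
 moreover have "(LINT z|lborel. \<rho> z) = 1" using pos unfolding rs by (simp add: c_def)
 moreover have "0 <= \<rho> z" for z using pos sn by (simp add: rs c_def)
 moreover have "\<rho> z = 0" if "norm z \<ge> e" for z using that by (simp add: rs s0)
 ultimately show ?thesis unfolding mollifier_def by blast
qed

text \<open>Values in a Banach space let the same operator act on functions and on their
  gradients.\<close>

definition conv :: "('a::euclidean_space => real) => ('a => 'b::{banach,second_countable_topology}) => 'a => 'b" where
 "conv \<rho> u x = (LINT y|lborel. \<rho> (x - y) *\<^sub>R u y)"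

lemma lborel_distr_reflect:
 fixes c :: "'a::euclidean_space"
 shows "distr lborel borel (%y. c - y) = lborel" using lborel_affine[of "-1" c] by (simp add: density_1)

lemma nn_integral_lborel_shift:
 fixes f :: "'a::euclidean_space => ennreal"
 assumes [measurable]: "bm f"
 shows "(nnl (%y. f (y + c))) = (nnl (%y. f y))"
 by (subst (2) lborel_distr_plus[symmetric, of c]) (simp add: nn_integral_distr add.commute)

lemma integral_lborel_reflect:
 fixes f :: "'a::euclidean_space => 'b::{banach,second_countable_topology}"
 assumes [measurable]: "bm f"
 shows "(LINT y|lborel. f (c - y)) = (LINT y|lborel. f y)"
 by (subst (2) lborel_distr_reflect[symmetric, of c]) (simp add: integral_distr)

lemma integral_lborel_shift:
 fixes f :: "'a::euclidean_space => 'b::{banach,second_countable_topology}"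
 assumes [measurable]: "bm f"
 shows "(LINT y|lborel. f (y + c)) = (LINT y|lborel. f y)"
 by (subst (2) lborel_distr_plus[symmetric, of c]) (simp add: integral_distr add.commute)

lemma integrable_bounded_scaleR:
 fixes f :: "'a => 'b::{banach,second_countable_topology}" and r :: "'a => real"
 assumes f: "integrable M f" and r[measurable]: "r \<in> borel_measurable M" and b: "\<And>x. \<bar>r x\<bar> <= B"
 shows "integrable M (%x. r x *\<^sub>R f x)"
proof (rule Bochner_Integration.integrable_bound)
 show "integrable M (%x. B *\<^sub>R f x)" using f by simp
 show "AE x in M. norm (r x *\<^sub>R f x) <= norm (B *\<^sub>R f x)"
  using b by (intro AE_I2) (auto intro!: mult_right_mono order_trans[OF b abs_ge_self])
qed (use f in measurable)

lemma conv_integrable: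
 fixes u :: "'a::euclidean_space => 'b::{banach,second_countable_topology}"
 assumes "continuous_on UNIV \<rho>" "\<And>x. \<bar>\<rho> x\<bar> <= B" "integrable lborel u"
 shows "integrable lborel (%y. \<rho> (x - y) *\<^sub>R u y)"
proof (rule integrable_bounded_scaleR[OF assms(3)])
 show "\<And>y. \<bar>\<rho> (x - y)\<bar> <= B" by (rule assms(2))
 have "continuous_on UNIV (%y. \<rho> (x - y))"
  by (rule continuous_on_compose2[OF assms(1)]) (auto intro!: continuous_intros)
 then show "(%y. \<rho> (x - y)) \<in> borel_measurable lborel" using borel_measurable_continuous_onI by simp
qed

lemma continuous_on_conv:
 fixes u :: "'a::euclidean_space => 'b::{banach,second_countable_topology}"
 assumes c: "continuous_on UNIV \<rho>" and b: "\<And>x. \<bar>\<rho> x\<bar> <= B" and u: "integrable lborel u"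
 shows "continuous_on UNIV (conv \<rho> u)"
proof -
 have "(conv \<rho> u \<circ> X) \<longlonglongrightarrow> conv \<rho> u x" if "X \<longlonglongrightarrow> x" for X x unfolding conv_def comp_def
 proof (rule integral_dominated_convergence)
  show "integrable lborel (%y. B * norm (u y))" using u by simp
  show "AE y in lborel. (%i. \<rho> (X i - y) *\<^sub>R u y) \<longlonglongrightarrow> \<rho> (x - y) *\<^sub>R u y"
  proof (intro AE_I2 tendsto_intros)
   fix y
   have "isCont \<rho> (x - y)" using c by (simp add: continuous_on_eq_continuous_at)
   then show "(%i. \<rho> (X i - y)) \<longlonglongrightarrow> \<rho> (x - y)"
    by (rule isCont_tendsto_compose) (intro tendsto_intros that)
  qed
  show "AE y in lborel. norm (\<rho> (X i - y) *\<^sub>R u y) <= B * norm (u y)" for i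
   using b by (auto intro!: mult_right_mono)
  show "(%y. \<rho> (x - y) *\<^sub>R u y) \<in> borel_measurable lborel"
     "(%y. \<rho> (X i - y) *\<^sub>R u y) \<in> borel_measurable lborel" for i
   by (rule borel_measurable_integrable[OF conv_integrable[OF c b u]])+
 qed
 then show ?thesis unfolding continuous_on_sequentially by blast
qed

text \<open>Differentiation under the integral sign: with L a Lipschitz constant of \<rho> that also
  bounds its derivative, the normalized remainders are dominated by 2 L |u|.\<close>

lemma conv_has_derivative:
 fixes u :: "'a::euclidean_space => real"
 assumes \<rho>: "C1_compact \<rho>" and u: "integrable lborel u"
 shows "(conv \<rho> u has_derivative
      (%h. LINT y|lborel. fd \<rho> (x - y) h *\<^sub>R u y)) (at x)"
proof -
 obtain L where L: "L > 0" "\<And>x y. \<bar>\<rho> x - \<rho> y\<bar> <= L * norm (x - y)"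
  "\<And>x h. \<bar>fd \<rho> x h\<bar> <= L * norm h" using C1_compact_lipschitz[OF \<rho>] by blast
 have c: "continuous_on UNIV \<rho>" by (rule C1_compact_continuous[OF \<rho>])
 obtain B where B: "\<And>x. \<bar>\<rho> x\<bar> <= B"
  by (rule continuous_compact_support_bounded[OF c, of "closure {x. \<rho> x \<noteq> 0}"])
   (use \<rho> closure_subset[of "{x. \<rho> x \<noteq> 0}"] in \<open>auto simp: C1_compact_def\<close>)
 let ?D = "%x. fd \<rho> x"
 have cD: "continuous_on UNIV (%x. ?D x h)" for h using \<rho> by (auto simp: C1_compact_def)
 have D: "(\<rho> has_derivative ?D x) (at x)" for x
  using \<rho> by (auto simp: C1_compact_def frechet_derivative_works)
 have lin: "linear (?D x)" for x using D has_derivative_linear by blast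
 have int: "integrable lborel (%y. ?D (x - y) h *\<^sub>R u y)" for h x
  by (rule conv_integrable[OF cD L(3) u])
 have intr: "integrable lborel (%y. \<rho> (x - y) *\<^sub>R u y)" for x by (rule conv_integrable[OF c B u])
 have bl: "bounded_linear (%h. LINT y|lborel. ?D (x - y) h *\<^sub>R u y)"
 proof (rule bounded_linear_intro[where K = "LINT y|lborel. L * norm (u y)"])
  show "(LINT y|lborel. ?D (x - y) (h + k) *\<^sub>R u y) =
    (LINT y|lborel. ?D (x - y) h *\<^sub>R u y) + (LINT y|lborel. ?D (x - y) k *\<^sub>R u y)" for h k
   by (subst Bochner_Integration.integral_add[symmetric, OF int int])
    (simp add: linear_add[OF lin] algebra_simps)
  show "(LINT y|lborel. ?D (x - y) (r *\<^sub>R h) *\<^sub>R u y) = r *\<^sub>R (LINT y|lborel. ?D (x - y) h *\<^sub>R u y)" for r h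
   by (subst integral_scaleR_right[symmetric]) (simp add: linear_scale[OF lin] algebra_simps)
  show "norm (LINT y|lborel. ?D (x - y) h *\<^sub>R u y) <= norm h * (LINT y|lborel. L * norm (u y))" for h
  proof -
   have "norm (LINT y|lborel. ?D (x - y) h *\<^sub>R u y) <= (LINT y|lborel. norm h * (L * norm (u y)))"
   proof (rule order_trans[OF Bochner_Integration.integral_norm_bound integral_mono])
    show "integrable lborel (%y. norm (?D (x - y) h *\<^sub>R u y))" using int by (rule integrable_norm)
    show "integrable lborel (%y. norm h * (L * norm (u y)))" using u by simp
    show "norm (?D (x - y) h *\<^sub>R u y) <= norm h * (L * norm (u y))" for y
     using mult_right_mono[OF L(3)[of "x - y" h] abs_ge_zero[of "u y"]]
     by (simp add: abs_mult algebra_simps)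
   qed
   then show ?thesis by simp
  qed
 qed
 show ?thesis unfolding has_derivative_at_within
 proof (rule conjI[OF bl])
  show "((%z. (conv \<rho> u z - conv \<rho> u x - (LINT y|lborel. ?D (x - y) (z - x) *\<^sub>R u y)) /\<^sub>R norm (z - x)) \<longlongrightarrow> 0) (at x)"
   unfolding tendsto_at_iff_sequentially comp_def
  proof (intro allI impI)
   fix X assume X: "\<forall>i. X i \<in> UNIV - {x}" "X \<longlonglongrightarrow> x"
   let ?q = "%i y. ((\<rho> (X i - y) - \<rho> (x - y) - ?D (x - y) (X i - x)) / norm (X i - x)) *\<^sub>R u y"
   have eq: "(conv \<rho> u (X i) - conv \<rho> u x - (LINT y|lborel. ?D (x - y) (X i - x) *\<^sub>R u y)) /\<^sub>R norm (X i - x)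
     = (LINT y|lborel. ?q i y)" for i
   proof -
    have "(LINT y|lborel. ?q i y) =
     (LINT y|lborel. (\<rho> (X i - y) *\<^sub>R u y - \<rho> (x - y) *\<^sub>R u y - ?D (x - y) (X i - x) *\<^sub>R u y) /\<^sub>R norm (X i - x))"
     by (rule Bochner_Integration.integral_cong) (auto simp: field_simps)
    then show ?thesis unfolding conv_def using int intr by simp
   qed
   have "(%i. LINT y|lborel. ?q i y) \<longlonglongrightarrow> (LINT y::'a|lborel. 0)"
   proof (rule integral_dominated_convergence)
    show "integrable lborel (%y. 2 * L * norm (u y))" using u by simp
    show "AE y in lborel. norm (?q i y) <= 2 * L * norm (u y)" for i
    proof (rule AE_I2)
     fix y
     have "X i \<noteq> x" using X by auto
     have "\<bar>\<rho> (X i - y) - \<rho> (x - y) - ?D (x - y) (X i - x)\<bar> <= 2 * L * norm (X i - x)"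
      using L(2)[of "X i - y" "x - y"] L(3)[of "x - y" "X i - x"] by simp
     then have "\<bar>(\<rho> (X i - y) - \<rho> (x - y) - ?D (x - y) (X i - x)) / norm (X i - x)\<bar> <= 2 * L"
      using \<open>X i \<noteq> x\<close> by (simp add: field_simps)
     from mult_right_mono[OF this abs_ge_zero[of "u y"]]
     show "norm (?q i y) <= 2 * L * norm (u y)" by (simp add: abs_mult)
    qed
    show "AE y in lborel. null_seq (%i. ?q i y)"
    proof (rule AE_I2)
     fix y
     have "((%z. (\<rho> z - \<rho> (x - y) - ?D (x - y) (z - (x - y))) /\<^sub>R norm (z - (x - y))) \<longlongrightarrow> 0) (at (x - y))"
      using D[of "x - y"] unfolding has_derivative_at_within by blast
     then have "null_seq (%i. (\<rho> (X i - y) - \<rho> (x - y) - ?D (x - y) ((X i - y) - (x - y))) /\<^sub>R norm ((X i - y) - (x - y)))"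
      unfolding tendsto_at_iff_sequentially comp_def
      using X by (auto dest!: spec[of _ "%i. X i - y"] intro!: tendsto_intros)
     then have "(%i. ((\<rho> (X i - y) - \<rho> (x - y) - ?D (x - y) (X i - x)) / norm (X i - x)) *\<^sub>R u y) \<longlonglongrightarrow> 0 *\<^sub>R u y"
      by (intro tendsto_intros) (simp add: divide_inverse mult.commute)
     then show "null_seq (%i. ?q i y)" by simp
    qed
    show "(%y. ?q i y) \<in> borel_measurable lborel" for i
    proof -
     have "(%y. (\<rho> (X i - y) *\<^sub>R u y - \<rho> (x - y) *\<^sub>R u y - ?D (x - y) (X i - x) *\<^sub>R u y) /\<^sub>R norm (X i - x)) \<in> borel_measurable lborel"
      using int intr by (intro borel_measurable_scaleR borel_measurable_diff borel_measurable_integrable) auto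
     then show ?thesis by (simp add: field_simps)
    qed
   qed simp
   then show "null_seq (%i. (conv \<rho> u (X i) - conv \<rho> u x - (LINT y|lborel. ?D (x - y) (X i - x) *\<^sub>R u y)) /\<^sub>R norm (X i - x))"
    unfolding eq by simp
  qed
 qed
qed

lemma mollifier_facts:
 assumes "mollifier e \<rho>"
 shows "C1_compact \<rho>" "continuous_on UNIV \<rho>" "\<exists>B. \<forall>x. \<bar>\<rho> x\<bar> <= B" "\<And>x. 0 <= \<rho> x"
  "\<And>x. norm x \<ge> e ==> \<rho> x = 0" "integrable lborel \<rho>" "(nnl (%x. \<rho> x)) = 1"
proof -
 have sub: "closure {x. \<rho> x \<noteq> 0} \<subseteq> cball 0 e"
  by (rule closure_minimal) (use assms in \<open>force simp: mollifier_def\<close>, simp)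
 then have "test_function UNIV \<rho>" using assms bounded_subset[OF bounded_cball sub]
  unfolding test_function_def mollifier_def by (auto simp: compact_eq_bounded_closed)
 then show c1: "C1_compact \<rho>" by (rule test_function_C1)
 then show c: "continuous_on UNIV \<rho>" by (rule C1_compact_continuous)
 show 0: "\<And>x. norm x \<ge> e ==> \<rho> x = 0" and pos: "\<And>x. 0 <= \<rho> x" using assms unfolding mollifier_def by blast+
 show "\<exists>B. \<forall>x. \<bar>\<rho> x\<bar> <= B" using continuous_compact_support_bounded[OF c compact_cball[of 0 e]] 0
  by (metis less_le_not_le linear mem_cball_0 real_norm_def)
 show i: "integrable lborel \<rho>"
  by (rule continuous_compact_support_integrable[OF c compact_cball[of 0 e]]) (auto intro!: 0)
 have "(LINT z|lborel. \<rho> z) = 1" using assms unfolding mollifier_def by blast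
 then show "(nnl (%x. \<rho> x)) = 1" using nn_integral_eq_integral[OF i] pos by simp
qed

lemma mollifier_mono: "mollifier e \<rho> ==> e <= e' ==> mollifier e' \<rho>" unfolding mollifier_def by force

lemma mollifier_translate:
 assumes "mollifier e \<rho>"
 shows "integrable lborel (%y. \<rho> (x - y))" "(LINT y|lborel. \<rho> (x - y)) = 1"
proof -
 have [measurable]: "bm \<rho>" using mollifier_facts(2)[OF assms] by (rule borel_measurable_continuous_onI)
 show "(LINT y|lborel. \<rho> (x - y)) = 1"
  using assms by (subst integral_lborel_reflect) (auto simp: mollifier_def)
 then show "integrable lborel (%y. \<rho> (x - y))" using not_integrable_integral_eq by fastforce
qed

text \<open>Tonelli's theorem and the unit mass of \<rho>. It is applied to an L1 error and, after
  Jensen's inequality, to the square of a gradient.\<close>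

lemma conv_L1_bound:
 fixes u :: "complex => 'b::{banach,second_countable_topology}"
 assumes "mollifier e \<rho>" and [measurable]: "bm u"
 shows "(nnl (%x. (nnl (%y. ennreal (\<rho> (x - y)) * ennreal (norm (u y)))))) = (nnl (%y. norm (u y)))"
proof -
 have [measurable]: "bm \<rho>"
  using mollifier_facts(2)[OF assms(1)] by (rule borel_measurable_continuous_onI)
 have "(nnl (%x. (nnl (%y. ennreal (\<rho> (x - y)) * ennreal (norm (u y)))))) =
  (nnl (%y. (nnl (%x. ennreal (\<rho> (x - y)) * ennreal (norm (u y))))))"
  by (rule lborel_pair.Fubini'[symmetric]) measurable
 also have "\<dots> = (nnl (%y. (nnl (%x. ennreal (\<rho> (x - y)))) * ennreal (norm (u y))))"
  by (intro nn_integral_cong nn_integral_multc) measurable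
 also have "\<dots> = (nnl (%y. 1 * ennreal (norm (u y))))"
  using nn_integral_lborel_shift[of "%x. ennreal (\<rho> x)" "- y" for y] mollifier_facts(7)[OF assms(1)] by simp
 finally show ?thesis by simp
qed

lemma norm_conv_le:
 fixes u :: "complex => 'b::{banach,second_countable_topology}"
 assumes "mollifier e \<rho>" "integrable lborel u"
 shows "ennreal (norm (conv \<rho> u x)) <= (nnl (%y. ennreal (\<rho> (x - y)) * ennreal (norm (u y))))"
proof -
 obtain B where "\<And>x. \<bar>\<rho> x\<bar> <= B" using mollifier_facts(3)[OF assms(1)] by blast
 then have "ennreal (norm (conv \<rho> u x)) <= (nnl (%y. ennreal (norm (\<rho> (x - y) *\<^sub>R u y))))"
  unfolding conv_def
  using integral_norm_bound_ennreal[OF conv_integrable[OF mollifier_facts(2)[OF assms(1)] _ assms(2)]] by blast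
 also have "\<dots> = (nnl (%y. ennreal (\<rho> (x - y)) * ennreal (norm (u y))))"
  using mollifier_facts(4)[OF assms(1)] by (simp add: ennreal_mult)
 finally show ?thesis .
qed

text \<open>Jensen's inequality: \<rho>(x - y) dy is a probability measure, under which the variance
  of u about its mean \<open>conv \<rho> u x\<close> is nonnegative.\<close>

lemma norm_conv_sq_le:
 fixes u :: "complex => 'b::euclidean_space"
 assumes m: "mollifier e \<rho>" and u: "integrable lborel u" and u2: "integrable lborel (%x. (norm (u x))^2)"
 shows "ennreal ((norm (conv \<rho> u x))^2) <= (nnl (%y. ennreal (\<rho> (x - y)) * ennreal (norm ((norm (u y))^2))))"
proof -
 obtain B where B: "\<And>x. \<bar>\<rho> x\<bar> <= B" using mollifier_facts(3)[OF m] by blast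
 note c = conv_integrable[OF mollifier_facts(2)[OF m] B]
 define G where "G = conv \<rho> u x"
 have i0: "integrable lborel (%y. \<rho> (x - y))" "(LINT y|lborel. \<rho> (x - y)) = 1"
  using mollifier_translate[OF m] by auto
 have i1: "integrable lborel (%y. \<rho> (x - y) *\<^sub>R u y)" using c[OF u] .
 have i2: "integrable lborel (%y. \<rho> (x - y) * (norm (u y))^2)" using c[OF u2] by simp
 have i3: "integrable lborel (%y. (\<rho> (x - y) *\<^sub>R u y) \<bullet> G)" by (rule integrable_inner_left) (rule i1)
 have "0 <= (LINT y|lborel. \<rho> (x - y) * (norm (u y - G))^2)"
  using mollifier_facts(4)[OF m] by (intro integral_nonneg_AE AE_I2) auto
 also have "\<dots> = (LINT y|lborel. \<rho> (x - y) * (norm (u y))^2 - 2 * ((\<rho> (x - y) *\<^sub>R u y) \<bullet> G) + \<rho> (x - y) * (norm G)^2)"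
  by (rule Bochner_Integration.integral_cong)
   (auto simp: power2_norm_eq_inner algebra_simps inner_commute)
 also have "\<dots> = (LINT y|lborel. \<rho> (x - y) * (norm (u y))^2) - 2 * (LINT y|lborel. (\<rho> (x - y) *\<^sub>R u y) \<bullet> G) + (norm G)^2"
  using i0 i2 i3 by simp
 also have "(LINT y|lborel. (\<rho> (x - y) *\<^sub>R u y) \<bullet> G) = (LINT y|lborel. (\<rho> (x - y) *\<^sub>R u y)) \<bullet> G"
  by (rule integral_inner_left) (use i1 in auto)
 also have "(LINT y|lborel. (\<rho> (x - y) *\<^sub>R u y)) \<bullet> G = (norm G)^2"
  by (simp add: G_def conv_def power2_norm_eq_inner)
 finally have "(norm G)^2 <= (LINT y|lborel. \<rho> (x - y) * (norm (u y))^2)" by simp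
 then have "ennreal ((norm G)^2) <= ennreal (LINT y|lborel. \<rho> (x - y) * (norm (u y))^2)"
  by (rule ennreal_leI)
 also have "\<dots> = (nnl (%y. ennreal (\<rho> (x - y) * (norm (u y))^2)))"
  using mollifier_facts(4)[OF m] by (intro nn_integral_eq_integral[symmetric] i2) auto
 finally show ?thesis using mollifier_facts(4)[OF m] by (simp add: G_def ennreal_mult)
qed

section \<open>Continuous approximation in L1 and convergence of mollifications\<close>

definition L1_approx :: "('a::euclidean_space => 'b::euclidean_space) => bool" where
 "L1_approx f \<longleftrightarrow> (\<forall>\<eta>>0. \<exists>\<phi> K. continuous_on UNIV \<phi> \<and> compact K \<and> (\<forall>x. x \<notin> K --> \<phi> x = 0) \<and>
   (nnl (%x. norm (f x - \<phi> x))) < ennreal \<eta>)"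

lemma L1_approx_lim:
 assumes s: "\<And>i. L1_approx (s i)" and [measurable]: "\<And>i. s i \<in> borel_measurable borel" "bm f"
  and lim: "null_seq (%i. (nnl (%x. norm (f x - s i x))))"
 shows "L1_approx f" unfolding L1_approx_def
proof (intro allI impI)
 fix \<eta> :: real assume "\<eta> > 0"
 then have "\<forall>\<^sub>F i in sequentially. (nnl (%x. norm (f x - s i x))) < ennreal (\<eta>/2)"
  using order_tendstoD(2)[OF lim] by simp
 then obtain i where i: "(nnl (%x. norm (f x - s i x))) < ennreal (\<eta>/2)"
  by (auto simp: eventually_sequentially)
 obtain \<phi> K where p: "continuous_on UNIV \<phi>" "compact K" "\<forall>x. x \<notin> K --> \<phi> x = 0"
  "(nnl (%x. norm (s i x - \<phi> x))) < ennreal (\<eta>/2)"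
  using s[of i] \<open>\<eta> > 0\<close> unfolding L1_approx_def by (metis half_gt_zero)
 have [measurable]: "bm \<phi>" using p(1) by (rule borel_measurable_continuous_onI)
 have "(nnl (%x. norm (f x - \<phi> x))) <= (nnl (%x. ennreal (norm (f x - s i x)) + ennreal (norm (s i x - \<phi> x))))"
  by (intro nn_integral_mono) (simp add: ennreal_plus[symmetric] norm_triangle_le_diff del: ennreal_plus, metis diff_add_cancel add_diff_eq norm_triangle_ineq)
 also have "\<dots> = (nnl (%x. norm (f x - s i x))) + (nnl (%x. norm (s i x - \<phi> x)))"
  by (rule nn_integral_add) measurable
 also have "\<dots> < ennreal (\<eta>/2) + ennreal (\<eta>/2)" using i p(4) by (intro add_strict_mono)
 also have "\<dots> = ennreal \<eta>" using \<open>\<eta> > 0\<close> by (simp add: ennreal_plus[symmetric] del: ennreal_plus)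
 finally show "\<exists>\<phi> K. continuous_on UNIV \<phi> \<and> compact K \<and> (\<forall>x. x \<notin> K --> \<phi> x = 0) \<and>
   (nnl (%x. norm (f x - \<phi> x))) < ennreal \<eta>" using p(1-3) by blast
qed

text \<open>Squeeze A between a closed and an open set of nearly the same measure. A Urysohn
  function that is c on the first and 0 off the second errs only on the two thin remainders.\<close>

lemma L1_approx_indicator_bounded:
 fixes A :: "'a::euclidean_space set" and c :: "'b::euclidean_space"
 assumes A: "A \<in> sets borel" "bounded A"
 shows "L1_approx (%x. indicator A x *\<^sub>R c)" unfolding L1_approx_def
proof (intro allI impI)
 fix \<eta> :: real assume "\<eta> > 0"
 \<comment> \<open>Each of the two remainders costs at most norm c times \<delta>; the added 1 makes
   the final bound strict and admits c = 0.\<close>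
 define \<delta> where "\<delta> = \<eta> / (2 * (norm c + 1))"
 have "\<delta> > 0" using \<open>\<eta> > 0\<close> by (simp add: \<delta>_def add_nonneg_pos)
 have AL: "A \<in> sets lebesgue" using A by auto
 obtain T where T: "open T" "A \<subseteq> T" "T - A \<in> lmeasurable" "emeasure lebesgue (T - A) < ennreal \<delta>"
  using sets_lebesgue_outer_open[OF AL \<open>\<delta> > 0\<close>] by blast
 obtain C where C: "closed C" "C \<subseteq> A" "A - C \<in> lmeasurable" "emeasure lebesgue (A - C) < ennreal \<delta>"
  using sets_lebesgue_inner_closed[OF AL \<open>\<delta> > 0\<close>] by blast
 obtain R where R: "A \<subseteq> ball 0 R" using A(2) bounded_subset_ballD by blast
 \<comment> \<open>The ball gives the approximant compact support.\<close>
 define W where "W = T \<inter> ball 0 R"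
 have W: "open W" "A \<subseteq> W" "W \<subseteq> T" using T R by (auto simp: W_def)
 obtain \<phi> where \<phi>: "continuous_on UNIV \<phi>" "\<And>x. \<phi> x \<in> closed_segment c 0"
  "\<And>x. x \<in> C ==> \<phi> x = c" "\<And>x. x \<in> - W ==> \<phi> x = 0"
 proof (rule Urysohn_local[of UNIV C "- W" c 0])
  show "C \<inter> - W = {}" using C W by blast
 qed (use C W in auto)
 have ns: "norm (\<phi> x) <= norm c \<and> norm (c - \<phi> x) <= norm c" for x
  using segment_bound[OF \<phi>(2)[of x]] by (simp add: norm_minus_commute)
 have pw: "ennreal (norm (indicator A x *\<^sub>R c - \<phi> x)) <= ennreal (norm c) * indicator (T - A) x + ennreal (norm c) * indicator (A - C) x" for x
  using ns[of x] \<phi>(3,4)[of x] W C(2)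
  by (cases "x \<in> C"; cases "x \<in> A"; cases "x \<in> W") (auto simp: indicator_def intro!: ennreal_leI)
 have mb: "T - A \<in> sets borel" "A - C \<in> sets borel" using T C A by auto
 have "(nnl (%x. norm (indicator A x *\<^sub>R c - \<phi> x))) <=
  (nnl (%x. ennreal (norm c) * indicator (T - A) x + ennreal (norm c) * indicator (A - C) x))"
  by (intro nn_integral_mono pw)
 also have "\<dots> = ennreal (norm c) * emeasure lborel (T - A) + ennreal (norm c) * emeasure lborel (A - C)"
  using mb by (subst nn_integral_add) (auto simp: nn_integral_cmult_indicator)
 also have "\<dots> <= ennreal (norm c) * ennreal \<delta> + ennreal (norm c) * ennreal \<delta>"
  using T(4) C(4) mb by (intro add_mono mult_left_mono) (auto simp: less_imp_le)
 also have "\<dots> = ennreal (2 * norm c * \<delta>)"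
  using \<open>\<delta> > 0\<close> by (simp add: ennreal_mult[symmetric] ennreal_plus[symmetric] del: ennreal_plus)
 also have "\<dots> < ennreal \<eta>"
 proof (rule ennreal_lessI[OF \<open>\<eta> > 0\<close>])
  have "2 * norm c * \<delta> = \<eta> * (norm c / (norm c + 1))"
   using \<open>\<eta> > 0\<close> add_nonneg_pos[OF norm_ge_zero[of c] zero_less_one] by (simp add: \<delta>_def divide_simps)
  also have "\<dots> < \<eta> * 1"
   using \<open>\<eta> > 0\<close> by (intro mult_strict_left_mono) (auto simp: divide_less_eq add_nonneg_pos)
  finally show "2 * norm c * \<delta> < \<eta>" by simp
 qed
 finally show "\<exists>\<phi> K. continuous_on UNIV \<phi> \<and> compact K \<and> (\<forall>x. x \<notin> K --> \<phi> x = 0) \<and>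
   (nnl (%x. norm (indicator A x *\<^sub>R c - \<phi> x))) < ennreal \<eta>"
  using \<phi>(1,4) by (intro exI[of _ \<phi>] exI[of _ "cball 0 R"]) (auto simp: W_def)
qed

lemma integrable_L1_approx:
 fixes f :: "'a::euclidean_space => 'b::euclidean_space"
 assumes "integrable lborel f"
 shows "L1_approx f" using assms
proof (induction rule: integrable_induct)
 case (base A c)
 have [measurable]: "A \<in> sets borel" "cball (0::'a) (real i) \<in> sets borel" for i using base by auto
 show ?case
 \<comment> \<open>The set A has finite measure but may be unbounded, hence the exhaustion by
   balls.\<close>
 proof (rule L1_approx_lim[where s = "%n x. indicator (A \<inter> cball 0 (real n)) x *\<^sub>R c"])
  show "L1_approx (%x. indicator (A \<inter> cball 0 (real i)) x *\<^sub>R c)" for i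
   by (intro L1_approx_indicator_bounded) auto
  have "integrable lborel (%x. indicator A x *\<^sub>R c)" using base by auto
  then have fin: "(nnl (%x. norm (indicator A x *\<^sub>R c))) < \<infinity>" by (simp add: integrable_iff_bounded)
  show "null_seq (%i. \<integral>\<^sup>+x. norm (indicator A x *\<^sub>R c - indicator (A \<inter> cball 0 (real i)) x *\<^sub>R c) \<partial>lborel)"
  proof (rule nn_integral_dominated_convergence_norm[OF _ _ _ _ fin])
   show "AE x in lborel. (%i. indicator (A \<inter> cball 0 (real i)) x *\<^sub>R c) \<longlonglongrightarrow> indicator A x *\<^sub>R c"
   proof (intro AE_I2 tendsto_eventually)
    fix x :: 'a
    obtain n where "norm x <= real n" using real_arch_simple by blast
    then show "\<forall>\<^sub>F i in sequentially. indicator (A \<inter> cball 0 (real i)) x *\<^sub>R c = indicator A x *\<^sub>R c"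
     by (auto simp: eventually_sequentially indicator_def intro!: exI[of _ n])
   qed
  qed (measurable, auto simp: indicator_def)
 qed measurable
next
 case (add f g)
 have [measurable]: "bm f" "bm g"
  using add.hyps borel_measurable_integrable by (metis measurable_lborel2)+
 show ?case unfolding L1_approx_def
 proof (intro allI impI)
  fix \<eta> :: real assume "\<eta> > 0"
  obtain \<phi> K where p: "continuous_on UNIV \<phi>" "compact K" "\<forall>x. x \<notin> K --> \<phi> x = 0"
   "(nnl (%x. norm (f x - \<phi> x))) < ennreal (\<eta>/2)"
   using add.IH(1) \<open>\<eta> > 0\<close> unfolding L1_approx_def by (metis half_gt_zero)
  obtain \<psi> L where q: "continuous_on UNIV \<psi>" "compact L" "\<forall>x. x \<notin> L --> \<psi> x = 0"
   "(nnl (%x. norm (g x - \<psi> x))) < ennreal (\<eta>/2)"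
   using add.IH(2) \<open>\<eta> > 0\<close> unfolding L1_approx_def by (metis half_gt_zero)
  have [measurable]: "bm \<phi>" "bm \<psi>" using p(1) q(1) by (auto intro: borel_measurable_continuous_onI)
  have "(nnl (%x. norm (f x + g x - (\<phi> x + \<psi> x)))) <= (nnl (%x. ennreal (norm (f x - \<phi> x)) + ennreal (norm (g x - \<psi> x))))"
   by (intro nn_integral_mono) (simp add: ennreal_plus[symmetric] norm_diff_triangle_ineq del: ennreal_plus)
  also have "\<dots> = (nnl (%x. norm (f x - \<phi> x))) + (nnl (%x. norm (g x - \<psi> x)))"
   by (rule nn_integral_add) measurable
  also have "\<dots> < ennreal (\<eta>/2) + ennreal (\<eta>/2)" using q(4) p(4) by (intro add_strict_mono)
  also have "\<dots> = ennreal \<eta>" using \<open>\<eta> > 0\<close> by (simp add: ennreal_plus[symmetric] del: ennreal_plus)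
  finally show "\<exists>\<phi> K. continuous_on UNIV \<phi> \<and> compact K \<and> (\<forall>x. x \<notin> K --> \<phi> x = 0) \<and>
    (nnl (%x. norm (f x + g x - \<phi> x))) < ennreal \<eta>"
   using p(1-3) q(1-3) by (intro exI[of _ "%x. \<phi> x + \<psi> x"] exI[of _ "K \<union> L"])
    (auto intro!: continuous_intros)
 qed
next
 case (lim f s)
 have [measurable]: "bm f" "s i \<in> borel_measurable borel" for i
  using lim.hyps borel_measurable_integrable by (metis measurable_lborel2)+
 show ?case
 proof (rule L1_approx_lim[of s, OF lim.IH])
  have "(nnl (%x. ennreal (2 * norm (f x)))) < \<infinity>"
   using integrable_mult_right[OF integrable_norm[OF lim.hyps(4)], of 2]
   by (subst (asm) integrable_iff_bounded) simp
  then show "null_seq (%i. \<integral>\<^sup>+x. norm (f x - s i x) \<partial>lborel)"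
   by (rule nn_integral_dominated_convergence_norm[rotated 4])
    (use lim.hyps in auto)
 qed measurable
qed

text \<open>With a continuous \<phi> of compact support close to u, the error splits into the
  mollified difference u - \<phi>, the mollification error of \<phi>, and \<phi> - u. The scale e
  works for all mollifiers at once, so that one mollifier can later serve a function and its weak
  gradient together.\<close>

lemma mollify_L1:
 fixes u :: "complex => 'b::euclidean_space"
 assumes u: "integrable lborel u" and "\<eta> > 0"
 shows "\<exists>e>0. \<forall>\<rho>. mollifier e \<rho> --> (nnl (%x. norm (conv \<rho> u x - u x))) < ennreal \<eta>"
proof -
 have "L1_approx u" using integrable_L1_approx[OF u] .
 then obtain \<phi> K where p: "continuous_on UNIV \<phi>" "compact K" "\<And>x. x \<notin> K ==> \<phi> x = 0"
  "(nnl (%x. norm (u x - \<phi> x))) < ennreal (\<eta>/3)"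
  using \<open>\<eta> > 0\<close> unfolding L1_approx_def by (metis divide_pos_pos zero_less_numeral)
 have [measurable]: "bm u" "bm \<phi>"
  using borel_measurable_integrable[OF u] borel_measurable_continuous_onI[OF p(1)] by simp_all
 have \<phi>i: "integrable lborel \<phi>" by (rule continuous_compact_support_integrable[OF p(1-3)])
 obtain R where R: "K \<subseteq> cball 0 R"
  using compact_imp_bounded[OF p(2)] bounded_subset_ballD ball_subset_cball by (metis order_trans)
 define m where "m = measure lborel (cball (0::complex) (R + 1))"
 \<comment> \<open>The mollification error of \<phi> is at most \<delta> and lives on a ball of
   measure m, so it contributes at most \<eta>/3.\<close>
 define \<delta> where "\<delta> = \<eta> / (3 * (m + 1))"
 have m0: "m \<ge> 0" by (simp add: m_def)
 then have "\<delta> > 0" using \<open>\<eta> > 0\<close> by (simp add: \<delta>_def)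
 have "uniformly_continuous_on (cball 0 (R + 2)) \<phi>"
  by (intro compact_uniformly_continuous continuous_on_subset[OF p(1)]) auto
 then obtain e0 where e0: "e0 > 0" "\<And>x y. x \<in> cball 0 (R + 2) ==> y \<in> cball 0 (R + 2) ==> dist y x < e0 ==> dist (\<phi> y) (\<phi> x) < \<delta>"
  unfolding uniformly_continuous_on_def using \<open>\<delta> > 0\<close> by metis
 \<comment> \<open>With e at most 1 the support grows only from radius R to R + 1, and the points
   compared stay in the ball of radius R + 2.\<close>
 define e where "e = min e0 1"
 have "e > 0" using e0 by (simp add: e_def)
 moreover have "(nnl (%x. norm (conv \<rho> u x - u x))) < ennreal \<eta>" if m: "mollifier e \<rho>" for \<rho>
 proof -
  obtain B where B: "\<And>x. \<bar>\<rho> x\<bar> <= B" using mollifier_facts(3)[OF m] by blast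
  note c\<rho> = mollifier_facts(2)[OF m]
  have d: "integrable lborel (%x. u x - \<phi> x)" using u \<phi>i by simp
  note ci = conv_integrable[OF c\<rho> B]
  have [measurable]: "conv \<rho> (%x. u x - \<phi> x) \<in> borel_measurable borel" "conv \<rho> \<phi> \<in> borel_measurable borel"
   "conv \<rho> u \<in> borel_measurable borel" "bm \<rho>"
   using continuous_on_conv[OF c\<rho> B] u \<phi>i d c\<rho> by (auto intro!: borel_measurable_continuous_onI)
  have split: "conv \<rho> u x = conv \<rho> (%x. u x - \<phi> x) x + conv \<rho> \<phi> x" for x
   unfolding conv_def by (subst Bochner_Integration.integral_add[symmetric])
    (use ci[OF d] ci[OF \<phi>i] in \<open>auto simp: algebra_simps\<close>)
  have 1: "norm (conv \<rho> \<phi> x - \<phi> x) <= \<delta> * indicator (cball 0 (R + 1)) x" for x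
  proof -
   have i: "integrable lborel (%y. \<rho> (x - y))" "(LINT y|lborel. \<rho> (x - y)) = 1"
    using mollifier_translate[OF m] by auto
   have eq: "conv \<rho> \<phi> x - \<phi> x = (LINT y|lborel. \<rho> (x - y) *\<^sub>R (\<phi> y - \<phi> x))"
    using ci[OF \<phi>i, of x] i by (simp add: conv_def scaleR_diff_right)
   have "norm (\<rho> (x - y) *\<^sub>R (\<phi> y - \<phi> x)) <= \<delta> * indicator (cball 0 (R + 1)) x * \<rho> (x - y)" for y
   proof (cases "norm (x - y) < e")
    case True
    then have le: "norm (x - y) < 1" "dist y x < e0" by (auto simp: e_def dist_norm norm_minus_commute)
    show ?thesis
    proof (cases "norm x <= R + 1")
     case True
     have "norm y <= norm x + norm (x - y)" by (metis norm_triangle_sub norm_minus_commute)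
     then have "dist (\<phi> y) (\<phi> x) < \<delta>" using True le by (intro e0) auto
     then have "norm (\<phi> y - \<phi> x) <= \<delta>" by (simp add: dist_norm)
     from mult_right_mono[OF this mollifier_facts(4)[OF m, of "x - y"]]
     show ?thesis using True mollifier_facts(4)[OF m] by (simp add: mult.commute)
    next
     case False
     have "norm x <= norm y + norm (x - y)" by (metis norm_triangle_sub)
     then have "x \<notin> K" "y \<notin> K" using R False le by (auto simp: subset_eq)
     then show ?thesis using p(3) False by simp
    qed
   next
    case False
    then show ?thesis using mollifier_facts(5)[OF m, of "x - y"] by simp
   qed
   then have "norm (conv \<rho> \<phi> x - \<phi> x) <= (LINT y|lborel. \<delta> * indicator (cball 0 (R + 1)) x * \<rho> (x - y))"
    unfolding eq using ci[OF \<phi>i, of x] i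
    by (intro order_trans[OF Bochner_Integration.integral_norm_bound integral_mono])
     (auto simp: scaleR_diff_right)
   then show ?thesis using i by simp
  qed
  have em: "emeasure lborel (cball (0::complex) (R + 1)) = ennreal m"
   unfolding m_def using emeasure_lborel_cball_finite[of "0::complex" "R + 1"]
   by (intro emeasure_eq_ennreal_measure) auto
  have A: "(nnl (%x. norm (conv \<rho> \<phi> x - \<phi> x))) <= ennreal (\<eta>/3)"
  proof -
   have "(nnl (%x. norm (conv \<rho> \<phi> x - \<phi> x))) <= (nnl (%x. ennreal \<delta> * indicator (cball (0::complex) (R + 1)) x))"
   proof (intro nn_integral_mono)
    fix x
    show "ennreal (norm (conv \<rho> \<phi> x - \<phi> x)) <= ennreal \<delta> * indicator (cball 0 (R + 1)) x"
     using ennreal_leI[OF 1[of x]] by (cases "x \<in> cball 0 (R + 1)") auto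
   qed
   also have "\<dots> = ennreal \<delta> * ennreal m" by (simp add: nn_integral_cmult_indicator em)
   also have "\<dots> = ennreal (\<delta> * m)" using \<open>\<delta> > 0\<close> by (simp add: m0 ennreal_mult)
   also have "\<dots> <= ennreal (\<eta>/3)" using \<open>\<eta> > 0\<close> m0 by (intro ennreal_leI) (simp add: \<delta>_def field_simps)
   finally show ?thesis .
  qed
  have "(nnl (%x. norm (conv \<rho> (%x. u x - \<phi> x) x))) <=
    (nnl (%x. (nnl (%y. ennreal (\<rho> (x - y)) * ennreal (norm (u y - \<phi> y))))))"
   by (intro nn_integral_mono norm_conv_le[OF m d])
  also have "\<dots> = (nnl (%y. norm (u y - \<phi> y)))" by (rule conv_L1_bound[OF m]) measurable
  finally have B: "(nnl (%x. norm (conv \<rho> (%x. u x - \<phi> x) x))) < ennreal (\<eta>/3)" using p(4) by simp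
  have "(nnl (%x. norm (conv \<rho> u x - u x))) <=
    (nnl (%x. ennreal (norm (conv \<rho> (%x. u x - \<phi> x) x)) + ennreal (norm (conv \<rho> \<phi> x - \<phi> x)) + ennreal (norm (u x - \<phi> x))))"
  proof (intro nn_integral_mono)
   fix x
   have "conv \<rho> u x - u x = conv \<rho> (%x. u x - \<phi> x) x + (conv \<rho> \<phi> x - \<phi> x) - (u x - \<phi> x)"
    by (simp add: split)
   then have "norm (conv \<rho> u x - u x) <= norm (conv \<rho> (%x. u x - \<phi> x) x) + norm (conv \<rho> \<phi> x - \<phi> x) + norm (u x - \<phi> x)"
    by (metis (no_types, lifting) add_right_mono norm_triangle_ineq norm_triangle_ineq4 order_trans)
   then show "ennreal (norm (conv \<rho> u x - u x)) <= ennreal (norm (conv \<rho> (%x. u x - \<phi> x) x)) + ennreal (norm (conv \<rho> \<phi> x - \<phi> x)) + ennreal (norm (u x - \<phi> x))"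
    by (simp add: ennreal_plus[symmetric] del: ennreal_plus)
  qed
  also have "\<dots> = (nnl (%x. norm (conv \<rho> (%x. u x - \<phi> x) x))) + (nnl (%x. norm (conv \<rho> \<phi> x - \<phi> x))) + (nnl (%x. norm (u x - \<phi> x)))"
   by (simp add: nn_integral_add)
  also have "\<dots> <= ennreal (\<eta>/3) + ennreal (\<eta>/3) + (nnl (%x. norm (u x - \<phi> x)))"
   using A B by (intro add_mono) auto
  also have "\<dots> < ennreal (\<eta>/3) + ennreal (\<eta>/3) + ennreal (\<eta>/3)"
   using p(4) by (simp only: ennreal_add_left_cancel_less) auto
  also have "\<dots> = ennreal \<eta>" using \<open>\<eta> > 0\<close> by (simp add: ennreal_plus[symmetric] del: ennreal_plus)
  finally show ?thesis .
 qed
 ultimately show ?thesis by blast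
qed

section \<open>Weak gradients\<close>

text \<open>Difference quotients in the direction e have integral zero by translation invariance,
  and they converge dominatedly to the directional derivative.\<close>

lemma integral_frechet_derivative_C1_compact:
 fixes F :: "'a::euclidean_space => real"
 assumes F: "C1_compact F"
 shows "(LINT x|lborel. fd F x e) = 0"
proof -
 obtain L where L: "L > 0" "\<And>x y. \<bar>F x - F y\<bar> <= L * norm (x - y)"
  by (rule C1_compact_lipschitz[OF F]) (rule that)
 have cF: "continuous_on UNIV F" by (rule C1_compact_continuous[OF F])
 have "bounded (closure {x. F x \<noteq> 0})" using F by (simp add: C1_compact_def compact_imp_bounded)
 then obtain R where "closure {x. F x \<noteq> 0} \<subseteq> ball 0 R"
  using bounded_subset_ballD[of "closure {x. F x \<noteq> 0}" 0] by auto
 then have "closure {x. F x \<noteq> 0} \<subseteq> cball 0 R" using ball_subset_cball[of 0 R] by (rule order_trans)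
 then have R: "F x = 0" if "norm x > R" for x
 proof -
  have "x \<notin> cball 0 R" using that by simp
  then have "x \<notin> {x. F x \<noteq> 0}"
   using \<open>closure {x. F x \<noteq> 0} \<subseteq> cball 0 R\<close> closure_subset[of "{x. F x \<noteq> 0}"] by blast
  then show ?thesis by simp
 qed
 have Fi: "integrable lborel F"
  by (rule continuous_compact_support_integrable[OF cF compact_cball[of 0 R]]) (auto intro: R)
 have [measurable]: "bm F" using cF by (rule borel_measurable_continuous_onI)
 define t where "t = (%n. 1 / real (Suc n))"
 have t: "t n > 0" "t n <= 1" for n by (auto simp: t_def)
 have t0: "t \<longlonglongrightarrow> 0" unfolding t_def using LIMSEQ_inverse_real_of_nat by (simp add: divide_inverse)
 define q where "q = (%n x. (F (x + t n *\<^sub>R e) - F x) / t n)"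
 have Fs: "integrable lborel (%x. F (x + c))" "(LINT x|lborel. F (x + c)) = (LINT x|lborel. F x)" for c
 proof -
  show "(LINT x|lborel. F (x + c)) = (LINT x|lborel. F x)" by (rule integral_lborel_shift) measurable
  have "integrable (distr lborel borel ((+) c)) F" using Fi by (simp add: lborel_distr_plus)
  then show "integrable lborel (%x. F (x + c))" by (simp add: integrable_distr_eq add.commute)
 qed
 have q0: "(LINT x|lborel. q n x) = 0" for n using Fs[of "t n *\<^sub>R e"] Fi by (simp add: q_def)
 have "(%n. LINT x|lborel. q n x) \<longlonglongrightarrow> (LINT x|lborel. fd F x e)"
 proof (rule integral_dominated_convergence)
  show "(%x. fd F x e) \<in> borel_measurable lborel"
   using F unfolding C1_compact_def by (auto intro: borel_measurable_continuous_onI)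
  show "q n \<in> borel_measurable lborel" for n unfolding q_def by measurable
  \<comment> \<open>Since \<open>t n\<close> is at most 1, a shifted point can reach the support
    only from the ball enlarged by norm e.\<close>
  show "integrable lborel (%x. L * norm e * indicator (cball (0::'a) (R + norm e)) x)"
   using emeasure_lborel_cball_finite[of "0::'a" "R + norm e"]
   by (intro integrable_mult_right integrable_real_indicator) auto
  show "AE x in lborel. (%n. q n x) \<longlonglongrightarrow> fd F x e"
  proof (rule AE_I2)
   fix x
   have D: "(F has_derivative fd F x) (at x)"
   proof -
    have "F differentiable at x" using F by (simp add: C1_compact_def)
    then show ?thesis by (rule iffD1[OF frechet_derivative_works])
   qed
   have "((%t. x + t *\<^sub>R e) has_derivative (%t. t *\<^sub>R e)) (at (0::real))"
    by (auto intro!: derivative_eq_intros)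
   then have "((%t. F (x + t *\<^sub>R e)) has_derivative (%t. fd F x (t *\<^sub>R e))) (at 0)"
    by (rule has_derivative_compose) (use D in simp)
   then have "((%t. F (x + t *\<^sub>R e)) has_real_derivative fd F x e) (at 0)"
    unfolding has_field_derivative_def
    by (rule has_derivative_eq_rhs) (simp add: linear_scale[OF has_derivative_linear[OF D]] fun_eq_iff)
   then have "((%h. (F (x + h *\<^sub>R e) - F x) / h) \<longlongrightarrow> fd F x e) (at 0)"
    by (simp add: has_field_derivative_iff)
   then show "(%n. q n x) \<longlonglongrightarrow> fd F x e" unfolding q_def
    by (rule filterlim_compose) (use t(1) t0 in \<open>auto simp: filterlim_at less_le\<close>)
  qed
  show "AE x in lborel. norm (q n x) <= L * norm e * indicator (cball 0 (R + norm e)) x" for n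
  proof (rule AE_I2)
   fix x
   show "norm (q n x) <= L * norm e * indicator (cball 0 (R + norm e)) x"
   proof (cases "norm x <= R + norm e")
    case True
    have "\<bar>F (x + t n *\<^sub>R e) - F x\<bar> <= L * (t n * norm e)"
    proof -
     have "norm (x + t n *\<^sub>R e - x) = t n * norm e" using less_imp_le[OF t(1)[of n]] by simp
     then show ?thesis using L(2)[of "x + t n *\<^sub>R e" x] by metis
    qed
    then have "\<bar>F (x + t n *\<^sub>R e) - F x\<bar> / t n <= L * norm e"
     using t(1)[of n] by (subst pos_divide_le_eq) (auto simp: mult_ac)
    then show ?thesis using True t(1)[of n] by (simp add: q_def)
   next
    case False
    have "norm x <= norm (x + t n *\<^sub>R e) + norm (t n *\<^sub>R e)" using norm_triangle_ineq4[of "x + t n *\<^sub>R e" "t n *\<^sub>R e"] by simp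
    also have "norm (t n *\<^sub>R e) <= 1 * norm e" using t[of n] by (simp add: mult_left_le_one_le)
    finally have "norm (x + t n *\<^sub>R e) > R" using False by simp
    moreover have "norm x > R" using False norm_ge_zero[of e] by linarith
    ultimately show ?thesis using R False by (simp add: q_def)
   qed
  qed
 qed
 then have "(%n. 0) \<longlonglongrightarrow> (LINT x|lborel. fd F x e)" by (simp add: q0)
 from LIMSEQ_unique[OF this tendsto_const] show ?thesis by simp
qed

definition C1_on :: "'a::euclidean_space set => ('a => real) => ('a => 'a) => bool" where
 "C1_on N w G \<longleftrightarrow> open N \<and> (\<forall>x\<in>N. (w has_derivative (%h. G x \<bullet> h)) (at x)) \<and> continuous_on N G"

lemma C1_on_continuous: "C1_on N w G ==> continuous_on N w"
 unfolding C1_on_def by (meson continuous_at_imp_continuous_on has_derivative_continuous)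

lemma C1_on_subset: "C1_on N w G ==> open N' ==> N' \<subseteq> N ==> C1_on N' w G"
 unfolding C1_on_def by (meson continuous_on_subset subset_eq)

lemma continuous_on_locally_integrable:
 fixes g :: "'a::euclidean_space => 'b::euclidean_space"
 shows "continuous_on N g ==> locally_integrable N g" unfolding locally_integrable_def set_integrable_def
 by (intro allI impI borel_integrable_compact) (auto intro: continuous_on_subset)

lemma integrable_test_mult:
 fixes h :: "'a::euclidean_space => 'b::euclidean_space" and b :: "'a => real"
 assumes "locally_integrable U h" "compact K" "K \<subseteq> U"
  "continuous_on UNIV b" "\<And>x. x \<notin> K ==> b x = 0"
 shows "sint U (%x. b x *\<^sub>R h x)"
  "(LINT x:U|lborel. b x *\<^sub>R h x) = (LINT x:K|lborel. b x *\<^sub>R h x)"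
  "sint K (%x. b x *\<^sub>R h x)"
proof -
 have "\<exists>B>0. \<forall>x. norm (b x) <= B" by (rule continuous_compact_support_bounded[OF assms(4,2,5)]) auto
 then obtain B where B: "B > 0" "\<And>x. norm (b x) <= B" by blast
 have eq: "indicator U x *\<^sub>R (b x *\<^sub>R h x) = b x *\<^sub>R (indicator K x *\<^sub>R h x)"
  "indicator K x *\<^sub>R (b x *\<^sub>R h x) = b x *\<^sub>R (indicator K x *\<^sub>R h x)" for x
  using assms(3,5) by (auto simp: indicator_def)
 have "integrable lborel (%x. indicator K x *\<^sub>R h x)"
  using assms unfolding locally_integrable_def set_integrable_def by blast
 then have "integrable lborel (%x. b x *\<^sub>R (indicator K x *\<^sub>R h x))"
  by (rule integrable_bounded_scaleR[where B = B]) (use B borel_measurable_continuous_onI[OF assms(4)] in auto)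
 then show "sint U (%x. b x *\<^sub>R h x)" "sint K (%x. b x *\<^sub>R h x)"
  "(LINT x:U|lborel. b x *\<^sub>R h x) = (LINT x:K|lborel. b x *\<^sub>R h x)"
  unfolding set_integrable_def set_lebesgue_integral_def eq by simp_all
qed

lemma test_function_facts:
 assumes "test_function U \<phi>"
 shows "compact (closure {x. \<phi> x \<noteq> 0})" "closure {x. \<phi> x \<noteq> 0} \<subseteq> U" "continuous_on UNIV \<phi>"
  "continuous_on UNIV (%x. fd \<phi> x e)"
  "\<And>x. x \<notin> closure {x. \<phi> x \<noteq> 0} ==> \<phi> x = 0"
  "\<And>x. x \<notin> closure {x. \<phi> x \<noteq> 0} ==> fd \<phi> x e = 0"
  "\<phi> differentiable at x"
 using assms test_function_C1[OF assms] C1_compact_continuous[OF test_function_C1[OF assms]]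
  closure_subset[of "{x. \<phi> x \<noteq> 0}"] frechet_derivative_eq_0_outside_support[of _ \<phi>]
 by (auto simp: test_function_def C1_compact_def)

lemma weak_gradient_test_integrable:
 fixes g :: "'a::euclidean_space => 'a"
 assumes "test_function U \<phi>" "locally_integrable U u" "locally_integrable U g"
 shows "sint U (%x. u x * fd \<phi> x e)"
  "sint U (%x. (g x \<bullet> e) * \<phi> x)"
proof -
 note t = test_function_facts[OF assms(1)]
 show "sint U (%x. u x * fd \<phi> x e)"
  using integrable_test_mult(1)[OF assms(2) t(1,2,4,6)] by (simp add: mult.commute)
 have "sint U (%x. \<phi> x *\<^sub>R g x)" using integrable_test_mult(1)[OF assms(3) t(1,2,3,5)] .
 then have "integrable lborel (%x. (indicator U x *\<^sub>R (\<phi> x *\<^sub>R g x)) \<bullet> e)"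
  unfolding set_integrable_def by (intro integrable_inner_left) auto
 then show "sint U (%x. (g x \<bullet> e) * \<phi> x)" unfolding set_integrable_def by (simp add: mult_ac)
qed

lemma locally_integrable_lincomb:
 fixes f g :: "'a::euclidean_space => 'b::euclidean_space"
 shows "locally_integrable U f ==> locally_integrable U g ==> locally_integrable U (%x. a *\<^sub>R f x + b *\<^sub>R g x)"
 unfolding locally_integrable_def by (intro allI impI set_integral_add(1) set_integrable_scaleR_right) auto

lemma is_weak_gradient_lincomb:
 fixes U :: "'a::euclidean_space set"
 assumes "is_weak_gradient U u g" "is_weak_gradient U v h"
 shows "is_weak_gradient U (%x. a * u x + b * v x) (%x. a *\<^sub>R g x + b *\<^sub>R h x)"
proof -
 have li: "locally_integrable U u" "locally_integrable U v" "locally_integrable U g" "locally_integrable U h"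
  using assms unfolding is_weak_gradient_def by blast+
 show ?thesis unfolding is_weak_gradient_def
 proof (intro conjI allI impI)
  show "locally_integrable U (%x. a * u x + b * v x)"
   using locally_integrable_lincomb[OF li(1,2), of a b] by simp
  show "locally_integrable U (%x. a *\<^sub>R g x + b *\<^sub>R h x)"
   using locally_integrable_lincomb[OF li(3,4)] .
  fix \<phi> and e :: 'a assume te: "test_function U \<phi> \<and> e \<in> Basis"
  then have t: "test_function U \<phi>" by blast
  have 1: "(LBINT x:U. (a * u x + b * v x) * fd \<phi> x e) =
    a * (LBINT x:U. u x * fd \<phi> x e) + b * (LBINT x:U. v x * fd \<phi> x e)"
   using weak_gradient_test_integrable(1)[OF t li(1,3), of e] weak_gradient_test_integrable(1)[OF t li(2,4), of e]
   by (simp add: algebra_simps set_integral_add set_integral_mult_right)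
  have 2: "(LBINT x:U. ((a *\<^sub>R g x + b *\<^sub>R h x) \<bullet> e) * \<phi> x) =
    a * (LBINT x:U. (g x \<bullet> e) * \<phi> x) + b * (LBINT x:U. (h x \<bullet> e) * \<phi> x)"
   using weak_gradient_test_integrable(2)[OF t li(1,3), of e] weak_gradient_test_integrable(2)[OF t li(2,4), of e]
   by (simp add: algebra_simps inner_add_left set_integral_add set_integral_mult_right)
  show "(LBINT x:U. (a * u x + b * v x) * fd \<phi> x e) = - (LBINT x:U. ((a *\<^sub>R g x + b *\<^sub>R h x) \<bullet> e) * \<phi> x)"
   unfolding 1 2 using assms te unfolding is_weak_gradient_def by auto
 qed
qed

text \<open>The product of w with a test function, extended by zero, is continuously differentiable
  on the whole space. The integral of its derivative vanishes, and the product rule turns this into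
  the integration by parts.\<close>

lemma C1_on_weak_gradient:
 fixes U :: "'a::euclidean_space set"
 assumes C: "C1_on U w G"
 shows "is_weak_gradient U w G" unfolding is_weak_gradient_def
proof (intro conjI allI impI)
 have U: "open U" and D: "\<And>x. x \<in> U ==> (w has_derivative (%h. G x \<bullet> h)) (at x)" and cG: "continuous_on U G"
  using C by (auto simp: C1_on_def)
 have cw: "continuous_on U w" using C by (rule C1_on_continuous)
 show lw: "locally_integrable U w" and lG: "locally_integrable U G"
  using cw cG by (auto intro: continuous_on_locally_integrable)
 fix \<phi> and e :: 'a assume "test_function U \<phi> \<and> e \<in> Basis"
 then have t: "test_function U \<phi>" by blast
 note tf = test_function_facts[OF t]
 let ?K = "closure {x. \<phi> x \<noteq> 0}"
 define F where "F = (%x. if x \<in> U then w x * \<phi> x else 0)"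
 define DF where "DF = (%x h. if x \<in> U then w x * fd \<phi> x h + (G x \<bullet> h) * \<phi> x else 0)"
 have FD: "(F has_derivative DF x) (at x)" for x
 proof (cases "x \<in> U")
  case True
  have "((%x. w x * \<phi> x) has_derivative DF x) (at x)"
   unfolding DF_def using True has_derivative_mult[OF D[OF True] tf(7)[unfolded frechet_derivative_works]]
   by simp
  then show ?thesis by (rule has_derivative_transform_within_open[OF _ U True]) (simp add: F_def)
 next
  case False
  then have "x \<in> - ?K" using tf(2) by blast
  have "((%_. 0) has_derivative DF x) (at x)" using False by (simp add: DF_def)
  then show ?thesis
  proof (rule has_derivative_transform_within_open[OF _ _ \<open>x \<in> - ?K\<close>])
   fix y assume "y \<in> - ?K"
   then have "\<phi> y = 0" using tf(5) by blast
   then show "0 = F y" by (simp add: F_def)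
  qed (rule open_Compl, rule closed_closure)
 qed
 have fF: "fd F x = DF x" for x by (rule frechet_derivative_at[OF FD, symmetric])
 have "C1_compact F" unfolding C1_compact_def
 proof (intro conjI allI)
  show "F differentiable at x" for x by (rule differentiableI[OF FD])
  show "compact (closure {x. F x \<noteq> 0})"
  proof -
   have "closure {x. F x \<noteq> 0} \<subseteq> ?K" by (rule closure_mono) (auto simp: F_def)
   then show ?thesis using bounded_subset[OF compact_imp_bounded[OF tf(1)]] by (simp add: compact_eq_bounded_closed)
  qed
  show "continuous_on UNIV (%x. fd F x h)" for h
  proof -
   have 1: "continuous_on U (%x. DF x h)"
    unfolding DF_def by (rule continuous_on_eq[where f = "%x. w x * fd \<phi> x h + (G x \<bullet> h) * \<phi> x"])
     (auto intro!: continuous_intros cw cG continuous_on_subset[OF tf(3)] continuous_on_subset[OF tf(4)])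
   have 2: "continuous_on (- ?K) (%x. DF x h)"
   proof (rule continuous_on_eq[where f = "%x. 0"])
    fix y assume "y \<in> - ?K"
    then have "\<phi> y = 0" "fd \<phi> y h = 0" using tf(5,6) by blast+
    then show "0 = DF y h" by (simp add: DF_def)
   qed simp
   have "U \<union> - ?K = UNIV" using tf(2) by blast
   then show ?thesis using continuous_on_open_Un[OF U _ 1 2] by (simp add: fF open_Compl)
  qed
 qed
 from integral_frechet_derivative_C1_compact[OF this, of e]
 have "0 = (LINT x|lborel. DF x e)" by (simp add: fF)
 also have "\<dots> = (LBINT x:U. w x * fd \<phi> x e + (G x \<bullet> e) * \<phi> x)"
  unfolding set_lebesgue_integral_def by (rule Bochner_Integration.integral_cong) (auto simp: DF_def)
 also have "\<dots> = (LBINT x:U. w x * fd \<phi> x e) + (LBINT x:U. (G x \<bullet> e) * \<phi> x)"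
  by (intro set_integral_add weak_gradient_test_integrable[OF t lw lG])
 finally show "(LBINT x:U. w x * fd \<phi> x e) = - (LBINT x:U. (G x \<bullet> e) * \<phi> x)" by simp
qed

text \<open>A test function sees only its compact support K, so the approximants may live on
  neighbourhoods that depend on K and have to be close only in L1 over K. In this form the criterion
  accepts mollifications, which exist only away from the boundary of U.\<close>

lemma is_weak_gradient_limit:
 fixes U :: "'a::euclidean_space set"
 assumes u: "locally_integrable U u" and g: "locally_integrable U g"
  and appr: "\<And>K \<eta>. compact K ==> K \<subseteq> U ==> \<eta> > 0 ==>
   \<exists>N w G. K \<subseteq> N \<and> is_weak_gradient N w G \<and> (LBINT x:K. norm (w x - u x)) <= \<eta> \<and>
    (LBINT x:K. norm (G x - g x)) <= \<eta>"
 shows "is_weak_gradient U u g" unfolding is_weak_gradient_def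
proof (intro conjI allI impI u g)
 fix \<phi> and e :: 'a assume te: "test_function U \<phi> \<and> e \<in> Basis"
 have t: "test_function U \<phi>" and e: "e \<in> Basis" using te by simp_all
 note tf = test_function_facts[OF t]
 define K where "K = closure {x. \<phi> x \<noteq> 0}"
 have K: "compact K" "K \<subseteq> U" unfolding K_def by (rule tf(1), rule tf(2))
 have "\<exists>L>0. \<forall>x. \<bar>fd \<phi> x e\<bar> <= L * norm e" by (rule C1_compact_lipschitz[OF test_function_C1[OF t]]) auto
 then obtain L where L: "L > 0" "\<And>x. \<bar>fd \<phi> x e\<bar> <= L * norm e" by blast
 have "\<exists>B>0. \<forall>x. norm (\<phi> x) <= B" by (rule continuous_compact_support_bounded[OF tf(3,1,5)]) auto
 then obtain B where B: "B > 0" "\<And>x. norm (\<phi> x) <= B" by blast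
 let ?I = "%U u g. (LBINT x:U. u x * fd \<phi> x e) + (LBINT x:U. (g x \<bullet> e) * \<phi> x)"
 have IK: "?I N w G = (LBINT x:K. w x * fd \<phi> x e + (G x \<bullet> e) * \<phi> x)"
  "sint K (%x. w x * fd \<phi> x e + (G x \<bullet> e) * \<phi> x)"
  "sint K w" "sint K G"
  if "K \<subseteq> N" "locally_integrable N w" "locally_integrable N G" for N w G
 proof -
  have lK: "locally_integrable K w" "locally_integrable K G"
   using that unfolding locally_integrable_def by auto
  have tK: "test_function K \<phi>" using t by (auto simp: test_function_def K_def)
  note i = weak_gradient_test_integrable[OF tK lK, of e]
  have z: "\<phi> x = 0" "fd \<phi> x e = 0" if "x \<notin> K" for x
   using tf(5)[of x] tf(6)[of x e] that unfolding K_def by blast+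
  have 1: "(LBINT x:N. w x * fd \<phi> x e) = (LBINT x:K. w x * fd \<phi> x e)"
   unfolding set_lebesgue_integral_def
   by (rule Bochner_Integration.integral_cong) (use that(1) z in \<open>auto simp: indicator_def\<close>)
  have 2: "(LBINT x:N. (G x \<bullet> e) * \<phi> x) = (LBINT x:K. (G x \<bullet> e) * \<phi> x)"
   unfolding set_lebesgue_integral_def
   by (rule Bochner_Integration.integral_cong) (use that(1) z in \<open>auto simp: indicator_def\<close>)
  show "?I N w G = (LBINT x:K. w x * fd \<phi> x e + (G x \<bullet> e) * \<phi> x)"
   unfolding 1 2 by (rule set_integral_add(2)[symmetric, OF i])
  show "sint K (%x. w x * fd \<phi> x e + (G x \<bullet> e) * \<phi> x)" by (rule set_integral_add(1)[OF i])
  show "sint K w" "sint K G" using lK K(1) unfolding locally_integrable_def by auto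
 qed
 have bd: "\<bar>?I U u g\<bar> <= (L + B) * \<eta>" if "\<eta> > 0" for \<eta>
 proof -
  obtain N w G where w: "K \<subseteq> N" "is_weak_gradient N w G" "(LBINT x:K. norm (w x - u x)) <= \<eta>"
    "(LBINT x:K. norm (G x - g x)) <= \<eta>" using appr[OF K \<open>\<eta> > 0\<close>] by blast
  have lw: "locally_integrable N w" "locally_integrable N G" using w(2) by (auto simp: is_weak_gradient_def)
  have "test_function N \<phi>" using test_function_subset[OF t] w(1) by (simp add: K_def)
  then have "?I N w G = 0" using w(2) e by (simp add: is_weak_gradient_def)
  then have 0: "(LBINT x:K. w x * fd \<phi> x e + (G x \<bullet> e) * \<phi> x) = 0" using IK(1)[OF w(1) lw] by simp
  have i1: "sint K (%x. norm (w x - u x))" "sint K (%x. norm (G x - g x))"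
   by (intro set_integrable_norm set_integral_diff(1) IK(3)[OF w(1) lw] IK(3)[OF K(2) u g]
     IK(4)[OF w(1) lw] IK(4)[OF K(2) u g])+
  have "?I U u g = (LBINT x:K. (u x * fd \<phi> x e + (g x \<bullet> e) * \<phi> x) -
    (w x * fd \<phi> x e + (G x \<bullet> e) * \<phi> x))"
   using set_integral_diff(2)[OF IK(2)[OF K(2) u g] IK(2)[OF w(1) lw]] 0 IK(1)[OF K(2) u g] by simp
  also have "\<bar>\<dots>\<bar> <= (LBINT x:K. L * norm (w x - u x) + B * norm (G x - g x))"
  proof -
   have "norm (LBINT x:K. (u x * fd \<phi> x e + (g x \<bullet> e) * \<phi> x) -
    (w x * fd \<phi> x e + (G x \<bullet> e) * \<phi> x)) <=
    (LBINT x:K. norm ((u x * fd \<phi> x e + (g x \<bullet> e) * \<phi> x) -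
    (w x * fd \<phi> x e + (G x \<bullet> e) * \<phi> x)))"
    by (rule set_integral_norm_bound) (intro set_integral_diff(1) IK(2)[OF K(2) u g] IK(2)[OF w(1) lw])
   also have "\<dots> <= (LBINT x:K. L * norm (w x - u x) + B * norm (G x - g x))"
   proof (rule set_integral_mono)
    show "sint K (%x. norm ((u x * fd \<phi> x e + (g x \<bullet> e) * \<phi> x) -
     (w x * fd \<phi> x e + (G x \<bullet> e) * \<phi> x)))"
     by (intro set_integrable_norm set_integral_diff(1) IK(2)[OF K(2) u g] IK(2)[OF w(1) lw])
    show "sint K (%x. L * norm (w x - u x) + B * norm (G x - g x))"
     using i1 by (intro set_integral_add(1) set_integrable_mult_right) auto
    fix x
    have ne: "norm e = 1" using e by simp
    have "(u x * fd \<phi> x e + (g x \<bullet> e) * \<phi> x) - (w x * fd \<phi> x e + (G x \<bullet> e) * \<phi> x)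
     = (u x - w x) * fd \<phi> x e + ((g x - G x) \<bullet> e) * \<phi> x" by (simp add: algebra_simps)
    also have "norm \<dots> <= \<bar>u x - w x\<bar> * \<bar>fd \<phi> x e\<bar> + \<bar>(g x - G x) \<bullet> e\<bar> * \<bar>\<phi> x\<bar>"
     by (metis abs_mult abs_triangle_ineq real_norm_def)
    also have "\<dots> <= \<bar>u x - w x\<bar> * L + norm (g x - G x) * B"
     using L(2)[of x] B(2)[of x] Cauchy_Schwarz_ineq2[of "g x - G x" e] ne
     by (intro add_mono mult_mono) auto
    finally show "norm ((u x * fd \<phi> x e + (g x \<bullet> e) * \<phi> x) - (w x * fd \<phi> x e + (G x \<bullet> e) * \<phi> x))
     <= L * norm (w x - u x) + B * norm (G x - g x)"
     by (simp add: mult.commute norm_minus_commute abs_minus_commute)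
   qed
   finally show ?thesis by simp
  qed
  also have "\<dots> = L * (LBINT x:K. norm (w x - u x)) + B * (LBINT x:K. norm (G x - g x))"
   using i1 by (simp add: set_integral_add set_integral_mult_right)
  also have "\<dots> <= L * \<eta> + B * \<eta>" using w L B by (intro add_mono mult_left_mono) auto
  finally show ?thesis by (simp add: algebra_simps)
 qed
 have "\<bar>?I U u g\<bar> <= 0"
 proof (rule field_le_epsilon)
  fix \<epsilon> :: real assume "\<epsilon> > 0"
  then show "\<bar>?I U u g\<bar> <= 0 + \<epsilon>" using bd[of "\<epsilon> / (L + B)"] L(1) B(1) by simp
 qed
 then show "(LBINT x:U. u x * fd \<phi> x e) = - (LBINT x:U. (g x \<bullet> e) * \<phi> x)" by simp
qed

text \<open>Mollification at a scale below the distance of K from the complement of U. Besides L1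
  closeness it keeps sup bounds, which for M = 0 gives the uniqueness of weak gradients, and it does
  not increase the energy, which the approximation on the disc relies on.\<close>

lemma weak_gradient_approx:
 fixes U :: "complex set"
 assumes U: "open U" and K: "compact K" "K \<subseteq> U" and wg: "is_weak_gradient U u g" and "\<eta> > 0"
 shows "\<exists>N w G. K \<subseteq> N \<and> N \<subseteq> U \<and> C1_on N w G \<and>
   (LBINT x:K. norm (w x - u x)) <= \<eta> \<and> (LBINT x:K. norm (G x - g x)) <= \<eta> \<and>
   (\<forall>M. (\<forall>x\<in>U. \<bar>u x\<bar> <= M) --> (\<forall>x\<in>N. \<bar>w x\<bar> <= M)) \<and>
   (sint U (%x. (norm (g x))^2) -->
    (LBINT x:K. (norm (G x))\<^sup>2) <= (LBINT x:U. (norm (g x))\<^sup>2))"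
\<comment> \<open>By convention the distance to the empty set is 0, so the neighbourhoods of K below
  make sense only for nonempty K.\<close>
proof (cases "K = {}")
 case True
 then show ?thesis by (intro exI[of _ "{}"] exI[of _ "%_. 0"])
   (use \<open>\<eta> > 0\<close> in \<open>auto simp: C1_on_def set_lebesgue_integral_def intro!: integral_nonneg_AE\<close>)
next
 case False
 have li: "locally_integrable U u" "locally_integrable U g" using wg by (auto simp: is_weak_gradient_def)
 have "\<exists>d>0. \<forall>x\<in>K. \<forall>y\<in>- U. d <= dist x y" using K U by (intro separate_compact_closed) auto
 then obtain d where d: "d > 0" "\<And>x y. x \<in> K ==> y \<in> - U ==> d <= dist x y" by blast
 define e where "e = d / 2"
 have e: "e > 0" using d(1) by (simp add: e_def)
 define K' where "K' = {x. infdist x K <= e}"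
 have cK': "compact K'" unfolding K'_def by (rule compact_infdist_le[OF False K(1) e])
 have K'U: "K' \<subseteq> U"
 proof
  fix y assume "y \<in> K'"
  obtain x where x: "x \<in> K" "infdist y K = dist y x"
   using infdist_attains_inf[OF compact_imp_closed[OF K(1)] False] by blast
  show "y \<in> U"
  proof (rule ccontr)
   assume "y \<notin> U"
   then have "d <= dist x y" using d(2)[OF x(1)] by simp
   then show False using \<open>y \<in> K'\<close> x d(1) by (simp add: K'_def e_def dist_commute)
  qed
 qed
 define N where "N = {x. infdist x K < e / 2}"
 have oN: "open N" unfolding N_def by (intro open_Collect_less continuous_intros)
 have KN: "K \<subseteq> N" using e by (auto simp: N_def)
 have NK': "N \<subseteq> K'" using e by (auto simp: N_def K'_def)
 have near: "y \<in> K'" if "x \<in> N" "dist x y < e / 2" for x y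
  using that infdist_triangle[of y K x] by (simp add: N_def K'_def dist_commute)
 have sK': "K' \<in> sets borel" using compact_imp_closed[OF cK'] by (rule borel_closed)
 have sK: "K \<in> sets borel" using compact_imp_closed[OF K(1)] by (rule borel_closed)
 define u' where "u' = (%x. indicator K' x *\<^sub>R u x)"
 define g' where "g' = (%x. indicator K' x *\<^sub>R g x)"
 have iu: "integrable lborel u'" and ig: "integrable lborel g'"
  using li cK' K'U unfolding u'_def g'_def locally_integrable_def set_integrable_def by blast+
 obtain e1 where e1: "e1 > 0" "\<And>\<rho>. mollifier e1 \<rho> ==> (nnl (%x. norm (conv \<rho> u' x - u' x))) < ennreal \<eta>"
  using mollify_L1[OF iu \<open>\<eta> > 0\<close>] by blast
 obtain e2 where e2: "e2 > 0" "\<And>\<rho>. mollifier e2 \<rho> ==> (nnl (%x. norm (conv \<rho> g' x - g' x))) < ennreal \<eta>"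
  using mollify_L1[OF ig \<open>\<eta> > 0\<close>] by blast
 \<comment> \<open>Strictly below e/2, the gap between N and K', so that mollifying at a point of N
   involves only values on K'.\<close>
 define e3 where "e3 = min (min e1 e2) (e / 3)"
 have "e3 > 0" using e1 e2 e by (simp add: e3_def)
 then obtain \<rho> where m: "mollifier e3 \<rho>" using mollifier_exists by blast
 have e3: "e3 <= e1" "e3 <= e2" "e3 < e / 2" using e by (auto simp: e3_def)
 note mf = mollifier_facts[OF m]
 obtain B where B: "\<And>x. \<bar>\<rho> x\<bar> <= B" using mf(3) by blast
 define w where "w = conv \<rho> u'"
 define G where "G = conv \<rho> g'"
 have cw: "continuous_on UNIV w" and cG: "continuous_on UNIV G"
  unfolding w_def G_def using continuous_on_conv[OF mf(2) B] iu ig by auto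
 have [measurable]: "bm w" "bm G" "bm u'"
  "bm g'"
  using cw cG iu ig by (auto intro!: borel_measurable_continuous_onI dest: borel_measurable_integrable)
 let ?D = "%x h. LINT y|lborel. fd \<rho> (x - y) h *\<^sub>R u' y"
 have Dw: "(w has_derivative ?D x) (at x)" for x
  unfolding w_def by (rule conv_has_derivative[OF mf(1) iu])
 \<comment> \<open>For x in N the reflected translate of \<rho> is an admissible test function. Its
   derivative carries a minus sign, which cancels the one in the definition of weak
   gradients.\<close>
 have DG: "?D x b = G x \<bullet> b" if "x \<in> N" "b \<in> Basis" for x b
 proof -
  let ?\<phi> = "%y. \<rho> (x - y)"
  have fd: "fd ?\<phi> y h = - fd \<rho> (x - y) h" for y h
  proof -
   have "\<rho> differentiable at (x - y)" using mf(1) by (simp add: C1_compact_def)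
   then have D\<rho>: "(\<rho> has_derivative fd \<rho> (x - y)) (at (x - y))"
    by (rule iffD1[OF frechet_derivative_works])
   have "((%y. x - y) has_derivative (%h. - h)) (at y)" by (auto intro!: derivative_eq_intros)
   from has_derivative_compose[OF this D\<rho>]
   have "(?\<phi> has_derivative (%h. fd \<rho> (x - y) (- h))) (at y)" .
   from frechet_derivative_at[OF this] show ?thesis
    using linear_neg[OF has_derivative_linear[OF D\<rho>]] by metis
  qed
  have sup: "closure {y. ?\<phi> y \<noteq> 0} \<subseteq> cball x e3"
  proof (rule closure_minimal)
   show "{y. ?\<phi> y \<noteq> 0} \<subseteq> cball x e3"
   proof
    fix y assume "y \<in> {y. ?\<phi> y \<noteq> 0}"
    then have "\<not> norm (x - y) \<ge> e3" using mf(5) by auto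
    then show "y \<in> cball x e3" by (simp add: dist_norm)
   qed
  qed simp
  have supK': "cball x e3 \<subseteq> K'" using near[OF that(1)] e3 by (auto simp: subset_eq)
  have t: "test_function U ?\<phi>" unfolding test_function_def
  proof (intro conjI allI)
   show "Ck k ?\<phi>" for k using m by (auto simp: mollifier_def)
   show "compact (closure {y. ?\<phi> y \<noteq> 0})"
    using bounded_subset[OF bounded_cball sup] by (simp add: compact_eq_bounded_closed)
   show "closure {y. ?\<phi> y \<noteq> 0} \<subseteq> U" using sup supK' K'U by blast
  qed
  note tf = test_function_facts[OF t]
  have z: "?\<phi> y = 0" "fd ?\<phi> y b = 0" if "y \<notin> K'" for y using tf(5,6) sup supK' that by blast+
  have "?D x b = - (LINT y|lborel. fd ?\<phi> y b *\<^sub>R u' y)" by (simp add: fd)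
  also have "(LINT y|lborel. fd ?\<phi> y b *\<^sub>R u' y) = (LBINT y:U. u y * fd ?\<phi> y b)"
   unfolding set_lebesgue_integral_def
   by (rule Bochner_Integration.integral_cong) (use z K'U in \<open>auto simp: u'_def indicator_def\<close>)
  also have "\<dots> = - (LBINT y:U. (g y \<bullet> b) * ?\<phi> y)"
   using wg t that(2) unfolding is_weak_gradient_def by blast
  also have "(LBINT y:U. (g y \<bullet> b) * ?\<phi> y) = (LINT y|lborel. (?\<phi> y *\<^sub>R g' y) \<bullet> b)"
   unfolding set_lebesgue_integral_def
   by (rule Bochner_Integration.integral_cong) (use z K'U in \<open>auto simp: g'_def indicator_def\<close>)
  also have "\<dots> = (LINT y|lborel. ?\<phi> y *\<^sub>R g' y) \<bullet> b"
   by (rule integral_inner_left) (rule conv_integrable[OF mf(2) B ig])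
  finally show ?thesis by (simp add: G_def conv_def)
 qed
 have C: "C1_on N w G" unfolding C1_on_def
 proof (intro conjI ballI oN)
  fix x assume "x \<in> N"
  have "?D x h = G x \<bullet> h" for h
  proof -
   have l: "linear (?D x)" using Dw has_derivative_linear by blast
   have "?D x h = ?D x (\<Sum>b\<in>Basis. (h \<bullet> b) *\<^sub>R b)" by (simp only: euclidean_representation)
   also have "\<dots> = (\<Sum>b\<in>Basis. (h \<bullet> b) *\<^sub>R ?D x b)" by (simp only: linear_sum[OF l] linear_scale[OF l])
   also have "\<dots> = (\<Sum>b\<in>Basis. (h \<bullet> b) * (G x \<bullet> b))" using DG[OF \<open>x \<in> N\<close>] by (intro sum.cong) auto
   also have "\<dots> = G x \<bullet> h" by (subst euclidean_inner) (simp add: mult.commute)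
   finally show ?thesis .
  qed
  then show "(w has_derivative (%h. G x \<bullet> h)) (at x)" by (intro has_derivative_eq_rhs[OF Dw]) auto
 qed (rule continuous_on_subset[OF cG], simp)
 have L1: "(LBINT x:K. norm (f x - h x)) <= \<eta>"
  if "(nnl (%x. norm (f x - h' x))) < ennreal \<eta>" "\<And>x. x \<in> K ==> h x = h' x"
   "bm f" "bm h'"
  for f h h' :: "complex => 'b::euclidean_space"
 proof -
  have [measurable]: "bm f" "bm h'" "K \<in> sets borel" using that sK by auto
  have "(LBINT x:K. norm (f x - h x)) = (LINT x|lborel. indicator K x * norm (f x - h' x))"
   unfolding set_lebesgue_integral_def
   by (rule Bochner_Integration.integral_cong) (use that(2) in \<open>auto simp: indicator_def\<close>)
  also have "\<dots> = enn2real (nnl (%x. ennreal (indicator K x * norm (f x - h' x))))"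
  proof (rule integral_eq_nn_integral)
   show "(%x. indicator K x * norm (f x - h' x)) \<in> borel_measurable lborel"
    by (intro borel_measurable_times borel_measurable_indicator borel_measurable_norm borel_measurable_diff)
     (use sK that(3,4) in auto)
  qed auto
  also have "\<dots> <= enn2real (ennreal \<eta>)"
  proof (rule enn2real_mono)
   have "(nnl (%x. ennreal (indicator K x * norm (f x - h' x)))) <= (nnl (%x. norm (f x - h' x)))"
    by (intro nn_integral_mono ennreal_leI) (auto simp: indicator_def)
   then show "(nnl (%x. ennreal (indicator K x * norm (f x - h' x)))) <= ennreal \<eta>"
    using that(1) by (simp add: less_imp_le order_trans)
  qed simp
  finally show ?thesis using \<open>\<eta> > 0\<close> by simp
 qed
 have KK': "x \<in> K'" if "x \<in> K" for x using that KN NK' by blast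
 have 1: "(LBINT x:K. norm (w x - u x)) <= \<eta>"
 proof (rule L1[OF e1(2)[OF mollifier_mono[OF m e3(1)], folded w_def]])
  show "u x = u' x" if "x \<in> K" for x using KK'[OF that] by (simp add: u'_def)
 qed measurable
 have 2: "(LBINT x:K. norm (G x - g x)) <= \<eta>"
 proof (rule L1[OF e2(2)[OF mollifier_mono[OF m e3(2)], folded G_def]])
  show "g x = g' x" if "x \<in> K" for x using KK'[OF that] by (simp add: g'_def)
 qed measurable
 have 3: "\<bar>w x\<bar> <= M" if M: "\<forall>x\<in>U. \<bar>u x\<bar> <= M" and "x \<in> N" for M x
 proof -
  have "x \<in> U" using that(2) NK' K'U by blast
  then have M0: "0 <= M" using M abs_ge_zero[of "u x"] by force
  have "\<bar>w x\<bar> <= (LINT y|lborel. M * \<rho> (x - y))"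
  proof -
   have "norm (w x) <= (LINT y|lborel. M * \<rho> (x - y))" unfolding w_def conv_def
   proof (rule order_trans[OF Bochner_Integration.integral_norm_bound integral_mono])
    show "integrable lborel (%y. norm (\<rho> (x - y) *\<^sub>R u' y))"
     by (intro integrable_norm conv_integrable[OF mf(2) B iu])
    show "integrable lborel (%y. M * \<rho> (x - y))" using mollifier_translate(1)[OF m] by simp
    fix y
    have "\<bar>u' y\<bar> <= M" using M M0 K'U by (auto simp: u'_def indicator_def)
    from mult_right_mono[OF this mf(4)[of "x - y"]]
    show "norm (\<rho> (x - y) *\<^sub>R u' y) <= M * \<rho> (x - y)" using mf(4) by (simp add: mult.commute abs_mult)
   qed
   then show ?thesis by simp
  qed
  then show ?thesis using mollifier_translate(2)[OF m] by simp
 qed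
 \<comment> \<open>Jensen's inequality at each point, then Tonelli's theorem: mollification does not
   increase L2 norms.\<close>
 have 4: "(LBINT x:K. (norm (G x))\<^sup>2) <= (LBINT x:U. (norm (g x))\<^sup>2)"
  if i2: "sint U (%x. (norm (g x))^2)"
 proof -
  have ig2: "integrable lborel (%x. (norm (g' x))^2)"
  proof (rule Bochner_Integration.integrable_bound[OF i2[unfolded set_integrable_def]])
   show "AE x in lborel. norm ((norm (g' x))^2) <= norm (indicator U x *\<^sub>R (norm (g x))\<^sup>2)"
    using K'U by (intro AE_I2) (auto simp: g'_def indicator_def)
  qed measurable
  have sqK: "integrable lborel (%x. indicator K x *\<^sub>R (norm (G x))\<^sup>2)"
   by (rule borel_integrable_compact[OF K(1)])
    (intro continuous_intros continuous_on_subset[OF cG], simp)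
  have "ennreal (LBINT x:K. (norm (G x))\<^sup>2) = (nnl (%x. ennreal (indicator K x *\<^sub>R (norm (G x))\<^sup>2)))"
   unfolding set_lebesgue_integral_def by (rule nn_integral_eq_integral[symmetric, OF sqK]) auto
  also have "\<dots> <= (nnl (%x. (nnl (%y. ennreal (\<rho> (x - y)) * ennreal (norm ((norm (g' y))^2))))))"
  proof (intro nn_integral_mono)
   fix x
   have "ennreal (indicator K x *\<^sub>R (norm (G x))\<^sup>2) <= ennreal ((norm (G x))^2)"
    by (intro ennreal_leI) (auto simp: indicator_def)
   also have "\<dots> <= (nnl (%y. ennreal (\<rho> (x - y)) * ennreal (norm ((norm (g' y))^2))))"
    unfolding G_def by (rule norm_conv_sq_le[OF m ig ig2])
   finally show "ennreal (indicator K x *\<^sub>R (norm (G x))\<^sup>2) <= (nnl (%y. ennreal (\<rho> (x - y)) * ennreal (norm ((norm (g' y))^2))))" .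
  qed
  also have "\<dots> = (nnl (%y. norm ((norm (g' y))^2)))" by (rule conv_L1_bound[OF m]) measurable
  also have "\<dots> <= (nnl (%y. ennreal (indicator U y *\<^sub>R (norm (g y))\<^sup>2)))"
   by (intro nn_integral_mono ennreal_leI) (use K'U in \<open>auto simp: g'_def indicator_def\<close>)
  also have "\<dots> = ennreal (LBINT x:U. (norm (g x))\<^sup>2)" unfolding set_lebesgue_integral_def
   by (rule nn_integral_eq_integral[OF i2[unfolded set_integrable_def]]) auto
  finally show ?thesis
   by (subst (asm) ennreal_le_iff) (auto simp: set_lebesgue_integral_def intro!: integral_nonneg_AE)
 qed
 show ?thesis
 proof (intro exI[of _ N] exI[of _ w] exI[of _ G] conjI)
  show "N \<subseteq> U" using NK' K'U by blast
 qed (use 1 2 3 4 KN C in auto)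
qed

lemma locally_integrable_null:
 fixes d :: "'a::euclidean_space => 'b::euclidean_space"
 assumes U: "open U" and li: "locally_integrable U d"
  and z: "\<And>K \<eta>. compact K ==> K \<subseteq> U ==> \<eta> > 0 ==> (LBINT x:K. norm (d x)) <= \<eta>"
 shows "AE x in lborel. x \<in> U --> d x = 0"
proof -
 obtain C where C: "\<And>n. compact (C n)" "\<And>n. C n \<subseteq> U" "\<And>n. C n \<subseteq> interior (C (Suc n))" "\<Union>(range C) = U"
  using open_Union_compact_subsets[OF U] by metis
 have "AE x in lborel. x \<in> C n --> d x = 0" for n
 proof -
  have i: "integrable lborel (%x. norm (indicator (C n) x *\<^sub>R d x))"
   using li C unfolding locally_integrable_def set_integrable_def by (intro integrable_norm) blast
  have "(LBINT x:C n. norm (d x)) <= 0" by (rule field_le_epsilon) (use z[OF C(1,2)] in simp)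
  then have "(LINT x|lborel. norm (indicator (C n) x *\<^sub>R d x)) <= 0"
   unfolding set_lebesgue_integral_def by simp
  moreover have "(LINT x|lborel. norm (indicator (C n) x *\<^sub>R d x)) \<ge> 0" by (rule integral_nonneg_AE) simp
  ultimately have "(LINT x|lborel. norm (indicator (C n) x *\<^sub>R d x)) = 0" by linarith
  then have "AE x in lborel. norm (indicator (C n) x *\<^sub>R d x) = 0"
   using integral_nonneg_eq_0_iff_AE[OF i] by simp
  then show ?thesis by eventually_elim auto
 qed
 then have "AE x in lborel. \<forall>n. x \<in> C n --> d x = 0" by (intro iffD2[OF AE_all_countable] allI)
 then show ?thesis unfolding C(4)[symmetric] by (rule eventually_mono) auto
qed

text \<open>The difference of the two is a weak gradient of the zero function, whose mollifications
  vanish identically together with their gradients.\<close>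

lemma weak_gradient_unique:
 fixes U :: "complex set"
 assumes U: "open U" and g: "is_weak_gradient U u g" and h: "is_weak_gradient U u h"
 shows "AE x in lborel. x \<in> U --> g x = h x"
proof -
 define d where "d = (%x. 1 *\<^sub>R g x + (-1) *\<^sub>R h x)"
 have wd: "is_weak_gradient U (%x. 1 * u x + (-1) * u x) d"
  unfolding d_def by (rule is_weak_gradient_lincomb[OF g h])
 then have ld: "locally_integrable U d" by (simp add: is_weak_gradient_def)
 have "AE x in lborel. x \<in> U --> d x = 0"
 proof (rule locally_integrable_null[OF U ld])
  fix K and \<eta> :: real assume K: "compact K" "K \<subseteq> U" and "\<eta> > 0"
  obtain N w G where N: "K \<subseteq> N" "C1_on N w G" "(LBINT x:K. norm (G x - d x)) <= \<eta>"
   "\<And>M. (\<forall>x\<in>U. \<bar>1 * u x + (-1) * u x\<bar> <= M) ==> (\<forall>x\<in>N. \<bar>w x\<bar> <= M)"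
   using weak_gradient_approx[OF U K wd \<open>\<eta> > 0\<close>] by blast
  have w0: "w x = 0" if "x \<in> N" for x using N(4)[of 0] that by simp
  have "G x = 0" if "x \<in> N" for x
  proof -
   have oN: "open N" and D: "(w has_derivative (%h. G x \<bullet> h)) (at x)" using N(2) that by (auto simp: C1_on_def)
   have "((%_. 0) has_derivative (%h. G x \<bullet> h)) (at x)"
    by (rule has_derivative_transform_within_open[OF D oN that]) (simp add: w0)
   moreover have "((%_. 0::real) has_derivative (%h. 0)) (at x)" by simp
   ultimately have "(%h. G x \<bullet> h) = (%h. 0)" by (rule has_derivative_unique)
   then have "G x \<bullet> G x = 0" by metis
   then show ?thesis by simp
  qed
  then have "(LBINT x:K. norm (G x - d x)) = (LBINT x:K. norm (d x))"
   unfolding set_lebesgue_integral_def using N(1)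
   by (intro Bochner_Integration.integral_cong) (auto simp: indicator_def)
  then show "(LBINT x:K. norm (d x)) <= \<eta>" using N(3) by simp
 qed
 then show ?thesis by eventually_elim (simp add: d_def)
qed

section \<open>Change of variables for injective holomorphic maps\<close>

text \<open>The Jacobian formula is applied on \<open>real^2\<close>, with which the complex plane
  is identified, Lebesgue measure included.\<close>

definition vec2 :: "complex => real^2" where "vec2 z = (\<chi> i. if i = 1 then Re z else Im z)"

definition cplx :: "real^2 => complex" where "cplx x = Complex (x$1) (x$2)"

lemma cplx_vec2 [simp]: "cplx (vec2 z) = z" and vec2_cplx [simp]: "vec2 (cplx x) = x"
 by (auto simp: vec2_def cplx_def vec_eq_iff forall_2)

lemma linear_vec2: "linear vec2" and linear_cplx: "linear cplx"
 by (auto intro!: linearI simp: vec2_def cplx_def vec_eq_iff complex_eq_iff)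

lemma has_derivative_vec2: "(vec2 has_derivative vec2) F" and has_derivative_cplx: "(cplx has_derivative cplx) F'"
 by (auto intro!: bounded_linear_imp_has_derivative linear_vec2 linear_cplx simp: linear_conv_bounded_linear[symmetric])

lemma continuous_vec2: "continuous_on A vec2" and continuous_cplx: "continuous_on B cplx"
 by (auto intro!: linear_continuous_on linear_vec2 linear_cplx simp: linear_conv_bounded_linear[symmetric])

lemma measurable_vec2 [measurable]: "bm vec2" and measurable_cplx [measurable]: "bm cplx"
 by (auto intro: borel_measurable_continuous_onI continuous_vec2 continuous_cplx)

lemma lborel_distr_vec2: "distr lborel borel vec2 = (lborel :: (real^2) measure)"
proof (rule lborel_eqI[symmetric])
 fix l u :: "real^2"
 assume lu: "\<And>b. b \<in> Basis ==> l \<bullet> b <= u \<bullet> b"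
 have B: "(Basis :: (real^2) set) = {axis 1 1, axis 2 1}" by (auto simp: Basis_vec_def UNIV_2)
 have ne: "axis 1 (1::real) \<noteq> (axis 2 1 :: real^2)" by (simp add: axis_eq_axis)
 have le: "l $ 1 <= u $ 1" "l $ 2 <= u $ 2" using lu[of "axis 1 1"] lu[of "axis 2 1"] by (auto simp: B inner_axis)
 have eq: "vec2 -` box l u = box (cplx l) (cplx u)"
  by (auto simp: box_def B Basis_complex_def inner_axis vec2_def cplx_def)
 have "emeasure (distr lborel borel vec2) (box l u) = emeasure lborel (box (cplx l) (cplx u))"
  by (subst emeasure_distr) (auto simp: eq[simplified])
 also have "\<dots> = ennreal (\<Prod>b\<in>Basis. (cplx u - cplx l) \<bullet> b)"
  using le by (intro emeasure_lborel_box) (auto simp: Basis_complex_def cplx_def)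
 also have "\<dots> = ennreal (\<Prod>b\<in>Basis. (u - l) \<bullet> b)"
  by (simp add: B ne Basis_complex_def cplx_def inner_axis complex_eq_iff)
 finally show "emeasure (distr lborel borel vec2) (box l u) = ennreal (\<Prod>b\<in>Basis. (u - l) \<bullet> b)" .
qed simp

lemma vec2_image: "vec2 ` S = cplx -` S" by (auto simp: image_iff) (metis vec2_cplx)

text \<open>As a real linear map, multiplication by f'(z) has determinant |f'(z)|^2.\<close>

lemma emeasure_holomorphic_image:
 assumes U: "open U" and hol: "f holomorphic_on U" and inj: "inj_on f U"
  and S: "S \<in> sets borel" "S \<subseteq> U" and fS: "f ` S \<in> sets borel"
 shows "emeasure lborel (f ` S) = (nnl (%z. ennreal (indicator S z * (norm (deriv f z))^2)))"
proof -
 define F where "F = (%x. vec2 (f (cplx x)))"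
 define F' where "F' = (%x h. vec2 (deriv f (cplx x) * cplx h))"
 define T where "T = vec2 ` S"
 define J where "J = (%x. indicator T x * (norm (deriv f (cplx x)))^2 :: real)"
 have Tb: "T \<in> sets borel" unfolding T_def vec2_image using measurable_sets[OF measurable_cplx S(1)] by simp
 have FT: "F ` T = vec2 ` (f ` S)" by (auto simp: F_def T_def image_image)
 have FTb: "F ` T \<in> sets borel" unfolding FT vec2_image using measurable_sets[OF measurable_cplx fS] by simp
 have der: "(F has_derivative F' x) (at x within T)" if "x \<in> T" for x
 proof -
  have "cplx x \<in> U" using that S by (auto simp: T_def)
  then have d: "(f has_derivative (%h. deriv f (cplx x) * h)) (at (cplx x))"
   using holomorphic_derivI[OF hol U] by (simp add: has_field_derivative_def)
  have "(F has_derivative F' x) (at x)" unfolding F_def F'_def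
   by (rule has_derivative_compose[OF has_derivative_compose[OF has_derivative_cplx d] has_derivative_vec2])
  then show ?thesis by (rule has_derivative_at_withinI)
 qed
 have injF: "inj_on F T"
 proof (rule inj_onI)
  fix x y assume "x \<in> T" "y \<in> T" "F x = F y"
  then have "f (cplx x) = f (cplx y)" by (metis F_def cplx_vec2)
  moreover have "cplx x \<in> U" "cplx y \<in> U" using \<open>x \<in> T\<close> \<open>y \<in> T\<close> S by (auto simp: T_def)
  ultimately have "cplx x = cplx y" using inj by (simp add: inj_on_eq_iff)
  then show "x = y" by (metis vec2_cplx)
 qed
 have det: "det (matrix (F' x)) = (norm (deriv f (cplx x)))^2" for x
  by (simp add: det_2 matrix_def F'_def vec2_def cplx_def axis_def cmod_power2) (simp add: power2_eq_square)
 have TL: "T \<in> sets lebesgue" using Tb by simp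
 have cdf: "continuous_on U (deriv f)"
  using holomorphic_deriv[OF hol U] by (rule holomorphic_on_imp_continuous_on)
 have Jb: "bm J"
 proof -
  have "continuous_on (cplx -` U) (%x. (norm (deriv f (cplx x)))^2)"
   by (intro continuous_intros continuous_on_compose2[OF cdf continuous_cplx]) auto
  moreover have oU: "open (cplx -` U)" using U continuous_cplx[of UNIV] open_vimage by blast
  ultimately have "bm (%x. indicator (cplx -` U) x *\<^sub>R (norm (deriv f (cplx x)))\<^sup>2)"
   by (intro borel_measurable_continuous_on_indicator) auto
  then have "bm (%x. indicator T x * (indicator (cplx -` U) x *\<^sub>R (norm (deriv f (cplx x)))\<^sup>2))"
   using Tb by (intro borel_measurable_times borel_measurable_indicator)
  moreover have "(%x. indicator T x * (indicator (cplx -` U) x *\<^sub>R (norm (deriv f (cplx x)))\<^sup>2)) = J"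
   using S by (auto simp: J_def T_def indicator_def fun_eq_iff)
  ultimately show ?thesis by simp
 qed
 have J0: "0 <= J x" for x by (simp add: J_def)
 have JI: "(J has_integral m) UNIV \<longleftrightarrow> ((%x. \<bar>det (matrix (F' x))\<bar>) has_integral m) T" for m
 proof -
  have "J = (%x. if x \<in> T then (norm (deriv f (cplx x)))\<^sup>2 else 0)" by (auto simp: J_def)
  then show ?thesis
   using has_integral_restrict_UNIV[of T "%x. (norm (deriv f (cplx x)))^2" m] by (simp add: det)
 qed
 have main: "emeasure lborel (F ` T) = (nnl (%x. ennreal (J x)))"
 \<comment> \<open>The Jacobian theorem is an equivalence about finite values. If the integral is
   infinite, a finite measure of the image would contradict it.\<close>
 proof (cases "(nnl (%x. ennreal (J x))) < \<infinity>")
  case True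
  then have "J integrable_on UNIV" by (intro nn_integral_integrable_on Jb J0)
  then obtain m where m: "(J has_integral m) UNIV" by blast
  then have "F ` T \<in> lmeasurable \<and> measure lebesgue (F ` T) = m"
   using has_measure_differentiable_image[OF TL der injF] JI by blast
  then have "emeasure lebesgue (F ` T) = ennreal m" by (simp add: emeasure_eq_measure2)
  moreover have "(nnl (%x. ennreal (J x))) = ennreal m"
   by (rule nn_integral_has_integral_lborel[OF Jb J0 m])
  ultimately show ?thesis using FTb by simp
 next
  case False
  have "emeasure lborel (F ` T) = \<infinity>"
  proof (rule ccontr)
   assume "\<not> ?thesis"
   then have "F ` T \<in> lmeasurable" using FTb by (auto simp: fmeasurable_def top.not_eq_extremum)
   then obtain m where "((%x. \<bar>det (matrix (F' x))\<bar>) has_integral m) T"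
    using has_measure_differentiable_image[OF TL der injF] by blast
   then have "(J has_integral m) UNIV" using JI by blast
   then have "(nnl (%x. ennreal (J x))) = ennreal m"
    by (rule nn_integral_has_integral_lborel[OF Jb J0])
   then show False using False by simp
  qed
  moreover have "(nnl (%x. ennreal (J x))) = \<infinity>" using False by (simp add: less_top[symmetric])
  ultimately show ?thesis by simp
 qed
 have e1: "emeasure lborel (F ` T) = emeasure lborel (f ` S)"
 proof -
  have "vec2 -` (vec2 ` (f ` S)) = f ` S" by (auto simp: image_iff) (metis cplx_vec2)
  then show ?thesis using FTb by (subst lborel_distr_vec2[symmetric]) (simp add: emeasure_distr FT)
 qed
 have e2: "(nnl (%x. ennreal (J x))) = (nnl (%z. ennreal (indicator S z * (norm (deriv f z))^2)))"
 proof -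
  have "J (vec2 z) = indicator S z * (norm (deriv f z))^2" for z
   by (auto simp: J_def T_def indicator_def) (metis cplx_vec2 imageE)
  then show ?thesis using Jb by (subst lborel_distr_vec2[symmetric]) (simp add: nn_integral_distr)
 qed
 show ?thesis using main e1 e2 by simp
qed

definition jac_measure :: "complex set => (complex => complex) => complex measure" where
 "jac_measure U f = density lborel (%z. ennreal (indicator U z * (norm (deriv f z))^2))"

text \<open>Off U nothing is known about f. Cut off, it is a Borel map on the whole plane, and
  \<open>jac_measure\<close> does not charge the complement of U.\<close>

definition restr_fun :: "complex set => (complex => complex) => complex => complex" where
 "restr_fun U f z = indicator U z *\<^sub>R f z"

lemma restr_fun_measurable:
 assumes "open U" "f holomorphic_on U"
 shows "restr_fun U f \<in> borel_measurable borel" unfolding restr_fun_def[abs_def]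
 by (intro borel_measurable_continuous_on_indicator holomorphic_on_imp_continuous_on assms) (use assms in auto)

lemma jacobian_measurable:
 assumes "open U" "f holomorphic_on U"
 shows "bm (%z. indicator U z * (norm (deriv f z))^2 :: real)"
proof -
 have "bm (%z. indicator U z *\<^sub>R (norm (deriv f z))\<^sup>2)"
  by (intro borel_measurable_continuous_on_indicator continuous_intros holomorphic_on_imp_continuous_on
    holomorphic_deriv assms) (use assms in auto)
 then show ?thesis by simp
qed

text \<open>Change of variables as an equality of measures, so that integrability and integrals
  follow from the rules for image measures and densities.\<close>

lemma distr_jac_measure:
 assumes U: "open U" and hol: "f holomorphic_on U" and inj: "inj_on f U"
 shows "distr (jac_measure U f) borel (restr_fun U f) = density lborel (indicator (f ` U))"
proof (rule measure_eqI)
 have [measurable]: "restr_fun U f \<in> borel_measurable borel" by (rule restr_fun_measurable[OF U hol])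
 have [measurable]: "bm (%z. indicator U z * (norm (deriv f z))^2 :: real)"
  by (rule jacobian_measurable[OF U hol])
 have oV: "open (f ` U)" by (rule open_mapping_thm3[OF hol U inj])
 show "sets (distr (jac_measure U f) borel (restr_fun U f)) = sets (density lborel (indicator (f ` U)))" by simp
 fix A assume "A \<in> sets (distr (jac_measure U f) borel (restr_fun U f))"
 then have A: "A \<in> sets borel" by simp
 define S where "S = U \<inter> restr_fun U f -` A"
 have S: "S \<in> sets borel" using measurable_sets[OF restr_fun_measurable[OF U hol] A] U by (auto simp: S_def)
 have fS: "f ` S = f ` U \<inter> A" by (auto simp: S_def restr_fun_def)
 have "emeasure (distr (jac_measure U f) borel (restr_fun U f)) A = emeasure (jac_measure U f) (restr_fun U f -` A)"
  using A by (subst emeasure_distr) (auto simp: jac_measure_def)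
 also have "\<dots> = (nnl (%z. ennreal (indicator U z * (norm (deriv f z))^2) * indicator (restr_fun U f -` A) z))"
  unfolding jac_measure_def using measurable_sets[OF restr_fun_measurable[OF U hol] A]
  by (intro emeasure_density) auto
 also have "\<dots> = (nnl (%z. ennreal (indicator S z * (norm (deriv f z))^2)))"
  by (intro nn_integral_cong) (auto simp: S_def indicator_def)
 also have "\<dots> = emeasure lborel (f ` S)"
  by (rule emeasure_holomorphic_image[OF U hol inj S, symmetric]) (use oV A in \<open>auto simp: S_def fS[unfolded S_def]\<close>)
 also have "\<dots> = emeasure (density lborel (indicator (f ` U))) A"
  using A oV by (subst emeasure_density) (auto simp: fS nn_integral_indicator[symmetric] indicator_inter_arith mult.commute simp del: nn_integral_indicator intro!: nn_integral_cong)
 finally show "emeasure (distr (jac_measure U f) borel (restr_fun U f)) A = emeasure (density lborel (indicator (f ` U))) A" .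
qed

lemma holomorphic_change_of_variables:
 fixes \<phi> :: "complex => real"
 assumes U: "open U" and hol: "f holomorphic_on U" and inj: "inj_on f U" and i: "sint (f ` U) \<phi>"
 shows "sint U (%z. (norm (deriv f z))\<^sup>2 * \<phi> (f z))"
  "(LBINT z:U. (norm (deriv f z))\<^sup>2 * \<phi> (f z)) = (LBINT w:f ` U. \<phi> w)"
proof -
 have [measurable]: "restr_fun U f \<in> borel_measurable borel" by (rule restr_fun_measurable[OF U hol])
 have jm [measurable]: "bm (%z. indicator U z * (norm (deriv f z))^2 :: real)"
  by (rule jacobian_measurable[OF U hol])
 have oV: "open (f ` U)" by (rule open_mapping_thm3[OF hol U inj])
 define \<psi> where "\<psi> = (%w. indicator (f ` U) w *\<^sub>R \<phi> w)"
 have i\<psi>: "integrable lborel \<psi>" using i by (simp add: set_integrable_def \<psi>_def)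
 then have [measurable]: "bm \<psi>" by simp
 have dens: "density lborel (indicator (f ` U)) = density lborel (%w. ennreal (indicator (f ` U) w))"
  by (simp add: ennreal_indicator)
 have idem: "indicator (f ` U) w * \<psi> w = \<psi> w" for w by (auto simp: \<psi>_def indicator_def)
 have id: "integrable (density lborel (indicator (f ` U))) \<psi>"
  unfolding dens using oV i\<psi> by (subst integrable_density) (auto simp: idem)
 have vd: "(LINT w|density lborel (indicator (f ` U)). \<psi> w) = (LBINT w:f ` U. \<phi> w)"
  unfolding dens set_lebesgue_integral_def using oV
  by (subst integral_density) (auto simp: idem, simp add: \<psi>_def)
 have eq: "(indicator U z * (norm (deriv f z))^2) *\<^sub>R \<psi> (restr_fun U f z) = indicator U z *\<^sub>R ((norm (deriv f z))^2 * \<phi> (f z))" for z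
  by (auto simp: \<psi>_def restr_fun_def indicator_def)
 have sj: "sets (jac_measure U f) = sets borel" by (simp add: jac_measure_def)
 have "integrable (jac_measure U f) (%z. \<psi> (restr_fun U f z))"
  using id unfolding distr_jac_measure[OF U hol inj, symmetric]
  by (subst (asm) integrable_distr_eq) (auto simp: measurable_cong_sets[OF sj refl])
 then have "integrable lborel (%z. (indicator U z * (norm (deriv f z))^2) *\<^sub>R \<psi> (restr_fun U f z))"
  unfolding jac_measure_def by (subst (asm) integrable_density) auto
 then show "sint U (%z. (norm (deriv f z))\<^sup>2 * \<phi> (f z))" unfolding set_integrable_def eq[symmetric] .
 have "(LBINT w:f ` U. \<phi> w) = (LINT z|jac_measure U f. \<psi> (restr_fun U f z))"
  unfolding vd[symmetric] distr_jac_measure[OF U hol inj, symmetric]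
  by (subst integral_distr) (auto simp: measurable_cong_sets[OF sj refl])
 also have "\<dots> = (LINT z|lborel. (indicator U z * (norm (deriv f z))^2) *\<^sub>R \<psi> (restr_fun U f z))"
  unfolding jac_measure_def by (subst integral_density) auto
 also have "\<dots> = (LBINT z:U. (norm (deriv f z))\<^sup>2 * \<phi> (f z))" unfolding set_lebesgue_integral_def eq ..
 finally show "(LBINT z:U. (norm (deriv f z))\<^sup>2 * \<phi> (f z)) = (LBINT w:f ` U. \<phi> w)" by simp
qed

section \<open>Chain rules\<close>

lemma set_integrable_bounded_mult:
 fixes h :: "'a => 'b::{banach,second_countable_topology}" and b :: "'a => real"
 assumes "set_integrable M K h" "(%x. indicator K x * b x) \<in> borel_measurable M" "\<And>x. x \<in> K ==> \<bar>b x\<bar> <= B"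
 shows "set_integrable M K (%x. b x *\<^sub>R h x)"
proof -
 have "integrable M (%x. (indicator K x * b x) *\<^sub>R (indicator K x *\<^sub>R h x))"
  by (rule integrable_bounded_scaleR[where B = "\<bar>B\<bar>"])
   (use assms in \<open>auto simp: set_integrable_def indicator_def intro: order_trans[OF _ abs_ge_self]\<close>)
 then show ?thesis unfolding set_integrable_def
  by (rule Bochner_Integration.integrable_cong[THEN iffD1, OF refl, rotated]) (auto simp: indicator_def)
qed

lemma set_integrable_dominated:
 fixes f :: "'a => 'b::{banach,second_countable_topology}" and h :: "'a => real"
 assumes "set_integrable M K h" "(%x. indicator K x *\<^sub>R f x) \<in> borel_measurable M" "\<And>x. x \<in> K ==> norm (f x) <= h x"
 shows "set_integrable M K f" unfolding set_integrable_def
proof (rule Bochner_Integration.integrable_bound[OF assms(1)[unfolded set_integrable_def] assms(2)])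
 show "AE x in M. norm (indicator K x *\<^sub>R f x) <= norm (indicator K x *\<^sub>R h x)"
  using assms(3) by (intro AE_I2) (auto simp: indicator_def intro: order_trans[OF _ abs_ge_self])
qed

lemma set_integral_tendsto_0:
 fixes f :: "nat => 'a => real"
 assumes h: "set_integrable M K h" and m: "\<And>n. (%x. indicator K x * f n x) \<in> borel_measurable M"
  and b: "\<And>n x. x \<in> K ==> \<bar>f n x\<bar> <= h x" and l: "AE x in M. x \<in> K --> null_seq (%n. f n x)"
 shows "null_seq (%n. LINT x:K|M. f n x)"
proof -
 have "(%n. LINT x:K|M. f n x) \<longlonglongrightarrow> (LINT x|M. (0::real))" unfolding set_lebesgue_integral_def
 proof (rule integral_dominated_convergence[OF _ _ h[unfolded set_integrable_def]])
  show "AE x in M. null_seq (%n. indicator K x *\<^sub>R f n x)" using l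
  proof eventually_elim
   fix x assume "x \<in> K --> null_seq (%n. f n x)"
   then show "null_seq (%n. indicator K x *\<^sub>R f n x)" by (cases "x \<in> K") auto
  qed
  show "AE x in M. norm (indicator K x *\<^sub>R f n x) <= indicator K x *\<^sub>R h x" for n
   using b by (intro AE_I2) (auto simp: indicator_def)
 qed (use m in auto)
 then show ?thesis by simp
qed

lemma is_weak_gradient_limit_seq:
 fixes U :: "'a::euclidean_space set"
 assumes "locally_integrable U u" "locally_integrable U g" "\<And>n. is_weak_gradient U (w n) (G n)"
  and "\<And>K. compact K ==> K \<subseteq> U ==> null_seq (%n. LBINT x:K. norm (w n x - u x))"
  and "\<And>K. compact K ==> K \<subseteq> U ==> null_seq (%n. LBINT x:K. norm (G n x - g x))"
 shows "is_weak_gradient U u g"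
proof (rule is_weak_gradient_limit[OF assms(1,2)])
 fix K :: "'a set" and \<eta> :: real assume K: "compact K" "K \<subseteq> U" and "\<eta> > 0"
 have "\<forall>\<^sub>F n in sequentially. (LBINT x:K. norm (w n x - u x)) < \<eta> \<and> (LBINT x:K. norm (G n x - g x)) < \<eta>"
  using order_tendstoD(2)[OF assms(4)[OF K] \<open>\<eta> > 0\<close>] order_tendstoD(2)[OF assms(5)[OF K] \<open>\<eta> > 0\<close>]
  by (rule eventually_conj)
 then obtain n where "(LBINT x:K. norm (w n x - u x)) < \<eta>" "(LBINT x:K. norm (G n x - g x)) < \<eta>"
  by (auto simp: eventually_sequentially)
 then show "\<exists>N w G. K \<subseteq> N \<and> is_weak_gradient N w G \<and> (LBINT x:K. norm (w x - u x)) <= \<eta> \<and>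
    (LBINT x:K. norm (G x - g x)) <= \<eta>"
  using K assms(3) by (intro exI[of _ U] exI[of _ "w n"] exI[of _ "G n"]) auto
qed

lemma is_weak_gradient_dominated:
 fixes U :: "'a::euclidean_space set"
 assumes u: "locally_integrable U u" and g: "locally_integrable U g"
  and w: "\<And>n. is_weak_gradient U (w n) (G n)"
  and h: "locally_integrable U h" "\<And>n x. x \<in> U ==> \<bar>w n x - u x\<bar> <= h x"
  and k: "locally_integrable U k" "\<And>n x. x \<in> U ==> norm (G n x - g x) <= k x"
  and lim: "\<And>x. x \<in> U ==> (%n. w n x) \<longlonglongrightarrow> u x" "\<And>x. x \<in> U ==> (%n. G n x) \<longlonglongrightarrow> g x"
 shows "is_weak_gradient U u g"
proof (rule is_weak_gradient_limit_seq[OF u g w])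
 fix K :: "'a set" assume K: "compact K" "K \<subseteq> U"
 have i: "sint K (%x. norm (w n x - u x))" "sint K (%x. norm (G n x - g x))" for n
 proof -
  have 1: "sint K (w n)" "sint K (G n)"
   using w[of n] K by (auto simp: is_weak_gradient_def locally_integrable_def)
  have 2: "sint K u" "sint K g" using u g K by (auto simp: locally_integrable_def)
  show "sint K (%x. norm (w n x - u x))"
   by (rule set_integrable_norm[OF set_integral_diff(1)[OF 1(1) 2(1)]])
  show "sint K (%x. norm (G n x - g x))"
   by (rule set_integrable_norm[OF set_integral_diff(1)[OF 1(2) 2(2)]])
 qed
 show "null_seq (%n. LBINT x:K. norm (w n x - u x))"
 proof (rule set_integral_tendsto_0[of lborel K h])
  show "(%x. indicator K x * norm (w n x - u x)) \<in> borel_measurable lborel" for n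
   using borel_measurable_integrable[OF i(1)[of n, unfolded set_integrable_def]] by simp
  show "AE x in lborel. x \<in> K --> null_seq (%n. norm (w n x - u x))"
   using lim(1) K by (intro AE_I2 impI tendsto_norm_zero LIM_zero) auto
 qed (use h K in \<open>auto simp: locally_integrable_def\<close>)
 show "null_seq (%n. LBINT x:K. norm (G n x - g x))"
 proof (rule set_integral_tendsto_0[of lborel K k])
  show "(%x. indicator K x * norm (G n x - g x)) \<in> borel_measurable lborel" for n
   using borel_measurable_integrable[OF i(2)[of n, unfolded set_integrable_def]] by simp
  show "AE x in lborel. x \<in> K --> null_seq (%n. norm (G n x - g x))"
   using lim(2) K by (intro AE_I2 impI tendsto_norm_zero LIM_zero) auto
 qed (use k K in \<open>auto simp: locally_integrable_def\<close>)
qed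

lemma locally_integrable_measurable:
 assumes "locally_integrable U u" "compact K" "K \<subseteq> U"
 shows "bm (%x. indicator K x *\<^sub>R u x)"
 using assms borel_measurable_integrable[of lborel "%x. indicator K x *\<^sub>R u x"]
 by (simp add: locally_integrable_def set_integrable_def)

lemma measurable_indicator_compose:
 fixes u :: "'a::euclidean_space => 'b::euclidean_space" and \<psi> :: "'b => 'c::euclidean_space"
 assumes "bm (%x. indicator K x *\<^sub>R u x)" "bm \<psi>" "K \<in> sets borel"
 shows "bm (%x. indicator K x *\<^sub>R \<psi> (u x))"
proof -
 have "bm (%x. indicator K x *\<^sub>R \<psi> (indicator K x *\<^sub>R u x))"
  using measurable_compose[OF assms(1,2)] assms(3) by (intro borel_measurable_scaleR borel_measurable_indicator)
 moreover have "(%x. indicator K x *\<^sub>R \<psi> (indicator K x *\<^sub>R u x)) = (%x. indicator K x *\<^sub>R \<psi> (u x))"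
  by (auto simp: indicator_def fun_eq_iff)
 ultimately show ?thesis by simp
qed

lemma locally_integrable_lipschitz_compose:
 fixes u :: "'a::euclidean_space => real"
 assumes u: "locally_integrable U u" and m: "bm \<psi>" and b: "\<And>t. \<bar>\<psi> t\<bar> <= A + B * \<bar>t\<bar>"
 shows "locally_integrable U (%x. \<psi> (u x))" unfolding locally_integrable_def
proof (intro allI impI)
 fix K assume K: "K \<subseteq> U" "compact K"
 have uK: "sint K u" using u K by (auto simp: locally_integrable_def)
 have Kb: "K \<in> sets borel" using compact_imp_closed[OF K(2)] by (rule borel_closed)
 have cK: "sint K (%_. A)" unfolding set_integrable_def using K by (intro borel_integrable_compact) auto
 show "sint K (%x. \<psi> (u x))"
 proof (rule set_integrable_dominated)
  show "sint K (%x. A + B * norm (u x))"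
   by (intro set_integral_add(1) cK set_integrable_mult_right set_integrable_norm uK)
  show "(%x. indicator K x *\<^sub>R \<psi> (u x)) \<in> borel_measurable lborel"
   using measurable_indicator_compose[OF locally_integrable_measurable[OF u K(2,1)] m Kb] by simp
 qed (use b in auto)
qed

lemma locally_integrable_bounded_factor:
 fixes g :: "'a::euclidean_space => 'b::euclidean_space"
 assumes u: "locally_integrable U u" and g: "locally_integrable U g" and m: "bm \<psi>"
  and b: "\<And>t. \<bar>\<psi> t\<bar> <= B"
 shows "locally_integrable U (%x. \<psi> (u x :: real) *\<^sub>R g x)" unfolding locally_integrable_def
proof (intro allI impI)
 fix K assume K: "K \<subseteq> U" "compact K"
 have Kb: "K \<in> sets borel" using compact_imp_closed[OF K(2)] by (rule borel_closed)
 show "sint K (%x. \<psi> (u x) *\<^sub>R g x)"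
 proof (rule set_integrable_bounded_mult)
  show "sint K g" using g K by (auto simp: locally_integrable_def)
  show "(%x. indicator K x * \<psi> (u x)) \<in> borel_measurable lborel"
   using measurable_indicator_compose[OF locally_integrable_measurable[OF u K(2,1)] m Kb] by simp
 qed (rule b)
qed

lemma C1_on_compose_real:
 assumes C: "C1_on N w G" and \<psi>: "\<And>t. (\<psi> has_real_derivative \<psi>' t) (at t)" "continuous_on UNIV \<psi>'"
 shows "C1_on N (%x. \<psi> (w x)) (%x. \<psi>' (w x) *\<^sub>R G x)" unfolding C1_on_def
proof (intro conjI ballI)
 show "open N" using C by (simp add: C1_on_def)
 show "continuous_on N (%x. \<psi>' (w x) *\<^sub>R G x)"
  using C by (intro continuous_on_scaleR continuous_on_compose2[OF \<psi>(2) C1_on_continuous[OF C]]) (auto simp: C1_on_def)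
 fix x assume "x \<in> N"
 then have D: "(w has_derivative (%h. G x \<bullet> h)) (at x)" using C by (simp add: C1_on_def)
 from has_derivative_compose[OF D \<psi>(1)[unfolded has_field_derivative_def]]
 show "((%x. \<psi> (w x)) has_derivative (%h. (\<psi>' (w x) *\<^sub>R G x) \<bullet> h)) (at x)" by simp
qed

text \<open>For smooth approximants w, G of u, g near K the error of the gradient splits into
  \<psi>'(w) (G - g), small in L1 because \<psi>' is bounded, and (\<psi>'(w) - \<psi>'(u)) g. The
  second part tends to 0 along a subsequence on which w converges almost everywhere, dominated by 2
  B |g|.\<close>

lemma weak_gradient_chain_C1:
 fixes U :: "complex set"
 assumes U: "open U" and wg: "is_weak_gradient U u g"
  and \<psi>: "\<And>t. (\<psi> has_real_derivative \<psi>' t) (at t)" "continuous_on UNIV \<psi>'" and B: "\<And>t. \<bar>\<psi>' t\<bar> <= B"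
 shows "is_weak_gradient U (%x. \<psi> (u x)) (%x. \<psi>' (u x) *\<^sub>R g x)"
proof -
 have u: "locally_integrable U u" and g: "locally_integrable U g" using wg by (auto simp: is_weak_gradient_def)
 have c\<psi>: "continuous_on UNIV \<psi>" using \<psi>(1) by (meson DERIV_isCont continuous_at_imp_continuous_on)
 have m: "bm \<psi>" "bm \<psi>'" using c\<psi> \<psi>(2) by (auto intro: borel_measurable_continuous_onI)
 have B0: "0 <= B" using B[of 0] by linarith
 have lip: "\<bar>\<psi> s - \<psi> t\<bar> <= B * \<bar>s - t\<bar>" for s t
 proof -
  have "norm (\<psi> s - \<psi> t) <= B * norm (s - t)"
   by (rule field_differentiable_bound[of UNIV \<psi> \<psi>']) (use \<psi>(1) B in auto)
  then show ?thesis by simp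
 qed
 have bd: "\<bar>\<psi> t\<bar> <= \<bar>\<psi> 0\<bar> + B * \<bar>t\<bar>" for t using lip[of t 0] by simp
 show ?thesis
 proof (rule is_weak_gradient_limit[OF locally_integrable_lipschitz_compose[OF u m(1) bd]
    locally_integrable_bounded_factor[OF u g m(2) B]])
  fix K and \<eta> :: real assume K: "compact K" "K \<subseteq> U" and "\<eta> > 0"
  define \<epsilon> where "\<epsilon> = (%n. 1 / real (Suc n))"
  have e0: "\<epsilon> n > 0" for n by (simp add: \<epsilon>_def)
  have el: "\<epsilon> \<longlonglongrightarrow> 0" unfolding \<epsilon>_def using LIMSEQ_inverse_real_of_nat by (simp add: divide_inverse)
  have ex: "\<exists>X. K \<subseteq> fst X \<and> C1_on (fst X) (fst (snd X)) (snd (snd X)) \<and>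
   (LBINT x:K. norm (fst (snd X) x - u x)) <= \<epsilon> n \<and> (LBINT x:K. norm (snd (snd X) x - g x)) <= \<epsilon> n" for n
  proof -
   from weak_gradient_approx[OF U K wg e0[of n]] obtain N w G where "K \<subseteq> N" "C1_on N w G"
    "(LBINT x:K. norm (w x - u x)) <= \<epsilon> n" "(LBINT x:K. norm (G x - g x)) <= \<epsilon> n" by (elim exE conjE)
   then show ?thesis by (intro exI[of _ "(N, w, G)"]) simp
  qed
  have "\<exists>X. \<forall>n. K \<subseteq> fst (X n) \<and> C1_on (fst (X n)) (fst (snd (X n))) (snd (snd (X n))) \<and>
   (LBINT x:K. norm (fst (snd (X n)) x - u x)) <= \<epsilon> n \<and> (LBINT x:K. norm (snd (snd (X n)) x - g x)) <= \<epsilon> n"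
   by (rule choice, rule allI, rule ex)
  then obtain X where X: "\<forall>n. K \<subseteq> fst (X n) \<and> C1_on (fst (X n)) (fst (snd (X n))) (snd (snd (X n))) \<and>
   (LBINT x:K. norm (fst (snd (X n)) x - u x)) <= \<epsilon> n \<and> (LBINT x:K. norm (snd (snd (X n)) x - g x)) <= \<epsilon> n"
   by (elim exE)
  define N where "N = (%n. fst (X n))"
  define w where "w = (%n. fst (snd (X n)))"
  define G where "G = (%n. snd (snd (X n)))"
  have N: "\<And>n. K \<subseteq> N n" "\<And>n. C1_on (N n) (w n) (G n)"
   "\<And>n. (LBINT x:K. norm (w n x - u x)) <= \<epsilon> n" "\<And>n. (LBINT x:K. norm (G n x - g x)) <= \<epsilon> n"
   using X unfolding N_def w_def G_def by simp_all
  have Kb: "K \<in> sets borel" using compact_imp_closed[OF K(1)] by (rule borel_closed)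
  have iK: "sint K (w n)" "sint K (G n)" for n
   using C1_on_weak_gradient[OF N(2)[of n]] N(1) K(1) by (auto simp: is_weak_gradient_def locally_integrable_def)
  have iu: "sint K u" "sint K g" using u g K by (auto simp: locally_integrable_def)
  have mu: "bm (%x. indicator K x *\<^sub>R u x)" "bm (%x. indicator K x *\<^sub>R g x)"
   using locally_integrable_measurable[OF u K] locally_integrable_measurable[OF g K] .
  have mw: "bm (%x. indicator K x *\<^sub>R w n x)" for n
   using iK(1)[of n] by (simp add: set_integrable_def borel_measurable_integrable)
  have squeeze: "null_seq (%n. a n)" if "\<And>n. 0 <= a n" "\<And>n. a n <= \<epsilon> n" for a
   by (rule tendsto_sandwich[OF _ _ tendsto_const el]) (use that in auto)
  have nn: "0 <= (LBINT x:K. norm (f x :: 'z::real_normed_vector))" for f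
   unfolding set_lebesgue_integral_def by (intro integral_nonneg_AE) auto
  have "\<exists>r. strict_mono r \<and> (AE x in lborel. null_seq (%n. indicator K x *\<^sub>R (w (r n) x - u x)))"
  proof (rule tendsto_L1_AE_subseq)
   show "integrable lborel (%x. indicator K x *\<^sub>R (w n x - u x))" for n
    using set_integral_diff(1)[OF iK(1) iu(1), of n] by (simp add: set_integrable_def)
   show "null_seq (%n. LINT x|lborel. norm (indicator K x *\<^sub>R (w n x - u x)))"
    using squeeze[OF nn N(3)] by (simp add: set_lebesgue_integral_def abs_mult)
  qed
  then obtain r where r: "strict_mono r" "AE x in lborel. null_seq (%n. indicator K x *\<^sub>R (w (r n) x - u x))" by blast
  have m3: "(%x. indicator K x * (\<bar>\<psi>' (w (r n) x) - \<psi>' (u x)\<bar> * norm (g x))) \<in> borel_measurable lborel" for n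
  proof -
   have "(%x. \<bar>indicator K x *\<^sub>R \<psi>' (w (r n) x) - indicator K x *\<^sub>R \<psi>' (u x)\<bar> * norm (indicator K x *\<^sub>R g x)) \<in> borel_measurable lborel"
    using measurable_indicator_compose[OF mw m(2) Kb, of "r n"] measurable_indicator_compose[OF mu(1) m(2) Kb] mu(2) by measurable
   then show ?thesis by (rule measurable_cong[THEN iffD1, rotated]) (auto simp: indicator_def)
  qed
  have T3: "null_seq (%n. LBINT x:K. \<bar>\<psi>' (w (r n) x) - \<psi>' (u x)\<bar> * norm (g x))"
  proof (rule set_integral_tendsto_0[of lborel K "%x. 2 * B * norm (g x)", OF _ m3])
   show "sint K (%x. 2 * B * norm (g x))" by (intro set_integrable_mult_right set_integrable_norm iu)
   show "\<bar>\<bar>\<psi>' (w (r n) x) - \<psi>' (u x)\<bar> * norm (g x)\<bar> <= 2 * B * norm (g x)" for n x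
   proof -
    have "\<bar>\<psi>' (w (r n) x) - \<psi>' (u x)\<bar> <= 2 * B" using B[of "w (r n) x"] B[of "u x"] by linarith
    then show ?thesis by (simp add: abs_mult mult_right_mono)
   qed
   show "AE x in lborel. x \<in> K --> null_seq (%n. \<bar>\<psi>' (w (r n) x) - \<psi>' (u x)\<bar> * norm (g x))" using r(2)
   proof eventually_elim
    fix x assume l: "null_seq (%n. indicator K x *\<^sub>R (w (r n) x - u x))"
    show "x \<in> K --> null_seq (%n. \<bar>\<psi>' (w (r n) x) - \<psi>' (u x)\<bar> * norm (g x))"
    proof
     assume "x \<in> K"
     then have "(%n. w (r n) x) \<longlonglongrightarrow> u x" using l by (simp add: LIM_zero_iff)
     moreover have "isCont \<psi>' (u x)" using \<psi>(2) by (simp add: continuous_on_eq_continuous_at)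
     ultimately have "(%n. \<psi>' (w (r n) x)) \<longlonglongrightarrow> \<psi>' (u x)" by (rule isCont_tendsto_compose[rotated])
     then have "null_seq (%n. \<bar>\<psi>' (w (r n) x) - \<psi>' (u x)\<bar>)" by (intro tendsto_rabs_zero LIM_zero)
     then show "null_seq (%n. \<bar>\<psi>' (w (r n) x) - \<psi>' (u x)\<bar> * norm (g x))" by (rule tendsto_mult_left_zero)
    qed
   qed
  qed
  have er: "null_seq (%n. B * \<epsilon> (r n))"
   using LIMSEQ_subseq_LIMSEQ[OF el r(1)] tendsto_mult_right_zero by (auto simp: comp_def)
  have "\<forall>\<^sub>F n in sequentially. B * \<epsilon> (r n) < \<eta> / 2 \<and> (LBINT x:K. \<bar>\<psi>' (w (r n) x) - \<psi>' (u x)\<bar> * norm (g x)) < \<eta> / 2"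
   using order_tendstoD(2)[OF er, of "\<eta>/2"] order_tendstoD(2)[OF T3, of "\<eta>/2"] \<open>\<eta> > 0\<close>
   by (intro eventually_conj) auto
  then obtain n where n: "B * \<epsilon> (r n) < \<eta> / 2" "(LBINT x:K. \<bar>\<psi>' (w (r n) x) - \<psi>' (u x)\<bar> * norm (g x)) < \<eta> / 2"
   by (auto simp: eventually_sequentially)
  let ?w = "w (r n)" and ?G = "G (r n)"
  have C: "C1_on (N (r n)) (%x. \<psi> (?w x)) (%x. \<psi>' (?w x) *\<^sub>R ?G x)"
   by (rule C1_on_compose_real[OF N(2) \<psi>])
  have wgC: "is_weak_gradient (N (r n)) (%x. \<psi> (?w x)) (%x. \<psi>' (?w x) *\<^sub>R ?G x)" by (rule C1_on_weak_gradient[OF C])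
  have iC: "sint K (%x. \<psi> (?w x))" "sint K (%x. \<psi>' (?w x) *\<^sub>R ?G x)"
   using wgC N(1) K(1) by (auto simp: is_weak_gradient_def locally_integrable_def)
  have iuC: "sint K (%x. \<psi> (u x))" "sint K (%x. \<psi>' (u x) *\<^sub>R g x)"
   using locally_integrable_lipschitz_compose[OF u m(1) bd] locally_integrable_bounded_factor[OF u g m(2) B] K
   by (auto simp: locally_integrable_def)
  have i1: "sint K (%x. norm (?w x - u x))" "sint K (%x. norm (?G x - g x))"
   by (intro set_integrable_norm set_integral_diff(1) iK iu)+
  have i3: "sint K (%x. \<bar>\<psi>' (?w x) - \<psi>' (u x)\<bar> * norm (g x))"
  proof (rule set_integrable_dominated)
   show "sint K (%x. 2 * B * norm (g x))" by (intro set_integrable_mult_right set_integrable_norm iu)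
   show "norm (\<bar>\<psi>' (?w x) - \<psi>' (u x)\<bar> * norm (g x)) <= 2 * B * norm (g x)" for x
   proof -
    have "\<bar>\<psi>' (?w x) - \<psi>' (u x)\<bar> <= 2 * B" using B[of "?w x"] B[of "u x"] by linarith
    then show ?thesis by (simp add: abs_mult mult_right_mono)
   qed
  qed (use m3[of n] in simp)
  have "(LBINT x:K. norm (\<psi> (?w x) - \<psi> (u x))) <= (LBINT x:K. B * norm (?w x - u x))"
  proof (rule set_integral_mono)
   show "sint K (%x. norm (\<psi> (?w x) - \<psi> (u x)))"
    by (intro set_integrable_norm set_integral_diff(1) iC iuC)
   show "sint K (%x. B * norm (?w x - u x))" by (intro set_integrable_mult_right i1)
  qed (use lip in auto)
  also have "\<dots> = B * (LBINT x:K. norm (?w x - u x))" by (rule set_integral_mult_right)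
  also have "\<dots> <= B * \<epsilon> (r n)" by (intro mult_left_mono N B0)
  finally have 1: "(LBINT x:K. norm (\<psi> (?w x) - \<psi> (u x))) <= \<eta>" using n \<open>\<eta> > 0\<close> by linarith
  have "(LBINT x:K. norm (\<psi>' (?w x) *\<^sub>R ?G x - \<psi>' (u x) *\<^sub>R g x)) <=
   (LBINT x:K. B * norm (?G x - g x) + \<bar>\<psi>' (?w x) - \<psi>' (u x)\<bar> * norm (g x))"
  proof (rule set_integral_mono)
   show "sint K (%x. norm (\<psi>' (?w x) *\<^sub>R ?G x - \<psi>' (u x) *\<^sub>R g x))"
    by (intro set_integrable_norm set_integral_diff(1) iC iuC)
   show "sint K (%x. B * norm (?G x - g x) + \<bar>\<psi>' (?w x) - \<psi>' (u x)\<bar> * norm (g x))"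
    by (intro set_integral_add(1) set_integrable_mult_right i1 i3)
   fix x
   have "\<psi>' (?w x) *\<^sub>R ?G x - \<psi>' (u x) *\<^sub>R g x = \<psi>' (?w x) *\<^sub>R (?G x - g x) + (\<psi>' (?w x) - \<psi>' (u x)) *\<^sub>R g x"
    by (simp add: algebra_simps)
   then have "norm (\<psi>' (?w x) *\<^sub>R ?G x - \<psi>' (u x) *\<^sub>R g x) <= \<bar>\<psi>' (?w x)\<bar> * norm (?G x - g x) + \<bar>\<psi>' (?w x) - \<psi>' (u x)\<bar> * norm (g x)"
    by (metis norm_scaleR norm_triangle_ineq)
   also have "\<dots> <= B * norm (?G x - g x) + \<bar>\<psi>' (?w x) - \<psi>' (u x)\<bar> * norm (g x)"
    using B by (intro add_mono mult_right_mono) auto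
   finally show "norm (\<psi>' (?w x) *\<^sub>R ?G x - \<psi>' (u x) *\<^sub>R g x) <= B * norm (?G x - g x) + \<bar>\<psi>' (?w x) - \<psi>' (u x)\<bar> * norm (g x)" .
  qed
  also have "\<dots> = (LBINT x:K. B * norm (?G x - g x)) + (LBINT x:K. \<bar>\<psi>' (?w x) - \<psi>' (u x)\<bar> * norm (g x))"
   by (rule set_integral_add(2)) (intro set_integrable_mult_right i1 i3)+
  also have "(LBINT x:K. B * norm (?G x - g x)) = B * (LBINT x:K. norm (?G x - g x))" by (rule set_integral_mult_right)
  also have "\<dots> <= B * \<epsilon> (r n)" by (intro mult_left_mono N B0)
  finally have 2: "(LBINT x:K. norm (\<psi>' (?w x) *\<^sub>R ?G x - \<psi>' (u x) *\<^sub>R g x)) <= \<eta>" using n by linarith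
  show "\<exists>N w G. K \<subseteq> N \<and> is_weak_gradient N w G \<and> (LBINT x:K. norm (w x - \<psi> (u x))) <= \<eta> \<and>
    (LBINT x:K. norm (G x - \<psi>' (u x) *\<^sub>R g x)) <= \<eta>" using N(1) wgC 1 2 by blast
 qed
qed

text \<open>The integral of h from 0 to t with its sign: for negative t the second indicator takes
  over.\<close>

definition primitive0 :: "(real => real) => real => real" where
 "primitive0 h t = (LINT x|lborel. (indicator {0..t} x - indicator {t..0} x) * h x)"

lemma integrable_indicator_Icc: "integrable lborel (indicator {a..b::real} :: real => real)"
 by (rule integrable_real_indicator) (auto simp: emeasure_lborel_Icc_eq)

lemma interval_mult_integrable:
 fixes h :: "real => real"
 assumes "bm h" "\<And>x. \<bar>h x\<bar> <= 1"
 shows "integrable lborel (%x. indicator {a..b} x * h x :: real)"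
proof -
 have "integrable lborel (%x. h x *\<^sub>R (indicator {a..b} x :: real))"
  by (rule integrable_bounded_scaleR[OF integrable_indicator_Icc, where B = 1]) (use assms in auto)
 then show ?thesis by (simp add: mult.commute)
qed

lemma primitive0_integrable:
 fixes h :: "real => real"
 assumes "bm h" "\<And>x. \<bar>h x\<bar> <= 1"
 shows "integrable lborel (%x. (indicator {0..t} x - indicator {t..0} x) * h x :: real)"
 using Bochner_Integration.integrable_diff[OF interval_mult_integrable[OF assms, of 0 t] interval_mult_integrable[OF assms, of t 0]]
 by (simp add: left_diff_distrib)

lemma primitive0_diff:
 assumes h: "bm h" "\<And>x. \<bar>h x\<bar> <= 1" and "a <= b"
 shows "primitive0 h b - primitive0 h a = (LBINT x:{a..b}. h x)"
proof -
 have "primitive0 h b - primitive0 h a =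
  (LINT x|lborel. (indicator {0..b} x - indicator {b..0} x) * h x - (indicator {0..a} x - indicator {a..0} x) * h x)"
  unfolding primitive0_def by (rule Bochner_Integration.integral_diff[symmetric, OF primitive0_integrable[OF h] primitive0_integrable[OF h]])
 also have "\<dots> = (LINT x|lborel. indicator {a..b} x * h x)"
 proof (rule integral_cong_AE)
  show "(%x. indicator {a..b} x * h x) \<in> borel_measurable lborel" using h by measurable
  show "(%x. (indicator {0..b} x - indicator {b..0} x) * h x - (indicator {0..a} x - indicator {a..0} x) * h x) \<in> borel_measurable lborel"
   using h by measurable
  \<comment> \<open>The closed intervals overlap in their end points, so these three points are
    discarded.\<close>
  have "AE x in lborel. x \<noteq> 0 \<and> x \<noteq> a \<and> x \<noteq> b"
   using AE_lborel_singleton[of 0] AE_lborel_singleton[of a] AE_lborel_singleton[of b] by eventually_elim simp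
  then show "AE x in lborel. (indicator {0..b} x - indicator {b..0} x) * h x - (indicator {0..a} x - indicator {a..0} x) * h x = indicator {a..b} x * h x"
  proof eventually_elim
   case (elim x)
   then show ?case using \<open>a <= b\<close> by (auto simp: indicator_def)
  qed
 qed
 finally show ?thesis by (simp add: set_lebesgue_integral_def)
qed

lemma primitive0_0: "primitive0 h 0 = 0" unfolding primitive0_def by simp

lemma primitive0_lipschitz:
 assumes h: "bm h" "\<And>x. \<bar>h x\<bar> <= 1"
 shows "\<bar>primitive0 h b - primitive0 h a\<bar> <= \<bar>b - a\<bar>"
proof -
 have *: "\<bar>primitive0 h b - primitive0 h a\<bar> <= b - a" if "a <= b" for a b
 proof -
  have i: "integrable lborel (%x. indicator {a..b} x * h x)" by (rule interval_mult_integrable[OF h])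
  have "\<bar>primitive0 h b - primitive0 h a\<bar> = norm (LINT x|lborel. indicator {a..b} x * h x)"
   by (simp add: primitive0_diff[OF h that] set_lebesgue_integral_def)
  also have "\<dots> <= (LINT x|lborel. indicator {a..b} x)"
  proof (rule order_trans[OF Bochner_Integration.integral_norm_bound integral_mono])
   show "norm (indicator {a..b} x * h x) <= indicator {a..b} x" for x using h(2) by (auto simp: indicator_def)
  qed (rule integrable_norm[OF i], rule integrable_indicator_Icc)
  also have "\<dots> = b - a" using that by simp
  finally show ?thesis .
 qed
 show ?thesis using *[of a b] *[of b a] by (cases "a <= b") auto
qed

lemma primitive0_DERIV:
 assumes c: "continuous_on UNIV h" and b: "\<And>x. \<bar>h x\<bar> <= 1"
 shows "(primitive0 h has_real_derivative h t) (at t)"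
proof -
 have m: "bm h" using c by (rule borel_measurable_continuous_onI)
 \<comment> \<open>Near t the primitive is an indefinite integral starting at t - 1, whatever the
   sign of t.\<close>
 have eq: "primitive0 h x = primitive0 h (t - 1) + integral {t - 1..x} h" if "x \<in> {t - 1<..<t + 1}" for x
 proof -
  have "sint {t - 1..x} h"
   using interval_mult_integrable[OF m b, of "t - 1" x] by (simp add: set_integrable_def)
  then have "(LBINT x:{t - 1..x}. h x) = integral {t - 1..x} h" by (rule set_borel_integral_eq_integral(2))
  then show ?thesis using primitive0_diff[OF m b, of "t - 1" x] that by simp
 qed
 have "((%x. primitive0 h (t - 1) + integral {t - 1..x} h) has_real_derivative 0 + h t) (at t within {t - 1..t + 1})"
  by (intro DERIV_add DERIV_const integral_has_real_derivative continuous_on_subset[OF c]) auto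
 then have d0: "((%x. primitive0 h (t - 1) + integral {t - 1..x} h) has_real_derivative h t) (at t within {t - 1..t + 1})"
  by simp
 have "((%x. primitive0 h (t - 1) + integral {t - 1..x} h) has_real_derivative h t) (at t within {t - 1<..<t + 1})"
  by (rule DERIV_subset[OF d0]) auto
 then have "((%x. primitive0 h (t - 1) + integral {t - 1..x} h) has_real_derivative h t) (at t)"
  by (subst (asm) at_within_open) auto
 then show ?thesis
  by (rule has_field_derivative_transform_within_open[where S = "{t - 1<..<t + 1}"]) (auto simp: eq)
qed

text \<open>Continuous functions that increase to the indicator of the open set G.\<close>

definition open_approx :: "real set => nat => real => real" where
 "open_approx G n t = min 1 (real n * infdist t (- G))"

text \<open>The signed measure of G between 0 and t. Two choices of G matter: (0,1) gives the unit
  contraction, and a small dense G gives a strictly increasing function whose chain rule has no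
  contribution from the complement of G.\<close>

definition open_primitive :: "real set => real => real" where
 "open_primitive G = primitive0 (indicator G)"

text \<open>The complement of G is taken nonempty because the distance to the empty set is 0 by
  convention, which would make the approximants vanish.\<close>

lemma open_approx_facts:
 assumes "open G" "- G \<noteq> {}"
 shows "continuous_on UNIV (open_approx G n)" "0 <= open_approx G n t" "open_approx G n t <= 1"
  "(%n. open_approx G n t) \<longlonglongrightarrow> indicator G t"
proof -
 show "continuous_on UNIV (open_approx G n)" unfolding open_approx_def by (intro continuous_intros)
 show "0 <= open_approx G n t" "open_approx G n t <= 1" by (auto simp: open_approx_def infdist_nonneg)
 show "(%n. open_approx G n t) \<longlonglongrightarrow> indicator G t"
 proof (cases "t \<in> G")
  case True
  have "infdist t (- G) \<noteq> 0" using in_closed_iff_infdist_zero[of "- G" t] assms True by auto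
  then have p: "infdist t (- G) > 0" using infdist_nonneg[of t "- G"] by linarith
  obtain N where N: "1 / infdist t (- G) <= real N" using real_arch_simple by blast
  have "open_approx G n t = 1" if "n \<ge> N" for n
  proof -
   have "1 / infdist t (- G) <= real n" using N that by linarith
   then show ?thesis using p by (simp add: open_approx_def divide_le_eq)
  qed
  then have "\<forall>\<^sub>F n in sequentially. open_approx G n t = indicator G t"
   using True by (auto simp: eventually_sequentially)
  then show ?thesis by (rule tendsto_eventually)
 next
  case False
  then show ?thesis by (simp add: open_approx_def)
 qed
qed

lemma open_primitive_facts:
 assumes G: "open G" "- G \<noteq> {}"
 shows "(primitive0 (open_approx G n) has_real_derivative open_approx G n t) (at t)"
  "\<bar>primitive0 (open_approx G n) t\<bar> <= \<bar>t\<bar>"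
  "(%n. primitive0 (open_approx G n) t) \<longlonglongrightarrow> open_primitive G t"
  "a <= b ==> open_primitive G b - open_primitive G a = measure lborel (G \<inter> {a..b})"
  "\<bar>open_primitive G b - open_primitive G a\<bar> <= \<bar>b - a\<bar>"
  "open_primitive G 0 = 0" "continuous_on UNIV (open_primitive G)"
proof -
 note f = open_approx_facts[OF G]
 have b: "\<bar>open_approx G n t\<bar> <= 1" for n t using f(2,3) by simp
 have m: "open_approx G n \<in> borel_measurable borel" for n using f(1) by (rule borel_measurable_continuous_onI)
 have mi: "indicator G \<in> borel_measurable borel" using G by auto
 have bi: "\<bar>indicator G x\<bar> <= (1::real)" for x by (auto simp: indicator_def)
 show "(primitive0 (open_approx G n) has_real_derivative open_approx G n t) (at t)"
  by (rule primitive0_DERIV[OF f(1) b])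
 show "\<bar>primitive0 (open_approx G n) t\<bar> <= \<bar>t\<bar>"
  using primitive0_lipschitz[OF m b, of n t 0] by (simp add: primitive0_0)
 show "\<bar>open_primitive G b - open_primitive G a\<bar> <= \<bar>b - a\<bar>" for a b
  unfolding open_primitive_def by (rule primitive0_lipschitz[OF mi bi])
 then show "continuous_on UNIV (open_primitive G)"
  by (auto simp: continuous_on_iff dist_real_def intro: le_less_trans)
 show "open_primitive G 0 = 0" by (simp add: open_primitive_def primitive0_0)
 show "(%n. primitive0 (open_approx G n) t) \<longlonglongrightarrow> open_primitive G t"
  unfolding primitive0_def open_primitive_def
 proof (rule integral_dominated_convergence)
  show "integrable lborel (%x. indicator {0..t} x + indicator {t..0} x :: real)"
   by (intro Bochner_Integration.integrable_add integrable_indicator_Icc)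
  show "AE x in lborel. (%n. (indicator {0..t} x - indicator {t..0} x) * open_approx G n x) \<longlonglongrightarrow> (indicator {0..t} x - indicator {t..0} x) * indicator G x"
   by (intro AE_I2 tendsto_mult_left f(4))
  show "AE x in lborel. norm ((indicator {0..t} x - indicator {t..0} x) * open_approx G n x) <= indicator {0..t} x + indicator {t..0} x" for n
   using b[of n] by (intro AE_I2) (auto simp: indicator_def)
 qed (use m mi in measurable)
 show "open_primitive G b - open_primitive G a = measure lborel (G \<inter> {a..b})" if "a <= b"
  unfolding open_primitive_def primitive0_diff[OF mi bi that]
  by (simp add: set_lebesgue_integral_def indicator_inter_arith[symmetric] Int_commute)
qed

text \<open>Limit of the chain rule for continuously differentiable functions. The slopes
  \<open>open_approx G n\<close> converge at every point and not merely almost everywhere, so the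
  level sets of u never have to be discussed.\<close>

lemma weak_gradient_chain_open:
 fixes U :: "complex set"
 assumes U: "open U" and wg: "is_weak_gradient U u g" and G: "open G" "- G \<noteq> {}"
 shows "is_weak_gradient U (%x. open_primitive G (u x)) (%x. indicator G (u x) *\<^sub>R g x)"
proof -
 have u: "locally_integrable U u" and g: "locally_integrable U g" using wg by (auto simp: is_weak_gradient_def)
 note f = open_approx_facts[OF G] and p = open_primitive_facts[OF G]
 have b: "\<bar>open_approx G n t\<bar> <= 1" for n t using f(2,3) by simp
 show ?thesis
 proof (rule is_weak_gradient_dominated)
  show "is_weak_gradient U (%x. primitive0 (open_approx G n) (u x)) (%x. open_approx G n (u x) *\<^sub>R g x)" for n
   by (rule weak_gradient_chain_C1[OF U wg p(1) f(1) b])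
  show "locally_integrable U (%x. open_primitive G (u x))"
   by (rule locally_integrable_lipschitz_compose[OF u borel_measurable_continuous_onI[OF p(7)], where A = 0 and B = 1])
    (use p(5)[of _ 0] p(6) in simp)
  show "locally_integrable U (%x. indicator G (u x) *\<^sub>R g x)"
  proof (rule locally_integrable_bounded_factor[OF u g, where B = 1])
   show "indicator G \<in> borel_measurable borel" by (rule borel_measurable_indicator[OF borel_open[OF G(1)]])
  qed (auto simp: indicator_def)
  show "locally_integrable U (%x. 2 * \<bar>u x\<bar>)"
   by (rule locally_integrable_lipschitz_compose[OF u, where A = 0 and B = 2]) auto
  show "locally_integrable U (%x. 2 * norm (g x))"
   using g unfolding locally_integrable_def by (intro allI impI set_integrable_mult_right set_integrable_norm) auto
  show "\<bar>primitive0 (open_approx G n) (u x) - open_primitive G (u x)\<bar> <= 2 * \<bar>u x\<bar>" for n x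
   using p(2)[of n "u x"] p(5)[of "u x" 0] p(6) by simp
  show "norm (open_approx G n (u x) *\<^sub>R g x - indicator G (u x) *\<^sub>R g x) <= 2 * norm (g x)" for n x
  proof -
   have "\<bar>open_approx G n (u x) - indicator G (u x)\<bar> <= 2" using b[of n "u x"] by (auto simp: indicator_def)
   from mult_right_mono[OF this norm_ge_zero[of "g x"]]
   show ?thesis by (simp flip: scaleR_diff_left)
  qed
  show "(%n. primitive0 (open_approx G n) (u x)) \<longlonglongrightarrow> open_primitive G (u x)" for x by (rule p(3))
  show "(%n. open_approx G n (u x) *\<^sub>R g x) \<longlonglongrightarrow> indicator G (u x) *\<^sub>R g x" for x
   by (intro tendsto_scaleR f(4) tendsto_const)
 qed
qed

lemma open_primitive_01: "open_primitive {0<..<1} t = min (max 0 t) 1"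
proof -
 have G: "open {0<..<1::real}" "- {0<..<1::real} \<noteq> {}" by (auto intro: exI[of _ 0])
 note p = open_primitive_facts[OF G]
 consider "t <= 0" | "0 <= t" "t <= 1" | "1 <= t" by linarith
 then show ?thesis
 proof cases
  case 1
  then have "{0<..<1} \<inter> {t..0::real} = {}" by auto
  then show ?thesis using p(4)[OF 1] p(6) 1 by simp
 next
  case 2
  have "measure lborel ({0<..<1} \<inter> {0..t}) = measure lborel {0<..<t}"
  proof (cases "t = 1")
   case True
   then have "{0<..<1} \<inter> {0..t} = {0<..<t}" by auto
   then show ?thesis by simp
  next
   case False
   then have "{0<..<1} \<inter> {0..t} = {0<..t}" using 2 by auto
   then show ?thesis using 2 by simp
  qed
  then show ?thesis using p(4)[OF 2(1)] p(6) 2 by simp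
 next
  case 3
  then have "{0<..<1} \<inter> {0..t} = {0<..<1::real}" by auto
  then show ?thesis using p(4)[of 0 t] p(6) 3 by simp
 qed
qed

lemma weak_gradient_trunc:
 fixes U :: "complex set"
 assumes "open U" "is_weak_gradient U u g"
 shows "is_weak_gradient U (%x. min (max 0 (u x)) 1) (%x. indicator {0<..<1} (u x) *\<^sub>R g x)"
proof -
 have "is_weak_gradient U (%x. open_primitive {0<..<1} (u x)) (%x. indicator {0<..<1} (u x) *\<^sub>R g x)"
  by (rule weak_gradient_chain_open[OF assms]) (auto intro: exI[of _ 0])
 then show ?thesis by (simp only: open_primitive_01)
qed

text \<open>Where the Jacobian is bounded below, integrals over K are controlled by integrals over
  its image.\<close>

lemma compose_set_integrable:
 fixes h :: "complex => 'b::euclidean_space"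
 assumes U: "open U" and hol: "f holomorphic_on U" and inj: "inj_on f U" and K: "compact K" "K \<subseteq> U"
  and h: "sint (f ` K) h" and C: "\<And>z. z \<in> K ==> 1 <= C * (norm (deriv f z))^2"
 shows "sint K (%z. h (f z))"
  "(LBINT z:K. norm (h (f z))) <= C * (LBINT w:f ` K. norm (h w))"
proof -
 define \<phi> where "\<phi> = (%w. indicator (f ` K) w * norm (h w))"
 have hn: "sint (f ` K) (%w. norm (h w))" by (rule set_integrable_norm[OF h])
 have ind: "indicator (f ` K) (f z) = (indicator K z :: real)" if "z \<in> U" for z
  using that K inj by (auto simp: indicator_def inj_on_def)
 have "sint (f ` U) \<phi>" using hn unfolding set_integrable_def \<phi>_def
  by (rule Bochner_Integration.integrable_cong[THEN iffD1, OF refl, rotated]) (use K in \<open>auto simp: indicator_def\<close>)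
 note cov = holomorphic_change_of_variables[OF U hol inj this]
 have e1: "indicator U z *\<^sub>R ((norm (deriv f z))^2 * \<phi> (f z)) = indicator K z *\<^sub>R ((norm (deriv f z))^2 * norm (h (f z)))" for z
  using K(2) ind[of z] by (cases "z \<in> U") (auto simp: \<phi>_def indicator_def)
 have iK: "sint K (%z. (norm (deriv f z))\<^sup>2 * norm (h (f z)))"
  using cov(1) unfolding set_integrable_def e1 .
 have iCK: "sint K (%z. C * ((norm (deriv f z))^2 * norm (h (f z))))"
  by (intro set_integrable_mult_right iK)
 have vK: "(LBINT z:K. (norm (deriv f z))\<^sup>2 * norm (h (f z))) = (LBINT w:f ` K. norm (h w))"
 proof -
  have "(LBINT z:K. (norm (deriv f z))\<^sup>2 * norm (h (f z))) = (LBINT w:f ` U. \<phi> w)"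
   using cov(2) unfolding set_lebesgue_integral_def e1 .
  also have "\<dots> = (LBINT w:f ` K. norm (h w))" unfolding set_lebesgue_integral_def \<phi>_def
   by (rule Bochner_Integration.integral_cong) (use K in \<open>auto simp: indicator_def\<close>)
  finally show ?thesis .
 qed
 have Kb: "K \<in> sets borel" using compact_imp_closed[OF K(1)] by (rule borel_closed)
 have mh: "(%z. indicator K z *\<^sub>R h (f z)) \<in> borel_measurable lborel"
 proof -
  have "bm (%w. indicator (f ` K) w *\<^sub>R h w)"
   using borel_measurable_integrable[OF h[unfolded set_integrable_def]] by simp
  from measurable_compose[OF restr_fun_measurable[OF U hol] this]
  have "bm (%z. indicator K z *\<^sub>R (indicator (f ` K) (restr_fun U f z) *\<^sub>R h (restr_fun U f z)))"
   by (rule borel_measurable_scaleR[OF borel_measurable_indicator[OF Kb]])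
  moreover have "indicator K z *\<^sub>R (indicator (f ` K) (restr_fun U f z) *\<^sub>R h (restr_fun U f z)) = indicator K z *\<^sub>R h (f z)" for z
   using K(2) by (auto simp: indicator_def restr_fun_def)
  ultimately show ?thesis by simp
 qed
 have bd: "norm (h (f z)) <= C * ((norm (deriv f z))^2 * norm (h (f z)))" if "z \<in> K" for z
  using mult_right_mono[OF C[OF that] norm_ge_zero[of "h (f z)"]] by (simp add: mult.assoc)
 show i: "sint K (%z. h (f z))" by (rule set_integrable_dominated[OF iCK mh bd])
 have "(LBINT z:K. norm (h (f z))) <= (LBINT z:K. C * ((norm (deriv f z))^2 * norm (h (f z))))"
  by (rule set_integral_mono[OF set_integrable_norm[OF i] iCK bd])
 then show "(LBINT z:K. norm (h (f z))) <= C * (LBINT w:f ` K. norm (h w))" by (simp add: vK)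
qed

text \<open>The inner product of G(f z) with f'(z) h equals that of cnj(f'(z)) G(f z) with h, hence
  the conjugate. The identity is transported from smooth approximants on a neighbourhood of the
  image of K.\<close>

lemma weak_gradient_conformal:
 assumes U: "open U" and hol: "f holomorphic_on U" and inj: "inj_on f U" and wg: "is_weak_gradient (f ` U) u g"
 shows "is_weak_gradient U (%z. u (f z)) (%z. cnj (deriv f z) * g (f z))"
proof -
 have u: "locally_integrable (f ` U) u" and g: "locally_integrable (f ` U) g" using wg by (auto simp: is_weak_gradient_def)
 have oV: "open (f ` U)" by (rule open_mapping_thm3[OF hol U inj])
 have cf: "continuous_on U f" using hol by (rule holomorphic_on_imp_continuous_on)
 have cdf: "continuous_on U (deriv f)"
  using holomorphic_deriv[OF hol U] by (rule holomorphic_on_imp_continuous_on)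
 have cK: "\<exists>C>0. \<forall>z\<in>K. 1 <= C * (norm (deriv f z))^2" and cM: "\<exists>M>0. \<forall>z\<in>K. norm (deriv f z) <= M"
  if K: "compact K" "K \<subseteq> U" for K
 proof -
  have c: "continuous_on K (deriv f)" using cdf K(2) by (rule continuous_on_subset)
  have nz: "deriv f z \<noteq> 0" if "z \<in> K" for z
   using holomorphic_injective_imp_regular[OF hol U inj] K(2) that by auto
  have "compact (deriv f ` K)" using c K(1) by (rule compact_continuous_image)
  then obtain M where M: "M > 0" "\<forall>y\<in>deriv f ` K. norm y <= M"
   using compact_imp_bounded bounded_pos by blast
  then show "\<exists>M>0. \<forall>z\<in>K. norm (deriv f z) <= M" by auto
  have "compact ((%z. inverse ((norm (deriv f z))^2)) ` K)"
   using K(1) nz by (intro compact_continuous_image continuous_intros c) auto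
  then obtain C where C: "C > 0" "\<forall>y\<in>(%z. inverse ((norm (deriv f z))^2)) ` K. norm y <= C"
   using compact_imp_bounded bounded_pos by blast
  have "1 <= C * (norm (deriv f z))^2" if "z \<in> K" for z
  proof -
   have "inverse ((norm (deriv f z))^2) <= C" using C(2) that by auto
   then show ?thesis using nz[OF that] by (simp add: divide_simps split: if_splits)
  qed
  then show "\<exists>C>0. \<forall>z\<in>K. 1 <= C * (norm (deriv f z))^2" using C(1) by blast
 qed
 have fK: "compact (f ` K)" "f ` K \<subseteq> f ` U" if "compact K" "K \<subseteq> U" for K
  using that by (auto intro!: compact_continuous_image continuous_on_subset[OF cf])
 have iu: "sint K (%z. u (f z))" and ig: "sint K (%z. cnj (deriv f z) * g (f z))"
  if K: "compact K" "K \<subseteq> U" for K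
 proof -
  obtain C where C: "C > 0" "\<forall>z\<in>K. 1 <= C * (norm (deriv f z))^2" using cK[OF K] by (elim exE conjE)
  obtain M where M: "M > 0" "\<forall>z\<in>K. norm (deriv f z) <= M" using cM[OF K] by (elim exE conjE)
  have ui: "sint (f ` K) u" and gi: "sint (f ` K) g"
   using u g fK[OF K] by (auto simp: locally_integrable_def)
  show "sint K (%z. u (f z))" by (rule compose_set_integrable(1)[OF U hol inj K ui]) (use C in auto)
  have gf: "sint K (%z. g (f z))"
   by (rule compose_set_integrable(1)[OF U hol inj K gi]) (use C in auto)
  show "sint K (%z. cnj (deriv f z) * g (f z))"
  proof (rule set_integrable_dominated)
   show "sint K (%z. M * norm (g (f z)))" by (intro set_integrable_mult_right set_integrable_norm gf)
   have "(%z. (indicator K z *\<^sub>R cnj (deriv f z)) * (indicator K z *\<^sub>R g (f z))) \<in> borel_measurable lborel"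
   proof (rule borel_measurable_times)
    show "(%z. indicator K z *\<^sub>R g (f z)) \<in> borel_measurable lborel"
     using gf by (auto simp: set_integrable_def)
    have "integrable lborel (%z. indicator K z *\<^sub>R cnj (deriv f z))"
     using K by (intro borel_integrable_compact continuous_intros continuous_on_subset[OF cdf])
    then show "(%z. indicator K z *\<^sub>R cnj (deriv f z)) \<in> borel_measurable lborel" by (rule borel_measurable_integrable)
   qed
   moreover have "(%z. (indicator K z *\<^sub>R cnj (deriv f z)) * (indicator K z *\<^sub>R g (f z))) =
     (%z. indicator K z *\<^sub>R (cnj (deriv f z) * g (f z)))" by (auto simp: indicator_def fun_eq_iff)
   ultimately show "(%z. indicator K z *\<^sub>R (cnj (deriv f z) * g (f z))) \<in> borel_measurable lborel" by simp
   show "norm (cnj (deriv f z) * g (f z)) <= M * norm (g (f z))" if "z \<in> K" for z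
    using M(2) that by (auto simp: norm_mult intro!: mult_right_mono)
  qed
 qed
 show ?thesis
 proof (rule is_weak_gradient_limit)
  show "locally_integrable U (%z. u (f z))" "locally_integrable U (%z. cnj (deriv f z) * g (f z))"
   unfolding locally_integrable_def using iu ig by auto
  fix K and \<eta> :: real assume K: "compact K" "K \<subseteq> U" and "\<eta> > 0"
  obtain C where C: "C > 0" "\<forall>z\<in>K. 1 <= C * (norm (deriv f z))^2" using cK[OF K] by (elim exE conjE)
  obtain M where M: "M > 0" "\<forall>z\<in>K. norm (deriv f z) <= M" using cM[OF K] by (elim exE conjE)
  \<comment> \<open>Makes both C \<epsilon> and M C \<epsilon> at most \<eta>; C comes from the
    Jacobian, M from the factor f'.\<close>
  define \<epsilon> where "\<epsilon> = \<eta> / (C * (M + 1))"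
  have "\<epsilon> > 0" using \<open>\<eta> > 0\<close> C M by (simp add: \<epsilon>_def)
  have Ce: "C * \<epsilon> = \<eta> / (M + 1)" using C M by (simp add: \<epsilon>_def)
  have Ce1: "C * \<epsilon> <= \<eta>" "M * (C * \<epsilon>) <= \<eta>"
   unfolding Ce using M \<open>\<eta> > 0\<close> by (simp_all add: divide_le_eq field_simps)
  from weak_gradient_approx[OF oV fK[OF K] wg \<open>\<epsilon> > 0\<close>] obtain N w G where
   N: "f ` K \<subseteq> N" "N \<subseteq> f ` U" "C1_on N w G" "(LBINT x:f ` K. norm (w x - u x)) <= \<epsilon>" "(LBINT x:f ` K. norm (G x - g x)) <= \<epsilon>"
   by (elim exE conjE)
  define N' where "N' = U \<inter> f -` N"
  have oN: "open N" using N(3) by (simp add: C1_on_def)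
  have oN': "open N'" unfolding N'_def by (rule continuous_open_preimage[OF cf U oN])
  have KN': "K \<subseteq> N'" using N(1) K by (auto simp: N'_def)
  have C1: "C1_on N' (%z. w (f z)) (%z. cnj (deriv f z) * G (f z))" unfolding C1_on_def
  proof (intro conjI ballI oN')
   show "continuous_on N' (%z. cnj (deriv f z) * G (f z))"
    using N(3) by (intro continuous_intros continuous_on_subset[OF cdf] continuous_on_compose2[where g = G and f = f and t = N]
      continuous_on_subset[OF cf]) (auto simp: N'_def C1_on_def)
   fix z assume z: "z \<in> N'"
   then have d1: "(f has_derivative (%h. deriv f z * h)) (at z)"
    using holomorphic_derivI[OF hol U, of z] by (simp add: has_field_derivative_def N'_def)
   have d2: "(w has_derivative (%h. G (f z) \<bullet> h)) (at (f z))" using N(3) z by (auto simp: C1_on_def N'_def)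
   show "((%z. w (f z)) has_derivative (%h. (cnj (deriv f z) * G (f z)) \<bullet> h)) (at z)"
    by (rule has_derivative_eq_rhs[OF has_derivative_compose[OF d1 d2]])
     (auto simp: fun_eq_iff inner_complex_def algebra_simps)
  qed
  have li: "sint (f ` K) w" "sint (f ` K) G"
   using C1_on_weak_gradient[OF N(3)] N(1) fK[OF K] by (auto simp: is_weak_gradient_def locally_integrable_def)
  have ui: "sint (f ` K) u" and gi: "sint (f ` K) g"
   using u g fK[OF K] by (auto simp: locally_integrable_def)
  have wu: "sint (f ` K) (%x. w x - u x)" and Gg: "sint (f ` K) (%x. G x - g x)"
   by (rule set_integral_diff(1)[OF li(1) ui], rule set_integral_diff(1)[OF li(2) gi])
  have "(LBINT z:K. norm (w (f z) - u (f z))) <= C * (LBINT x:f ` K. norm (w x - u x))"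
   by (rule compose_set_integrable(2)[OF U hol inj K wu]) (use C in auto)
  also have "\<dots> <= C * \<epsilon>" using N(4) C by (intro mult_left_mono) auto
  finally have 1: "(LBINT z:K. norm (w (f z) - u (f z))) <= \<eta>" using Ce1 by linarith
  have iGg: "sint K (%z. G (f z) - g (f z))"
   by (rule compose_set_integrable(1)[OF U hol inj K Gg]) (use C in auto)
  have iGc: "sint K (%z. cnj (deriv f z) * G (f z))"
   using C1_on_weak_gradient[OF C1] KN' K by (auto simp: is_weak_gradient_def locally_integrable_def)
  have "(LBINT z:K. norm (cnj (deriv f z) * G (f z) - cnj (deriv f z) * g (f z))) <= (LBINT z:K. M * norm (G (f z) - g (f z)))"
  proof (rule set_integral_mono)
   show "sint K (%z. norm (cnj (deriv f z) * G (f z) - cnj (deriv f z) * g (f z)))"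
    by (rule set_integrable_norm[OF set_integral_diff(1)[OF iGc ig[OF K]]])
   show "sint K (%z. M * norm (G (f z) - g (f z)))" by (intro set_integrable_mult_right set_integrable_norm iGg)
   fix z assume "z \<in> K"
   then have "norm (deriv f z) <= M" using M by blast
   from mult_right_mono[OF this norm_ge_zero[of "G (f z) - g (f z)"]]
   show "norm (cnj (deriv f z) * G (f z) - cnj (deriv f z) * g (f z)) <= M * norm (G (f z) - g (f z))"
    by (simp add: norm_mult flip: right_diff_distrib)
  qed
  also have "\<dots> = M * (LBINT z:K. norm (G (f z) - g (f z)))" by (rule set_integral_mult_right)
  also have "\<dots> <= M * (C * (LBINT x:f ` K. norm (G x - g x)))"
   by (intro mult_left_mono compose_set_integrable(2)[OF U hol inj K Gg]) (use C M in auto)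
  also have "\<dots> <= M * (C * \<epsilon>)" using N(5) C M by (intro mult_left_mono) auto
  finally have 2: "(LBINT z:K. norm (cnj (deriv f z) * G (f z) - cnj (deriv f z) * g (f z))) <= \<eta>" using Ce1 by linarith
  show "\<exists>N w G. K \<subseteq> N \<and> is_weak_gradient N w G \<and> (LBINT z:K. norm (w z - u (f z))) <= \<eta> \<and>
    (LBINT z:K. norm (G z - cnj (deriv f z) * g (f z))) <= \<eta>" using KN' C1_on_weak_gradient[OF C1] 1 2
   by (intro exI[of _ N'] exI[of _ "%z. w (f z)"] exI[of _ "%z. cnj (deriv f z) * G (f z)"] conjI)
 qed
qed

section \<open>Nonnegative quadratic forms\<close>

text \<open>One notion for the Dirichlet integral, the L2 product and their sum. As elements are
  functions and not classes, the form may have a kernel.\<close>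

definition psd :: "('a => real) set => (('a => real) => ('a => real) => real) => bool" where
 "psd H B \<longleftrightarrow>
   (\<forall>u\<in>H. \<forall>v\<in>H. \<forall>a b. (%x. a * u x + b * v x) \<in> H) \<and>
   (\<forall>u\<in>H. \<forall>v\<in>H. \<forall>w\<in>H. \<forall>a b. B (%x. a * u x + b * v x) w = a * B u w + b * B v w) \<and>
   (\<forall>u\<in>H. \<forall>v\<in>H. B u v = B v u) \<and>
   (\<forall>u\<in>H. 0 <= B u u)"

lemma psdD:
 assumes "psd H B" "u \<in> H" "v \<in> H"
 shows "(%x. a * u x + b * v x) \<in> H" "w \<in> H ==> B (%x. a * u x + b * v x) w = a * B u w + b * B v w"
  "B u v = B v u" "0 <= B u u" using assms unfolding psd_def by blast+

lemma psd_diff: "psd H B ==> u \<in> H ==> v \<in> H ==> (%x. u x - v x) \<in> H" using psdD(1)[of H B u v 1 "-1"] by simp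

lemma psd_mid: "psd H B ==> u \<in> H ==> v \<in> H ==> (%x. (u x + v x) / 2) \<in> H"
 using psdD(1)[of H B u v "1/2" "1/2"] by (simp add: add_divide_distrib)

lemma psd_expand:
 assumes p: "psd H B" and u: "u \<in> H" and v: "v \<in> H"
 shows "B (%x. a * u x + b * v x) (%x. a * u x + b * v x) = a\<^sup>2 * B u u + 2 * a * b * B u v + b\<^sup>2 * B v v"
proof -
 let ?w = "%x. a * u x + b * v x"
 have w: "?w \<in> H" by (rule psdD(1)[OF p u v])
 have "B ?w ?w = a * B u ?w + b * B v ?w" by (rule psdD(2)[OF p u v w])
 also have "B u ?w = a * B u u + b * B v u" using psdD(3)[OF p u w] psdD(2)[OF p u v u] by simp
 also have "B v ?w = a * B u v + b * B v v" using psdD(3)[OF p v w] psdD(2)[OF p u v v] by simp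
 finally show ?thesis using psdD(3)[OF p u v] by (simp add: power2_eq_square algebra_simps)
qed

lemma psd_diff_expand:
 assumes p: "psd H B" and u: "u \<in> H" and v: "v \<in> H"
 shows "B (%x. u x - v x) (%x. u x - v x) = B u u - 2 * B u v + B v v"
 using psd_expand[OF p u v, of 1 "-1"] by simp

lemma psd_diff_commute:
 assumes p: "psd H B" and u: "u \<in> H" and v: "v \<in> H"
 shows "B (%x. u x - v x) (%x. u x - v x) = B (%x. v x - u x) (%x. v x - u x)"
 by (simp add: psd_diff_expand[OF p u v] psd_diff_expand[OF p v u] psdD(3)[OF p u v])

lemma psd_parallelogram:
 assumes p: "psd H B" and u: "u \<in> H" and v: "v \<in> H"
 shows "B (%x. (u x + v x) / 2) (%x. (u x + v x) / 2) =
  B u u / 2 + B v v / 2 - B (%x. u x - v x) (%x. u x - v x) / 4"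
 using psd_expand[OF p u v, of "1/2" "1/2"] psd_diff_expand[OF p u v]
 by (simp add: add_divide_distrib power2_eq_square) (simp add: field_simps)

lemma psd_triangle:
 assumes p: "psd H B" and u: "u \<in> H" and v: "v \<in> H" and w: "w \<in> H"
 shows "B (%x. u x - w x) (%x. u x - w x) <=
  2 * B (%x. u x - v x) (%x. u x - v x) + 2 * B (%x. v x - w x) (%x. v x - w x)"
proof -
 let ?a = "%x. u x - v x" and ?b = "%x. v x - w x"
 have a: "?a \<in> H" and b: "?b \<in> H" using psd_diff[OF p] u v w by auto
 have "0 <= B (%x. 1 * ?a x + (-1) * ?b x) (%x. 1 * ?a x + (-1) * ?b x)"
  by (rule psdD(4)[OF p psdD(1)[OF p a b] b])
 then have "2 * B ?a ?b <= B ?a ?a + B ?b ?b" unfolding psd_expand[OF p a b] by simp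
 moreover have "B (%x. u x - w x) (%x. u x - w x) = B ?a ?a + 2 * B ?a ?b + B ?b ?b"
  using psd_expand[OF p a b, of 1 1] by simp
 ultimately show ?thesis by linarith
qed

lemma psd_CS:
 assumes p: "psd H B" and u: "u \<in> H" and v: "v \<in> H"
 shows "(B u v)^2 <= B u u * B v v"
proof -
 have q: "0 <= B u u + 2 * t * B u v + t\<^sup>2 * B v v" for t
  using psdD(4)[OF p psdD(1)[OF p u v, of 1 t] u] unfolding psd_expand[OF p u v] by (simp add: mult.assoc)
 show ?thesis
 proof (cases "B v v = 0")
  case True
  have "B u v = 0"
  proof (rule ccontr)
   assume n: "B u v \<noteq> 0"
   \<comment> \<open>When B v v = 0 the quadratic in t is affine, and this value of t would make it
     equal to -1.\<close>
   have "2 * (- (B u u + 1) / (2 * B u v)) * B u v = - (B u u + 1)" using n by simp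
   then show False using q[of "- (B u u + 1) / (2 * B u v)"] True by simp
  qed
  then show ?thesis using True by simp
 next
  case False
  then have pos: "B v v > 0" using psdD(4)[OF p v v] by simp
  have "0 <= B u u + 2 * (- B u v / B v v) * B u v + (- B u v / B v v)^2 * B v v" by (rule q)
  also have "\<dots> = B u u - (B u v)\<^sup>2 / B v v" using pos by (simp add: power2_eq_square)
  finally show ?thesis using pos by (simp add: divide_le_eq)
 qed
qed

lemma psd_tendsto:
 assumes p: "psd H B" and un: "\<And>n. us n \<in> H" and vn: "\<And>n. vs n \<in> H" and u: "u \<in> H" and v: "v \<in> H"
  and lu: "null_seq (%n. B (%x. us n x - u x) (%x. us n x - u x))"
  and lv: "null_seq (%n. B (%x. vs n x - v x) (%x. vs n x - v x))"
 shows "(%n. B (us n) (vs n)) \<longlonglongrightarrow> B u v"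
proof -
 let ?a = "%n x. us n x - u x" and ?b = "%n x. vs n x - v x"
 have a: "?a n \<in> H" and b: "?b n \<in> H" for n using psd_diff[OF p] un vn u v by auto
 have eq: "B (us n) (vs n) = B u v + B (?a n) v + B u (?b n) + B (?a n) (?b n)" for n
 proof -
  have "B (us n) (vs n) = B (%x. 1 * u x + 1 * ?a n x) (vs n)" by simp
  also have "\<dots> = B u (vs n) + B (?a n) (vs n)" by (subst psdD(2)[OF p u a vn]) simp
  also have "B u (vs n) = B (%x. 1 * v x + 1 * ?b n x) u" using psdD(3)[OF p u vn] by simp
  also have "\<dots> = B v u + B (?b n) u" by (subst psdD(2)[OF p v b u]) simp
  also have "B (?a n) (vs n) = B (%x. 1 * v x + 1 * ?b n x) (?a n)" using psdD(3)[OF p a vn] by simp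
  also have "\<dots> = B v (?a n) + B (?b n) (?a n)" by (subst psdD(2)[OF p v b a]) simp
  finally show ?thesis
   using psdD(3)[OF p v u] psdD(3)[OF p b u] psdD(3)[OF p v a] psdD(3)[OF p b a] by simp
 qed
 have z: "null_seq (%n. B (f n) (g n))" if "\<And>n. f n \<in> H" "\<And>n. g n \<in> H"
  "null_seq (%n. B (f n) (f n) * B (g n) (g n))" for f g
 proof -
  have "null_seq (%n. (B (f n) (g n))\<^sup>2)"
   by (rule tendsto_sandwich[OF _ _ tendsto_const that(3)]) (auto intro!: always_eventually psd_CS[OF p] that)
  then have "(%n. sqrt ((B (f n) (g n))^2)) \<longlonglongrightarrow> sqrt 0" by (rule tendsto_real_sqrt)
  then show ?thesis by (simp add: tendsto_rabs_zero_iff)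
 qed
 have "(%n. B u v + B (?a n) v + B u (?b n) + B (?a n) (?b n)) \<longlonglongrightarrow> B u v + 0 + 0 + 0"
 proof (intro tendsto_add tendsto_const z)
  show "null_seq (%n. B (?a n) (?a n) * B v v)" by (rule tendsto_mult_left_zero[OF lu])
  show "null_seq (%n. B u u * B (?b n) (?b n))" by (rule tendsto_mult_right_zero[OF lv])
  show "null_seq (%n. B (?a n) (?a n) * B (?b n) (?b n))" using tendsto_mult[OF lu lv] by simp
 qed (use a b u v in auto)
 then show ?thesis unfolding eq by simp
qed

text \<open>Dyadic convex combinations of a tail of a sequence; iterated midpoints suffice for the Mazur argument.\<close>

inductive_set tail_mid :: "(nat => 'a => real) => nat => ('a => real) set" for us n where
 base: "n <= k ==> us k \<in> tail_mid us n"
| mid: "v \<in> tail_mid us n ==> w \<in> tail_mid us n ==> (%x. (v x + w x) / 2) \<in> tail_mid us n"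

lemma tail_mid_mono: "v \<in> tail_mid us m ==> n <= m ==> v \<in> tail_mid us n"
 by (induction rule: tail_mid.induct) (auto intro: tail_mid.intros)

lemma tail_mid_invariant:
 assumes "s \<in> tail_mid us n" "\<And>k. n <= k ==> P (us k)" "\<And>v w. P v ==> P w ==> P (%x. (v x + w x) / 2)"
 shows "P s" using assms(1) by (induction rule: tail_mid.induct) (auto intro: assms(2,3))

text \<open>Take near-minimizers of B over the midpoint hulls of the tails. The infima d n increase
  and stay below C, hence converge. The midpoint of s m and s n lies in the hull of the earlier
  tail, so the parallelogram identity forces s to be Cauchy.\<close>

lemma psd_mazur:
 assumes p: "psd H B" and un: "\<And>n. us n \<in> H" and C: "\<And>n. B (us n) (us n) <= C"
 shows "\<exists>s. (\<forall>n. s n \<in> tail_mid us n) \<and> (\<forall>n. s n \<in> H) \<and> (\<forall>n. B (s n) (s n) <= C) \<and> seq_Cauchy_for (%w. B w w) s"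
proof -
 have inv: "v \<in> H \<and> B v v <= C" if "v \<in> tail_mid us n" for v n
 proof (rule tail_mid_invariant[OF that])
  show "us k \<in> H \<and> B (us k) (us k) <= C" for k using un C by blast
  fix v w assume vw: "v \<in> H \<and> B v v <= C" "w \<in> H \<and> B w w <= C"
  have d: "0 <= B (%x. v x - w x) (%x. v x - w x)"
   using psd_diff[OF p, of v w] psdD(4)[OF p] vw by blast
  show "(%x. (v x + w x) / 2) \<in> H \<and> B (%x. (v x + w x) / 2) (%x. (v x + w x) / 2) <= C"
   using psd_mid[OF p, of v w] psd_parallelogram[OF p, of v w] vw d by simp
 qed
 define d where "d = (%n. INF v\<in>tail_mid us n. B v v)"
 have ne: "tail_mid us n \<noteq> {}" for n using tail_mid.base[of n n us] by auto
 have bb: "bdd_below ((%v. B v v) ` tail_mid us n)" for n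
  by (rule bdd_belowI2[where m = 0]) (use inv psdD(4)[OF p] in blast)
 have dle: "d n <= B v v" if "v \<in> tail_mid us n" for v n unfolding d_def by (rule cINF_lower[OF bb that])
 have dC: "d n <= C" for n using dle[OF tail_mid.base[of n n us]] C[of n] by simp
 have dmono: "d n <= d m" if "n <= m" for n m
  unfolding d_def using tail_mid_mono that by (intro cINF_superset_mono ne bb) auto
 have "\<exists>v\<in>tail_mid us n. B v v < d n + 1 / real (Suc n)" for n
 proof -
  have "d n < d n + 1 / real (Suc n)" by simp
  then show ?thesis unfolding d_def using cINF_less_iff[OF ne bb] by blast
 qed
 then obtain s where s: "\<And>n. s n \<in> tail_mid us n" "\<And>n. B (s n) (s n) < d n + 1 / real (Suc n)" by metis
 have "incseq d" by (rule monoI) (rule dmono)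
 then obtain L where "d \<longlonglongrightarrow> L" using incseq_convergent[of d C] dC by blast
 then have cd: "Cauchy d" by (rule LIMSEQ_imp_Cauchy)
 have "seq_Cauchy_for (%w. B w w) s" unfolding seq_Cauchy_for_def
 proof (intro allI impI)
  fix \<epsilon> :: real assume e: "\<epsilon> > 0"
  \<comment> \<open>The final estimate is 2 (d m - d n) plus \<epsilon>/4 from each of the two
    near-minimizers.\<close>
  obtain N1 where N1: "\<And>m n. m \<ge> N1 ==> n \<ge> N1 ==> \<bar>d m - d n\<bar> < \<epsilon> / 4"
   using CauchyD[OF cd, of "\<epsilon>/4"] e by auto
  obtain N2 where "inverse (real (Suc N2)) < \<epsilon> / 8" using reals_Archimedean[of "\<epsilon>/8"] e by auto
  then have N2: "1 / real (Suc N2) < \<epsilon> / 8" by (simp only: inverse_eq_divide)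
  have main: "B (%x. s m x - s n x) (%x. s m x - s n x) < \<epsilon>" if "n \<ge> max N1 N2" "m \<ge> n" for m n
  proof -
   have sm: "s m \<in> tail_mid us n" using tail_mid_mono[OF s(1) that(2)] .
   have H: "s m \<in> H" "s n \<in> H" using inv s(1) by blast+
   have "d n <= B (%x. (s m x + s n x) / 2) (%x. (s m x + s n x) / 2)"
    by (rule dle[OF tail_mid.mid[OF sm s(1)]])
   also have "\<dots> = B (s m) (s m) / 2 + B (s n) (s n) / 2 - B (%x. s m x - s n x) (%x. s m x - s n x) / 4"
    by (rule psd_parallelogram[OF p H])
   finally have 1: "B (%x. s m x - s n x) (%x. s m x - s n x) <= 2 * B (s m) (s m) + 2 * B (s n) (s n) - 4 * d n" by simp
   have in1: "1 / real (Suc k) < \<epsilon> / 8" if "k \<ge> N2" for k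
   proof -
    have "1 / real (Suc k) <= 1 / real (Suc N2)" using that by (simp add: frac_le)
    then show ?thesis using N2 by (rule le_less_trans)
   qed
   have "d m - d n < \<epsilon> / 4" using N1[of m n] that abs_ge_self[of "d m - d n"] by linarith
   moreover have "B (s m) (s m) < d m + \<epsilon> / 8" using s(2)[of m] in1[of m] that by simp
   moreover have "B (s n) (s n) < d n + \<epsilon> / 8" using s(2)[of n] in1[of n] that by simp
   ultimately show ?thesis using 1 by linarith
  qed
  show "\<exists>N. \<forall>m\<ge>N. \<forall>n\<ge>N. B (%x. s m x - s n x) (%x. s m x - s n x) < \<epsilon>"
  proof (intro exI allI impI)
   fix m n assume mn: "max N1 N2 <= m" "max N1 N2 <= n"
   have H: "s m \<in> H" "s n \<in> H" using inv s(1) by blast+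
   show "B (%x. s m x - s n x) (%x. s m x - s n x) < \<epsilon>"
   proof (cases "n <= m")
    case True then show ?thesis using main mn by blast
   next
    case False
    then have "B (%x. s n x - s m x) (%x. s n x - s m x) < \<epsilon>" using main[of m n] mn by simp
    then show ?thesis using psd_diff_commute[OF p H] by simp
   qed
  qed
 qed
 then show ?thesis using s(1) inv by blast
qed

section \<open>Completeness of square-integrable functions\<close>

lemma norm_diff_sq_le: "(norm (a - b :: 'b::real_normed_vector))^2 <= 2 * (norm a)^2 + 2 * (norm b)^2"
proof -
 have "(norm (a - b))^2 <= (norm a + norm b)^2" by (intro power_mono norm_triangle_ineq4) simp
 also have "\<dots> <= 2 * (norm a)^2 + 2 * (norm b)^2"
  using sum_squares_bound[of "norm a" "norm b"] by (simp add: power2_sum)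
 finally show ?thesis .
qed

lemma integrable_norm_diff_sq:
 fixes f g :: "'a => 'b::{banach,second_countable_topology}"
 assumes [measurable]: "f \<in> borel_measurable M" "g \<in> borel_measurable M"
  and "integrable M (%x. (norm (f x))^2)" "integrable M (%x. (norm (g x))^2)"
 shows "integrable M (%x. (norm (f x - g x))^2)"
proof (rule Bochner_Integration.integrable_bound)
 show "integrable M (%x. 2 * (norm (f x))^2 + 2 * (norm (g x))^2)" using assms by simp
 show "AE x in M. norm ((norm (f x - g x))^2) <= norm (2 * (norm (f x))^2 + 2 * (norm (g x))^2)"
  using norm_diff_sq_le by (intro AE_I2) auto
qed measurable

text \<open>Riesz-Fischer theorem for Banach space values: a fast subsequence converges almost
  everywhere, and Fatou's lemma turns this into convergence in mean square.\<close>

lemma L2_complete: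
 fixes f :: "nat => 'a => 'b::{banach,second_countable_topology}"
 assumes m [measurable]: "\<And>n. f n \<in> borel_measurable M" and i: "\<And>n. integrable M (%x. (norm (f n x))^2)"
  and cau: "\<And>\<epsilon>. \<epsilon> > 0 ==> \<exists>N. \<forall>m\<ge>N. \<forall>n\<ge>N. (LINT x|M. (norm (f m x - f n x))\<^sup>2) < \<epsilon>"
 shows "\<exists>g. g \<in> borel_measurable M \<and> integrable M (%x. (norm (g x))^2) \<and>
  (%n. LINT x|M. (norm (f n x - g x))\<^sup>2) \<longlonglongrightarrow> 0"
proof -
 \<comment> \<open>Rate 8^-k: weighted with 2^k the squared increments still sum to a geometric
   series of ratio 1/4, so almost everywhere the increments are bounded by a multiple of
   2^(-k/2).\<close>
 define a where "a = (%k. (1/8::real) ^ k)"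
 have idiff: "integrable M (%x. (norm (f m x - f n x))^2)" for m n
  by (rule integrable_norm_diff_sq[OF m m i i])
 have ex: "\<exists>N. \<forall>m\<ge>N. \<forall>n\<ge>N. (LINT x|M. (norm (f m x - f n x))\<^sup>2) < a k" for k
  by (rule cau) (simp add: a_def)
 have "\<exists>N. \<forall>k. \<forall>m\<ge>N k. \<forall>n\<ge>N k. (LINT x|M. (norm (f m x - f n x))\<^sup>2) < a k"
  by (rule choice, rule allI, rule ex)
 then obtain N where N: "\<And>k m n. m \<ge> N k ==> n \<ge> N k ==> (LINT x|M. (norm (f m x - f n x))\<^sup>2) < a k"
  by blast
 \<comment> \<open>Partial sums give an increasing index sequence with \<open>r k\<close> at least
   \<open>N k\<close>.\<close>
 define r where "r = (%k. \<Sum>j\<le>k. N j)"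
 have rN: "N k <= r k" for k unfolding r_def by (rule member_le_sum) auto
 have rm: "r k <= r (Suc k)" for k by (simp add: r_def)
 define d where "d = (%k x. f (r (Suc k)) x - f (r k) x)"
 have dm [measurable]: "d k \<in> borel_measurable M" for k unfolding d_def by measurable
 have dI: "(LINT x|M. (norm (d k x))\<^sup>2) < a k" for k
  unfolding d_def by (rule N) (use rN[of k] rm[of k] in linarith)+
 have di: "integrable M (%x. (norm (d k x))^2)" for k unfolding d_def by (rule idiff)
 have "(\<integral>\<^sup>+x. (\<Sum>k. ennreal (2 ^ k * (norm (d k x))^2)) \<partial>M) = (\<Sum>k. \<integral>\<^sup>+x. ennreal (2 ^ k * (norm (d k x))^2) \<partial>M)"
  by (rule nn_integral_suminf) measurable
 also have "\<dots> <= (\<Sum>k. ennreal ((1/4) ^ k))"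
 proof (rule suminf_le)
  fix k
  have "(\<integral>\<^sup>+x. ennreal (2 ^ k * (norm (d k x))^2) \<partial>M) = ennreal (LINT x|M. 2 ^ k * (norm (d k x))^2)"
   using di by (intro nn_integral_eq_integral) auto
  also have "\<dots> = ennreal (2 ^ k * (LINT x|M. (norm (d k x))\<^sup>2))" by simp
  also have "\<dots> <= ennreal (2 ^ k * a k)" using dI[of k] by (intro ennreal_leI mult_left_mono) auto
  also have "2 ^ k * a k = (1/4) ^ k" by (simp add: a_def power_mult_distrib[symmetric])
  finally show "(\<integral>\<^sup>+x. ennreal (2 ^ k * (norm (d k x))^2) \<partial>M) <= ennreal ((1/4) ^ k)" .
 qed auto
 also have "\<dots> = ennreal (\<Sum>k. (1/4) ^ k)" by (rule suminf_ennreal2) auto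
 also have "\<dots> < \<infinity>" by simp
 finally have "(\<integral>\<^sup>+x. (\<Sum>k. ennreal (2 ^ k * (norm (d k x))^2)) \<partial>M) \<noteq> \<infinity>" by simp
 then have "AE x in M. (\<Sum>k. ennreal (2 ^ k * (norm (d k x))^2)) \<noteq> \<infinity>"
  by (rule nn_integral_noteq_infinite[rotated]) measurable
 then have ae: "AE x in M. convergent (%k. f (r k) x)"
 proof eventually_elim
  fix x assume fin: "(\<Sum>k. ennreal (2 ^ k * (norm (d k x))^2)) \<noteq> \<infinity>"
  define c where "c = enn2real (\<Sum>k. ennreal (2 ^ k * (norm (d k x))^2))"
  have c: "2 ^ k * (norm (d k x))^2 <= c" for k
  proof -
   have "ennreal (2 ^ k * (norm (d k x))^2) <= (\<Sum>k. ennreal (2 ^ k * (norm (d k x))^2))"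
    by (rule order_trans[OF _ sum_le_suminf[OF summableI, of "{k}"]]) auto
   also have "\<dots> = ennreal c"
    unfolding c_def by (rule ennreal_enn2real[symmetric]) (use fin in \<open>simp add: less_top\<close>)
   finally show ?thesis by (rule iffD1[OF ennreal_le_iff, rotated]) (simp add: c_def)
  qed
  have nd: "norm (d k x) <= sqrt c * (1 / sqrt 2) ^ k" for k
  proof -
   have "(norm (d k x))^2 <= c / 2 ^ k" using c[of k] by (simp add: field_simps)
   then have "norm (d k x) <= sqrt (c / 2 ^ k)" by (rule real_le_rsqrt)
   also have "\<dots> = sqrt c * (1 / sqrt 2) ^ k" by (simp add: real_sqrt_divide real_sqrt_power power_divide)
   finally show ?thesis .
  qed
  have "summable (%k. sqrt c * (1 / sqrt 2) ^ k)" by (intro summable_mult summable_geometric) simp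
  then have "summable (%k. norm (d k x))" by (rule summable_comparison_test[rotated]) (use nd in auto)
  then have "summable (%k. d k x)" by (rule summable_norm_cancel)
  then have "convergent (%n. \<Sum>k<n. d k x)" by (simp add: summable_iff_convergent)
  moreover have "(\<Sum>k<n. d k x) = f (r n) x - f (r 0) x" for n
   unfolding d_def by (rule sum_lessThan_telescope)
  ultimately have "convergent (%n. f (r n) x - f (r 0) x)" by simp
  then show "convergent (%k. f (r k) x)" using convergent_diff_const_right_iff by blast
 qed
 define g where "g = (%x. lim (%k. f (r k) x))"
 have gm [measurable]: "g \<in> borel_measurable M" unfolding g_def by measurable
 have lim: "AE x in M. (%k. f (r k) x) \<longlonglongrightarrow> g x"
  using ae by eventually_elim (simp add: g_def convergent_LIMSEQ_iff)
 have fatou: "(\<integral>\<^sup>+x. ennreal ((norm (f n x - g x))^2) \<partial>M) <= ennreal (a K)" if "n \<ge> N K" for n K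
 proof -
  have "(\<integral>\<^sup>+x. ennreal ((norm (f n x - g x))^2) \<partial>M) <= (\<integral>\<^sup>+x. liminf (%k. ennreal ((norm (f n x - f (r k) x))^2)) \<partial>M)"
  proof (rule nn_integral_mono_AE)
   show "AE x in M. ennreal ((norm (f n x - g x))^2) <= liminf (%k. ennreal ((norm (f n x - f (r k) x))^2))"
    using lim
   proof eventually_elim
    fix x assume "(%k. f (r k) x) \<longlonglongrightarrow> g x"
    then have l: "(%k. ennreal ((norm (f n x - f (r k) x))^2)) \<longlonglongrightarrow> ennreal ((norm (f n x - g x))^2)"
     by (intro tendsto_ennrealI tendsto_intros)
    show "ennreal ((norm (f n x - g x))^2) <= liminf (%k. ennreal ((norm (f n x - f (r k) x))^2))"
     using lim_imp_Liminf[OF trivial_limit_sequentially l] by simp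
   qed
  qed
  also have "\<dots> <= liminf (%k. \<integral>\<^sup>+x. ennreal ((norm (f n x - f (r k) x))^2) \<partial>M)"
   by (rule nn_integral_liminf) measurable
  also have "\<dots> <= ennreal (a K)"
  proof (rule Liminf_le)
   show "\<forall>\<^sub>F k in sequentially. (\<integral>\<^sup>+x. ennreal ((norm (f n x - f (r k) x))^2) \<partial>M) <= ennreal (a K)"
    unfolding eventually_sequentially
   proof (intro exI allI impI)
    fix k assume "K <= k"
    then have "r K <= r k" unfolding r_def by (intro sum_mono2) auto
    then have "r k \<ge> N K" using rN[of K] by linarith
    have "(\<integral>\<^sup>+x. ennreal ((norm (f n x - f (r k) x))^2) \<partial>M) = ennreal (LINT x|M. (norm (f n x - f (r k) x))\<^sup>2)"
     by (rule nn_integral_eq_integral[OF idiff]) auto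
    also have "\<dots> <= ennreal (a K)" using N[OF that \<open>r k \<ge> N K\<close>] by (intro ennreal_leI) simp
    finally show "(\<integral>\<^sup>+x. ennreal ((norm (f n x - f (r k) x))^2) \<partial>M) <= ennreal (a K)" .
   qed
  qed simp
  finally show ?thesis .
 qed
 have ifg: "integrable M (%x. (norm (f n x - g x))^2)" if "n \<ge> N 0" for n
  using fatou[OF that] by (intro integrableI_bounded) (auto simp: le_less_trans[OF _ ennreal_less_top])
 have ig: "integrable M (%x. (norm (g x))^2)"
 proof (rule Bochner_Integration.integrable_bound)
  show "integrable M (%x. 2 * (norm (f (N 0) x))^2 + 2 * (norm (f (N 0) x - g x))^2)" using i ifg by simp
  show "AE x in M. norm ((norm (g x))^2) <= norm (2 * (norm (f (N 0) x))^2 + 2 * (norm (f (N 0) x - g x))^2)"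
   using norm_diff_sq_le[of "f (N 0) x" "f (N 0) x - g x" for x] by (intro AE_I2) simp
 qed measurable
 have val: "(LINT x|M. (norm (f n x - g x))\<^sup>2) <= a K" if "n \<ge> N K" for n K
 proof -
  have i': "integrable M (%x. (norm (f n x - g x))^2)" by (rule integrable_norm_diff_sq[OF m gm i ig])
  have "ennreal (LINT x|M. (norm (f n x - g x))\<^sup>2) <= ennreal (a K)"
   using fatou[OF that] nn_integral_eq_integral[OF i'] by simp
  then show ?thesis by (subst (asm) ennreal_le_iff) (auto simp: a_def)
 qed
 have "null_seq (%n. LINT x|M. (norm (f n x - g x))\<^sup>2)"
 proof (rule LIMSEQ_I)
  fix \<epsilon> :: real assume "\<epsilon> > 0"
  then obtain K where "a K < \<epsilon>" unfolding a_def using real_arch_pow_inv[of \<epsilon> "1/8"] by auto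
  then show "\<exists>n0. \<forall>n\<ge>n0. norm ((LINT x|M. (norm (f n x - g x))\<^sup>2) - 0) < \<epsilon>"
   using val[of K] by (intro exI[of _ "N K"]) (auto simp: abs_of_nonneg integral_nonneg_AE intro: le_less_trans)
 qed
 then show ?thesis using gm ig by blast
qed

section \<open>Homogeneous and inhomogeneous Sobolev spaces\<close>

text \<open>Square integrability of u is left out: this is what conformal maps preserve, and where
  limits of energy-Cauchy sequences are found.\<close>

definition Hd :: "complex set => (complex => real) set" where
 "Hd U = {u. \<exists>g. is_weak_gradient U u g \<and> sint U (%x. (norm (g x))^2)}"

definition L1_loc_lim :: "complex set => (nat => complex => real) => (complex => real) => bool" where
 "L1_loc_lim U us u \<longleftrightarrow> locally_integrable U u \<and>
   (\<forall>K\<subseteq>U. compact K --> null_seq (%n. LBINT x:K. norm (us n x - u x)))"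

lemma locally_integrable_measurable_open:
 fixes g :: "'a::euclidean_space => 'b::euclidean_space"
 assumes U: "open U" and g: "locally_integrable U g"
 shows "bm (%x. indicator U x *\<^sub>R g x)"
proof -
 obtain C where C: "\<And>n. compact (C n)" "\<And>n. C n \<subseteq> U" "\<And>n. C n \<subseteq> interior (C (Suc n))" "\<Union>(range C) = U"
  using open_Union_compact_subsets[OF U] by metis
 have mono: "C n \<subseteq> C m" if "n <= m" for n m
  using that by (rule lift_Suc_mono_le[rotated]) (meson C(3) interior_subset order_trans)
 show ?thesis
 proof (rule borel_measurable_LIMSEQ_metric)
  show "bm (%x. indicator (C n) x *\<^sub>R g x)" for n by (rule locally_integrable_measurable[OF g C(1,2)])
  fix x
  show "(%n. indicator (C n) x *\<^sub>R g x) \<longlonglongrightarrow> indicator U x *\<^sub>R g x"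
  proof (cases "x \<in> U")
   case True
   then obtain n where "x \<in> C n" using C(4) by blast
   then have "\<forall>\<^sub>F m in sequentially. indicator (C m) x *\<^sub>R g x = indicator U x *\<^sub>R g x"
    using mono True by (auto simp: eventually_sequentially indicator_def intro!: exI[of _ n])
   then show ?thesis by (rule tendsto_eventually)
  next
   case False
   then have "x \<notin> C n" for n using C(2) by blast
   then show ?thesis using False by simp
  qed
 qed
qed

lemma norm_sq_indicator: "(norm (indicator U x *\<^sub>R y))^2 = indicator U x *\<^sub>R (norm y)\<^sup>2"
 by (simp add: indicator_def)

lemma set_integrable_inner:
 fixes g h :: "complex => complex"
 assumes U: "open U" and g: "locally_integrable U g" "sint U (%x. (norm (g x))^2)"
  and h: "locally_integrable U h" "sint U (%x. (norm (h x))^2)"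
 shows "sint U (%x. g x \<bullet> h x)"
proof (rule set_integrable_dominated)
 show "sint U (%x. (norm (g x))^2 + (norm (h x))^2)" by (rule set_integral_add(1)[OF g(2) h(2)])
 have "bm (%x. (indicator U x *\<^sub>R g x) \<bullet> (indicator U x *\<^sub>R h x))"
  by (intro borel_measurable_inner locally_integrable_measurable_open[OF U] g h)
 moreover have "(%x. (indicator U x *\<^sub>R g x) \<bullet> (indicator U x *\<^sub>R h x)) = (%x. indicator U x *\<^sub>R (g x \<bullet> h x))"
  by (auto simp: indicator_def fun_eq_iff)
 ultimately show "(%x. indicator U x *\<^sub>R (g x \<bullet> h x)) \<in> borel_measurable lborel" by simp
 show "norm (g x \<bullet> h x) <= (norm (g x))^2 + (norm (h x))^2" for x
 proof -
  have "norm (g x \<bullet> h x) <= norm (g x) * norm (h x)" by (simp add: Cauchy_Schwarz_ineq2)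
  also have "\<dots> <= (norm (g x))^2 + (norm (h x))^2"
  proof -
   have "0 <= norm (g x) * norm (h x)" by simp
   then show ?thesis using sum_squares_bound[of "norm (g x)" "norm (h x)"] unfolding mult.assoc by linarith
  qed
  finally show ?thesis .
 qed
qed

text \<open>The choice in \<open>weak_gradient\<close> only promises some weak gradient; its square
  integrability is inherited from the witness by uniqueness.\<close>

lemma weak_gradient_Hd:
 assumes U: "open U" and u: "u \<in> Hd U"
 shows "is_weak_gradient U u (weak_gradient U u)" "locally_integrable U (weak_gradient U u)" "locally_integrable U u"
  "sint U (%x. (norm (weak_gradient U u x))^2)"
proof -
 obtain g where g: "is_weak_gradient U u g" "sint U (%x. (norm (g x))^2)" using u by (auto simp: Hd_def)
 show w: "is_weak_gradient U u (weak_gradient U u)" unfolding weak_gradient_def by (rule someI[of _ g]) (rule g(1))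
 show lw: "locally_integrable U (weak_gradient U u)" and "locally_integrable U u" using w by (auto simp: is_weak_gradient_def)
 have lg: "locally_integrable U g" using g by (auto simp: is_weak_gradient_def)
 have [measurable]: "bm (%x. indicator U x *\<^sub>R weak_gradient U u x)" "bm (%x. indicator U x *\<^sub>R g x)"
  using locally_integrable_measurable_open[OF U] lw lg by auto
 have "integrable lborel (%x. (norm (indicator U x *\<^sub>R weak_gradient U u x))^2) \<longleftrightarrow> integrable lborel (%x. (norm (indicator U x *\<^sub>R g x))^2)"
 proof (rule integrable_cong_AE)
  show "AE x in lborel. (norm (indicator U x *\<^sub>R weak_gradient U u x))\<^sup>2 = (norm (indicator U x *\<^sub>R g x))^2"
   using weak_gradient_unique[OF U w g(1)] by eventually_elim (auto simp: indicator_def)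
 qed (measurable)
 then show "sint U (%x. (norm (weak_gradient U u x))^2)"
  using g(2) unfolding set_integrable_def norm_sq_indicator by blast
qed

lemma dirichlet_integral_eq:
 assumes U: "open U" and g: "is_weak_gradient U u g" and h: "is_weak_gradient U v h"
 shows "dirichlet_integral U u v = (LBINT x:U. g x \<bullet> h x)"
proof -
 have w: "is_weak_gradient U u (weak_gradient U u)" "is_weak_gradient U v (weak_gradient U v)"
  unfolding weak_gradient_def by (rule someI[of _ g], rule g) (rule someI[of _ h], rule h)
 have [measurable]: "bm (%x. indicator U x *\<^sub>R weak_gradient U u x)" "bm (%x. indicator U x *\<^sub>R g x)"
  "bm (%x. indicator U x *\<^sub>R weak_gradient U v x)" "bm (%x. indicator U x *\<^sub>R h x)"
  using locally_integrable_measurable_open[OF U] w g h by (auto simp: is_weak_gradient_def)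
 have eq: "indicator U x *\<^sub>R (a x \<bullet> b x) = (indicator U x *\<^sub>R a x) \<bullet> (indicator U x *\<^sub>R b x)" for a b :: "complex => complex" and x
  by (auto simp: indicator_def)
 show ?thesis unfolding dirichlet_integral_def set_lebesgue_integral_def eq
 proof (rule integral_cong_AE)
  show "AE x in lborel. (indicator U x *\<^sub>R weak_gradient U u x) \<bullet> (indicator U x *\<^sub>R weak_gradient U v x) = (indicator U x *\<^sub>R g x) \<bullet> (indicator U x *\<^sub>R h x)"
   using weak_gradient_unique[OF U w(1) g] weak_gradient_unique[OF U w(2) h] by eventually_elim (auto simp: indicator_def)
 qed measurable
qed

lemma dirichlet_integral_self:
 assumes U: "open U" and g: "is_weak_gradient U u g"
 shows "energy U u = (LBINT x:U. (norm (g x))\<^sup>2)"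
 using dirichlet_integral_eq[OF U g g] by (simp add: power2_norm_eq_inner)

lemma HdI:
 assumes "is_weak_gradient U u g" "sint U (%x. (norm (g x))^2)"
 shows "u \<in> Hd U" using assms by (auto simp: Hd_def)

lemma Hd_lincomb:
 assumes U: "open U" and u: "u \<in> Hd U" and v: "v \<in> Hd U"
 shows "(%x. a * u x + b * v x) \<in> Hd U"
proof (rule HdI[OF is_weak_gradient_lincomb[OF weak_gradient_Hd(1)[OF U u] weak_gradient_Hd(1)[OF U v]]])
 let ?g = "weak_gradient U u" and ?h = "weak_gradient U v"
 note g = weak_gradient_Hd[OF U u] and h = weak_gradient_Hd[OF U v]
 show "sint U (%x. (norm (a *\<^sub>R ?g x + b *\<^sub>R ?h x))^2)"
 proof (rule set_integrable_dominated)
  show "sint U (%x. 2 * a\<^sup>2 * (norm (?g x))^2 + 2 * b\<^sup>2 * (norm (?h x))^2)"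
   by (intro set_integral_add(1) set_integrable_mult_right g(4) h(4))
  have [measurable]: "bm (%x. indicator U x *\<^sub>R (a *\<^sub>R ?g x + b *\<^sub>R ?h x))"
   by (rule locally_integrable_measurable_open[OF U locally_integrable_lincomb[OF g(2) h(2)]])
  have "bm (%x. (norm (indicator U x *\<^sub>R (a *\<^sub>R ?g x + b *\<^sub>R ?h x)))^2)" by measurable
  then show "(%x. indicator U x *\<^sub>R (norm (a *\<^sub>R ?g x + b *\<^sub>R ?h x))\<^sup>2) \<in> borel_measurable lborel"
   by (simp only: norm_sq_indicator measurable_lborel2)
  show "norm ((norm (a *\<^sub>R ?g x + b *\<^sub>R ?h x))^2) <= 2 * a\<^sup>2 * (norm (?g x))^2 + 2 * b\<^sup>2 * (norm (?h x))^2" for x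
   using norm_diff_sq_le[of "a *\<^sub>R ?g x" "- (b *\<^sub>R ?h x)"] by (simp add: power_mult_distrib)
 qed
qed

lemma psd_Hd:
 assumes U: "open U" shows "psd (Hd U) (dirichlet_integral U)" unfolding psd_def
proof (intro conjI ballI allI)
 fix u v assume u: "u \<in> Hd U" and v: "v \<in> Hd U"
 note g = weak_gradient_Hd[OF U u] and h = weak_gradient_Hd[OF U v]
 show "(%x. a * u x + b * v x) \<in> Hd U" for a b by (rule Hd_lincomb[OF U u v])
 show "dirichlet_integral U u v = dirichlet_integral U v u"
  by (simp add: dirichlet_integral_def inner_commute)
 show "dirichlet_integral U (%x. a * u x + b * v x) w = a * dirichlet_integral U u w + b * dirichlet_integral U v w"
  if w: "w \<in> Hd U" for a b w
 proof -
  note k = weak_gradient_Hd[OF U w]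
  have "dirichlet_integral U (%x. a * u x + b * v x) w =
    (LBINT x:U. (a *\<^sub>R weak_gradient U u x + b *\<^sub>R weak_gradient U v x) \<bullet> weak_gradient U w x)"
   by (rule dirichlet_integral_eq[OF U is_weak_gradient_lincomb[OF g(1) h(1)] k(1)])
  also have "\<dots> = (LBINT x:U. a * (weak_gradient U u x \<bullet> weak_gradient U w x) + b * (weak_gradient U v x \<bullet> weak_gradient U w x))"
   by (simp add: inner_add_left)
  also have "\<dots> = (LBINT x:U. a * (weak_gradient U u x \<bullet> weak_gradient U w x)) + (LBINT x:U. b * (weak_gradient U v x \<bullet> weak_gradient U w x))"
   by (intro set_integral_add(2) set_integrable_mult_right set_integrable_inner[OF U g(2,4) k(2,4)] set_integrable_inner[OF U h(2,4) k(2,4)])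
  finally show ?thesis by (simp add: dirichlet_integral_def)
 qed
 show "0 <= energy U u"
  unfolding dirichlet_integral_def set_lebesgue_integral_def by (intro integral_nonneg_AE AE_I2) auto
qed

lemma Hd_trunc:
 assumes U: "open U" and u: "u \<in> Hd U"
 shows "(%x. min (max 0 (u x)) 1) \<in> Hd U"
  "energy U (%x. min (max 0 (u x)) 1) <= energy U u"
proof -
 let ?g = "weak_gradient U u"
 note g = weak_gradient_Hd[OF U u]
 have w: "is_weak_gradient U (%x. min (max 0 (u x)) 1) (%x. indicator {0<..<1} (u x) *\<^sub>R ?g x)"
  by (rule weak_gradient_trunc[OF U g(1)])
 then have lw: "locally_integrable U (%x. indicator {0<..<1} (u x) *\<^sub>R ?g x)" by (auto simp: is_weak_gradient_def)
 have le: "(norm (indicator {0<..<1} (u x) *\<^sub>R ?g x))^2 <= (norm (?g x))^2" for x by (auto simp: indicator_def)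
 have i: "sint U (%x. (norm (indicator {0<..<1} (u x) *\<^sub>R ?g x))^2)"
 proof (rule set_integrable_dominated[OF g(4)])
  have [measurable]: "bm (%x. indicator U x *\<^sub>R (indicator {0<..<1} (u x) *\<^sub>R ?g x))"
   by (rule locally_integrable_measurable_open[OF U lw])
  have "bm (%x. (norm (indicator U x *\<^sub>R (indicator {0<..<1} (u x) *\<^sub>R ?g x)))^2)" by measurable
  then show "(%x. indicator U x *\<^sub>R (norm (indicator {0<..<1} (u x) *\<^sub>R ?g x))\<^sup>2) \<in> borel_measurable lborel"
   by (simp only: norm_sq_indicator measurable_lborel2)
  show "norm ((norm (indicator {0<..<1} (u x) *\<^sub>R ?g x))^2) <= (norm (?g x))^2" for x using le[of x] by simp
 qed
 show "(%x. min (max 0 (u x)) 1) \<in> Hd U" by (rule HdI[OF w i])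
 show "energy U (%x. min (max 0 (u x)) 1) <= energy U u"
  unfolding dirichlet_integral_self[OF U w] dirichlet_integral_self[OF U g(1)]
  by (rule set_integral_mono[OF i g(4) le])
qed

lemma conformal_inner: "(cnj c * a) \<bullet> (cnj c * b) = (norm c)^2 * (a \<bullet> b)"
 by (simp add: inner_complex_def cmod_power2) (simp add: algebra_simps power2_eq_square)

text \<open>The factor |f'|^2 produced by the two gradients is exactly the Jacobian of the change of
  variables; this coincidence is special to dimension two.\<close>

lemma Hd_conformal:
 assumes U: "open U" and hol: "f holomorphic_on U" and inj: "inj_on f U" and u: "u \<in> Hd (f ` U)"
 shows "(%z. u (f z)) \<in> Hd U"
  "v \<in> Hd (f ` U) ==> dirichlet_integral U (%z. u (f z)) (%z. v (f z)) = dirichlet_integral (f ` U) u v"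
proof -
 have oV: "open (f ` U)" by (rule open_mapping_thm3[OF hol U inj])
 note g = weak_gradient_Hd[OF oV u]
 have wu: "is_weak_gradient U (%z. u (f z)) (%z. cnj (deriv f z) * weak_gradient (f ` U) u (f z))"
  by (rule weak_gradient_conformal[OF U hol inj g(1)])
 have "sint U (%z. (norm (deriv f z))\<^sup>2 * (norm (weak_gradient (f ` U) u (f z)))^2)"
  by (rule holomorphic_change_of_variables(1)[OF U hol inj g(4)])
 then have "sint U (%z. (norm (cnj (deriv f z) * weak_gradient (f ` U) u (f z)))\<^sup>2)"
  by (simp add: norm_mult power_mult_distrib)
 from HdI[OF wu this] show "(%z. u (f z)) \<in> Hd U" .
 assume v: "v \<in> Hd (f ` U)"
 note h = weak_gradient_Hd[OF oV v]
 have wv: "is_weak_gradient U (%z. v (f z)) (%z. cnj (deriv f z) * weak_gradient (f ` U) v (f z))"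
  by (rule weak_gradient_conformal[OF U hol inj h(1)])
 show "dirichlet_integral U (%z. u (f z)) (%z. v (f z)) = dirichlet_integral (f ` U) u v"
  unfolding dirichlet_integral_eq[OF U wu wv] dirichlet_integral_eq[OF oV g(1) h(1)] conformal_inner
  by (rule holomorphic_change_of_variables(2)[OF U hol inj set_integrable_inner[OF oV g(2,4) h(2,4)]])
qed

text \<open>Integrate |d| <= t + |d|^2 / t. With t free this stands in for the Cauchy-Schwarz
  inequality.\<close>

lemma set_integral_norm_le_sq:
 fixes d :: "'a::euclidean_space => 'b::euclidean_space"
 assumes K: "compact K" and d: "sint K d" "sint K (%x. (norm (d x))^2)" and "t > 0"
 shows "(LBINT x:K. norm (d x)) <= t * measure lborel K + (LBINT x:K. (norm (d x))\<^sup>2) / t"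
proof -
 have c: "sint K (%_. t)" unfolding set_integrable_def by (rule borel_integrable_compact[OF K]) simp
 have "(LBINT x:K. norm (d x)) <= (LBINT x:K. t + (norm (d x))^2 / t)"
 proof (rule set_integral_mono[OF set_integrable_norm[OF d(1)]])
  show "sint K (%x. t + (norm (d x))^2 / t)"
   by (intro set_integral_add(1) c set_integrable_divide d(2))
  show "norm (d x) <= t + (norm (d x))^2 / t" for x
  proof (cases "norm (d x) <= t")
   case True then show ?thesis using \<open>t > 0\<close> by (simp add: add_increasing2)
  next
   case False
   then have "norm (d x) * t <= (norm (d x))^2" by (simp add: power2_eq_square mult_left_mono)
   then have "norm (d x) <= (norm (d x))^2 / t" using \<open>t > 0\<close> by (simp add: le_divide_eq)
   then show ?thesis using \<open>t > 0\<close> by simp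
  qed
 qed
 also have "\<dots> = (LBINT x:K. t) + (LBINT x:K. (norm (d x))\<^sup>2 / t)"
  by (intro set_integral_add(2) c set_integrable_divide d(2))
 also have "(LBINT x:K. t) = t * measure lborel K"
  using K by (simp add: set_lebesgue_integral_def borel_compact measure_def mult.commute)
 finally show ?thesis by (simp add: set_integral_divide_zero)
qed

lemma L1_tendsto_of_L2:
 fixes d :: "nat => 'a::euclidean_space => 'b::euclidean_space"
 assumes K: "compact K" and d: "\<And>n. sint K (d n)" "\<And>n. sint K (%x. (norm (d n x))^2)"
  and l: "null_seq (%n. LBINT x:K. (norm (d n x))\<^sup>2)"
 shows "null_seq (%n. LBINT x:K. norm (d n x))"
proof (rule LIMSEQ_I)
 fix \<epsilon> :: real assume e: "\<epsilon> > 0"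
 define c where "c = measure lborel K + 1"
 have c: "c > 0" unfolding c_def by (rule add_nonneg_pos) auto
 define t where "t = \<epsilon> / (2 * c)"
 have t: "t > 0" using e c by (simp add: t_def)
 have tm: "t * measure lborel K < \<epsilon> / 2"
 proof -
  have "t * measure lborel K < t * c" using t by (simp add: c_def)
  also have "\<dots> = \<epsilon> / 2" using c by (simp add: t_def)
  finally show ?thesis .
 qed
 have nn: "0 <= (LBINT x:K. norm (d n x))" for n
  unfolding set_lebesgue_integral_def by (intro integral_nonneg_AE AE_I2) auto
 obtain N where N: "\<And>n. n \<ge> N ==> (LBINT x:K. (norm (d n x))\<^sup>2) < t * \<epsilon> / 2"
  using order_tendstoD(2)[OF l, of "t * \<epsilon> / 2"] e t by (auto simp: eventually_sequentially)
 have "(LBINT x:K. norm (d n x)) < \<epsilon>" if "n \<ge> N" for n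
 proof -
  have "(LBINT x:K. (norm (d n x))\<^sup>2) / t < \<epsilon> / 2" using N[OF that] t by (simp add: divide_less_eq mult.commute)
  then show ?thesis using set_integral_norm_le_sq[OF K d(1) d(2) t, of n] tm by linarith
 qed
 then show "\<exists>N. \<forall>n\<ge>N. norm ((LBINT x:K. norm (d n x)) - 0) < \<epsilon>" using nn by auto
qed

lemma square_integrable_locally_integrable:
 fixes G :: "'a::euclidean_space => 'b::euclidean_space"
 assumes m: "bm (%x. indicator U x *\<^sub>R G x)" and i: "sint U (%x. (norm (G x))^2)"
 shows "locally_integrable U G" unfolding locally_integrable_def
proof (intro allI impI)
 fix K assume K: "K \<subseteq> U" "compact K"
 have Kb: "K \<in> sets borel" using compact_imp_closed[OF K(2)] by (rule borel_closed)
 have iK: "sint K (%x. (norm (G x))^2)" by (rule set_integrable_subset[OF i]) (use Kb K in auto)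
 have c: "sint K (%_. 1::real)" unfolding set_integrable_def by (rule borel_integrable_compact[OF K(2)]) simp
 show "sint K G"
 proof (rule set_integrable_dominated)
  show "sint K (%x. 1 + (norm (G x))^2)" by (rule set_integral_add(1)[OF c iK])
  have "bm (%x. indicator K x *\<^sub>R (indicator U x *\<^sub>R G x))"
   by (rule borel_measurable_scaleR[OF borel_measurable_indicator[OF Kb] m])
  moreover have "(%x. indicator K x *\<^sub>R (indicator U x *\<^sub>R G x)) = (%x. indicator K x *\<^sub>R G x)"
   using K by (auto simp: indicator_def fun_eq_iff)
  ultimately show "(%x. indicator K x *\<^sub>R G x) \<in> borel_measurable lborel" by simp
  show "norm (G x) <= 1 + (norm (G x))^2" for x
  proof (cases "norm (G x) <= 1")
   case False
   then have "norm (G x) * 1 <= norm (G x) * norm (G x)" by (intro mult_left_mono) auto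
   then show ?thesis by (simp add: power2_eq_square)
  qed (simp add: add_increasing2)
 qed
qed

text \<open>The gradients converge in L2 by completeness, and local L1 convergence of the functions
  identifies the limit as the weak gradient of u.\<close>

lemma Hd_closed:
 assumes U: "open U" and us: "\<And>n. us n \<in> Hd U" and cau: "seq_Cauchy_for (%w. energy U w) us"
  and lim: "L1_loc_lim U us u"
 shows "u \<in> Hd U" "null_seq (%n. energy U (%x. us n x - u x))"
proof -
 note g = weak_gradient_Hd[OF U us]
 let ?g = "%n. weak_gradient U (us n)"
 let ?f = "%n x. indicator U x *\<^sub>R ?g n x"
 have fm: "?f n \<in> borel_measurable lborel" for n using locally_integrable_measurable_open[OF U g(2)] by simp
 have fi: "integrable lborel (%x. (norm (?f n x))^2)" for n
  using g(4)[of n] unfolding set_integrable_def norm_sq_indicator .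
 have wd: "is_weak_gradient U (%x. us m x - us n x) (%x. ?g m x - ?g n x)" for m n
  using is_weak_gradient_lincomb[OF g(1) g(1), of 1 m "-1" n] by simp
 have eq: "(norm (?f m x - ?f n x))^2 = indicator U x *\<^sub>R (norm (?g m x - ?g n x))\<^sup>2" for m n x
  by (simp add: indicator_def)
 have Dd: "energy U (%x. us m x - us n x) = (LINT x|lborel. (norm (?f m x - ?f n x))\<^sup>2)" for m n
  unfolding dirichlet_integral_self[OF U wd] set_lebesgue_integral_def eq ..
 have "\<exists>G. G \<in> borel_measurable lborel \<and> integrable lborel (%x. (norm (G x))^2) \<and>
  (%n. LINT x|lborel. (norm (?f n x - G x))\<^sup>2) \<longlonglongrightarrow> 0"
 proof (rule L2_complete[OF fm fi])
  show "\<exists>N. \<forall>m\<ge>N. \<forall>n\<ge>N. (LINT x|lborel. (norm (?f m x - ?f n x))\<^sup>2) < \<epsilon>" if "\<epsilon> > 0" for \<epsilon>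
   using cau that unfolding seq_Cauchy_for_def Dd by blast
 qed
 then obtain G where G: "G \<in> borel_measurable lborel" "integrable lborel (%x. (norm (G x))^2)"
  "null_seq (%n. LINT x|lborel. (norm (?f n x - G x))\<^sup>2)" by (elim exE conjE)
 have Ub: "U \<in> sets borel" using U by (rule borel_open)
 have GU: "bm (%x. indicator U x *\<^sub>R G x)"
  using G(1) by (intro borel_measurable_scaleR borel_measurable_indicator[OF Ub]) simp
 have iG: "sint U (%x. (norm (G x))^2)"
  unfolding set_integrable_def by (rule integrable_mult_indicator[OF _ G(2)]) (use Ub in simp)
 have lG: "locally_integrable U G" by (rule square_integrable_locally_integrable[OF GU iG])
 have wG: "is_weak_gradient U u G"
 proof (rule is_weak_gradient_limit_seq[OF _ lG g(1)])
  show "locally_integrable U u" using lim by (simp add: L1_loc_lim_def)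
  fix K assume K: "compact K" "K \<subseteq> U"
  show "null_seq (%n. LBINT x:K. norm (us n x - u x))" using lim K by (simp add: L1_loc_lim_def)
  have Kb: "K \<in> sets borel" using compact_imp_closed[OF K(1)] by (rule borel_closed)
  have idG: "integrable lborel (%x. (norm (?f n x - G x))^2)" for n by (rule integrable_norm_diff_sq[OF fm G(1) fi G(2)])
  have eqK: "indicator K x *\<^sub>R (norm (?g n x - G x))\<^sup>2 = indicator K x *\<^sub>R (norm (?f n x - G x))\<^sup>2" for n x
   using K(2) by (auto simp: indicator_def)
  have iK: "sint K (%x. (norm (?g n x - G x))^2)" for n
   unfolding set_integrable_def eqK by (rule integrable_mult_indicator[OF _ idG]) (use Kb in simp)
  show "null_seq (%n. LBINT x:K. norm (?g n x - G x))"
  proof (rule L1_tendsto_of_L2[OF K(1) _ iK])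
   show "sint K (%x. ?g n x - G x)" for n
    by (rule set_integral_diff(1)) (use g(2)[of n] lG K in \<open>auto simp: locally_integrable_def\<close>)
   show "null_seq (%n. LBINT x:K. (norm (?g n x - G x))\<^sup>2)"
   proof (rule tendsto_sandwich[OF _ _ tendsto_const G(3)])
    show "\<forall>\<^sub>F n in sequentially. 0 <= (LBINT x:K. (norm (?g n x - G x))\<^sup>2)"
     unfolding set_lebesgue_integral_def by (intro always_eventually allI integral_nonneg_AE AE_I2) auto
    show "\<forall>\<^sub>F n in sequentially. (LBINT x:K. (norm (?g n x - G x))\<^sup>2) <= (LINT x|lborel. (norm (?f n x - G x))\<^sup>2)"
     unfolding set_lebesgue_integral_def eqK
     by (intro always_eventually allI integral_mono idG iK[unfolded set_integrable_def eqK]) (auto simp: indicator_def)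
   qed
  qed
 qed
 show "u \<in> Hd U" by (rule HdI[OF wG iG])
 have wn: "is_weak_gradient U (%x. us n x - u x) (%x. ?g n x - G x)" for n
  using is_weak_gradient_lincomb[OF g(1) wG, of 1 n "-1"] by simp
 have idG: "integrable lborel (%x. (norm (?f n x - G x))^2)" for n by (rule integrable_norm_diff_sq[OF fm G(1) fi G(2)])
 have eqU: "indicator U x *\<^sub>R (norm (?g n x - G x))\<^sup>2 = indicator U x *\<^sub>R (norm (?f n x - G x))\<^sup>2" for n x
  by (auto simp: indicator_def)
 show "null_seq (%n. energy U (%x. us n x - u x))"
 proof (rule tendsto_sandwich[OF _ _ tendsto_const G(3)])
  show "\<forall>\<^sub>F n in sequentially. 0 <= energy U (%x. us n x - u x)"
   unfolding dirichlet_integral_self[OF U wn] set_lebesgue_integral_def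
   by (intro always_eventually allI integral_nonneg_AE AE_I2) auto
  show "\<forall>\<^sub>F n in sequentially. energy U (%x. us n x - u x) <= (LINT x|lborel. (norm (?f n x - G x))\<^sup>2)"
   unfolding dirichlet_integral_self[OF U wn] set_lebesgue_integral_def eqU
   by (intro always_eventually allI integral_mono idG integrable_mult_indicator) (use Ub in \<open>auto simp: indicator_def\<close>)
 qed
qed

text \<open>Mazur's lemma for the energy. The midpoint combinations still tend to u locally in L1,
  because a tail of \<open>us\<close> lies in any given L1 ball around u and such balls are
  convex.\<close>

lemma Hd_mazur:
 assumes U: "open U" and us: "\<And>n. us n \<in> Hd U" and C: "\<And>n. energy U (us n) <= C"
  and lim: "L1_loc_lim U us u"
 shows "u \<in> Hd U" "energy U u <= C"
  "\<exists>s. (\<forall>n. s n \<in> tail_mid us n) \<and> null_seq (%n. energy U (%x. s n x - u x))"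
proof -
 note p = psd_Hd[OF U]
 from psd_mazur[where us = us and C = C, OF p us C] obtain s where s0: "\<forall>n. s n \<in> tail_mid us n" "\<forall>n. s n \<in> Hd U"
  "\<forall>n. energy U (s n) <= C" "seq_Cauchy_for (%w. energy U w) s" by (elim exE conjE)
 have s: "\<And>n. s n \<in> tail_mid us n" "\<And>n. s n \<in> Hd U" "\<And>n. energy U (s n) <= C"
  "seq_Cauchy_for (%w. energy U w) s" using s0 by simp_all
 have lu: "locally_integrable U u" using lim by (simp add: L1_loc_lim_def)
 have slim: "L1_loc_lim U s u" unfolding L1_loc_lim_def
 proof (intro conjI allI impI lu LIMSEQ_I)
  fix K and \<epsilon> :: real assume K: "K \<subseteq> U" "compact K" and e: "\<epsilon> > 0"
  have uK: "sint K u" using lu K by (simp add: locally_integrable_def)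
  have "null_seq (%n. LBINT x:K. norm (us n x - u x))" using lim K by (simp add: L1_loc_lim_def)
  from order_tendstoD(2)[OF this e] obtain N where N: "\<And>n. n \<ge> N ==> (LBINT x:K. norm (us n x - u x)) < \<epsilon>"
   by (auto simp: eventually_sequentially)
  have "sint K (s n) \<and> (LBINT x:K. norm (s n x - u x)) < \<epsilon>" if "n \<ge> N" for n
  proof (rule tail_mid_invariant[OF s(1)[of n]])
   show "sint K (us k) \<and> (LBINT x:K. norm (us k x - u x)) < \<epsilon>" if "n <= k" for k
    using N[of k] that \<open>n \<ge> N\<close> weak_gradient_Hd(3)[OF U us[of k]] K by (auto simp: locally_integrable_def)
   fix v w :: "complex => real" assume v: "sint K v \<and> (LBINT x:K. norm (v x - u x)) < \<epsilon>"
    and w: "sint K w \<and> (LBINT x:K. norm (w x - u x)) < \<epsilon>"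
   have iv: "sint K (%x. norm (v x - u x))" and iw: "sint K (%x. norm (w x - u x))"
    by (rule set_integrable_norm[OF set_integral_diff(1)[OF conjunct1[OF v] uK]],
      rule set_integrable_norm[OF set_integral_diff(1)[OF conjunct1[OF w] uK]])
   have im: "sint K (%x. (v x + w x) / 2)" using v w by (intro set_integrable_divide set_integral_add(1)) auto
   have "(LBINT x:K. norm ((v x + w x) / 2 - u x)) <= (LBINT x:K. (1/2) * norm (v x - u x) + (1/2) * norm (w x - u x))"
   proof (rule set_integral_mono)
    show "sint K (%x. norm ((v x + w x) / 2 - u x))" by (rule set_integrable_norm[OF set_integral_diff(1)[OF im uK]])
    show "sint K (%x. (1/2) * norm (v x - u x) + (1/2) * norm (w x - u x))"
     by (intro set_integral_add(1) set_integrable_mult_right iv iw)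
    show "norm ((v x + w x) / 2 - u x) <= (1/2) * norm (v x - u x) + (1/2) * norm (w x - u x)" for x
     unfolding real_norm_def by (simp add: abs_if field_simps split: if_splits)
   qed
   also have "\<dots> = (1/2) * (LBINT x:K. norm (v x - u x)) + (1/2) * (LBINT x:K. norm (w x - u x))"
   proof -
    have "sint K (%x. (1/2) * norm (v x - u x))" "sint K (%x. (1/2) * norm (w x - u x))"
     by (intro set_integrable_mult_right iv iw)+
    from set_integral_add(2)[OF this] show ?thesis by (simp only: set_integral_mult_right)
   qed
   also have "\<dots> < \<epsilon>" using v w by linarith
   finally show "sint K (%x. (v x + w x) / 2) \<and> (LBINT x:K. norm ((v x + w x) / 2 - u x)) < \<epsilon>"
    using im by blast
  qed
  moreover have "0 <= (LBINT x:K. norm (s n x - u x))" for n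
   unfolding set_lebesgue_integral_def by (intro integral_nonneg_AE AE_I2) auto
  ultimately show "\<exists>N. \<forall>n\<ge>N. norm ((LBINT x:K. norm (s n x - u x)) - 0) < \<epsilon>" by (intro exI[of _ N]) auto
 qed
 note cl = Hd_closed[where us = s and u = u, OF U s(2,4) slim]
 show "u \<in> Hd U" by (rule cl(1))
 have "(%n. energy U (s n)) \<longlonglongrightarrow> energy U u"
  by (rule psd_tendsto[where us = s and vs = s and u = u and v = u, OF p s(2) s(2) cl(1) cl(1) cl(2) cl(2)])
 then show "energy U u <= C" by (rule LIMSEQ_le_const2) (use s(3) in blast)
 show "\<exists>s. (\<forall>n. s n \<in> tail_mid us n) \<and> null_seq (%n. energy U (%x. s n x - u x))"
  using s(1) cl(2) by blast
qed

section \<open>The reference measure\<close>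

lemma space_refl: "space (refl_measure U) = closure U"
 by (simp add: refl_measure_def space_restrict_space)

lemma sets_refl: "sets (refl_measure U) = sets (restrict_space borel (closure U))"
 unfolding refl_measure_def by (intro sets_restrict_space_cong) simp

lemma measurable_refl_iff:
 fixes f :: "complex => 'b::real_normed_vector"
 shows "f \<in> borel_measurable (refl_measure U) \<longleftrightarrow> (%x. indicator (closure U) x *\<^sub>R f x) \<in> borel_measurable borel"
 unfolding measurable_cong_sets[OF sets_refl refl] by (rule borel_measurable_restrict_space_iff) simp

lemma measurable_refl_open:
 fixes f :: "complex => 'b::euclidean_space"
 assumes U: "open U" and f: "f \<in> borel_measurable (refl_measure U)"
 shows "bm (%x. indicator U x *\<^sub>R f x)"
proof -
 have "bm (%x. indicator U x *\<^sub>R (indicator (closure U) x *\<^sub>R f x))"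
  using f[unfolded measurable_refl_iff]
  by (rule borel_measurable_scaleR[OF borel_measurable_indicator[OF borel_open[OF U]]])
 moreover have "(%x. indicator U x *\<^sub>R (indicator (closure U) x *\<^sub>R f x)) = (%x. indicator U x *\<^sub>R f x)"
  using closure_subset[of U] by (auto simp: indicator_def fun_eq_iff)
 ultimately show ?thesis by simp
qed

lemma AE_refl:
 assumes U: "open U"
 shows "(AE x in refl_measure U. P x) \<longleftrightarrow> (AE x in lborel. x \<in> U --> P x)"
proof -
 have "(AE x in refl_measure U. P x) \<longleftrightarrow> (AE x in density lborel (indicator U). x \<in> closure U --> P x)"
  unfolding refl_measure_def by (rule AE_restrict_space_iff) simp
 also have "\<dots> \<longleftrightarrow> (AE x in lborel. 0 < (indicator U x :: ennreal) --> x \<in> closure U --> P x)"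
  using U by (intro AE_density) auto
 also have "\<dots> \<longleftrightarrow> (AE x in lborel. x \<in> U --> P x)"
  using closure_subset[of U] by (intro AE_cong) (auto simp: indicator_def)
 finally show ?thesis .
qed

lemma integral_refl:
 fixes f :: "complex => real"
 assumes U: "open U" and f: "f \<in> borel_measurable (refl_measure U)"
 shows "integrable (refl_measure U) f \<longleftrightarrow> sint U f"
  "integral\<^sup>L (refl_measure U) f = (LBINT x:U. f x)"
proof -
 have dens: "density lborel (indicator U) = density lborel (%x. ennreal (indicator U x))"
  by (simp add: ennreal_indicator)
 have m: "(%x. indicator (closure U) x *\<^sub>R f x) \<in> borel_measurable lborel"
  using f by (simp add: measurable_refl_iff)
 have eq: "indicator U x *\<^sub>R (indicator (closure U) x *\<^sub>R f x) = indicator U x *\<^sub>R f x" for x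
  using closure_subset[of U] by (auto simp: indicator_def)
 have mU: "(indicator U :: complex => real) \<in> borel_measurable lborel" using U by simp
 have "integrable (refl_measure U) f \<longleftrightarrow> integrable (density lborel (indicator U)) (%x. indicator (closure U) x *\<^sub>R f x)"
  unfolding refl_measure_def by (rule integrable_restrict_space) simp
 also have "\<dots> \<longleftrightarrow> integrable lborel (%x. indicator U x *\<^sub>R (indicator (closure U) x *\<^sub>R f x))"
  unfolding dens by (rule integrable_density[OF m mU]) simp
 finally show "integrable (refl_measure U) f \<longleftrightarrow> sint U f" unfolding eq set_integrable_def .
 have "integral\<^sup>L (refl_measure U) f = integral\<^sup>L (density lborel (indicator U)) (%x. indicator (closure U) x *\<^sub>R f x)"
  unfolding refl_measure_def by (rule integral_restrict_space) simp
 also have "\<dots> = integral\<^sup>L lborel (%x. indicator U x *\<^sub>R (indicator (closure U) x *\<^sub>R f x))"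
  unfolding dens by (rule integral_density[OF m mU]) simp
 finally show "integral\<^sup>L (refl_measure U) f = (LBINT x:U. f x)"
  unfolding eq set_lebesgue_integral_def .
qed

lemma finite_measure_refl:
 assumes U: "open U" "bounded U"
 shows "finite_measure (refl_measure U)"
proof (rule finite_measureI)
 have "emeasure (refl_measure U) (space (refl_measure U)) = emeasure (density lborel (indicator U)) (closure U)"
  unfolding space_refl by (simp add: refl_measure_def emeasure_restrict_space)
 also have "\<dots> = emeasure lborel (U \<inter> closure U)"
  using U by (subst emeasure_density) (auto simp: indicator_inter_arith[symmetric])
 also have "\<dots> <= emeasure lborel U" using U by (intro emeasure_mono) auto
 also have "\<dots> < \<infinity>" using emeasure_bounded_finite[OF U(2)] by simp
 finally show "emeasure (refl_measure U) (space (refl_measure U)) \<noteq> \<infinity>" by simp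
qed

lemma continuous_measurable_refl:
 assumes "continuous_on (closure U) f" shows "f \<in> borel_measurable (refl_measure U)"
 unfolding measurable_cong_sets[OF sets_refl refl] by (rule borel_measurable_continuous_on_restrict[OF assms])

lemma psd_L2: "psd (L2 M) (%u v. \<integral>x. u x * v x \<partial>M)"
proof -
 have i: "integrable M (%x. u x * v x)" if "u \<in> L2 M" "v \<in> L2 M" for u v
 proof (rule Bochner_Integration.integrable_bound)
  show "integrable M (%x. (u x)^2 + (v x)^2)" using that by (auto simp: L2_def)
  show "(%x. u x * v x) \<in> borel_measurable M" using that by (auto simp: L2_def)
  have "\<bar>a * b\<bar> <= a\<^sup>2 + b\<^sup>2" for a b :: real
  proof -
   have "2 * \<bar>a * b\<bar> <= a\<^sup>2 + b\<^sup>2"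
    using sum_squares_bound[of "\<bar>a\<bar>" "\<bar>b\<bar>"] by (simp add: abs_mult mult.assoc)
   then show ?thesis using abs_ge_zero[of "a * b"] by linarith
  qed
  then show "AE x in M. norm (u x * v x) <= norm ((u x)^2 + (v x)^2)" by (intro AE_I2) simp
 qed
 have "(%x. a * u x + b * v x) \<in> L2 M" if "u \<in> L2 M" "v \<in> L2 M" for u v a b
 proof -
  have "integrable M (%x. a\<^sup>2 * (u x)^2 + 2 * a * b * (u x * v x) + b\<^sup>2 * (v x)^2)"
   using that i[OF that] by (auto simp: L2_def)
  moreover have "(%x. a\<^sup>2 * (u x)^2 + 2 * a * b * (u x * v x) + b\<^sup>2 * (v x)^2) = (%x. (a * u x + b * v x)^2)"
   by (auto simp: power2_eq_square algebra_simps)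
  ultimately show ?thesis using that by (auto simp: L2_def)
 qed
 moreover have "(\<integral>x. (a * u x + b * v x) * w x \<partial>M) = a * (\<integral>x. u x * w x \<partial>M) + b * (\<integral>x. v x * w x \<partial>M)"
  if "u \<in> L2 M" "v \<in> L2 M" "w \<in> L2 M" for u v w a b
  using i[OF that(1,3)] i[OF that(2,3)] by (simp add: distrib_right mult.assoc)
 ultimately show ?thesis unfolding psd_def by (auto simp: mult.commute intro!: integral_nonneg_AE)
qed

lemma L2_normsq_eq: "L2_normsq M u = (\<integral>x. u x * u x \<partial>M)" by (simp add: L2_normsq_def power2_eq_square)

lemma L2_normsq_nonneg: "0 <= L2_normsq M u" by (simp add: L2_normsq_def integral_nonneg_AE)

lemma L2_refl_facts:
 assumes U: "open U" and u: "u \<in> L2 (refl_measure U)"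
 shows "sint U (%x. (u x)^2)" "L2_normsq (refl_measure U) u = (LBINT x:U. (u x)\<^sup>2)" "locally_integrable U u"
proof -
 have m: "u \<in> borel_measurable (refl_measure U)" "(%x. (u x)^2) \<in> borel_measurable (refl_measure U)"
  using u by (auto simp: L2_def)
 show s: "sint U (%x. (u x)^2)" using integral_refl(1)[OF U m(2)] u by (simp add: L2_def)
 show "L2_normsq (refl_measure U) u = (LBINT x:U. (u x)\<^sup>2)"
  unfolding L2_normsq_def by (rule integral_refl(2)[OF U m(2)])
 show "locally_integrable U u"
  by (rule square_integrable_locally_integrable[OF measurable_refl_open[OF U m(1)]]) (use s in simp)
qed

lemma L2_L1_loc_lim:
 assumes U: "open U" and us: "\<And>n. us n \<in> L2 (refl_measure U)" and u: "u \<in> L2 (refl_measure U)"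
  and l: "null_seq (%n. L2_normsq (refl_measure U) (%x. us n x - u x))"
 shows "L1_loc_lim U us u" unfolding L1_loc_lim_def
proof (intro conjI allI impI)
 show "locally_integrable U u" by (rule L2_refl_facts(3)[OF U u])
 fix K assume K: "K \<subseteq> U" "compact K"
 have Kb: "K \<in> sets borel" using compact_imp_closed[OF K(2)] by (rule borel_closed)
 have d: "(%x. us n x - u x) \<in> L2 (refl_measure U)" for n by (rule psd_diff[OF psd_L2 us u])
 have iK: "sint K (%x. (norm (us n x - u x))^2)" for n
  using set_integrable_subset[OF L2_refl_facts(1)[OF U d[of n]], of K] Kb K by simp
 show "null_seq (%n. LBINT x:K. norm (us n x - u x))"
 proof (rule L1_tendsto_of_L2[OF K(2) _ iK])
  show "sint K (%x. us n x - u x)" for n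
   using L2_refl_facts(3)[OF U d[of n]] K by (simp add: locally_integrable_def)
  show "null_seq (%n. LBINT x:K. (norm (us n x - u x))\<^sup>2)"
  proof (rule tendsto_sandwich[OF _ _ tendsto_const l])
   show "\<forall>\<^sub>F n in sequentially. 0 <= (LBINT x:K. (norm (us n x - u x))\<^sup>2)"
    unfolding set_lebesgue_integral_def by (intro always_eventually allI integral_nonneg_AE AE_I2) auto
   show "\<forall>\<^sub>F n in sequentially. (LBINT x:K. (norm (us n x - u x))\<^sup>2) <= L2_normsq (refl_measure U) (%x. us n x - u x)"
   proof (intro always_eventually allI)
    fix n
    show "(LBINT x:K. (norm (us n x - u x))\<^sup>2) <= L2_normsq (refl_measure U) (%x. us n x - u x)"
     unfolding L2_refl_facts(2)[OF U d] set_lebesgue_integral_def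
     by (rule integral_mono[OF iK[unfolded set_integrable_def] L2_refl_facts(1)[OF U d, unfolded set_integrable_def]])
      (use K in \<open>auto simp: indicator_def\<close>)
   qed
  qed
 qed
qed

lemma L2_normsq_tendsto_bounded:
 assumes "finite_measure M" and m: "\<And>n. us n \<in> borel_measurable M" "u \<in> borel_measurable M"
  and b: "\<And>n x. x \<in> space M ==> \<bar>us n x - u x\<bar> <= C" and l: "AE x in M. (%n. us n x) \<longlonglongrightarrow> u x"
 shows "null_seq (%n. L2_normsq M (%x. us n x - u x))"
proof -
 interpret finite_measure M by fact
 have "(%n. \<integral>x. (us n x - u x)\<^sup>2 \<partial>M) \<longlonglongrightarrow> (\<integral>x. 0 \<partial>M)"
 proof (rule integral_dominated_convergence)
  show "integrable M (%x. C\<^sup>2)" by simp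
  show "AE x in M. norm ((us n x - u x)^2) <= C\<^sup>2" for n
  proof (rule AE_I2)
   fix x assume "x \<in> space M"
   from order_trans[OF b[OF this, of n] abs_ge_self] show "norm ((us n x - u x)^2) <= C\<^sup>2"
    by (simp add: abs_le_square_iff[symmetric])
  qed
  show "AE x in M. null_seq (%n. (us n x - u x)\<^sup>2)" using l
  proof eventually_elim
   fix x assume "(%n. us n x) \<longlonglongrightarrow> u x"
   then have "(%n. (us n x - u x)\<^sup>2) \<longlonglongrightarrow> (u x - u x)\<^sup>2" by (intro tendsto_intros)
   then show "null_seq (%n. (us n x - u x)\<^sup>2)" by simp
  qed
 qed (use m in measurable)
 then show ?thesis by (simp add: L2_normsq_def)
qed

lemma bounded_in_L2:
 assumes "finite_measure M" "u \<in> borel_measurable M" "\<And>x. x \<in> space M ==> \<bar>u x\<bar> <= C"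
 shows "u \<in> L2 M"
proof -
 interpret finite_measure M by fact
 have "integrable M (%x. (u x)^2)" by (rule integrable_const_bound[of _ "C\<^sup>2"])
   (use assms in \<open>auto intro!: AE_I2 simp: abs_le_square_iff[symmetric] intro: order_trans[OF _ abs_ge_self]\<close>)
 then show ?thesis using assms by (simp add: L2_def)
qed

section \<open>The space \<open>H\<^sup>1\<close>\<close>

lemma H1_iff: "u \<in> H1 U \<longleftrightarrow> u \<in> Hd U \<and> u \<in> L2 (refl_measure U)" by (auto simp: H1_def Hd_def)

text \<open>The squared norm that \<open>form1\<close> yields for reflecting Brownian motion, made
  bilinear so that the results on \<open>psd\<close> apply.\<close>

definition E1 :: "complex set => (complex => real) => (complex => real) => real" where
 "E1 U u v = 1/2 * dirichlet_integral U u v + (\<integral>x. u x * v x \<partial>refl_measure U)"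

abbreviation "E1sq U u \<equiv> E1 U u u"

lemma psd_H1: "open U ==> psd (H1 U) (dirichlet_integral U)"
 using psd_Hd[of U] psd_L2[of "refl_measure U"] unfolding psd_def by (auto simp: H1_iff)

lemma psd_E1:
 assumes U: "open U" shows "psd (H1 U) (E1 U)" using psd_Hd[OF U] psd_L2[of "refl_measure U"]
 unfolding psd_def E1_def by (auto simp: H1_iff algebra_simps intro!: add_nonneg_nonneg)

lemma E1_self: "E1sq U u = 1/2 * energy U u + L2_normsq (refl_measure U) u"
 by (simp add: E1_def L2_normsq_eq)

lemma E1_parts:
 assumes "open U" "u \<in> H1 U"
 shows "energy U u <= 2 * E1sq U u" "L2_normsq (refl_measure U) u <= E1sq U u" "0 <= energy U u"
 using psdD(4)[OF psd_H1[OF assms(1)] assms(2,2)] L2_normsq_nonneg[of "refl_measure U" u] by (auto simp: E1_self)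

lemma E1_tendsto_parts:
 assumes U: "open U" and us: "\<And>n. us n \<in> H1 U" and l: "null_seq (%n. E1sq U (us n))"
 shows "null_seq (%n. energy U (us n))" "null_seq (%n. L2_normsq (refl_measure U) (us n))"
proof -
 have l2: "null_seq (%n. 2 * E1sq U (us n))" using tendsto_mult_right_zero[OF l] .
 show "null_seq (%n. energy U (us n))"
  by (rule tendsto_sandwich[OF _ _ tendsto_const l2]) (auto intro!: always_eventually E1_parts[OF U us])
 show "null_seq (%n. L2_normsq (refl_measure U) (us n))"
  by (rule tendsto_sandwich[OF _ _ tendsto_const l]) (auto intro!: always_eventually E1_parts[OF U us] L2_normsq_nonneg)
qed

lemma E1_tendstoI:
 assumes "null_seq (%n. energy U (us n))" "null_seq (%n. L2_normsq (refl_measure U) (us n))"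
 shows "null_seq (%n. E1sq U (us n))"
 using tendsto_add[OF tendsto_mult_right_zero[OF assms(1), of "1/2"] assms(2)] by (simp add: E1_self)

text \<open>The combinations selected for the energy also converge in L2, because L2 balls around u
  are stable under midpoints by the parallelogram identity.\<close>

lemma H1_mazur:
 assumes U: "open U" and us: "\<And>n. us n \<in> H1 U" and C: "\<And>n. energy U (us n) <= C"
  and u: "u \<in> L2 (refl_measure U)" and l: "null_seq (%n. L2_normsq (refl_measure U) (%x. us n x - u x))"
 shows "u \<in> H1 U" "energy U u <= C"
  "\<exists>s. (\<forall>n. s n \<in> tail_mid us n) \<and> null_seq (%n. E1sq U (%x. s n x - u x))"
proof -
 have hd: "us n \<in> Hd U" and l2: "us n \<in> L2 (refl_measure U)" for n using us by (auto simp: H1_iff)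
 have lim: "L1_loc_lim U us u" by (rule L2_L1_loc_lim[OF U l2 u l])
 note m = Hd_mazur[where us = us and u = u and C = C, OF U hd C lim]
 show "u \<in> H1 U" using m(1) u by (simp add: H1_iff)
 show "energy U u <= C" by (rule m(2))
 from m(3) obtain s where s: "\<forall>n. s n \<in> tail_mid us n"
  "null_seq (%n. energy U (%x. s n x - u x))" by (elim exE conjE)
 have "null_seq (%n. L2_normsq (refl_measure U) (%x. s n x - u x))"
 proof (rule LIMSEQ_I)
  fix \<epsilon> :: real assume e: "\<epsilon> > 0"
  obtain N where N: "\<And>n. n \<ge> N ==> L2_normsq (refl_measure U) (%x. us n x - u x) < \<epsilon>"
   using order_tendstoD(2)[OF l e] by (auto simp: eventually_sequentially)
  let ?B = "%u v. \<integral>x. u x * v x \<partial>refl_measure U"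
  have "s n \<in> L2 (refl_measure U) \<and> ?B (%x. s n x - u x) (%x. s n x - u x) < \<epsilon>" if "n \<ge> N" for n
  proof (rule tail_mid_invariant[OF spec[OF s(1), of n]])
   show "us k \<in> L2 (refl_measure U) \<and> ?B (%x. us k x - u x) (%x. us k x - u x) < \<epsilon>" if "n <= k" for k
    using l2 N[of k] that \<open>n \<ge> N\<close> by (simp add: L2_normsq_eq)
   fix v w assume v: "v \<in> L2 (refl_measure U) \<and> ?B (%x. v x - u x) (%x. v x - u x) < \<epsilon>"
    and w: "w \<in> L2 (refl_measure U) \<and> ?B (%x. w x - u x) (%x. w x - u x) < \<epsilon>"
   let ?a = "%x. v x - u x" and ?b = "%x. w x - u x"
   have ab: "?a \<in> L2 (refl_measure U)" "?b \<in> L2 (refl_measure U)" using psd_diff[OF psd_L2] v w u by auto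
   have "?B (%x. (?a x + ?b x) / 2) (%x. (?a x + ?b x) / 2) <= ?B ?a ?a / 2 + ?B ?b ?b / 2"
    unfolding psd_parallelogram[OF psd_L2 ab] using psdD(4)[OF psd_L2 psd_diff[OF psd_L2 ab] u] by simp
   also have "\<dots> < \<epsilon>" using v w by linarith
   also have "(%x. (?a x + ?b x) / 2) = (%x. (v x + w x) / 2 - u x)" by (auto simp: field_simps)
   finally show "(%x. (v x + w x) / 2) \<in> L2 (refl_measure U) \<and> ?B (%x. (v x + w x) / 2 - u x) (%x. (v x + w x) / 2 - u x) < \<epsilon>"
    using psd_mid[OF psd_L2] v w by blast
  qed
  then show "\<exists>N. \<forall>n\<ge>N. norm (L2_normsq (refl_measure U) (%x. s n x - u x) - 0) < \<epsilon>"
   using L2_normsq_nonneg[of "refl_measure U"] by (intro exI[of _ N]) (simp add: L2_normsq_eq)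
 qed
 then show "\<exists>s. (\<forall>n. s n \<in> tail_mid us n) \<and> null_seq (%n. E1sq U (%x. s n x - u x))"
  using s E1_tendstoI[of U "%n x. s n x - u x"] by blast
qed

lemma H1_complete:
 assumes U: "open U" and us: "\<And>n. us n \<in> H1 U" and cau: "seq_Cauchy_for (%w. E1sq U w) us"
 shows "\<exists>u\<in>H1 U. null_seq (%n. E1sq U (%x. us n x - u x))"
proof -
 have hd: "us n \<in> Hd U" and l2: "us n \<in> L2 (refl_measure U)" for n using us by (auto simp: H1_iff)
 have d: "(%x. us m x - us n x) \<in> H1 U" for m n by (rule psd_diff[OF psd_H1[OF U] us us])
 \<comment> \<open>The factor 2 compensates the 1/2 in front of the Dirichlet integral, so that both
   parts of the norm are covered.\<close>
 have cau': "seq_Cauchy_for Q us" if "\<And>u. u \<in> H1 U ==> Q u <= 2 * E1sq U u" for Q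
  unfolding seq_Cauchy_for_def
 proof (intro allI impI)
  fix \<epsilon> :: real assume "\<epsilon> > 0"
  then obtain N where "\<forall>m\<ge>N. \<forall>n\<ge>N. E1sq U (%x. us m x - us n x) < \<epsilon> / 2"
   using cau unfolding seq_Cauchy_for_def by (meson half_gt_zero)
  then show "\<exists>N. \<forall>m\<ge>N. \<forall>n\<ge>N. Q (%x. us m x - us n x) < \<epsilon>"
   using that[OF d] by (intro exI[of _ N] allI impI) (smt (verit) field_sum_of_halves)
 qed
 have "seq_Cauchy_for (%u. L2_normsq (refl_measure U) u) us"
  by (rule cau') (use E1_parts(1-3)[OF U] in \<open>force simp: E1_self\<close>)
 then have "\<exists>g. g \<in> borel_measurable (refl_measure U) \<and> integrable (refl_measure U) (%x. (norm (g x))^2) \<and>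
  (%n. \<integral>x. (norm (us n x - g x))\<^sup>2 \<partial>refl_measure U) \<longlonglongrightarrow> 0"
  using l2 by (intro L2_complete) (auto simp: L2_def L2_normsq_def seq_Cauchy_for_def)
 then obtain u where "u \<in> borel_measurable (refl_measure U)" "integrable (refl_measure U) (%x. (norm (u x))^2)"
  and "null_seq (%n. \<integral>x. (norm (us n x - u x))\<^sup>2 \<partial>refl_measure U)" by (elim exE conjE)
 then have u: "u \<in> L2 (refl_measure U)" and lu: "null_seq (%n. L2_normsq (refl_measure U) (%x. us n x - u x))"
  by (simp_all add: L2_def L2_normsq_def)
 have cD: "seq_Cauchy_for (%w. energy U w) us" by (rule cau') (rule E1_parts(1)[OF U])
 note cl = Hd_closed[where us = us and u = u, OF U hd cD L2_L1_loc_lim[OF U l2 u lu]]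
 show ?thesis using cl u lu E1_tendstoI[of U "%n x. us n x - u x"] by (auto simp: H1_iff)
qed

text \<open>Measurability of v is assumed because changing a Borel function on a null set can
  destroy it.\<close>

lemma is_weak_gradient_AE_cong:
 fixes U :: "complex set"
 assumes ae: "AE x in lborel. x \<in> U --> u x = v x"
  and mv: "bm (%x. indicator U x *\<^sub>R v x)" and u: "is_weak_gradient U u g"
 shows "is_weak_gradient U v g" unfolding is_weak_gradient_def
proof (intro conjI allI impI)
 have lu: "locally_integrable U u" and lg: "locally_integrable U g" using u by (auto simp: is_weak_gradient_def)
 show "locally_integrable U g" by fact
 show lv: "locally_integrable U v" unfolding locally_integrable_def
 proof (intro allI impI)
  fix K assume K: "K \<subseteq> U" "compact K"
  have Kb: "K \<in> sets borel" using compact_imp_closed[OF K(2)] by (rule borel_closed)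
  have "bm (%x. indicator K x *\<^sub>R (indicator U x *\<^sub>R v x))"
   by (rule borel_measurable_scaleR[OF borel_measurable_indicator[OF Kb] mv])
  moreover have "(%x. indicator K x *\<^sub>R (indicator U x *\<^sub>R v x)) = (%x. indicator K x *\<^sub>R v x)"
   using K by (auto simp: indicator_def fun_eq_iff)
  ultimately have mK: "(%x. indicator K x *\<^sub>R v x) \<in> borel_measurable lborel" by simp
  have iu: "integrable lborel (%x. indicator K x *\<^sub>R u x)" using lu K by (simp add: locally_integrable_def set_integrable_def)
  have "AE x in lborel. indicator K x *\<^sub>R u x = indicator K x *\<^sub>R v x"
   using ae K by (auto elim!: eventually_mono simp: indicator_def)
  from integrable_cong_AE_imp[OF iu mK] this show "sint K v"
   unfolding set_integrable_def by (auto elim!: eventually_mono)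
 qed
 fix \<phi> and e :: complex assume te: "test_function U \<phi> \<and> e \<in> Basis"
 then have t: "test_function U \<phi>" by simp
 have "(LBINT x:U. v x * fd \<phi> x e) = (LBINT x:U. u x * fd \<phi> x e)" unfolding set_lebesgue_integral_def
 proof (rule integral_cong_AE)
  show "(%x. indicator U x *\<^sub>R (v x * fd \<phi> x e)) \<in> borel_measurable lborel"
   "(%x. indicator U x *\<^sub>R (u x * fd \<phi> x e)) \<in> borel_measurable lborel"
   using weak_gradient_test_integrable(1)[OF t lv lg, of e] weak_gradient_test_integrable(1)[OF t lu lg, of e]
   unfolding set_integrable_def by (auto dest: borel_measurable_integrable)
  show "AE x in lborel. indicator U x *\<^sub>R (v x * fd \<phi> x e) = indicator U x *\<^sub>R (u x * fd \<phi> x e)"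
   using ae by eventually_elim (auto simp: indicator_def)
 qed
 then show "(LBINT x:U. v x * fd \<phi> x e) = - (LBINT x:U. (g x \<bullet> e) * \<phi> x)"
  using u te unfolding is_weak_gradient_def by simp
qed

text \<open>Functions that agree almost everywhere have the same weak gradients, so the choice
  operator selects the same one and the Dirichlet integrals agree literally.\<close>

lemma H1_AE_cong:
 assumes U: "open U" and u: "u \<in> H1 U" and v: "v \<in> borel_measurable (refl_measure U)" and ae: "AE x in refl_measure U. u x = v x"
 shows "v \<in> H1 U" "dirichlet_integral U u = dirichlet_integral U v"
proof -
 have um: "u \<in> borel_measurable (refl_measure U)" using u by (simp add: H1_iff L2_def)
 have ae': "AE x in lborel. x \<in> U --> u x = v x" using ae AE_refl[OF U] by simp
 then have ae'': "AE x in lborel. x \<in> U --> v x = u x" by eventually_elim auto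
 have eq: "is_weak_gradient U u = is_weak_gradient U v"
  using is_weak_gradient_AE_cong[OF ae' measurable_refl_open[OF U v]] is_weak_gradient_AE_cong[OF ae'' measurable_refl_open[OF U um]]
  by blast
 then have "weak_gradient U u = weak_gradient U v" by (simp add: weak_gradient_def)
 then show D: "dirichlet_integral U u = dirichlet_integral U v" by (simp add: dirichlet_integral_def fun_eq_iff)
 have "v \<in> Hd U" using u eq by (simp add: H1_iff Hd_def)
 moreover have "integrable (refl_measure U) (%x. (v x)^2)"
  by (rule integrable_cong_AE_imp[of _ "%x. (u x)^2"]) (use u v ae in \<open>auto simp: H1_iff L2_def\<close>)
 ultimately show "v \<in> H1 U" using v by (simp add: H1_iff L2_def)
qed

section \<open>Unit contraction and truncation at integer levels\<close>

abbreviation trunc :: "('a => real) => 'a => real" where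
 "trunc u \<equiv> (%x. min (max 0 (u x)) 1)"

definition lin_space :: "('a => real) set => bool" where
 "lin_space A \<longleftrightarrow> (\<forall>u\<in>A. \<forall>v\<in>A. \<forall>a b. (%x. a * u x + b * v x) \<in> A)"

definition clip :: "nat => real => real" where
 "clip k t = max (- real k) (min (real k) t)"

lemma clip_bounds: "\<bar>clip k t\<bar> <= real k" "\<bar>clip k t - t\<bar> <= \<bar>t\<bar>" "\<bar>clip k t\<bar> <= \<bar>t\<bar>"
 by (auto simp: clip_def max_def min_def abs_if)

lemma clip_id: "\<bar>t\<bar> <= real k ==> clip k t = t" by (auto simp: clip_def max_def min_def)

lemma clip_tendsto: "(%k. clip k t) \<longlonglongrightarrow> t"
proof -
 obtain N where N: "\<bar>t\<bar> <= real N" using real_arch_simple by blast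
 have "clip k t = t" if "k \<ge> N" for k by (rule clip_id) (use N that in linarith)
 then have "\<forall>\<^sub>F k in sequentially. clip k t = t" by (auto simp: eventually_sequentially)
 then show ?thesis by (rule tendsto_eventually)
qed

lemma continuous_on_clip: "continuous_on A (clip k)" unfolding clip_def by (intro continuous_intros)

lemma measurable_clip [measurable]: "clip k \<in> borel_measurable borel"
 by (rule borel_measurable_continuous_onI[OF continuous_on_clip])

lemma clip_tendsto_clip: "us \<longlonglongrightarrow> t ==> (%n. clip k (us n)) \<longlonglongrightarrow> clip k t"
 by (rule continuous_on_tendsto_compose[OF continuous_on_clip[of UNIV]]) auto

text \<open>Truncation at level k is built from the unit contractions of u/k and - u/k, so a linear
  space stable under the unit contraction is stable under \<open>clip\<close>. The summands
  \<open>0 * u x\<close> give the arguments the shape of linear combinations.\<close>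

lemma clip_eq_trunc:
 "(%x. clip k (u x)) = (%x. real k * trunc (%x. (1 / real k) * u x + 0 * u x) x + (- real k) * trunc (%x. (- (1 / real k)) * u x + 0 * u x) x)"
proof (cases "k = 0")
 case False
 then have k: "real k > 0" by simp
 have "clip k t = real k * min (max 0 (t / real k)) 1 - real k * min (max 0 (- t / real k)) 1" for t
 proof (cases "t \<ge> 0")
  case True
  then have "- t / real k <= 0" using k by (simp add: divide_nonpos_pos)
  then show ?thesis using True k by (auto simp: clip_def max_def min_def divide_simps split: if_splits)
 next
  case False
  then have "t / real k <= 0" using k by (simp add: divide_nonpos_pos)
  then show ?thesis using False k by (auto simp: clip_def max_def min_def divide_simps split: if_splits)
 qed
 then show ?thesis by (simp add: fun_eq_iff)
qed (simp add: clip_def)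

lemma clip_lin_trunc:
 assumes "lin_space A" "\<And>a. a \<in> A ==> trunc a \<in> A" "u \<in> A"
 shows "(%x. clip k (u x)) \<in> A"
proof -
 have l: "(%x. a * v x + b * w x) \<in> A" if "v \<in> A" "w \<in> A" for v w a b using assms(1) that unfolding lin_space_def by blast
 show ?thesis
  unfolding clip_eq_trunc by (rule l[OF assms(2)[OF l[OF assms(3,3)]] assms(2)[OF l[OF assms(3,3)]]])
qed

text \<open>The energy of a difference is at most twice the sum of the energies, and both scaled
  contractions have at most the energy of u: hence the 4. A constant factor does no harm in the
  later uses.\<close>

lemma Hd_clip:
 assumes U: "open U" and u: "u \<in> Hd U"
 shows "(%x. clip k (u x)) \<in> Hd U"
  "energy U (%x. clip k (u x)) <= 4 * energy U u"
proof -
 note p = psd_Hd[OF U]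
 have lin: "lin_space (Hd U)" unfolding lin_space_def using Hd_lincomb[OF U] by blast
 show "(%x. clip k (u x)) \<in> Hd U" by (rule clip_lin_trunc[OF lin Hd_trunc(1)[OF U] u])
 let ?r = "real k"
 let ?a = "trunc (%x. (1 / ?r) * u x + 0 * u x)" and ?b = "trunc (%x. (- (1 / ?r)) * u x + 0 * u x)"
 have D0: "0 <= energy U u" by (rule psdD(4)[OF p u u])
 have c: "energy U (%x. c * u x + 0 * u x) = c\<^sup>2 * energy U u" for c
  using psd_expand[OF p u u, of c 0] by simp
 have ab: "?a \<in> Hd U" "?b \<in> Hd U" by (rule Hd_trunc(1)[OF U Hd_lincomb[OF U u u]])+
 have a: "?r\<^sup>2 * energy U ?a <= energy U u"
 proof -
  have "?r\<^sup>2 * energy U ?a <= ?r\<^sup>2 * ((1 / ?r)^2 * energy U u)"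
   unfolding c[symmetric] by (rule mult_left_mono[OF Hd_trunc(2)[OF U Hd_lincomb[OF U u u]]]) simp
  also have "\<dots> <= energy U u" using D0 by (cases "k = 0") (auto simp: power_divide)
  finally show ?thesis .
 qed
 have b: "?r\<^sup>2 * energy U ?b <= energy U u"
 proof -
  have "?r\<^sup>2 * energy U ?b <= ?r\<^sup>2 * ((- (1 / ?r))^2 * energy U u)"
   unfolding c[symmetric] by (rule mult_left_mono[OF Hd_trunc(2)[OF U Hd_lincomb[OF U u u]]]) simp
  also have "\<dots> <= energy U u" using D0 by (cases "k = 0") (auto simp: power_divide)
  finally show ?thesis .
 qed
 have "0 <= energy U (%x. ?r * ?a x + ?r * ?b x)" by (rule psdD(4)[OF p psdD(1)[OF p ab] ab(1)])
 then have "0 <= ?r\<^sup>2 * energy U ?a + 2 * ?r * ?r * dirichlet_integral U ?a ?b + ?r\<^sup>2 * energy U ?b"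
  unfolding psd_expand[OF p ab] .
 moreover have "energy U (%x. clip k (u x)) =
   ?r\<^sup>2 * energy U ?a + 2 * ?r * (- ?r) * dirichlet_integral U ?a ?b + (- ?r)^2 * energy U ?b"
  unfolding clip_eq_trunc psd_expand[OF p ab] ..
 ultimately show "energy U (%x. clip k (u x)) <= 4 * energy U u" using a b by simp
qed

lemma L2_clip_tendsto:
 assumes "u \<in> L2 M"
 shows "null_seq (%k. L2_normsq M (%x. clip k (u x) - u x))"
proof -
 have m: "u \<in> borel_measurable M" using assms by (simp add: L2_def)
 have "(%k. \<integral>x. (clip k (u x) - u x)\<^sup>2 \<partial>M) \<longlonglongrightarrow> (\<integral>x. 0 \<partial>M)"
 proof (rule integral_dominated_convergence)
  show "integrable M (%x. (u x)^2)" using assms by (simp add: L2_def)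
  show "AE x in M. norm ((clip k (u x) - u x)^2) <= (u x)^2" for k
   using clip_bounds(2) by (intro AE_I2) (simp add: abs_le_square_iff[symmetric])
  show "AE x in M. null_seq (%k. (clip k (u x) - u x)\<^sup>2)"
   by (intro AE_I2) (use tendsto_power[OF LIM_zero[OF clip_tendsto], of _ 2] in simp)
 qed (use m in measurable)
 then show ?thesis by (simp add: L2_normsq_def)
qed

lemma L2_AE_subseq:
 assumes "\<And>n. (%x. d n x) \<in> L2 M" "null_seq (%n. L2_normsq M (d n))"
 shows "\<exists>r. strict_mono r \<and> (AE x in M. null_seq (%n. d (r n) x))"
proof -
 have "\<exists>r. strict_mono r \<and> (AE x in M. null_seq (%n. (d (r n) x)\<^sup>2))"
  by (rule tendsto_L1_AE_subseq) (use assms in \<open>auto simp: L2_def L2_normsq_def\<close>)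
 then obtain r where r: "strict_mono r" "AE x in M. null_seq (%n. (d (r n) x)\<^sup>2)" by blast
 have "AE x in M. null_seq (%n. d (r n) x)" using r(2)
 proof eventually_elim
  fix x assume "null_seq (%n. (d (r n) x)\<^sup>2)"
  then have "(%n. sqrt ((d (r n) x)^2)) \<longlonglongrightarrow> sqrt 0" by (rule tendsto_real_sqrt)
  then show "null_seq (%n. d (r n) x)" by (simp add: tendsto_rabs_zero_iff)
 qed
 then show ?thesis using r(1) by blast
qed

text \<open>Truncate u at a level n, approximate in L1, and truncate again. For functions bounded by
  n the squared difference is at most 2 n times the difference, so L1 closeness gives L2
  closeness.\<close>

lemma continuous_dense_L2:
 assumes U: "open U" "bounded U" and u: "u \<in> L2 (refl_measure U)" and "\<epsilon> > 0"
 shows "\<exists>v. continuous_on UNIV v \<and> L2_normsq (refl_measure U) (%x. u x - v x) < \<epsilon>"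
proof -
 let ?M = "refl_measure U"
 interpret finite_measure ?M by (rule finite_measure_refl[OF U])
 have um: "u \<in> borel_measurable ?M" using u by (simp add: L2_def)
 define c where "c = clip"
 have cm: "(%x. c n (u x)) \<in> borel_measurable ?M" for n unfolding c_def using um by measurable
 have cb: "\<bar>c n t\<bar> <= real n" for n t unfolding c_def by (rule clip_bounds(1))
 have "null_seq (%n. L2_normsq ?M (%x. u x - c n (u x)))"
  using L2_clip_tendsto[OF u] by (simp add: c_def L2_normsq_def power2_commute)
 from order_tendstoD(2)[OF this, of "\<epsilon>/4"] obtain n where n: "L2_normsq ?M (%x. u x - c n (u x)) < \<epsilon>/4"
  using \<open>\<epsilon> > 0\<close> by (auto simp: eventually_sequentially)
 define f where "f = (%x. indicator U x *\<^sub>R c n (u x))"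
 have fm: "bm f" unfolding f_def by (rule measurable_refl_open[OF U(1) cm])
 have "integrable ?M (%x. c n (u x))"
  by (rule integrable_const_bound[of _ "real n"]) (use cb(1) cm in auto)
 then have fi: "integrable lborel f" using integral_refl(1)[OF U(1) cm] by (simp add: f_def set_integrable_def)
 \<comment> \<open>Makes 2 n \<delta> at most \<epsilon>/4; the added 1 covers n = 0.\<close>
 define \<delta> where "\<delta> = \<epsilon> / (8 * (real n + 1))"
 have d: "\<delta> > 0" using \<open>\<epsilon> > 0\<close> by (simp add: \<delta>_def)
 have "L1_approx f" by (rule integrable_L1_approx[OF fi])
 then obtain \<phi> K where p: "continuous_on UNIV \<phi>" "(nnl (%x. norm (f x - \<phi> x))) < ennreal \<delta>"
  unfolding L1_approx_def using d by meson
 have pm: "bm \<phi>" using p(1) by (rule borel_measurable_continuous_onI)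
 define v where "v = (%x. c n (\<phi> x))"
 have cv: "continuous_on UNIV v" unfolding v_def c_def by (rule continuous_on_compose2[OF continuous_on_clip[of UNIV] p(1)]) simp
 have vm: "v \<in> borel_measurable ?M" by (rule continuous_measurable_refl[OF continuous_on_subset[OF cv]]) simp
 have cvL: "v \<in> L2 ?M" by (rule bounded_in_L2[OF finite_measure_refl[OF U] vm, where C = "real n"]) (use cb in \<open>simp add: v_def\<close>)
 have cL: "(%x. c n (u x)) \<in> L2 ?M" by (rule bounded_in_L2[OF finite_measure_refl[OF U] cm, where C = "real n"]) (use cb in simp)
 have ifp: "integrable lborel (%x. norm (f x - \<phi> x))"
  by (rule integrableI_bounded) (use p(2) fm pm in \<open>auto simp: less_trans[OF _ ennreal_less_top]\<close>)
 have dL: "(%x. c n (u x) - v x) \<in> L2 ?M" by (rule psd_diff[OF psd_L2 cL cvL])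
 have "L2_normsq ?M (%x. c n (u x) - v x) = (LBINT x:U. (c n (u x) - v x)\<^sup>2)" by (rule L2_refl_facts(2)[OF U(1) dL])
 also have "\<dots> <= (LINT x|lborel. (2 * real n) * norm (f x - \<phi> x))" unfolding set_lebesgue_integral_def
 proof (rule integral_mono)
  show "integrable lborel (%x. indicator U x *\<^sub>R (c n (u x) - v x)\<^sup>2)"
   using L2_refl_facts(1)[OF U(1) dL] by (simp add: set_integrable_def)
  show "integrable lborel (%x. (2 * real n) * norm (f x - \<phi> x))" using ifp by (rule integrable_mult_right)
  show "indicator U x *\<^sub>R (c n (u x) - v x)\<^sup>2 <= (2 * real n) * norm (f x - \<phi> x)" for x
  proof (cases "x \<in> U")
   case True
   have cc: "c n (c n t) = c n t" for t by (auto simp: c_def clip_def max_def min_def)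
   have lip: "\<bar>c n s - c n t\<bar> <= \<bar>s - t\<bar>" for s t by (auto simp: c_def clip_def max_def min_def abs_if)
   have 1: "\<bar>c n (u x) - v x\<bar> <= 2 * real n" using cb(1)[of n "u x"] cb(1)[of n "\<phi> x"] unfolding v_def by linarith
   have 2: "\<bar>c n (u x) - v x\<bar> <= norm (f x - \<phi> x)" using lip[of "c n (u x)" "\<phi> x"] True by (simp add: v_def cc f_def)
   have "(c n (u x) - v x)^2 = \<bar>c n (u x) - v x\<bar> * \<bar>c n (u x) - v x\<bar>" by (simp add: power2_eq_square)
   also have "\<dots> <= (2 * real n) * norm (f x - \<phi> x)" by (intro mult_mono 1 2) auto
   finally show ?thesis using True by simp
  qed simp
 qed
 also have "\<dots> = (2 * real n) * (LINT x|lborel. norm (f x - \<phi> x))" by simp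
 also have "\<dots> <= (2 * real n) * \<delta>"
 proof (intro mult_left_mono)
  have "ennreal (LINT x|lborel. norm (f x - \<phi> x)) < ennreal \<delta>"
   using p(2) nn_integral_eq_integral[OF ifp] by simp
  then show "(LINT x|lborel. norm (f x - \<phi> x)) <= \<delta>" using d by (simp add: ennreal_less_iff integral_nonneg_AE)
 qed simp
 also have "\<dots> <= \<epsilon> / 4" using \<open>\<epsilon> > 0\<close> by (simp add: \<delta>_def field_simps)
 finally have 2: "L2_normsq ?M (%x. c n (u x) - v x) <= \<epsilon> / 4" .
 have "L2_normsq ?M (%x. u x - v x) <= 2 * L2_normsq ?M (%x. u x - c n (u x)) + 2 * L2_normsq ?M (%x. c n (u x) - v x)"
  unfolding L2_normsq_eq by (rule psd_triangle[OF psd_L2 u cL cvL])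
 then show ?thesis using n 2 cv by (intro exI[of _ v]) auto
qed

section \<open>Closures of cores in the Sobolev space\<close>

definition clH :: "complex set => (complex => real) set => (complex => real) set" where
 "clH U A = {u \<in> H1 U. \<forall>\<epsilon>>0. \<exists>a\<in>A. E1sq U (%x. u x - a x) < \<epsilon>}"

lemma clH_seq:
 assumes "u \<in> clH U A"
 shows "\<exists>a. \<forall>n. a n \<in> A \<and> E1sq U (%x. u x - a n x) < 1 / 2 ^ n"
proof -
 have "\<exists>a\<in>A. E1sq U (%x. u x - a x) < 1 / 2 ^ n" for n :: nat using assms unfolding clH_def by auto
 then show ?thesis by (intro choice allI) blast
qed

lemma half_power_tendsto: "null_seq (%n. 1 / 2 ^ n :: real)"
 using LIMSEQ_power_zero[of "1/2::real"] by (simp add: power_one_over)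

lemma clH_I:
 assumes U: "open U" and A: "A \<subseteq> H1 U" and u: "u \<in> H1 U" and us: "\<And>n. us n \<in> clH U A"
  and l: "null_seq (%n. E1sq U (%x. us n x - u x))"
 shows "u \<in> clH U A"
proof -
 note p = psd_E1[OF U]
 have "\<exists>a\<in>A. E1sq U (%x. u x - a x) < \<epsilon>" if e: "\<epsilon> > 0" for \<epsilon>
 proof -
  obtain n where n: "E1sq U (%x. us n x - u x) < \<epsilon> / 4"
   using order_tendstoD(2)[OF l, of "\<epsilon>/4"] e by (auto simp: eventually_sequentially)
  have "\<epsilon> / 4 > 0" using e by simp
  then obtain a where a: "a \<in> A" "E1sq U (%x. us n x - a x) < \<epsilon> / 4"
   using us[of n] unfolding clH_def by blast
  have H: "us n \<in> H1 U" "a \<in> H1 U" using us[of n] a(1) A by (auto simp: clH_def)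
  have "E1sq U (%x. u x - a x) <= 2 * E1sq U (%x. u x - us n x) + 2 * E1sq U (%x. us n x - a x)"
   by (rule psd_triangle[OF p u H])
  also have "E1sq U (%x. u x - us n x) = E1sq U (%x. us n x - u x)"
   by (rule psd_diff_commute[OF p u H(1)])
  finally show ?thesis using n a by (intro bexI[of _ a]) auto
 qed
 then show ?thesis using u by (simp add: clH_def)
qed

lemma clH_superset:
 assumes U: "open U" and A: "A \<subseteq> H1 U" shows "A \<subseteq> clH U A"
proof
 fix a assume a: "a \<in> A"
 then have "E1sq U (%x. a x - a x) = 0" using psd_diff_expand[OF psd_E1[OF U], of a a] A by auto
 then show "a \<in> clH U A" using a A by (auto simp: clH_def intro!: bexI[of _ a])
qed

lemma clH_lincomb:
 assumes U: "open U" and A: "A \<subseteq> H1 U" "lin_space A" and u: "u \<in> clH U A" and v: "v \<in> clH U A"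
 shows "(%x. a * u x + b * v x) \<in> clH U A"
proof -
 note p = psd_E1[OF U]
 have H: "u \<in> H1 U" "v \<in> H1 U" using u v by (auto simp: clH_def)
 let ?w = "%x. a * u x + b * v x"
 have w: "?w \<in> H1 U" by (rule psdD(1)[OF p H])
 have "\<exists>c\<in>A. E1sq U (%x. ?w x - c x) < \<epsilon>" if e: "\<epsilon> > 0" for \<epsilon>
 proof -
  \<comment> \<open>Dominates both squared coefficients; the added 1 keeps it positive when they
    vanish.\<close>
  define q where "q = a\<^sup>2 + b\<^sup>2 + 1"
  define \<delta> where "\<delta> = \<epsilon> / (4 * q)"
  have pos: "q > 0" unfolding q_def by (intro add_nonneg_pos add_nonneg_nonneg) auto
  have "\<delta> > 0" using e pos by (simp add: \<delta>_def)
  then obtain c d where c: "c \<in> A" "E1sq U (%x. u x - c x) < \<delta>"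
   and d: "d \<in> A" "E1sq U (%x. v x - d x) < \<delta>" using u v unfolding clH_def by blast
  have cd: "c \<in> H1 U" "d \<in> H1 U" using c d A by auto
  let ?f = "%x. u x - c x" and ?g = "%x. v x - d x"
  have f: "?f \<in> H1 U" and g: "?g \<in> H1 U" using psd_diff[OF p] H cd by auto
  have h: "(%x. a * c x + b * d x) \<in> A" using A(2) c d by (auto simp: lin_space_def)
  have "E1sq U (%x. a * ?f x - (- b) * ?g x) <= 2 * (a\<^sup>2 * E1sq U ?f) + 2 * (b\<^sup>2 * E1sq U ?g)"
  proof -
   have "0 <= E1sq U (%x. a * ?f x + (- b) * ?g x)" by (rule psdD(4)[OF p psdD(1)[OF p f g] f])
   then show ?thesis unfolding psd_expand[OF p f g] using psd_expand[OF p f g, of a b] by simp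
  qed
  moreover have "(%x. a * ?f x - (- b) * ?g x) = (%x. ?w x - (a * c x + b * d x))" by (auto simp: algebra_simps)
  ultimately have "E1sq U (%x. ?w x - (a * c x + b * d x)) <= 2 * (a\<^sup>2 * E1sq U ?f) + 2 * (b\<^sup>2 * E1sq U ?g)" by simp
  also have "\<dots> <= 2 * (a\<^sup>2 * \<delta>) + 2 * (b\<^sup>2 * \<delta>)" using c(2) d(2) by (intro add_mono mult_left_mono) auto
  also have "\<dots> <= 2 * (q * \<delta>)" using \<open>\<delta> > 0\<close> by (simp add: q_def algebra_simps)
  also have "\<dots> = \<epsilon> / 2" using pos by (simp add: \<delta>_def)
  finally show ?thesis using h e by (intro bexI[OF _ h]) auto
 qed
 then show ?thesis using w by (simp add: clH_def)
qed

lemma tail_mid_lin_space: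
 assumes "s \<in> tail_mid us n" "lin_space A" "\<And>k. us k \<in> A" shows "s \<in> A"
proof (rule tail_mid_invariant[OF assms(1)])
 show "us k \<in> A" for k by (rule assms(3))
 fix v w assume "v \<in> A" "w \<in> A"
 then have "(%x. (1/2) * v x + (1/2) * w x) \<in> A" using assms(2) unfolding lin_space_def by blast
 moreover have "(%x. (1/2) * v x + (1/2) * w x) = (%x. (v x + w x) / 2)" by (auto simp: field_simps)
 ultimately show "(%x. (v x + w x) / 2) \<in> A" by (simp only:)
qed

lemma clH_mazur:
 assumes U: "open U" and A: "A \<subseteq> H1 U" "lin_space A" and us: "\<And>n. us n \<in> clH U A"
  and C: "\<And>n. energy U (us n) <= C"
  and u: "u \<in> L2 (refl_measure U)" and l: "null_seq (%n. L2_normsq (refl_measure U) (%x. us n x - u x))"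
 shows "u \<in> clH U A" "energy U u <= C"
proof -
 have H: "us n \<in> H1 U" for n using us[of n] by (simp add: clH_def)
 note m = H1_mazur[where us = us and u = u and C = C, OF U H C u l]
 from m(3) obtain s where s: "\<forall>n. s n \<in> tail_mid us n"
  "null_seq (%n. E1sq U (%x. s n x - u x))" by (elim exE conjE)
 have "lin_space (clH U A)" unfolding lin_space_def using clH_lincomb[OF U A] by blast
 then have "s n \<in> clH U A" for n using tail_mid_lin_space[OF spec[OF s(1), of n]] us by blast
 from clH_I[where us = s and u = u, OF U A(1) m(1) this s(2)] show "u \<in> clH U A" .
 show "energy U u <= C" by (rule m(2))
qed

lemma trunc_H1:
 assumes U: "open U" and u: "u \<in> H1 U"
 shows "trunc u \<in> H1 U" "energy U (trunc u) <= energy U u"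
proof -
 have hd: "u \<in> Hd U" and l2: "u \<in> L2 (refl_measure U)" using u by (auto simp: H1_iff)
 have m: "u \<in> borel_measurable (refl_measure U)" using l2 by (simp add: L2_def)
 have "trunc u \<in> L2 (refl_measure U)"
 proof -
  have "integrable (refl_measure U) (%x. (trunc u x)^2)"
  proof (rule Bochner_Integration.integrable_bound)
   show "integrable (refl_measure U) (%x. (u x)^2)" using l2 by (simp add: L2_def)
   show "AE x in refl_measure U. norm ((trunc u x)^2) <= norm ((u x)^2)"
    by (intro AE_I2) (simp add: abs_le_square_iff[symmetric] abs_if)
  qed (use m in measurable)
  then show ?thesis using m by (simp add: L2_def)
 qed
 then show "trunc u \<in> H1 U" using Hd_trunc(1)[OF U hd] by (simp add: H1_iff)
 show "energy U (trunc u) <= energy U u" by (rule Hd_trunc(2)[OF U hd])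
qed

lemma psd_bound:
 assumes p: "psd H B" and u: "u \<in> H" and v: "v \<in> H"
 shows "B v v <= 2 * B u u + 2 * B (%x. u x - v x) (%x. u x - v x)"
proof -
 have "0 <= B (%x. 2 * u x + (-1) * v x) (%x. 2 * u x + (-1) * v x)"
  by (rule psdD(4)[OF p psdD(1)[OF p u v] u])
 then show ?thesis unfolding psd_expand[OF p u v] psd_diff_expand[OF p u v] by simp
qed

lemma psd_convergent_Cauchy:
 assumes p: "psd H B" and us: "\<And>n. us n \<in> H" and u: "u \<in> H"
  and l: "null_seq (%n. B (%x. us n x - u x) (%x. us n x - u x))"
 shows "seq_Cauchy_for (%w. B w w) us" unfolding seq_Cauchy_for_def
proof (intro allI impI)
 fix \<epsilon> :: real assume "\<epsilon> > 0"
 then have "\<epsilon> / 4 > 0" by simp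
 from order_tendstoD(2)[OF l this]
 obtain N where N: "\<And>n. n \<ge> N ==> B (%x. us n x - u x) (%x. us n x - u x) < \<epsilon> / 4"
  unfolding eventually_sequentially by blast
 have "B (%x. us m x - us n x) (%x. us m x - us n x) < \<epsilon>" if "m \<ge> N" "n \<ge> N" for m n
 proof -
  have "B (%x. us m x - us n x) (%x. us m x - us n x) <= 2 * B (%x. us m x - u x) (%x. us m x - u x) + 2 * B (%x. u x - us n x) (%x. u x - us n x)"
   by (rule psd_triangle[OF p us u us])
  also have "B (%x. u x - us n x) (%x. u x - us n x) = B (%x. us n x - u x) (%x. us n x - u x)" by (rule psd_diff_commute[OF p u us])
  finally show ?thesis using N[OF that(1)] N[OF that(2)] by linarith
 qed
 then show "\<exists>N. \<forall>m\<ge>N. \<forall>n\<ge>N. B (%x. us m x - us n x) (%x. us m x - us n x) < \<epsilon>" by blast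
qed

lemma H1_measurable: "u \<in> H1 U ==> u \<in> borel_measurable (refl_measure U)" by (simp add: H1_iff L2_def)

text \<open>Truncated at level k the sequence is bounded, so on the finite measure space almost
  everywhere convergence becomes L2 convergence, and Mazur's lemma, fed by the energy bound, puts
  the truncation of u in the closure. A second application of Mazur's lemma lets k tend to
  infinity.\<close>

lemma clH_AE_limit:
 assumes U: "open U" "bounded U" and A: "A \<subseteq> H1 U" "lin_space A" "\<And>a. a \<in> A ==> trunc a \<in> A"
  and us: "\<And>n. us n \<in> A" and C: "\<And>n. energy U (us n) <= C"
  and u: "u \<in> L2 (refl_measure U)" and l: "AE x in refl_measure U. (%n. us n x) \<longlonglongrightarrow> u x"
 shows "u \<in> clH U A"
proof -
 let ?M = "refl_measure U"
 have fin: "finite_measure ?M" by (rule finite_measure_refl[OF U])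
 have um: "u \<in> borel_measurable ?M" using u by (simp add: L2_def)
 have usH: "us n \<in> Hd U" for n using us A(1) H1_iff by blast
 have k: "(%x. clip k (u x)) \<in> clH U A \<and> energy U (%x. clip k (u x)) <= 4 * C" for k
 proof -
  let ?z = "%n x. clip k (us n x)"
  have zA: "?z n \<in> A" for n by (rule clip_lin_trunc[OF A(2,3) us])
  have z: "?z n \<in> clH U A" for n using clH_superset[OF U(1) A(1)] zA by blast
  have D: "energy U (?z n) <= 4 * C" for n using Hd_clip(2)[OF U(1) usH[of n], of k] C[of n] by linarith
  have L: "(%x. clip k (u x)) \<in> L2 ?M"
   by (rule bounded_in_L2[OF fin, where C = "real k"]) (use um clip_bounds in measurable)
  have "null_seq (%n. L2_normsq ?M (%x. ?z n x - clip k (u x)))"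
  proof (rule L2_normsq_tendsto_bounded[OF fin])
   show "?z n \<in> borel_measurable ?M" for n using zA A(1) H1_measurable by blast
   show "(%x. clip k (u x)) \<in> borel_measurable ?M" using um by measurable
   show "\<bar>?z n x - clip k (u x)\<bar> <= 2 * real k" for n x
    using clip_bounds(1)[of k "us n x"] clip_bounds(1)[of k "u x"] by linarith
   show "AE x in ?M. (%n. ?z n x) \<longlonglongrightarrow> clip k (u x)" using l by eventually_elim (rule clip_tendsto_clip)
  qed
  from clH_mazur[where us = ?z and u = "%x. clip k (u x)" and C = "4 * C", OF U(1) A(1,2) z D L this] show ?thesis by blast
 qed
 have kc: "(%x. clip k (u x)) \<in> clH U A" and kD: "energy U (%x. clip k (u x)) <= 4 * C" for k using k by auto
 show ?thesis
  by (rule clH_mazur(1)[where us = "%k x. clip k (u x)" and u = u and C = "4 * C", OF U(1) A(1,2) kc kD u L2_clip_tendsto[OF u]])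
qed

lemma clH_AE_seq:
 assumes U: "open U" and A: "A \<subseteq> H1 U" and u: "u \<in> clH U A"
 shows "\<exists>a. (\<forall>n. a n \<in> A) \<and> null_seq (%n. E1sq U (%x. a n x - u x)) \<and>
  (AE x in refl_measure U. (%n. a n x) \<longlonglongrightarrow> u x)"
proof -
 note p = psd_E1[OF U]
 have uH: "u \<in> H1 U" using u by (simp add: clH_def)
 from clH_seq[OF u] obtain a where a0: "\<forall>n. a n \<in> A \<and> E1sq U (%x. u x - a n x) < 1 / 2 ^ n" by (elim exE)
 then have aA: "a n \<in> A" and al: "E1sq U (%x. u x - a n x) < 1 / 2 ^ n" for n by auto
 have aH: "a n \<in> H1 U" for n using aA A by blast
 have dH: "(%x. a n x - u x) \<in> H1 U" for n by (rule psd_diff[OF p aH uH])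
 have l: "null_seq (%n. E1sq U (%x. a n x - u x))"
 proof (rule tendsto_sandwich[OF _ _ tendsto_const half_power_tendsto])
  show "\<forall>\<^sub>F n in sequentially. E1sq U (%x. a n x - u x) <= 1 / 2 ^ n"
   using al psd_diff_commute[OF p aH uH] by (intro always_eventually allI) (simp add: less_imp_le)
  show "\<forall>\<^sub>F n in sequentially. 0 <= E1sq U (%x. a n x - u x)"
   by (intro always_eventually allI psdD(4)[OF p dH dH])
 qed
 have "null_seq (%n. L2_normsq (refl_measure U) (%x. a n x - u x))"
  by (rule E1_tendsto_parts(2)[where us = "%n x. a n x - u x", OF U dH l])
 moreover have "(%x. a n x - u x) \<in> L2 (refl_measure U)" for n using dH H1_iff by blast
 ultimately have "\<exists>r. strict_mono r \<and> (AE x in refl_measure U. null_seq (%n. a (r n) x - u x))"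
  by (rule L2_AE_subseq[rotated])
 then obtain r where r: "strict_mono r" "AE x in refl_measure U. null_seq (%n. a (r n) x - u x)" by (elim exE conjE)
 have "null_seq (%n. E1sq U (%x. a (r n) x - u x))"
  using LIMSEQ_subseq_LIMSEQ[OF l r(1)] by (simp add: o_def)
 moreover have "AE x in refl_measure U. (%n. a (r n) x) \<longlonglongrightarrow> u x" using r(2) by eventually_elim (rule LIM_zero_cancel)
 ultimately show ?thesis using aA by (intro exI[of _ "%n. a (r n)"]) simp
qed

lemma E1_convergent_bounded:
 assumes U: "open U" and us: "\<And>n. us n \<in> H1 U" and u: "u \<in> H1 U"
  and l: "null_seq (%n. E1sq U (%x. us n x - u x))"
 shows "\<exists>C. \<forall>n. energy U (us n) <= C"
proof -
 note p = psd_H1[OF U]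
 have D: "null_seq (%n. energy U (%x. us n x - u x))"
  by (rule E1_tendsto_parts(1)[where us = "%n x. us n x - u x", OF U psd_diff[OF p us u] l])
 have "(%n. energy U (us n)) \<longlonglongrightarrow> energy U u"
  by (rule psd_tendsto[where us = us and vs = us and u = u and v = u, OF p us us u u D D])
 then have "Bseq (%n. energy U (us n))" by (intro convergent_imp_Bseq convergentI)
 then obtain C where "\<forall>n. norm (energy U (us n)) <= C" by (auto elim: BseqE)
 then show ?thesis by (metis abs_le_D1 real_norm_def)
qed

text \<open>The contractions of an approximating sequence converge almost everywhere and keep
  bounded energy, which is all that \<open>clH_AE_limit\<close> asks.\<close>

lemma clH_trunc:
 assumes U: "open U" "bounded U" and A: "A \<subseteq> H1 U" "lin_space A" and t: "\<And>a. a \<in> A ==> trunc a \<in> A" and u: "u \<in> clH U A"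
 shows "trunc u \<in> clH U A"
proof -
 from clH_AE_seq[OF U(1) A(1) u] obtain a where a: "\<forall>n. a n \<in> A" "null_seq (%n. E1sq U (%x. a n x - u x))"
  "AE x in refl_measure U. (%n. a n x) \<longlonglongrightarrow> u x" by (elim exE conjE)
 have uH: "u \<in> H1 U" using u by (simp add: clH_def)
 have aH: "a n \<in> H1 U" for n using a(1) A(1) by blast
 from E1_convergent_bounded[where us = a and u = u, OF U(1) aH uH a(2)] obtain C
  where C: "\<forall>n. energy U (a n) <= C" by (elim exE)
 have C': "energy U (trunc (a n)) <= C" for n
  using trunc_H1(2)[OF U(1) aH[of n]] C[rule_format, of n] by linarith
 have l: "AE x in refl_measure U. (%n. trunc (a n) x) \<longlonglongrightarrow> trunc u x"
  using a(3) by eventually_elim (intro tendsto_intros)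
 have "trunc u \<in> L2 (refl_measure U)" using trunc_H1(1)[OF U(1) uH] by (simp add: H1_iff)
 from clH_AE_limit[where us = "%n. trunc (a n)" and u = "trunc u" and C = C, OF U A t t[OF a(1)[rule_format]] C' this l]
 show ?thesis .
qed

section \<open>Regular Dirichlet forms generated by cores\<close>

definition gen_form :: "complex set => (complex => real) set => complex form" where
 "gen_form U F = form_on (%u v. 1/2 * dirichlet_integral U u v) F"

lemma gen_form_simps [simp]:
 "snd (gen_form U F) = F"
 "u \<in> F ==> v \<in> F ==> fst (gen_form U F) u v = 1/2 * dirichlet_integral U u v"
 by (auto simp: gen_form_def form_on_def)

lemma refl_BM_form_eq: "refl_BM_form U = gen_form U (H1 U)" by (simp add: refl_BM_form_def gen_form_def)

text \<open>The closures in question are compact, so that \<open>Cc\<close> consists of all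
  continuous functions on them.\<close>

definition uniformly_dense :: "complex set => (complex => real) set => bool" where
 "uniformly_dense X A \<longleftrightarrow> (\<forall>w. continuous_on X w --> (\<forall>\<epsilon>>0. \<exists>a\<in>A. \<forall>x\<in>X. \<bar>w x - a x\<bar> < \<epsilon>))"

lemma Cc_compact: "compact X ==> u \<in> Cc X \<longleftrightarrow> continuous_on X u" by (auto simp: Cc_def)

text \<open>Source of all regular Dirichlet forms below: reflecting Brownian motion, the conformal
  transforms and the proper subspace are closures of different cores A.\<close>

lemma regular_closure:
 assumes U: "open U" "bounded U" and A: "A \<subseteq> H1 U" "lin_space A" "\<And>a. a \<in> A ==> continuous_on (closure U) a"
  and t: "\<And>a. a \<in> A ==> trunc a \<in> A" and dense: "uniformly_dense (closure U) A"
 shows "regular_dirichlet_form (refl_measure U) (gen_form U (clH U A))"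
proof -
 let ?M = "refl_measure U" and ?F = "clH U A"
 define E where "E = fst (gen_form U ?F)"
 have gf: "gen_form U ?F = (E, ?F)" by (simp add: E_def prod_eq_iff)
 have Eq: "E u v = 1/2 * dirichlet_integral U u v" if "u \<in> ?F" "v \<in> ?F" for u v using that by (simp add: E_def)
 note p = psd_H1[OF U(1)]
 have FH: "?F \<subseteq> H1 U" by (auto simp: clH_def)
 have lc: "(%x. a * u x + b * v x) \<in> ?F" if "u \<in> ?F" "v \<in> ?F" for u v a b
  by (rule clH_lincomb[OF U(1) A(1,2) that])
 have f1: "form1 ?M E u = E1sq U u" if "u \<in> ?F" for u using Eq[OF that that] by (simp add: form1_def E1_self)
 have diff: "(%x. u x - v x) \<in> ?F" if "u \<in> ?F" "v \<in> ?F" for u v using lc[OF that, of 1 "-1"] by simp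
 have AF: "A \<subseteq> ?F" by (rule clH_superset[OF U(1) A(1)])
 have fin: "finite_measure ?M" by (rule finite_measure_refl[OF U])
 have cpt: "compact (closure U)" using U(2) by (simp add: compact_closure)
 have sym: "symmetric_form ?M (E, ?F)" unfolding symmetric_form_def prod.case
 proof (intro conjI ballI allI impI)
  show "?F \<subseteq> L2 ?M" using FH by (auto simp: H1_iff)
  \<comment> \<open>Membership in the closure depends only on the distances to elements of A, and
    these do not change under modification on null sets.\<close>
  show "ae_invariant ?M (E, ?F)" unfolding ae_invariant_def prod.case
  proof (intro ballI impI)
   fix u v assume u: "u \<in> ?F" and v: "v \<in> borel_measurable ?M" and ae: "AE x in ?M. u x = v x"
   have uH: "u \<in> H1 U" using u FH by blast
   note c = H1_AE_cong[OF U(1) uH v ae]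
   have vF: "v \<in> ?F"
   proof -
    have "E1sq U (%x. v x - a x) = E1sq U (%x. u x - a x)" if "a \<in> A" for a
    proof -
     have aH: "a \<in> H1 U" using that A by blast
     have am: "a \<in> borel_measurable ?M" using aH by (simp add: H1_iff L2_def)
     have um: "u \<in> borel_measurable ?M" using uH by (simp add: H1_iff L2_def)
     have ae2: "AE x in ?M. u x - a x = v x - a x" using ae by eventually_elim simp
     have dm: "(%x. v x - a x) \<in> borel_measurable ?M" "(%x. u x - a x) \<in> borel_measurable ?M" using v um am by auto
     note c2 = H1_AE_cong[OF U(1) psd_diff[OF p uH aH] dm(1) ae2]
     have ds: "dirichlet_integral U f g = dirichlet_integral U g f" for f g by (simp add: dirichlet_integral_def inner_commute)
     have "energy U (%x. v x - a x) = energy U (%x. u x - a x)" using c2(2) ds by metis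
     moreover have "L2_normsq ?M (%x. v x - a x) = L2_normsq ?M (%x. u x - a x)"
      unfolding L2_normsq_def by (rule integral_cong_AE) (use dm ae2 in auto)
     ultimately show ?thesis by (simp add: E1_self)
    qed
    then show ?thesis using u c(1) by (simp add: clH_def)
   qed
   have "E u w = E v w" if "w \<in> ?F" for w unfolding Eq[OF u that] Eq[OF vF that] c(2) ..
   then show "v \<in> ?F \<and> (\<forall>w\<in>?F. E u w = E v w)" using vF by blast
  qed
  show "form_on E ?F = (E, ?F)" by (auto simp: form_on_def E_def gen_form_def fun_eq_iff)
  show "(%x. a * u x + b * v x) \<in> ?F" if "u \<in> ?F" "v \<in> ?F" for u v a b by (rule lc[OF that])
  show "\<exists>v\<in>?F. L2_normsq ?M (%x. u x - v x) < \<epsilon>" if u: "u \<in> L2 ?M" and e: "0 < \<epsilon>" for u \<epsilon>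
  proof -
   have "\<epsilon> / 4 > 0" using e by simp
   from continuous_dense_L2[OF U u this] obtain v where v: "continuous_on UNIV v" "L2_normsq ?M (%x. u x - v x) < \<epsilon> / 4" by blast
   define m where "m = measure ?M (space ?M)"
   \<comment> \<open>At most 1, so that the squared error is at most \<delta>; the second bound
     absorbs the total mass m.\<close>
   define \<delta> where "\<delta> = min 1 (\<epsilon> / (4 * (m + 1)))"
   have m0: "m \<ge> 0" by (simp add: m_def)
   have d: "\<delta> > 0" "\<delta> <= 1" "\<delta> <= \<epsilon> / (4 * (m + 1))" using e m0 by (auto simp: \<delta>_def)
   have "continuous_on (closure U) v" using v(1) continuous_on_subset by blast
   then obtain a where a: "a \<in> A" "\<And>x. x \<in> closure U ==> \<bar>v x - a x\<bar> < \<delta>"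
    using dense d(1) unfolding uniformly_dense_def by blast
   have vm: "v \<in> borel_measurable ?M" by (rule continuous_measurable_refl[OF continuous_on_subset[OF v(1)]]) simp
   have aL: "a \<in> L2 ?M" using a(1) A by (auto simp: H1_iff)
   have dm: "(%x. v x - a x) \<in> borel_measurable ?M" using vm aL by (auto simp: L2_def)
   have dL: "(%x. v x - a x) \<in> L2 ?M"
    by (rule bounded_in_L2[OF fin dm, of \<delta>]) (use a(2) space_refl in \<open>auto simp: less_imp_le\<close>)
   have vL: "v \<in> L2 ?M" using psdD(1)[OF psd_L2 dL aL, of 1 1] by simp
   have "L2_normsq ?M (%x. v x - a x) <= (\<integral>x. \<delta> \<partial>?M)" unfolding L2_normsq_def
   proof (rule integral_mono_AE)
    show "integrable ?M (%x. (v x - a x)^2)" using dL by (simp add: L2_def)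
    show "integrable ?M (%x. \<delta>)" using finite_measure.integrable_const[OF fin] by blast
    show "AE x in ?M. (v x - a x)\<^sup>2 <= \<delta>"
    proof (rule AE_I2)
     fix x assume "x \<in> space ?M"
     then have "\<bar>v x - a x\<bar> <= \<delta>" using a(2) space_refl by (simp add: less_imp_le)
     then have "\<bar>v x - a x\<bar> * \<bar>v x - a x\<bar> <= \<delta> * 1" using d by (intro mult_mono) auto
     then show "(v x - a x)^2 <= \<delta>" by (simp add: power2_eq_square)
    qed
   qed
   also have "\<dots> = m * \<delta>" by (simp add: m_def)
   also have "\<dots> <= m * (\<epsilon> / (4 * (m + 1)))" using d(3) m0 by (rule mult_left_mono)
   also have "\<dots> <= \<epsilon> / 4" using m0 e by (simp add: field_simps)
   finally have "L2_normsq ?M (%x. v x - a x) <= \<epsilon> / 4" .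
   moreover have "L2_normsq ?M (%x. u x - a x) <= 2 * L2_normsq ?M (%x. u x - v x) + 2 * L2_normsq ?M (%x. v x - a x)"
    unfolding L2_normsq_eq by (rule psd_triangle[OF psd_L2 u vL aL])
   ultimately show ?thesis using v(2) a(1) AF by (intro bexI[of _ a]) auto
  qed
  show "E (%x. a * u x + b * v x) w = a * E u w + b * E v w" if "u \<in> ?F" "v \<in> ?F" "w \<in> ?F" for u v w a b
  proof -
   have "u \<in> H1 U" "v \<in> H1 U" "w \<in> H1 U" using that FH by auto
   note l = psdD(2)[OF p this(1,2) this(3), of a b]
   show ?thesis
    unfolding Eq[OF that(1,3)] Eq[OF that(2,3)] Eq[OF lc[OF that(1,2)] that(3)] l by (simp add: algebra_simps)
  qed
  show "E u v = E v u" if "u \<in> ?F" "v \<in> ?F" for u v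
  proof -
   have "u \<in> H1 U" "v \<in> H1 U" using that FH by auto
   from psdD(3)[OF p this] show ?thesis unfolding Eq[OF that] Eq[OF that(2,1)] by simp
  qed
  show "0 <= E u u" if "u \<in> ?F" for u
  proof -
   have "u \<in> H1 U" using that FH by auto
   from psdD(4)[OF p this this] show ?thesis unfolding Eq[OF that that] by simp
  qed
 qed
 have closed: "closed_form ?M (E, ?F)" unfolding closed_form_def prod.case
 proof (intro allI impI)
  fix us assume us: "(\<forall>n. us n \<in> ?F) \<and> seq_Cauchy_for (form1 ?M E) us"
  then have F: "us n \<in> ?F" for n by blast
  have H: "us n \<in> H1 U" for n using F FH by blast
  have "seq_Cauchy_for (%w. E1sq U w) us"
   using us f1[OF diff[OF F F]] unfolding seq_Cauchy_for_def by simp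
  from H1_complete[where us = us, OF U(1) H this] obtain u where u: "u \<in> H1 U" "null_seq (%n. E1sq U (%x. us n x - u x))" by blast
  have uF: "u \<in> ?F" by (rule clH_I[where us = us and u = u, OF U(1) A(1) u(1) F u(2)])
  show "\<exists>u\<in>?F. null_seq (%n. form1 ?M E (%x. us n x - u x))"
   using uF u(2) f1[OF diff[OF F uF]] by (intro bexI[of _ u]) auto
 qed
 have mark: "markovian (E, ?F)" unfolding markovian_def prod.case Let_def
 proof (intro ballI conjI)
  fix u assume u: "u \<in> ?F"
  show tF: "trunc u \<in> ?F" by (rule clH_trunc[OF U A(1,2) t u])
  have "u \<in> H1 U" using u FH by blast
  from trunc_H1(2)[OF U(1) this] show "E (trunc u) (trunc u) <= E u u" using Eq[OF u u] Eq[OF tF tF] by simp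
 qed
 show ?thesis unfolding regular_dirichlet_form_def gf prod.case dirichlet_form_def
 proof (intro conjI sym closed mark ballI allI impI)
  show "\<exists>v\<in>?F \<inter> Cc (space ?M). form1 ?M E (%x. u x - v x) < \<epsilon>" if u: "u \<in> ?F" and "0 < \<epsilon>" for u \<epsilon>
  proof -
   obtain a where a: "a \<in> A" "E1sq U (%x. u x - a x) < \<epsilon>" using u \<open>0 < \<epsilon>\<close> unfolding clH_def by blast
   have aF: "a \<in> ?F" using a(1) AF by blast
   show ?thesis using a aF f1[OF diff[OF u aF]] A(3)[OF a(1)] Cc_compact[OF cpt] by (intro bexI[of _ a]) (auto simp: space_refl)
  qed
  show "\<exists>v\<in>?F \<inter> Cc (space ?M). \<forall>x\<in>space ?M. \<bar>w x - v x\<bar> < \<epsilon>" if wC: "w \<in> Cc (space ?M)" and e: "0 < \<epsilon>" for w \<epsilon>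
  proof -
   have "continuous_on (closure U) w" using wC Cc_compact[OF cpt] by (simp add: space_refl)
   then obtain a where a: "a \<in> A" "\<forall>x\<in>closure U. \<bar>w x - a x\<bar> < \<epsilon>"
    using dense e unfolding uniformly_dense_def by blast
   then show ?thesis using AF A(3) Cc_compact[OF cpt] by (intro bexI[of _ a]) (auto simp: space_refl)
  qed
 qed
qed

section \<open>Conformal transforms of regular subspaces\<close>

lemma L1_loc_lim_dominated:
 assumes us: "\<And>n. locally_integrable U (us n)" and u: "locally_integrable U u" and h: "locally_integrable U h"
  and b: "\<And>n x. x \<in> U ==> \<bar>us n x - u x\<bar> <= h x" and l: "AE x in lborel. x \<in> U --> (%n. us n x) \<longlonglongrightarrow> u x"
 shows "L1_loc_lim U us u" unfolding L1_loc_lim_def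
proof (intro conjI allI impI u)
 fix K assume K: "K \<subseteq> U" "compact K"
 have i: "sint K (%x. us n x - u x)" for n
  by (rule set_integral_diff(1)) (use us[of n] u K in \<open>auto simp: locally_integrable_def\<close>)
 show "null_seq (%n. LBINT x:K. norm (us n x - u x))"
 proof (rule set_integral_tendsto_0[of lborel K h])
  show "sint K h" using h K by (simp add: locally_integrable_def)
  show "(%x. indicator K x * norm (us n x - u x)) \<in> borel_measurable lborel" for n
   using set_integrable_norm[OF i[of n]] by (simp add: set_integrable_def)
  show "\<bar>norm (us n x - u x)\<bar> <= h x" if "x \<in> K" for n x using b[of x n] K that by auto
  show "AE x in lborel. x \<in> K --> null_seq (%n. norm (us n x - u x))" using l
  proof eventually_elim
   fix x assume "x \<in> U --> (%n. us n x) \<longlonglongrightarrow> u x"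
   then show "x \<in> K --> null_seq (%n. norm (us n x - u x))"
    using K by (auto intro!: tendsto_rabs_zero LIM_zero)
  qed
 qed
qed

lemma locally_integrable_const: "locally_integrable U (%_. c::real)"
 by (rule continuous_on_locally_integrable) simp

text \<open>Lower semicontinuity of the energy under almost everywhere convergence, up to the factor
  from \<open>Hd_clip\<close>: truncation supplies the domination, Mazur's lemma the bound. The lost
  factor is harmless because the bound will be applied to differences in a Cauchy sequence.\<close>

lemma Hd_lsc_AE:
 assumes U: "open U" and ws: "\<And>n. ws n \<in> Hd U" and C: "\<And>n. energy U (ws n) <= C"
  and w: "locally_integrable U w" and l: "AE x in lborel. x \<in> U --> (%n. ws n x) \<longlonglongrightarrow> w x"
 shows "w \<in> Hd U" "energy U w <= 4 * C"
proof -
 have li: "locally_integrable U (%x. clip k (v x))" if "locally_integrable U v" for k v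
  by (rule locally_integrable_lipschitz_compose[OF that, where A = 0 and B = 1]) (use clip_bounds in auto)
 have k: "(%x. clip k (w x)) \<in> Hd U \<and> energy U (%x. clip k (w x)) <= 4 * C" for k
 proof -
  have lim: "L1_loc_lim U (%n x. clip k (ws n x)) (%x. clip k (w x))"
  proof (rule L1_loc_lim_dominated)
   show "locally_integrable U (%x. clip k (ws n x))" for n by (rule li[OF weak_gradient_Hd(3)[OF U ws]])
   show "locally_integrable U (%x. clip k (w x))" by (rule li[OF w])
   show "locally_integrable U (%_. 2 * real k)" by (rule locally_integrable_const)
   show "\<bar>clip k (ws n x) - clip k (w x)\<bar> <= 2 * real k" for n x
    using clip_bounds(1)[of k "ws n x"] clip_bounds(1)[of k "w x"] by linarith
   show "AE x in lborel. x \<in> U --> (%n. clip k (ws n x)) \<longlonglongrightarrow> clip k (w x)"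
    using l by eventually_elim (auto intro: clip_tendsto_clip)
  qed
  have D: "energy U (%x. clip k (ws n x)) <= 4 * C" for n
   using Hd_clip(2)[OF U ws[of n], of k] C[of n] by linarith
  show ?thesis
   using Hd_mazur(1,2)[where us = "%n x. clip k (ws n x)" and u = "%x. clip k (w x)" and C = "4 * C", OF U Hd_clip(1)[OF U ws] D lim] by blast
 qed
 have lim: "L1_loc_lim U (%k x. clip k (w x)) w"
 proof (rule L1_loc_lim_dominated)
  show "locally_integrable U (%x. clip n (w x))" for n by (rule li[OF w])
  show "locally_integrable U (%x. \<bar>w x\<bar>)" by (rule locally_integrable_lipschitz_compose[OF w, where A = 0 and B = 1]) auto
  show "AE x in lborel. x \<in> U --> (%k. clip k (w x)) \<longlonglongrightarrow> w x" by (intro AE_I2 impI clip_tendsto)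
 qed (use w clip_bounds in auto)
 note m = Hd_mazur(1,2)[where us = "%k x. clip k (w x)" and u = w and C = "4 * C", OF U _ _ lim]
 show "w \<in> Hd U" by (rule m(1)) (use k in auto)
 show "energy U w <= 4 * C" by (rule m(2)) (use k in auto)
qed

lemma is_weak_gradient_cong:
 assumes "\<And>x. x \<in> U ==> u x = v x"
 shows "is_weak_gradient U u = is_weak_gradient U v"
proof
 fix g
 have li: "sint K u \<longleftrightarrow> sint K v" if "K \<subseteq> U" for K
  unfolding set_integrable_def by (rule Bochner_Integration.integrable_cong) (use assms that in \<open>auto simp: indicator_def\<close>)
 have "(LBINT x:U. u x * c x) = (LBINT x:U. v x * c x)" for c
  unfolding set_lebesgue_integral_def by (rule Bochner_Integration.integral_cong) (use assms in \<open>auto simp: indicator_def\<close>)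
 then show "is_weak_gradient U u g = is_weak_gradient U v g"
  unfolding is_weak_gradient_def locally_integrable_def using li by auto
qed

lemma Hd_cong:
 assumes "\<And>x. x \<in> U ==> u x = v x"
 shows "u \<in> Hd U \<longleftrightarrow> v \<in> Hd U" "dirichlet_integral U u = dirichlet_integral U v" "dirichlet_integral U w u = dirichlet_integral U w v"
proof -
 have e: "is_weak_gradient U u = is_weak_gradient U v" by (rule is_weak_gradient_cong[OF assms])
 show "u \<in> Hd U \<longleftrightarrow> v \<in> Hd U" "dirichlet_integral U u = dirichlet_integral U v" "dirichlet_integral U w u = dirichlet_integral U w v"
  unfolding Hd_def dirichlet_integral_def weak_gradient_def mem_Collect_eq e by (rule refl)+
qed

section \<open>Conformal pairs and the transport of null sets\<close>

definition conf_pair :: "complex set => complex set => (complex => complex) => (complex => complex) => bool" where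
 "conf_pair U V f g \<longleftrightarrow> open U \<and> bounded U \<and> open V \<and> bounded V \<and> homeomorphism (closure U) (closure V) f g \<and>
   f ` U = V \<and> f holomorphic_on U \<and> g holomorphic_on V"

lemma conf_pairD:
 assumes "conf_pair U V f g"
 shows "open U" "bounded U" "open V" "bounded V" "f ` U = V" "f holomorphic_on U" "inj_on f U"
  "continuous_on (closure U) f" "f ` closure U = closure V" "\<And>x. x \<in> closure U ==> g (f x) = x"
  "\<And>y. y \<in> closure V ==> f (g y) = y" "\<And>y. y \<in> closure V ==> g y \<in> closure U" "\<And>x. x \<in> closure U ==> f x \<in> closure V"
  "continuous_on (closure V) g"
proof -
 have h: "homeomorphism (closure U) (closure V) f g" using assms by (simp add: conf_pair_def)
 show "open U" "bounded U" "open V" "bounded V" "f ` U = V" "f holomorphic_on U" using assms by (auto simp: conf_pair_def)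
 show gf: "\<And>x. x \<in> closure U ==> g (f x) = x" and "\<And>y. y \<in> closure V ==> f (g y) = y"
  "continuous_on (closure U) f" "f ` closure U = closure V" "continuous_on (closure V) g"
  using h by (auto simp: homeomorphism_def)
 show "\<And>y. y \<in> closure V ==> g y \<in> closure U" "\<And>x. x \<in> closure U ==> f x \<in> closure V"
  using h by (auto simp: homeomorphism_def)
 show "inj_on f U" by (rule inj_on_inverseI[of _ g]) (use gf closure_subset in blast)
qed

lemma conf_pair_sym:
 assumes "conf_pair U V f g" shows "conf_pair V U g f"
proof -
 have "g ` V = U" unfolding conf_pairD(5)[OF assms, symmetric] image_image
  using conf_pairD(10)[OF assms] closure_subset[of U] by force
 then show ?thesis using assms homeomorphism_symD by (auto simp: conf_pair_def)
qed

lemma Hd_conf: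
 assumes c: "conf_pair U V f g"
 shows "(%x. w (f x)) \<in> Hd U \<longleftrightarrow> w \<in> Hd V"
  "w \<in> Hd V ==> v \<in> Hd V ==> dirichlet_integral U (%x. w (f x)) (%x. v (f x)) = dirichlet_integral V w v"
proof -
 note d = conf_pairD[OF c] and e = conf_pairD[OF conf_pair_sym[OF c]]
 have up: "(%x. w (f x)) \<in> Hd U" if "w \<in> Hd V"
  by (rule Hd_conformal(1)[OF d(1,6,7)]) (use that d(5) in simp)
 show "(%x. w (f x)) \<in> Hd U \<longleftrightarrow> w \<in> Hd V"
 proof
  assume "(%x. w (f x)) \<in> Hd U"
  then have "(%y. w (f (g y))) \<in> Hd V" by (intro Hd_conformal(1)[OF e(1,6,7)]) (use e(5) in simp)
  moreover have "w y = w (f (g y))" if "y \<in> V" for y using e(10)[of y] that closure_subset[of V] by auto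
  ultimately show "w \<in> Hd V" by (simp add: Hd_cong(1)[of V w "%y. w (f (g y))"])
 qed (rule up)
 show "dirichlet_integral U (%x. w (f x)) (%x. v (f x)) = dirichlet_integral V w v" if "w \<in> Hd V" "v \<in> Hd V"
  using Hd_conformal(2)[OF d(1,6,7), of w v] that d(5) by simp
qed

lemma conf_measurable:
 assumes c: "conf_pair U V f g"
 shows "f \<in> measurable (refl_measure U) (refl_measure V)"
proof -
 note d = conf_pairD[OF c]
 have "f \<in> borel_measurable (restrict_space borel (closure U))" by (rule borel_measurable_continuous_on_restrict[OF d(8)])
 then have "f \<in> measurable (restrict_space borel (closure U)) (restrict_space borel (closure V))"
  by (rule measurable_restrict_space2[rotated]) (use d(13) in \<open>auto simp: space_restrict_space\<close>)
 then show ?thesis by (simp add: measurable_cong_sets[OF sets_refl sets_refl])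
qed

text \<open>Differentiable maps of the plane send null sets to null sets, so f carries the
  exceptional set in U to a null set in V.\<close>

lemma AE_holomorphic_inverse:
 assumes U: "open U" and f: "f holomorphic_on U" "\<And>x. x \<in> U ==> g (f x) = x" and V: "f ` U = V"
  and ae: "AE x in lborel. x \<in> U --> P x"
 shows "AE y in lborel. y \<in> V --> P (g y)"
proof -
 obtain N where N: "{x. \<not> (x \<in> U --> P x)} \<subseteq> N" "N \<in> null_sets lborel"
  using ae by (auto elim!: AE_E simp: null_sets_def)
 have "negligible N" using N(2) by (simp add: negligible_iff_null_sets null_sets_completionI)
 then have nN: "negligible (N \<inter> U)" by (rule negligible_subset) simp
 have df: "f differentiable_on (N \<inter> U)"
  using U f(1) holomorphic_on_imp_differentiable_on[of f U] differentiable_on_subset[of f U "N \<inter> U"] by blast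
 have "negligible (f ` (N \<inter> U))" by (rule negligible_differentiable_image_negligible[OF _ nN df]) simp
 then have "AE y in lebesgue. y \<notin> f ` (N \<inter> U)" unfolding negligible_iff_null_sets by (rule AE_not_in)
 then have "AE y in lebesgue. y \<in> V --> P (g y)"
 proof eventually_elim
  fix y assume y: "y \<notin> f ` (N \<inter> U)"
  show "y \<in> V --> P (g y)"
  proof
   assume "y \<in> V"
   then obtain x where x: "x \<in> U" "y = f x" using V by blast
   then have "x \<notin> N" using y by blast
   then show "P (g y)" using N(1) x f(2)[OF x(1)] by auto
  qed
 qed
 then show ?thesis by (simp add: AE_completion_iff)
qed

lemma AE_conf:
 assumes c: "conf_pair U V f g" and ae: "AE x in refl_measure U. P x"
 shows "AE y in refl_measure V. P (g y)"
proof -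
 note d = conf_pairD[OF c]
 have "AE x in lborel. x \<in> U --> P x" using ae AE_refl[OF d(1)] by blast
 moreover have "g (f x) = x" if "x \<in> U" for x using d(10) that closure_subset[of U] by blast
 ultimately have "AE y in lborel. y \<in> V --> P (g y)" by (intro AE_holomorphic_inverse[OF d(1,6) _ d(5)])
 then show ?thesis using AE_refl[OF d(3)] by blast
qed

text \<open>Null sets of V pull back to null sets of U, by the transport along the inverse
  pair.\<close>

lemma AE_distr_conf:
 assumes c: "conf_pair U V f g" and ae: "AE y in refl_measure V. P y"
 shows "AE y in distr (refl_measure U) (refl_measure V) f. P y"
proof -
 note m = conf_measurable[OF c]
 have "absolutely_continuous (refl_measure V) (distr (refl_measure U) (refl_measure V) f)"
  unfolding absolutely_continuous_def
 proof
  fix A assume A: "A \<in> null_sets (refl_measure V)"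
  then have "AE y in refl_measure V. y \<notin> A" by (rule AE_not_in)
  from AE_conf[OF conf_pair_sym[OF c] this] have "AE x in refl_measure U. f x \<notin> A" .
  then have "AE x in refl_measure U. x \<notin> f -` A \<inter> space (refl_measure U)" by eventually_elim auto
  moreover have "f -` A \<inter> space (refl_measure U) \<in> sets (refl_measure U)"
   using measurable_sets[OF m] A by auto
  ultimately have "f -` A \<inter> space (refl_measure U) \<in> null_sets (refl_measure U)"
   by (simp add: AE_iff_null_sets)
  then show "A \<in> null_sets (distr (refl_measure U) (refl_measure V) f)"
   using A by (auto simp: null_sets_distr_iff[OF m])
 qed
 then show ?thesis by (rule absolutely_continuous_AE[rotated]) (use ae in auto)
qed

section \<open>Regular subspaces and their continuous cores\<close>

definition core :: "complex set => (complex => real) set => (complex => real) set" where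
 "core U F = {u \<in> F. continuous_on (closure U) u}"

lemma gen_form_subspace:
 assumes "regular_dirichlet_form (refl_measure U) (gen_form U F)" "regular_dirichlet_form (refl_measure U) (refl_BM_form U)" "F \<subseteq> H1 U"
 shows "regular_subspace (refl_measure U) (gen_form U F) (refl_BM_form U)"
proof -
 have "fst (refl_BM_form U) u v = fst (gen_form U F) u v" if "u \<in> F" "v \<in> F" for u v
  using that assms(3) by (simp add: refl_BM_form_eq subset_eq)
 then show ?thesis using assms by (simp add: regular_subspace_def) (simp add: refl_BM_form_eq)
qed

text \<open>The decisive item is \<open>F = clH U (core U F)\<close>: regularity makes the core
  dense and closedness makes the domain complete, so a regular subspace is determined by its core,
  and only cores have to be followed through the transform.\<close>

lemma regular_subspace_facts:
 assumes U: "open U" "bounded U" and P: "regular_subspace (refl_measure U) P (refl_BM_form U)"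
 defines "F \<equiv> snd P"
 shows "P = gen_form U F" "F \<subseteq> H1 U" "core U F \<subseteq> H1 U" "lin_space (core U F)" "lin_space F"
  "\<And>u. u \<in> F ==> trunc u \<in> F" "\<And>u. u \<in> core U F ==> trunc u \<in> core U F"
  "uniformly_dense (closure U) (core U F)" "F = clH U (core U F)"
  "\<And>u v. u \<in> F ==> v \<in> borel_measurable (refl_measure U) ==> AE x in refl_measure U. u x = v x ==> v \<in> F"
proof -
 let ?M = "refl_measure U"
 obtain E where PE: "P = (E, F)" by (cases P) (simp add: F_def)
 have reg: "regular_dirichlet_form ?M (E, F)" and FH: "F \<subseteq> H1 U"
  and EqB: "\<And>u v. u \<in> F ==> v \<in> F ==> fst (refl_BM_form U) u v = E u v"
  using P by (auto simp: regular_subspace_def PE refl_BM_form_eq)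
 have Eq: "E u v = 1/2 * dirichlet_integral U u v" if "u \<in> F" "v \<in> F" for u v
  using EqB[OF that] that FH by (simp add: refl_BM_form_eq subset_eq)
 have sym: "symmetric_form ?M (E, F)" and cl: "closed_form ?M (E, F)" and mk: "markovian (E, F)"
  and d1: "\<And>u \<epsilon>. u \<in> F ==> \<epsilon> > 0 ==> \<exists>v\<in>F \<inter> Cc (space ?M). form1 ?M E (%x. u x - v x) < \<epsilon>"
  and d2: "\<And>w \<epsilon>. w \<in> Cc (space ?M) ==> \<epsilon> > 0 ==> \<exists>v\<in>F \<inter> Cc (space ?M). \<forall>x\<in>space ?M. \<bar>w x - v x\<bar> < \<epsilon>"
  using reg unfolding regular_dirichlet_form_def dirichlet_form_def prod.case by blast+
 have fo: "form_on E F = (E, F)" and lc: "\<And>u v a b. u \<in> F ==> v \<in> F ==> (%x. a * u x + b * v x) \<in> F"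
  and ai: "ae_invariant ?M (E, F)" using sym unfolding symmetric_form_def prod.case by blast+
 have cpt: "compact (closure U)" using U(2) by (simp add: compact_closure)
 have Cc: "u \<in> F \<inter> Cc (space ?M) \<longleftrightarrow> u \<in> core U F" for u
  unfolding space_refl using Cc_compact[OF cpt] by (auto simp: core_def)
 have "(if u \<in> F \<and> v \<in> F then E u v else undefined) = E u v" for u v
  using fun_cong[OF fun_cong[OF arg_cong[OF fo, of fst]], of u v] by (simp only: form_on_def fst_conv)
 \<comment> \<open>Off the domain the values are \<open>undefined\<close> on both sides, which makes
   equality of forms literal.\<close>
 then have "E = (%u v. if u \<in> F \<and> v \<in> F then 1/2 * dirichlet_integral U u v else undefined)"
  using Eq by (intro ext) metis
 then show "P = gen_form U F" unfolding PE gen_form_def form_on_def by simp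
 show "F \<subseteq> H1 U" by (rule FH)
 then show cH: "core U F \<subseteq> H1 U" by (auto simp: core_def)
 show lF: "lin_space F" using lc by (auto simp: lin_space_def)
 show "lin_space (core U F)" using lc by (auto simp: lin_space_def core_def intro!: continuous_intros)
 show tF: "trunc u \<in> F" if "u \<in> F" for u using mk that by (auto simp: markovian_def Let_def)
 show "trunc u \<in> core U F" if "u \<in> core U F" for u using tF that by (auto simp: core_def intro!: continuous_intros)
 show "uniformly_dense (closure U) (core U F)" unfolding uniformly_dense_def
 proof (intro allI impI)
  fix w :: "complex => real" and \<epsilon> :: real assume "continuous_on (closure U) w" "\<epsilon> > 0"
  then show "\<exists>a\<in>core U F. \<forall>x\<in>closure U. \<bar>w x - a x\<bar> < \<epsilon>"
   using d2[of w \<epsilon>] Cc Cc_compact[OF cpt] unfolding space_refl by blast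
 qed
 show inv: "v \<in> F" if "u \<in> F" "v \<in> borel_measurable ?M" "AE x in ?M. u x = v x" for u v
  using ai that unfolding ae_invariant_def prod.case by blast
 have diff: "(%x. u x - v x) \<in> F" if "u \<in> F" "v \<in> F" for u v using lc[OF that, of 1 "-1"] by simp
 have f1: "form1 ?M E u = E1sq U u" if "u \<in> F" for u using Eq[OF that that] by (simp add: form1_def E1_self)
 show "F = clH U (core U F)"
 proof
  show "F \<subseteq> clH U (core U F)"
  proof
   fix u assume u: "u \<in> F"
   have "\<exists>a\<in>core U F. E1sq U (%x. u x - a x) < \<epsilon>" if e: "\<epsilon> > 0" for \<epsilon>
   proof -
    obtain v where v: "v \<in> core U F" "form1 ?M E (%x. u x - v x) < \<epsilon>" using d1[OF u e] Cc by blast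
    have "v \<in> F" using v(1) by (simp add: core_def)
    then show ?thesis using v f1[OF diff[OF u]] by auto
   qed
   then show "u \<in> clH U (core U F)" using u FH by (auto simp: clH_def)
  qed
  show "clH U (core U F) \<subseteq> F"
  proof
   fix u assume u: "u \<in> clH U (core U F)"
   then have uH: "u \<in> H1 U" by (simp add: clH_def)
   from clH_AE_seq[OF U(1) cH u] obtain a where a: "\<forall>n. a n \<in> core U F"
    "null_seq (%n. E1sq U (%x. a n x - u x))" by (elim exE conjE)
   have aF: "a n \<in> F" for n using a(1) by (simp add: core_def)
   have aH: "a n \<in> H1 U" for n using aF FH by blast
   note p = psd_E1[OF U(1)]
   \<comment> \<open>Closedness yields a limit v in F of the same sequence. Then u and v have E1
     distance zero, so they agree almost everywhere, and F is invariant under such changes.\<close>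
   have "seq_Cauchy_for (form1 ?M E) a"
    using psd_convergent_Cauchy[where us = a and u = u, OF p aH uH a(2)]
    unfolding seq_Cauchy_for_def f1[OF diff[OF aF aF]] .
   then obtain v where v: "v \<in> F" "null_seq (%n. form1 ?M E (%x. a n x - v x))"
    using cl aF unfolding closed_form_def prod.case by blast
   have vH: "v \<in> H1 U" using v FH by blast
   have z: "E1sq U (%x. u x - v x) <= 0"
   proof (rule LIMSEQ_le_const)
    show "null_seq (%n. 2 * E1sq U (%x. a n x - u x) + 2 * form1 ?M E (%x. a n x - v x))"
     using tendsto_add[OF tendsto_mult_right_zero[OF a(2)] tendsto_mult_right_zero[OF v(2)], of 2 2] by simp
    show "\<exists>N. \<forall>n\<ge>N. E1sq U (%x. u x - v x) <= 2 * E1sq U (%x. a n x - u x) + 2 * form1 ?M E (%x. a n x - v x)"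
     unfolding f1[OF diff[OF aF v(1)]] psd_diff_commute[OF p aH uH] using psd_triangle[OF p uH aH vH] by blast
   qed
   have dH: "(%x. u x - v x) \<in> H1 U" by (rule psd_diff[OF p uH vH])
   have "L2_normsq ?M (%x. u x - v x) = 0"
    using E1_parts(2)[OF U(1) dH] z L2_normsq_nonneg[of ?M "%x. u x - v x"] by linarith
   then have "AE x in ?M. (u x - v x)\<^sup>2 = 0"
    using dH integral_nonneg_eq_0_iff_AE[of ?M "%x. (u x - v x)^2"] by (simp add: H1_iff L2_def L2_normsq_def)
   then have "AE x in ?M. v x = u x" by eventually_elim simp
   then show "u \<in> F" using inv[OF v(1)] uH by (simp add: H1_iff L2_def)
  qed
 qed
qed

text \<open>The future core of the transformed form. Continuity on the compact closure of V gives
  square integrability for both measures at once.\<close>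

definition push :: "complex set => (complex => complex) => (complex => real) set => (complex => real) set" where
 "push V f F = {w. continuous_on (closure V) w \<and> (%x. w (f x)) \<in> F}"

lemma continuous_bounded_L2:
 assumes U: "open U" "bounded U" and u: "continuous_on (closure U) u"
 shows "u \<in> L2 (refl_measure U)" "\<exists>C. \<forall>x\<in>closure U. \<bar>u x\<bar> <= C"
proof -
 have "compact (closure U)" using U by (simp add: compact_closure)
 then have "bounded (u ` closure U)" using compact_imp_bounded compact_continuous_image[OF u] by blast
 then show e: "\<exists>C. \<forall>x\<in>closure U. \<bar>u x\<bar> <= C" by (auto simp: bounded_iff)
 then obtain C where "\<forall>x\<in>closure U. \<bar>u x\<bar> <= C" by (elim exE)
 then show "u \<in> L2 (refl_measure U)"
  by (intro bounded_in_L2[OF finite_measure_refl[OF U] continuous_measurable_refl[OF u], where C = C]) (simp add: space_refl)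
qed

text \<open>The data of one transform. Interpreting it for the pair (f, g) and then for (g, f) gives
  the way there and back.\<close>

locale conf_subspace =
 fixes U V f g P F
 assumes c: "conf_pair U V f g" and P: "regular_subspace (refl_measure U) P (refl_BM_form U)"
 defines "F \<equiv> snd P"
begin

lemmas d = conf_pairD[OF c] and e = conf_pairD[OF conf_pair_sym[OF c]]
lemmas rs = regular_subspace_facts[OF d(1,2) P, folded F_def]

lemma FH: "u \<in> F ==> u \<in> H1 U" using rs(2) by blast

lemma push_back:
 assumes "w \<in> push V f F"
 shows "(%x. w (f x)) \<in> core U F" "w \<in> H1 V"
proof -
 have w: "continuous_on (closure V) w" "(%x. w (f x)) \<in> F" using assms by (auto simp: push_def)
 have "continuous_on (closure U) (%x. w (f x))"
  by (rule continuous_on_compose2[OF w(1) d(8)]) (use d(9) in auto)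
 then show "(%x. w (f x)) \<in> core U F" using w by (simp add: core_def)
 have "w \<in> Hd V" using Hd_conf(1)[OF c] FH[OF w(2)] H1_iff by blast
 then show "w \<in> H1 V" using continuous_bounded_L2(1)[OF d(3,4) w(1)] by (simp add: H1_iff)
qed

text \<open>Functions are total while g(f x) = x holds only on the closure, so membership must be
  insensitive to values elsewhere.\<close>

lemma F_cong:
 assumes "u \<in> F" "v \<in> borel_measurable (refl_measure U)" "\<And>x. x \<in> closure U ==> u x = v x"
 shows "v \<in> F" by (rule rs(10)[OF assms(1,2)]) (use assms(3) in \<open>auto intro!: AE_I2 simp: space_refl\<close>)

lemma push_forward:
 assumes "a \<in> core U F"
 shows "(%y. a (g y)) \<in> push V f F"
  "energy V (%y. a (g y)) = energy U a"
proof -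
 have a: "a \<in> F" "continuous_on (closure U) a" using assms by (auto simp: core_def)
 have c1: "continuous_on (closure V) (%y. a (g y))" by (rule continuous_on_compose2[OF a(2) d(14)]) (use d(12) in auto)
 have c2: "continuous_on (closure U) (%x. a (g (f x)))" by (rule continuous_on_compose2[OF c1 d(8)]) (use d(13) in auto)
 have "(%x. a (g (f x))) \<in> F"
  by (rule F_cong[OF a(1) continuous_measurable_refl[OF c2]]) (simp add: d(10))
 then show "(%y. a (g y)) \<in> push V f F" using c1 by (simp add: push_def)
 have "a \<in> Hd U" using FH[OF a(1)] by (simp add: H1_iff)
 then show "energy V (%y. a (g y)) = energy U a" by (rule Hd_conf(2)[OF conf_pair_sym[OF c]]) fact
qed

lemma push_H1: "push V f F \<subseteq> H1 V" using push_back(2) by blast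

lemma push_lin: "lin_space (push V f F)"
 using rs(5) unfolding lin_space_def push_def by (auto intro!: continuous_intros)

lemma push_trunc: "w \<in> push V f F ==> trunc w \<in> push V f F"
 using rs(6) unfolding push_def by (auto intro!: continuous_intros)

lemma push_dense: "uniformly_dense (closure V) (push V f F)" unfolding uniformly_dense_def
proof (intro allI impI)
 fix w :: "complex => real" and \<epsilon> :: real assume w: "continuous_on (closure V) w" and "\<epsilon> > 0"
 have "continuous_on (closure U) (%x. w (f x))"
  by (rule continuous_on_compose2[OF w d(8)]) (use d(9) in auto)
 then obtain a where a: "a \<in> core U F" "\<forall>x\<in>closure U. \<bar>w (f x) - a x\<bar> < \<epsilon>"
  using rs(8) \<open>\<epsilon> > 0\<close> unfolding uniformly_dense_def by blast
 have "\<bar>w y - a (g y)\<bar> < \<epsilon>" if "y \<in> closure V" for y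
  using bspec[OF a(2) d(12)[OF that]] d(11)[OF that] by simp
 then show "\<exists>a\<in>push V f F. \<forall>x\<in>closure V. \<bar>w x - a x\<bar> < \<epsilon>" using push_forward(1)[OF a(1)] by (intro bexI[of _ "%y. a (g y)"]) auto
qed

lemma push_regular: "regular_dirichlet_form (refl_measure V) (gen_form V (clH V (push V f F)))"
 by (rule regular_closure[OF d(3,4) push_H1 push_lin _ push_trunc push_dense]) (auto simp: push_def)

text \<open>L2 norms are not comparable under f, so an approximating sequence on V is brought back
  to U with its energies and its almost everywhere convergence only. By \<open>clH_AE_limit\<close>
  this is enough, the limit being continuous and thus square integrable.\<close>

lemma push_push: "push U g (clH V (push V f F)) = core U F"
proof
 show "core U F \<subseteq> push U g (clH V (push V f F))"
  using push_forward(1) clH_superset[OF d(3) push_H1] by (auto simp: push_def core_def)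
 show "push U g (clH V (push V f F)) \<subseteq> core U F"
 proof
  fix w assume "w \<in> push U g (clH V (push V f F))"
  then have w: "continuous_on (closure U) w" and wc: "(%y. w (g y)) \<in> clH V (push V f F)" by (auto simp: push_def)
  from clH_AE_seq[OF d(3) push_H1 wc] obtain a where a: "\<forall>n. a n \<in> push V f F"
   "null_seq (%n. E1sq V (%x. a n x - w (g x)))"
   "AE y in refl_measure V. (%n. a n y) \<longlonglongrightarrow> w (g y)" by (elim exE conjE)
  have aH: "a n \<in> H1 V" for n using a(1) push_H1 by blast
  have wH: "(%y. w (g y)) \<in> H1 V" using wc by (simp add: clH_def)
  from E1_convergent_bounded[where us = a and u = "%y. w (g y)", OF d(3) aH wH a(2)] obtain C
   where C: "\<forall>n. energy V (a n) <= C" by (elim exE)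
  let ?b = "%n x. a n (f x)"
  have b: "?b n \<in> core U F" for n using push_back(1) a(1) by blast
  have bC: "energy U (?b n) <= C" for n
  proof -
   have "a n \<in> Hd V" using aH H1_iff by blast
   from Hd_conf(2)[OF c this this] show ?thesis using C by simp
  qed
  from AE_conf[OF conf_pair_sym[OF c] a(3)] have "AE x in refl_measure U. (%n. ?b n x) \<longlonglongrightarrow> w (g (f x))" .
  moreover have "AE x in refl_measure U. g (f x) = x" using d(10) by (intro AE_I2) (simp add: space_refl)
  ultimately have l: "AE x in refl_measure U. (%n. ?b n x) \<longlonglongrightarrow> w x" by eventually_elim simp
  have "w \<in> clH U (core U F)"
   by (rule clH_AE_limit[where us = ?b and u = w and C = C, OF d(1,2) rs(3,4,7) b bC continuous_bounded_L2(1)[OF d(1,2) w] l])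
  then show "w \<in> core U F" using rs(9) w by (simp add: core_def)
 qed
qed

section \<open>The extended Dirichlet space of the transformed form\<close>

abbreviation "N \<equiv> distr (refl_measure U) (refl_measure V) f"
abbreviation "S \<equiv> spatial_transform (refl_measure U) (refl_measure V) f P"

lemma AE_N: "(AE y in N. Q y) \<longleftrightarrow> (AE y in refl_measure V. Q y)"
proof
 assume "AE y in N. Q y"
 then have "AE x in refl_measure U. Q (f x)" by (rule AE_distrD[OF conf_measurable[OF c]])
 then have "AE y in refl_measure V. Q (f (g y))" by (rule AE_conf[OF c])
 moreover have "AE y in refl_measure V. f (g y) = y" using d(11) by (intro AE_I2) (simp add: space_refl)
 ultimately show "AE y in refl_measure V. Q y" by eventually_elim simp
qed (rule AE_distr_conf[OF c])

text \<open>Square integrability for the image measure is that of the composition with f over U,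
  which membership in F already contains.\<close>

lemma snd_S: "snd S = {u \<in> borel_measurable (refl_measure V). (%x. u (f x)) \<in> F}"
proof -
 have "u \<in> L2 N" if "u \<in> borel_measurable (refl_measure V)" "(%x. u (f x)) \<in> F" for u
 proof -
  have "integrable (refl_measure U) (%x. (u (f x))^2)" using FH[OF that(2)] by (simp add: H1_iff L2_def)
  moreover have "(%y. (u y)\<^sup>2) \<in> borel_measurable (refl_measure V)" using that by measurable
  ultimately have "integrable N (%y. (u y)\<^sup>2)" by (simp add: integrable_distr_eq[OF conf_measurable[OF c]])
  then show ?thesis using that by (simp add: L2_def)
 qed
 moreover have "u \<in> borel_measurable (refl_measure V)" if "u \<in> L2 N" for u using that by (simp add: L2_def)
 moreover have "snd S = {u \<in> L2 N. (%x. u (f x)) \<in> F}"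
  by (simp add: spatial_transform_def form_on_def F_def case_prod_beta o_def)
 ultimately show ?thesis by (simp only:) blast
qed

lemma snd_S_Hd: "u \<in> snd S ==> u \<in> Hd V"
proof -
 assume "u \<in> snd S"
 then have "(%x. u (f x)) \<in> F" unfolding snd_S by blast
 then have "(%x. u (f x)) \<in> Hd U" using FH H1_iff by blast
 then show ?thesis unfolding Hd_conf(1)[OF c] .
qed

lemma snd_S_diff: "u \<in> snd S ==> v \<in> snd S ==> (%x. u x - v x) \<in> snd S"
proof -
 assume u: "u \<in> snd S" and v: "v \<in> snd S"
 have "(%x. u (f x)) \<in> F" "(%x. v (f x)) \<in> F" using u v unfolding snd_S by auto
 from rs(5)[unfolded lin_space_def, rule_format, OF this, of 1 "-1"]
 have "(%x. 1 * u (f x) + (-1) * v (f x)) \<in> F" .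
 then show ?thesis using u v unfolding snd_S by (auto intro: borel_measurable_diff)
qed

lemma fst_S:
 assumes u: "u \<in> snd S" and v: "v \<in> snd S"
 shows "fst S u v = 1/2 * dirichlet_integral V u v"
proof -
 have "fst S u v = fst P (u \<circ> f) (v \<circ> f)"
  using u v by (auto simp: spatial_transform_def form_on_def case_prod_beta)
 also have "\<dots> = 1/2 * dirichlet_integral U (%x. u (f x)) (%x. v (f x))"
  using u v by (subst rs(1)) (simp add: snd_S o_def)
 also have "\<dots> = 1/2 * dirichlet_integral V u v"
  using Hd_conf(2)[OF c snd_S_Hd[OF u] snd_S_Hd[OF v]] by simp
 finally show ?thesis .
qed

text \<open>The image measure has the null sets of Lebesgue measure on V and the form is half the
  energy, so approximating sequences can be described on V alone.\<close>

lemma approximating_iff: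
 "approximating N S us u \<longleftrightarrow> (\<forall>n. us n \<in> snd S) \<and> seq_Cauchy_for (%w. energy V w) us \<and>
   (AE y in refl_measure V. (%n. us n y) \<longlonglongrightarrow> u y)"
proof -
 have "seq_Cauchy_for (%w. fst S w w) us \<longleftrightarrow> seq_Cauchy_for (%w. energy V w) us" if us: "\<forall>n. us n \<in> snd S"
 proof -
  have eq: "fst S (%x. us m x - us n x) (%x. us m x - us n x) = 1/2 * energy V (%x. us m x - us n x)" for m n
   by (intro fst_S snd_S_diff) (use us in auto)
  show ?thesis unfolding seq_Cauchy_for_def eq
  proof (intro iffI allI impI)
   fix \<epsilon> :: real assume h: "\<forall>\<epsilon>>0. \<exists>N. \<forall>m\<ge>N. \<forall>n\<ge>N. 1 / 2 * energy V (%x. us m x - us n x) < \<epsilon>" "\<epsilon> > 0"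
   show "\<exists>N. \<forall>m\<ge>N. \<forall>n\<ge>N. energy V (%x. us m x - us n x) < \<epsilon>"
    using h(1)[THEN spec, of "\<epsilon>/2"] h(2) by simp
  next
   fix \<epsilon> :: real assume h: "\<forall>\<epsilon>>0. \<exists>N. \<forall>m\<ge>N. \<forall>n\<ge>N. energy V (%x. us m x - us n x) < \<epsilon>" "\<epsilon> > 0"
   show "\<exists>N. \<forall>m\<ge>N. \<forall>n\<ge>N. 1 / 2 * energy V (%x. us m x - us n x) < \<epsilon>"
    using h(1)[THEN spec, of "2 * \<epsilon>"] h(2) by (simp add: mult.commute)
  qed
 qed
 then show ?thesis unfolding approximating_def case_prod_beta AE_N by blast
qed

text \<open>The first two claims apply lower semicontinuity to us m - us n as n grows. For the
  third, the members of the sequence may fail to be continuous, so each is replaced by a core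
  element within 2^-n on U. The replacements have bounded energy and, along a subsequence, the same
  almost everywhere limit on V, where \<open>clH_AE_limit\<close> concludes.\<close>

lemma approximating_limit:
 assumes us: "approximating N S us u" and u: "u \<in> L2 (refl_measure V)"
 shows "u \<in> Hd V" "null_seq (%n. energy V (%x. us n x - u x))" "u \<in> clH V (push V f F)"
proof -
 note p = psd_Hd[OF d(3)]
 have S: "us n \<in> snd S" and cau: "seq_Cauchy_for (%w. energy V w) us"
  and l: "AE y in refl_measure V. (%n. us n y) \<longlonglongrightarrow> u y" for n
  using us unfolding approximating_iff by auto
 have H: "us n \<in> Hd V" for n using S snd_S_Hd by blast
 have ul: "locally_integrable V u" by (rule L2_refl_facts(3)[OF d(3) u])
 have l': "AE y in lborel. y \<in> V --> (%n. us n y) \<longlonglongrightarrow> u y" using l AE_refl[OF d(3)] by simp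
 have close: "\<exists>N. \<forall>m\<ge>N. (%x. us m x - u x) \<in> Hd V \<and> energy V (%x. us m x - u x) <= 4 * \<epsilon>" if eps: "\<epsilon> > 0" for \<epsilon>
 proof -
  obtain N where N: "\<And>m n. m \<ge> N ==> n \<ge> N ==> energy V (%x. us m x - us n x) < \<epsilon>"
   using cau eps unfolding seq_Cauchy_for_def by blast
  have "(%x. us m x - u x) \<in> Hd V \<and> energy V (%x. us m x - u x) <= 4 * \<epsilon>" if m: "m \<ge> N" for m
  proof -
   \<comment> \<open>Shifting the index by N places the whole sequence in the range of the Cauchy
     estimate.\<close>
   let ?w = "%n x. us m x - us (n + N) x"
   have w: "?w n \<in> Hd V" for n by (rule psd_diff[OF p H H])
   have wC: "energy V (?w n) <= \<epsilon>" for n using N[OF m, of "n + N"] by simp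
   have "sint K (%x. us m x - u x)" if "K \<subseteq> V" "compact K" for K
    by (rule set_integral_diff(1)) (use weak_gradient_Hd(3)[OF d(3) H[of m]] ul that in \<open>auto simp: locally_integrable_def\<close>)
   then have li: "locally_integrable V (%x. us m x - u x)" by (simp add: locally_integrable_def)
   have wl: "AE x in lborel. x \<in> V --> (%n. ?w n x) \<longlonglongrightarrow> us m x - u x" using l'
   proof eventually_elim
    fix x assume x: "x \<in> V --> (%n. us n x) \<longlonglongrightarrow> u x"
    show "x \<in> V --> (%n. ?w n x) \<longlonglongrightarrow> us m x - u x"
     using x by (auto intro!: tendsto_diff tendsto_const LIMSEQ_ignore_initial_segment)
   qed
   from Hd_lsc_AE[where ws = ?w and w = "%x. us m x - u x" and C = \<epsilon>, OF d(3) w wC li wl] show ?thesis by blast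
  qed
  then show ?thesis by blast
 qed
 obtain n0 where "(%x. us n0 x - u x) \<in> Hd V" using close[of 1] by auto
 from psd_diff[OF p H[of n0] this] show uH: "u \<in> Hd V" by simp
 show lim: "null_seq (%n. energy V (%x. us n x - u x))"
 proof (rule LIMSEQ_I)
  fix \<epsilon> :: real assume "\<epsilon> > 0"
  then have "\<epsilon> / 8 > 0" by simp
  from close[OF this] obtain N where N: "\<And>m. m \<ge> N ==> energy V (%x. us m x - u x) <= 4 * (\<epsilon> / 8)" by blast
  have "norm (energy V (%x. us m x - u x) - 0) < \<epsilon>" if "m \<ge> N" for m
   using N[OF that] psdD(4)[OF p psd_diff[OF p H[of m] uH] uH] \<open>\<epsilon> > 0\<close> by simp
  then show "\<exists>N. \<forall>n\<ge>N. norm (energy V (%x. us n x - u x) - 0) < \<epsilon>" by blast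
 qed
 have "(%n. energy V (us n)) \<longlonglongrightarrow> energy V u"
  by (rule psd_tendsto[where us = us and vs = us and u = u and v = u, OF p H H uH uH lim lim])
 then have "Bseq (%n. energy V (us n))" by (intro convergent_imp_Bseq convergentI)
 then obtain C where C: "\<forall>n. norm (energy V (us n)) <= C" by (auto elim: BseqE)
 have "\<exists>v\<in>core U F. E1sq U (%x. us n (f x) - v x) < 1 / 2 ^ n" for n
 proof -
  have "(%x. us n (f x)) \<in> clH U (core U F)" using S[of n] rs(9) unfolding snd_S by simp
  then show ?thesis unfolding clH_def by auto
 qed
 then have "\<forall>n. \<exists>v. v \<in> core U F \<and> E1sq U (%x. us n (f x) - v x) < 1 / 2 ^ n" by blast
 from choice[OF this] obtain v where v0: "\<forall>n. v n \<in> core U F \<and> E1sq U (%x. us n (f x) - v n x) < 1 / 2 ^ n" by (elim exE)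
 then have vc: "v n \<in> core U F" and vl: "E1sq U (%x. us n (f x) - v n x) < 1 / 2 ^ n" for n by auto
 note pU = psd_H1[OF d(1)]
 have usU: "(%x. us n (f x)) \<in> H1 U" for n using S[of n] FH unfolding snd_S by blast
 have vU: "v n \<in> H1 U" for n using vc rs(3) by blast
 have dU: "(%x. us n (f x) - v n x) \<in> H1 U" for n by (rule psd_diff[OF pU usU vU])
 \<comment> \<open>The difference has squared E1 norm at most 1, hence energy at most 2; doubled by
   \<open>psd_bound\<close> this is the 4.\<close>
 have vb: "energy U (v n) <= 2 * C + 4" for n
 proof -
  have "energy U (v n) <= 2 * energy U (%x. us n (f x)) + 2 * energy U (%x. us n (f x) - v n x)"
   by (rule psd_bound[OF pU usU vU])
  moreover have "energy U (%x. us n (f x)) <= C"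
   using Hd_conf(2)[OF c H[of n] H[of n]] abs_le_D1[OF C[THEN spec, of n, unfolded real_norm_def]] by simp
  moreover have "energy U (%x. us n (f x) - v n x) <= 2"
  proof -
   have "(1::real) / 2 ^ n <= 1" by simp
   then show ?thesis using E1_parts(1)[OF d(1) dU[of n]] vl[of n] by linarith
  qed
  ultimately show ?thesis by linarith
 qed
 have "null_seq (%n. L2_normsq (refl_measure U) (%x. us n (f x) - v n x))"
 proof (rule tendsto_sandwich[OF _ _ tendsto_const half_power_tendsto])
  show "\<forall>\<^sub>F n in sequentially. L2_normsq (refl_measure U) (%x. us n (f x) - v n x) <= 1 / 2 ^ n"
   using order_trans[OF E1_parts(2)[OF d(1) dU] less_imp_le[OF vl]] by (intro always_eventually allI)
 qed (auto simp: L2_normsq_nonneg)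
 moreover have "(%x. us n (f x) - v n x) \<in> L2 (refl_measure U)" for n using dU H1_iff by blast
 ultimately have "\<exists>r. strict_mono r \<and> (AE x in refl_measure U. null_seq (%n. us (r n) (f x) - v (r n) x))"
  by (rule L2_AE_subseq[rotated])
 then obtain r where r: "strict_mono r" "AE x in refl_measure U. null_seq (%n. us (r n) (f x) - v (r n) x)" by (elim exE conjE)
 have "AE y in refl_measure V. null_seq (%n. us (r n) (f (g y)) - v (r n) (g y))" by (rule AE_conf[OF c r(2)])
 moreover have "AE y in refl_measure V. f (g y) = y" using d(11) by (intro AE_I2) (simp add: space_refl)
 ultimately have z: "AE y in refl_measure V. (%n. v (r n) (g y)) \<longlonglongrightarrow> u y" using l
 proof eventually_elim
  fix y assume y: "null_seq (%n. us (r n) (f (g y)) - v (r n) (g y))" "f (g y) = y" "(%n. us n y) \<longlonglongrightarrow> u y"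
  have "(%n. us (r n) y) \<longlonglongrightarrow> u y" using LIMSEQ_subseq_LIMSEQ[OF y(3) r(1)] by (simp add: o_def)
  from tendsto_diff[OF this y(1)] show "(%n. v (r n) (g y)) \<longlonglongrightarrow> u y" by (simp add: y(2))
 qed
 have zb: "energy V (%y. v (r n) (g y)) <= 2 * C + 4" for n unfolding push_forward(2)[OF vc] by (rule vb)
 show "u \<in> clH V (push V f F)"
  by (rule clH_AE_limit[where us = "%n y. v (r n) (g y)" and u = u and C = "2 * C + 4", OF d(3,4) push_H1 push_lin push_trunc push_forward(1)[OF vc] zb u z])
qed

lemma approximating_exists:
 assumes u: "u \<in> clH V (push V f F)"
 shows "\<exists>us. approximating N S us u"
proof -
 note p = psd_H1[OF d(3)]
 from clH_AE_seq[OF d(3) push_H1 u] obtain a where a: "\<forall>n. a n \<in> push V f F"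
  "null_seq (%n. E1sq V (%x. a n x - u x))" "AE y in refl_measure V. (%n. a n y) \<longlonglongrightarrow> u y" by (elim exE conjE)
 have uH: "u \<in> H1 V" using u by (simp add: clH_def)
 have aH: "a n \<in> H1 V" for n using a(1) push_H1 by blast
 have dH: "(%x. a n x - u x) \<in> H1 V" for n by (rule psd_diff[OF p aH uH])
 have D: "null_seq (%n. energy V (%x. a n x - u x))"
  by (rule E1_tendsto_parts(1)[where us = "%n x. a n x - u x", OF d(3) dH a(2)])
 have "seq_Cauchy_for (%w. energy V w) a"
  by (rule psd_convergent_Cauchy[where us = a and u = u, OF p aH uH D])
 moreover have "a n \<in> snd S" for n
  using a(1) continuous_measurable_refl unfolding snd_S push_def by blast
 ultimately show ?thesis unfolding approximating_iff using a(3) by blast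
qed

lemma extended_form_eq:
 assumes u: "u \<in> clH V (push V f F)" and v: "v \<in> clH V (push V f F)"
 shows "extended_form N S u v = 1/2 * dirichlet_integral V u v"
proof -
 have lim: "(%n. fst S (us n) (vs n)) \<longlonglongrightarrow> 1/2 * dirichlet_integral V u v"
  if us: "approximating N S us u" and vs: "approximating N S vs v" for us vs
 proof -
  have L: "u \<in> L2 (refl_measure V)" "v \<in> L2 (refl_measure V)" using u v by (auto simp: clH_def H1_iff)
  note a = approximating_limit[OF us L(1)] and b = approximating_limit[OF vs L(2)]
  have S: "us n \<in> snd S" "vs n \<in> snd S" for n using us vs unfolding approximating_iff by auto
  have "(%n. dirichlet_integral V (us n) (vs n)) \<longlonglongrightarrow> dirichlet_integral V u v"
   by (rule psd_tendsto[where us = us and vs = vs and u = u and v = v, OF psd_Hd[OF d(3)] snd_S_Hd[OF S(1)] snd_S_Hd[OF S(2)] a(1) b(1) a(2) b(2)])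
  then show ?thesis unfolding fst_S[OF S] by (intro tendsto_mult tendsto_const)
 qed
 \<comment> \<open>If there were no approximating pair, every l would meet the description;
   existence of a pair makes the limit unique.\<close>
 obtain us vs where uv: "approximating N S us u" "approximating N S vs v"
  using approximating_exists[OF u] approximating_exists[OF v] by (elim exE)
 show ?thesis unfolding extended_form_def
 proof (rule the_equality)
  show "\<forall>us vs. approximating N S us u \<and> approximating N S vs v --> (%n. fst S (us n) (vs n)) \<longlonglongrightarrow> 1/2 * dirichlet_integral V u v"
   using lim by blast
  fix l assume "\<forall>us vs. approximating N S us u \<and> approximating N S vs v --> (%n. fst S (us n) (vs n)) \<longlonglongrightarrow> l"
  then have "(%n. fst S (us n) (vs n)) \<longlonglongrightarrow> l" using uv by blast
  then show "l = 1/2 * dirichlet_integral V u v" using lim[OF uv] by (rule LIMSEQ_unique)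
 qed
qed

lemma conformal_transform_eq: "conformal_transform U V f P = gen_form V (clH V (push V f F))"
proof -
 have "extended_space N S \<inter> L2 (refl_measure V) = clH V (push V f F)"
 proof (intro equalityI subsetI)
  fix u assume "u \<in> extended_space N S \<inter> L2 (refl_measure V)"
  then obtain us where "approximating N S us u" "u \<in> L2 (refl_measure V)" by (auto simp: extended_space_def)
  then show "u \<in> clH V (push V f F)" by (rule approximating_limit(3))
 next
  fix u assume u: "u \<in> clH V (push V f F)"
  then have "u \<in> L2 (refl_measure V)" by (auto simp: clH_def H1_iff)
  then show "u \<in> extended_space N S \<inter> L2 (refl_measure V)"
   using approximating_exists[OF u] by (auto simp: extended_space_def L2_def)
 qed
 then have "conformal_transform U V f P = form_on (extended_form N S) (clH V (push V f F))"
  by (simp add: conformal_transform_def time_change_def)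
 also have "\<dots> = gen_form V (clH V (push V f F))"
  unfolding gen_form_def form_on_def using extended_form_eq by (auto simp: fun_eq_iff)
 finally show ?thesis .
qed

lemma conformal_transform_regular:
 assumes "regular_dirichlet_form (refl_measure V) (refl_BM_form V)"
 shows "regular_subspace (refl_measure V) (conformal_transform U V f P) (refl_BM_form V)"
 unfolding conformal_transform_eq
 by (rule gen_form_subspace[OF push_regular assms]) (auto simp: clH_def)

end

text \<open>By \<open>push_push\<close> the double transform is the closure of the core of P, which
  is P itself.\<close>

lemma conformal_transform_inverse:
 assumes c: "conf_pair U V f g" and P: "regular_subspace (refl_measure U) P (refl_BM_form U)"
  and V: "regular_dirichlet_form (refl_measure V) (refl_BM_form V)"
 shows "conformal_transform V U g (conformal_transform U V f P) = P"
proof -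
 interpret a: conf_subspace U V f g P "snd P" by unfold_locales (use c P in auto)
 let ?Q = "conformal_transform U V f P"
 interpret b: conf_subspace V U g f ?Q "snd ?Q"
  by unfold_locales (use conf_pair_sym[OF c] a.conformal_transform_regular[OF V] in auto)
 have "conformal_transform V U g ?Q = gen_form U (clH U (push U g (clH V (push V f (snd P)))))"
  unfolding b.conformal_transform_eq unfolding a.conformal_transform_eq by simp
 also have "\<dots> = gen_form U (clH U (core U (snd P)))" unfolding a.push_push ..
 also have "\<dots> = P" using a.rs(1,9) by simp
 finally show ?thesis .
qed

lemma conformal_transform_unique_preimage:
 assumes c: "conf_pair U V f g" and P: "regular_subspace (refl_measure V) PV (refl_BM_form V)"
  and U: "regular_dirichlet_form (refl_measure U) (refl_BM_form U)"
  and V: "regular_dirichlet_form (refl_measure V) (refl_BM_form V)"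
 shows "\<exists>!PU. regular_subspace (refl_measure U) PU (refl_BM_form U) \<and> PV = conformal_transform U V f PU"
proof -
 note c' = conf_pair_sym[OF c]
 interpret b: conf_subspace V U g f PV "snd PV" by unfold_locales (use c' P in auto)
 show ?thesis
 proof (intro ex1I conjI)
  show "regular_subspace (refl_measure U) (conformal_transform V U g PV) (refl_BM_form U)" by (rule b.conformal_transform_regular[OF U])
  show "PV = conformal_transform U V f (conformal_transform V U g PV)" by (rule conformal_transform_inverse[OF c' P U, symmetric])
  fix PU assume "regular_subspace (refl_measure U) PU (refl_BM_form U) \<and> PV = conformal_transform U V f PU"
  then show "PU = conformal_transform V U g PV" using conformal_transform_inverse[OF c _ V] by auto
 qed
qed

section \<open>Boundary behaviour of the Riemann map of a Jordan domain\<close>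

lemma measurable_Complex_pair: "(%(x, y). Complex x y) \<in> borel_measurable (lborel \<Otimes>\<^sub>M lborel)"
proof -
 have "(%(x, y). Complex x y) = (%p. complex_of_real (fst p) + \<i> * complex_of_real (snd p))" by (auto simp: Complex_eq)
 moreover have "(%p. complex_of_real (fst p) + \<i> * complex_of_real (snd p)) \<in> borel_measurable (lborel \<Otimes>\<^sub>M lborel)" by measurable
 ultimately show ?thesis by simp
qed

lemma lborel_distr_Complex: "distr (lborel \<Otimes>\<^sub>M lborel) borel (%(x, y). Complex x y) = lborel"
proof (rule lborel_eqI[symmetric])
 fix l u :: complex
 assume lu: "\<And>b. b \<in> Basis ==> l \<bullet> b <= u \<bullet> b"
 have le: "Re l <= Re u" "Im l <= Im u" using lu[of 1] lu[of \<i>] by (auto simp: Basis_complex_def)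
 note m = measurable_Complex_pair
 have eq: "(%(x, y). Complex x y) -` box l u = {Re l<..<Re u} \<times> {Im l<..<Im u}"
  by (auto simp: box_def Basis_complex_def)
 have "emeasure (distr (lborel \<Otimes>\<^sub>M lborel) borel (%(x, y). Complex x y)) (box l u) = emeasure (lborel \<Otimes>\<^sub>M lborel) ({Re l<..<Re u} \<times> {Im l<..<Im u})"
  by (subst emeasure_distr[OF m]) (auto simp: eq space_pair_measure)
 also have "\<dots> = ennreal (Re u - Re l) * ennreal (Im u - Im l)"
  using le by (subst lborel.emeasure_pair_measure_Times) auto
 also have "\<dots> = ennreal (\<Prod>b\<in>Basis. (u - l) \<bullet> b)"
  using le by (simp add: Basis_complex_def ennreal_mult complex_eq_iff)
 finally show "emeasure (distr (lborel \<Otimes>\<^sub>M lborel) borel (%(x, y). Complex x y)) (box l u) = ennreal (\<Prod>b\<in>Basis. (u - l) \<bullet> b)" .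
qed simp

lemma nn_integral_complex_Fubini:
 assumes [measurable]: "bm F"
 shows "(nnl (%z. F z)) = (nnl (%x. \<integral>\<^sup>+y. F (Complex x y) \<partial>lborel))"
proof -
 note measurable_Complex_pair[measurable]
 have "(nnl (%z. F z)) = (\<integral>\<^sup>+p. F (case p of (x, y) => Complex x y) \<partial>(lborel \<Otimes>\<^sub>M lborel))"
  by (subst lborel_distr_Complex[symmetric], subst nn_integral_distr) auto
 also have "\<dots> = (nnl (%x. \<integral>\<^sup>+y. F (case (x, y) of (x, y) => Complex x y) \<partial>lborel))"
  by (subst lborel.nn_integral_fst[symmetric]) auto
 finally show ?thesis by simp
qed

lemma line_variation_le:
 fixes v :: "complex => real"
 assumes C: "C1_on N v G" and s: "\<And>t. t \<in> {a..b} ==> Complex x t \<in> N" and "a <= b"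
 shows "ennreal \<bar>v (Complex x b) - v (Complex x a)\<bar> <= (nnl (%t. ennreal (indicator N (Complex x t) * norm (G (Complex x t)))))"
proof -
 let ?f = "%t. G (Complex x t) \<bullet> \<i>"
 have op: "open N" and dv: "\<And>z. z \<in> N ==> (v has_derivative (%h. G z \<bullet> h)) (at z)" and cG: "continuous_on N G"
  using C by (auto simp: C1_on_def)
 have dl: "((%t. Complex x t) has_derivative (%h. h *\<^sub>R \<i>)) (at t)" for t
 proof -
  have "((%t. complex_of_real x + t *\<^sub>R \<i>) has_derivative (%h. h *\<^sub>R \<i>)) (at t)" by (auto intro!: derivative_eq_intros)
  moreover have "(%t. complex_of_real x + t *\<^sub>R \<i>) = (%t. Complex x t)" by (auto simp: complex_eq_iff)
  ultimately show ?thesis by (simp only:)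
 qed
 have D: "((%t. v (Complex x t)) has_real_derivative ?f t) (at t)" if "a <= t" "t <= b" for t
  using has_derivative_compose[OF dl dv[OF s[of t]]] that
  by (simp add: has_field_derivative_def mult_commute_abs)
 have ct: "isCont ?f t" if "a <= t" "t <= b" for t
 proof -
  have "isCont G (Complex x t)" using cG op s[of t] that by (simp add: continuous_on_eq_continuous_at)
  moreover have "isCont (%t. Complex x t) t" using dl has_derivative_continuous by blast
  ultimately have "isCont (%t. G (Complex x t)) t" by (rule isCont_o2[rotated])
  then show ?thesis by (intro continuous_intros)
 qed
 have h: "has_bochner_integral lborel (%t. ?f t * indicator {a..b} t) (v (Complex x b) - v (Complex x a))"
  by (rule has_bochner_integral_FTC_Icc_real[OF \<open>a <= b\<close> D ct]) auto
 then have "ennreal (norm (v (Complex x b) - v (Complex x a))) <= (nnl (%t. ennreal (norm (?f t * indicator {a..b} t))))"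
  using integral_norm_bound_ennreal[of lborel "%t. ?f t * indicator {a..b} t"] by (simp add: has_bochner_integral_iff)
 also have "\<dots> <= (nnl (%t. ennreal (indicator N (Complex x t) * norm (G (Complex x t)))))"
 proof (intro nn_integral_mono ennreal_leI)
  fix t
  have "\<bar>G (Complex x t) \<bullet> \<i>\<bar> <= norm (G (Complex x t))" using Cauchy_Schwarz_ineq2[of "G (Complex x t)" \<i>] by simp
  then show "norm (?f t * indicator {a..b} t) <= indicator N (Complex x t) * norm (G (Complex x t))"
   using s[of t] by (auto simp: indicator_def)
 qed
 finally show ?thesis by simp
qed

lemma set_integrable_const_bounded:
 fixes A :: "'a::euclidean_space set" and c :: real
 assumes "A \<in> sets borel" "bounded A"
 shows "sint A (%_. c)" unfolding set_integrable_def
 by (intro integrable_scaleR_left integrable_real_indicator) (use assms emeasure_bounded_finite in auto)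

text \<open>For abscissas filling a length of at least \<epsilon>/2, the vertical segment from a
  point of E to the real axis takes v from B to A, so |B - A| is at most the integral of |G| along
  the line. Integrate over the abscissas and bound |G| by \<tau> + |G|^2 / \<tau>; the 4 bounds the
  area \<pi> of the disc.\<close>

lemma length_area_bound:
 fixes v :: "complex => real"
 assumes C: "C1_on (ball 0 1) v G" and E: "connected E" "E \<subseteq> ball 0 1" "\<And>z. z \<in> E ==> v z = B"
  and A: "\<And>z. norm z <= 1 - \<epsilon> / 4 ==> v z = A" and z: "z1 \<in> E" "z2 \<in> E" "Re z2 - Re z1 \<ge> \<epsilon>" and "\<epsilon> > 0"
  and G: "sint (ball 0 1) (%z. (norm (G z))\<^sup>2)" "(LBINT z:ball 0 1. (norm (G z))\<^sup>2) <= D" and "\<tau> > 0"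
 shows "\<bar>B - A\<bar> * (\<epsilon> / 2) <= 4 * \<tau> + D / \<tau>"
proof -
 have cG: "continuous_on (ball 0 1) G" using C by (simp add: C1_on_def)
 let ?F = "%z. indicator (ball 0 1) z * norm (G z) :: real"
 have Fm: "bm ?F" using borel_measurable_continuous_on_indicator[OF _ continuous_on_norm[OF cG]] by simp
 \<comment> \<open>Clipping at 1 - \<epsilon>/4 keeps the foot of the segment where v = A. It costs
   at most \<epsilon>/4 at each end because E lies in the unit disc.\<close>
 define I where "I = {max (Re z1) (-(1 - \<epsilon>/4))..min (Re z2) (1 - \<epsilon>/4)}"
 have r: "\<bar>Re z1\<bar> < 1" "\<bar>Re z2\<bar> < 1"
  using z(1,2) E(2) abs_Re_le_cmod[of z1] abs_Re_le_cmod[of z2] by (auto simp: subset_eq)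
 have Imeas: "ennreal (\<epsilon> / 2) <= emeasure lborel I"
  unfolding I_def emeasure_lborel_Icc_eq using r z(3) \<open>\<epsilon> > 0\<close> by (auto intro!: ennreal_leI simp: max_def min_def)
 have line: "ennreal \<bar>B - A\<bar> <= (nnl (%t. ennreal (?F (Complex x t))))" if x: "x \<in> I" for x
 proof -
  have "connected (Re ` E)" by (intro connected_continuous_image continuous_intros E)
  then have "x \<in> Re ` E"
   by (rule connectedD_interval[of _ "Re z1" "Re z2"]) (use x z in \<open>auto simp: I_def\<close>)
  then obtain w where w: "w \<in> E" "Re w = x" by auto
  define y where "y = Im w"
  have wE: "w = Complex x y" using w by (auto simp: y_def)
  have "norm (Complex x 0) <= 1 - \<epsilon> / 4" using x by (auto simp: I_def complex_norm)
  then have v0: "v (Complex x 0) = A" by (rule A)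
  have vy: "v (Complex x y) = B" using E(3)[OF w(1)] wE by simp
  have seg: "Complex x t \<in> ball 0 1" if "\<bar>t\<bar> <= \<bar>y\<bar>" for t
  proof -
   have "norm (Complex x t) <= norm (Complex x y)"
    using that by (simp add: complex_norm abs_le_square_iff)
   also have "\<dots> < 1" using w(1) E(2) wE by auto
   finally show ?thesis by simp
  qed
  show ?thesis
  proof (cases "0 <= y")
   case True
   show ?thesis using line_variation_le[OF C, of 0 y x] seg True v0 vy by auto
  next
   case False
   show ?thesis using line_variation_le[OF C, of y 0 x] seg False v0 vy by (auto simp: abs_minus_commute)
  qed
 qed
 have i1: "sint (ball 0 1) (%z. \<tau> + (norm (G z))^2 / \<tau>)"
  by (intro set_integral_add(1) set_integrable_divide G set_integrable_const_bounded) auto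
 have le: "norm (G z) <= \<tau> + (norm (G z))^2 / \<tau>" for z
 proof -
  have "norm (G z) * \<tau> <= \<tau>\<^sup>2 + (norm (G z))^2"
   using sum_squares_bound[of "norm (G z)" \<tau>] mult_nonneg_nonneg[of "norm (G z)" \<tau>] \<open>\<tau> > 0\<close>
   unfolding mult.assoc by (smt (verit) norm_ge_zero)
  then show ?thesis using \<open>\<tau> > 0\<close> by (simp add: field_simps power2_eq_square)
 qed
 have i2: "sint (ball 0 1) (%z. norm (G z))"
  by (rule set_integrable_dominated[OF i1]) (use Fm le in auto)
 have mb: "measure lborel (ball (0::complex) 1) <= 4"
  using content_ball[of 1 "0::complex"] pi_less_4 by (simp add: unit_ball_vol_2)
 have "ennreal (\<bar>B - A\<bar> * (\<epsilon> / 2)) = ennreal \<bar>B - A\<bar> * ennreal (\<epsilon> / 2)" by (rule ennreal_mult) (use \<open>\<epsilon> > 0\<close> in auto)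
 also have "\<dots> <= ennreal \<bar>B - A\<bar> * emeasure lborel I" by (intro mult_left_mono Imeas) simp
 also have "\<dots> = (nnl (%x. ennreal \<bar>B - A\<bar> * indicator I x))" by (subst nn_integral_cmult_indicator) (auto simp: I_def)
 also have "\<dots> <= (nnl (%x. \<integral>\<^sup>+y. ennreal (?F (Complex x y)) \<partial>lborel))"
  by (intro nn_integral_mono) (use line in \<open>auto simp: indicator_def\<close>)
 also have "\<dots> = (nnl (%z. ennreal (?F z)))" by (rule nn_integral_complex_Fubini[symmetric]) (use Fm in measurable)
 also have "\<dots> = ennreal (LBINT z:ball 0 1. norm (G z))"
  unfolding set_lebesgue_integral_def using i2 by (subst nn_integral_eq_integral) (auto simp: set_integrable_def)
 finally have "\<bar>B - A\<bar> * (\<epsilon> / 2) <= (LBINT z:ball 0 1. norm (G z))"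
  by (subst (asm) ennreal_le_iff) (auto simp: set_lebesgue_integral_def intro!: integral_nonneg_AE)
 also have "\<dots> <= (LBINT z:ball 0 1. \<tau> + (norm (G z))^2 / \<tau>)" by (rule set_integral_mono[OF i2 i1]) (rule le)
 also have "\<dots> = \<tau> * measure lborel (ball (0::complex) 1) + (LBINT z:ball 0 1. (norm (G z))\<^sup>2) / \<tau>"
 proof -
  have c: "sint (ball (0::complex) 1) (%_. \<tau>)" by (rule set_integrable_const_bounded) auto
  show ?thesis using set_integral_add(2)[OF c set_integrable_divide[OF G(1), of \<tau>]]
   by (simp add: set_lebesgue_integral_def)
 qed
 also have "\<dots> <= 4 * \<tau> + D / \<tau>" using mb G(2) \<open>\<tau> > 0\<close> by (intro add_mono divide_right_mono) auto
 finally show ?thesis .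
qed

text \<open>If W met the outside of its boundary curve it would contain that outside; its complement
  would then be bounded and nonempty and have a bounded component, which simple connectedness
  excludes.\<close>

lemma jordan_domain_bounded:
 assumes W: "jordan_domain W"
 shows "bounded W" "frontier W \<noteq> {}" "open W" "connected W" "W \<noteq> {}" "W \<noteq> UNIV"
proof -
 obtain \<gamma> where g: "simple_path \<gamma>" "pathfinish \<gamma> = pathstart \<gamma>" "path_image \<gamma> = frontier W"
  and o: "open W" and con: "connected W" and sc: "simply_connected W"
  using W unfolding jordan_domain_def by blast
 show fr: "frontier W \<noteq> {}" unfolding g(3)[symmetric] by simp
 show "W \<noteq> {}" "W \<noteq> UNIV" using fr by auto
 show "open W" "connected W" by fact+
 obtain I O' where J: "bounded I" "open O'" "connected O'" "O' \<noteq> {}" "I \<union> O' = - frontier W" "open I"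
  using Jordan_curve[OF g(1,2)] unfolding g(3) by metis
 have WJ: "W \<subseteq> - frontier W" using o frontier_disjoint_eq[of W] by auto
 show "bounded W"
 proof (cases "W \<inter> O' = {}")
  case True
  then have "W \<subseteq> I" using WJ J(5) by blast
  then show ?thesis using J(1) bounded_subset by blast
 next
  case False
  have "O' \<subseteq> W" using connected_Int_frontier[OF J(3), of W] False J(5) by blast
  then have "- W \<subseteq> I \<union> frontier W" using J(5) by blast
  moreover have "bounded (frontier W)" using g bounded_simple_path_image by metis
  ultimately have b: "bounded (- W)" using J(1) by (meson bounded_Un bounded_subset)
  have "- W \<noteq> {}" using fr by (metis Compl_empty_eq double_complement frontier_UNIV)
  then obtain C where C: "C \<in> components (- W)" by (metis components_eq_empty equals0I)
  then have "\<not> bounded C" using sc simply_connected_eq_unbounded_complement_components[OF o] by blast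
  moreover have "bounded C" using bounded_subset[OF b in_components_subset[OF C]] .
  ultimately show ?thesis by blast
 qed
qed

lemma connected_frontier_subset:
 assumes "connected C" "C \<inter> W \<noteq> {}" "C \<inter> frontier W = {}"
 shows "C \<subseteq> W" using connected_Int_frontier[OF assms(1,2)] assms(3) by blast

text \<open>Janiszewski's theorem: if neither of two such sets with connected intersection separates
  x from y, their union does not either. One set is the boundary curve, the other consists of the
  complement of the \<epsilon>-ball and a boundary arc avoiding p.\<close>

lemma jordan_domain_locally_connected_boundary:
 assumes W: "jordan_domain W" and p: "p \<in> frontier W" and eps: "\<epsilon> > 0"
 shows "\<exists>\<delta>>0. \<forall>x\<in>W \<inter> ball p \<delta>. \<forall>y\<in>W \<inter> ball p \<delta>. \<exists>C. connected C \<and> C \<subseteq> W \<inter> ball p \<epsilon> \<and> x \<in> C \<and> y \<in> C"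
proof -
 obtain \<gamma>0 where g0: "simple_path \<gamma>0" "pathfinish \<gamma>0 = pathstart \<gamma>0" "path_image \<gamma>0 = frontier W"
  and o: "open W" and con: "connected W" using W unfolding jordan_domain_def by blast
 obtain a where a: "a \<in> {0..1}" "\<gamma>0 a = p" using p unfolding g0(3)[symmetric] path_image_def by auto
 \<comment> \<open>The loop is restarted at p, so parameters near either end give points near
   p.\<close>
 define \<gamma> where "\<gamma> = shiftpath a \<gamma>0"
 have a': "0 <= a" "a <= 1" using a by auto
 have g: "simple_path \<gamma>" "path_image \<gamma> = frontier W" "\<gamma> 0 = p" "\<gamma> 1 = p"
  using simple_path_shiftpath[OF g0(1,2) a'] path_image_shiftpath[OF a(1) g0(2)] g0(3)
   pathstart_shiftpath[OF a'(2), of \<gamma>0] pathfinish_shiftpath[OF a'(1) g0(2)] a(2)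
  by (auto simp: \<gamma>_def pathstart_def pathfinish_def)
 have c: "continuous_on {0..1} \<gamma>" using g(1) by (simp add: simple_path_def path_def)
 obtain s1 where s1: "s1 > 0" "\<And>t. t \<in> {0..1} ==> dist t 0 < s1 ==> dist (\<gamma> t) p < \<epsilon>"
  using c[unfolded continuous_on_iff, rule_format, of 0 \<epsilon>] eps g(3) by auto
 obtain s2 where s2: "s2 > 0" "\<And>t. t \<in> {0..1} ==> dist t 1 < s2 ==> dist (\<gamma> t) p < \<epsilon>"
  using c[unfolded continuous_on_iff, rule_format, of 1 \<epsilon>] eps g(4) by auto
 \<comment> \<open>Below both moduli of continuity, so that the parameters left out of the arc stay
   in the \<epsilon>-ball, and below 1/2, so that the arc is nonempty.\<close>
 define s where "s = min (min s1 s2) (1/2) / 2"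
 have s: "0 < s" "s < s1" "s < s2" "s < 1/2" using s1(1) s2(1) by (auto simp: s_def min_def)
 define J' where "J' = \<gamma> ` {s..1 - s}"
 have J'c: "compact J'" "connected J'"
  unfolding J'_def using s by (intro compact_continuous_image connected_continuous_image continuous_on_subset[OF c]; auto)+
 have J'sub: "J' \<subseteq> frontier W" unfolding J'_def g(2)[symmetric] path_image_def using s by auto
 have pJ': "p \<notin> J'"
 proof
  assume "p \<in> J'"
  then obtain t where t: "t \<in> {s..1 - s}" "\<gamma> t = \<gamma> 0" using g(3) by (auto simp: J'_def)
  have lf: "\<forall>x\<in>{0..1}. \<forall>y\<in>{0..1}. \<gamma> x = \<gamma> y --> x = y \<or> x = 0 \<and> y = 1 \<or> x = 1 \<and> y = 0"
   using g(1) by (simp add: simple_path_def loop_free_def)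
  have "t = 0 \<or> t = 1" using lf[rule_format, of t 0] t s by auto
  then show False using t(1) s by auto
 qed
 have rest: "frontier W - ball p \<epsilon> \<subseteq> J'"
 proof
  fix z assume z: "z \<in> frontier W - ball p \<epsilon>"
  then obtain t where t: "t \<in> {0..1}" "z = \<gamma> t" unfolding g(2)[symmetric] path_image_def by auto
  have "\<not> dist t 0 < s1" "\<not> dist t 1 < s2" using s1(2)[OF t(1)] s2(2)[OF t(1)] z t(2) by (auto simp: dist_commute)
  then have "t \<in> {s..1 - s}" using t(1) s by (auto simp: dist_real_def)
  then show "z \<in> J'" using t(2) by (auto simp: J'_def)
 qed
 \<comment> \<open>Adding the arc makes the intersection with the boundary exactly the connected set
   J'; the complement of the ball alone could meet the boundary in many pieces.\<close>
 define T where "T = J' \<union> - ball p \<epsilon>"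
 have clT: "closed T" unfolding T_def using J'c compact_imp_closed by (intro closed_Un) auto
 have "p \<notin> T" using pJ' eps by (auto simp: T_def)
 then obtain \<delta> where d: "\<delta> > 0" "ball p \<delta> \<subseteq> - T" using clT open_contains_ball[of "- T"] by (auto simp: open_Compl)
 show ?thesis
 proof (intro exI[of _ \<delta>] conjI ballI d(1))
  fix x y assume xy: "x \<in> W \<inter> ball p \<delta>" "y \<in> W \<inter> ball p \<delta>"
  have WJ: "W \<subseteq> - frontier W" using o frontier_disjoint_eq[of W] by auto
  have "connected_component (- (frontier W \<union> T)) x y"
  proof (rule Janiszewski)
   show "compact (frontier W)" by (rule compact_frontier_bounded[OF jordan_domain_bounded(1)[OF W]])
   show "closed T" by (rule clT)
   have "frontier W \<inter> T = J'" using J'sub rest by (auto simp: T_def)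
   then show "connected (frontier W \<inter> T)" using J'c by simp
   show "connected_component (- frontier W) x y" unfolding connected_component_def using con WJ xy by blast
   show "connected_component (- T) x y" unfolding connected_component_def using d(2) xy by (intro exI[of _ "ball p \<delta>"]) auto
  qed
  then obtain C where C: "connected C" "C \<subseteq> - (frontier W \<union> T)" "x \<in> C" "y \<in> C" unfolding connected_component_def by blast
  have "C \<subseteq> W" by (rule connected_frontier_subset[OF C(1)]) (use C xy in auto)
  then show "\<exists>C. connected C \<and> C \<subseteq> W \<inter> ball p \<epsilon> \<and> x \<in> C \<and> y \<in> C" using C by (intro exI[of _ C]) (auto simp: T_def)
 qed
qed

section \<open>Continuity of the Riemann map up to the boundary\<close>

definition riemann_pair :: "complex set => (complex => complex) => (complex => complex) => bool" where
 "riemann_pair W \<phi> h \<longleftrightarrow> open W \<and> bounded W \<and> \<phi> holomorphic_on ball 0 1 \<and> h holomorphic_on W \<and>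
   (\<forall>w\<in>W. h w \<in> ball 0 1 \<and> \<phi> (h w) = w) \<and> (\<forall>z\<in>ball 0 1. \<phi> z \<in> W \<and> h (\<phi> z) = z)"

lemma riemann_pairD:
 assumes "riemann_pair W \<phi> h"
 shows "open W" "bounded W" "\<phi> holomorphic_on ball 0 1" "h holomorphic_on W"
  "\<And>w. w \<in> W ==> h w \<in> ball 0 1" "\<And>w. w \<in> W ==> \<phi> (h w) = w"
  "\<And>z. z \<in> ball 0 1 ==> \<phi> z \<in> W" "\<And>z. z \<in> ball 0 1 ==> h (\<phi> z) = z"
  "\<phi> ` ball 0 1 = W" "inj_on \<phi> (ball 0 1)" "h ` W = ball 0 1" "inj_on h W"
proof -
 show a: "open W" "bounded W" "\<phi> holomorphic_on ball 0 1" "h holomorphic_on W"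
  "\<And>w. w \<in> W ==> h w \<in> ball 0 1" "\<And>w. w \<in> W ==> \<phi> (h w) = w"
  "\<And>z. z \<in> ball 0 1 ==> \<phi> z \<in> W" "\<And>z. z \<in> ball 0 1 ==> h (\<phi> z) = z"
  using assms unfolding riemann_pair_def by blast+
 show "\<phi> ` ball 0 1 = W" "h ` W = ball 0 1" using a(5-8) by force+
 show "inj_on \<phi> (ball 0 1)" by (rule inj_on_inverseI[of _ h]) (rule a(8))
 show "inj_on h W" by (rule inj_on_inverseI[of _ \<phi>]) (rule a(6))
qed

lemma riemann_pair_exists:
 assumes W: "jordan_domain W"
 shows "\<exists>\<phi> h. riemann_pair W \<phi> h"
proof -
 note b = jordan_domain_bounded[OF W]
 have "open W \<and> simply_connected W" using W by (simp add: jordan_domain_def)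
 then have "\<exists>f g. f holomorphic_on W \<and> g holomorphic_on ball 0 1 \<and>
   (\<forall>z\<in>W. f z \<in> ball 0 1 \<and> g (f z) = z) \<and> (\<forall>z\<in>ball 0 1. g z \<in> W \<and> f (g z) = z)"
  unfolding Riemann_mapping_theorem using b(5,6) by blast
 then obtain f g where "f holomorphic_on W" "g holomorphic_on ball 0 1"
   "\<forall>z\<in>W. f z \<in> ball 0 1 \<and> g (f z) = z" "\<forall>z\<in>ball 0 1. g z \<in> W \<and> f (g z) = z" by (elim exE conjE)
 then show ?thesis using b(1,3) unfolding riemann_pair_def by blast
qed

text \<open>ln |F| is the real part of a local logarithm of F, whose derivative is F'/F; the
  gradient is the conjugate. Writing it as half the logarithm of the squared norm avoids
  differentiating the norm.\<close>

lemma has_derivative_ln_norm_holomorphic: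
 assumes F: "(F has_field_derivative F') (at z)" and nz: "F z \<noteq> (0::complex)"
 shows "((%z. ln (norm (F z))) has_derivative (%h. cnj (F' / F z) \<bullet> h)) (at z)"
proof -
 have "(F has_derivative (%h. F' * h)) (at z)" using F by (simp add: has_field_derivative_def)
 then have "((%z. ln (F z \<bullet> F z) / 2) has_derivative (%h. ((F z \<bullet> (F' * h) + (F' * h) \<bullet> F z) * inverse (F z \<bullet> F z)) / 2)) (at z)"
  using nz by (auto intro!: derivative_eq_intros simp: field_simps)
 moreover have "ln (F z \<bullet> F z) / 2 = ln (norm (F z))" for z
 proof (cases "F z = 0")
  case False
  have "F z \<bullet> F z = (norm (F z))^2" by (simp add: power2_norm_eq_inner)
  then show ?thesis using False by (simp add: ln_realpow)
 qed simp
 moreover have "((F z \<bullet> (F' * h) + (F' * h) \<bullet> F z) * inverse (F z \<bullet> F z)) / 2 = cnj (F' / F z) \<bullet> h" for h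
 proof -
  have s: "a \<bullet> b = Re (cnj a * b)" for a b :: complex by (simp add: inner_complex_def)
  have "F' / F z = (F' * cnj (F z)) / of_real ((norm (F z))^2)"
   using nz complex_norm_square[of "F z"] by (simp add: divide_simps)
  then have "Re ((F' / F z) * h) = Re (cnj (F z) * (F' * h)) / (norm (F z))^2"
   by (simp only: times_divide_eq_left Re_divide_of_real) (simp add: mult_ac)
  then have "cnj (F' / F z) \<bullet> h = (F z \<bullet> (F' * h)) / (norm (F z))^2" by (simp add: s)
  moreover have "F z \<bullet> F z = (norm (F z))^2" by (simp only: power2_norm_eq_inner)
  ultimately show ?thesis by (simp only: inner_commute[of "F' * h" "F z"] divide_inverse) simp
 qed
 ultimately show ?thesis by simp
qed

text \<open>A trapezoid of height 1 with unit ramps at a and b. Its primitive is a continuously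
  differentiable step that rises by at least b - a - 2 and is constant outside the interval.\<close>

definition tent :: "real => real => real => real" where
 "tent a b t = max 0 (min 1 (min (t - a) (b - t)))"

lemma tent_facts:
 "continuous_on UNIV (tent a b)" "\<bar>tent a b t\<bar> <= 1" "\<not> (a < t \<and> t < b) ==> tent a b t = 0"
 "tent a b \<in> borel_measurable borel"
proof -
 show c: "continuous_on UNIV (tent a b)" unfolding tent_def[abs_def] by (intro continuous_intros)
 show "tent a b \<in> borel_measurable borel" by (rule borel_measurable_continuous_onI[OF c])
qed (auto simp: tent_def max_def min_def)

lemma primitive0_const:
 assumes h: "bm h" "\<And>x. \<bar>h x\<bar> <= 1" and "s <= t" and z: "\<And>x. s <= x ==> x <= t ==> h x = 0"
 shows "primitive0 h s = primitive0 h t"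
proof -
 have "(LBINT x:{s..t}. h x) = (LBINT x:{s..t}. 0)" by (rule set_lebesgue_integral_cong) (use z in auto)
 then show ?thesis using primitive0_diff[OF h \<open>s <= t\<close>] by (simp add: set_lebesgue_integral_def)
qed

lemma primitive0_tent:
 assumes "a + 2 <= b"
 shows "b - a - 2 <= primitive0 (tent a b) b - primitive0 (tent a b) a"
  "t <= a ==> primitive0 (tent a b) t = primitive0 (tent a b) a"
  "b <= t ==> primitive0 (tent a b) t = primitive0 (tent a b) b"
proof -
 note t = tent_facts(4)[of a b] tent_facts(2)[of a b]
 have "b - a - 2 = (LBINT x:{a..b}. indicator {a+1..b-1} x)"
 proof -
  have "(LBINT x:{a..b}. indicator {a+1..b-1} x :: real) = (LINT x|lborel. indicator {a+1..b-1} x)"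
   unfolding set_lebesgue_integral_def by (rule Bochner_Integration.integral_cong) (auto simp: indicator_def)
  then show ?thesis using assms by simp
 qed
 also have "\<dots> <= (LBINT x:{a..b}. tent a b x)"
 proof (rule set_integral_mono)
  show "sint {a..b} (tent a b)"
   using interval_mult_integrable[OF t, of a b] by (simp add: set_integrable_def)
  show "sint {a..b} (indicator {a+1..b-1} :: real => real)"
   unfolding set_integrable_def using interval_mult_integrable[of "indicator {a+1..b-1}" a b] by simp
 qed (auto simp: tent_def indicator_def)
 also have "\<dots> = primitive0 (tent a b) b - primitive0 (tent a b) a"
  by (rule primitive0_diff[OF t, symmetric]) (use assms in simp)
 finally show "b - a - 2 <= primitive0 (tent a b) b - primitive0 (tent a b) a" .
 show "t <= a ==> primitive0 (tent a b) t = primitive0 (tent a b) a"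
  by (rule primitive0_const[OF t]) (auto intro: tent_facts(3))
 show "b <= t ==> primitive0 (tent a b) t = primitive0 (tent a b) b"
  by (rule primitive0_const[OF t, symmetric]) (auto intro: tent_facts(3))
qed

text \<open>Cover the annulus by N dyadic rings. On each ring the weight is of the order of the
  inverse area, so every ring contributes at most 4 \<pi>, which is below 16.\<close>

lemma annulus_energy:
 fixes p :: complex and N :: nat
 assumes W: "open W" "bounded W" and d: "d > 0"
 defines "\<rho> \<equiv> %w. indicator {w. d / 2 ^ N < norm (w - p) \<and> norm (w - p) < d} w / (norm (w - p))^2"
 shows "sint W \<rho>" "(LBINT w:W. \<rho> w) <= 16 * real N"
proof -
 have rm: "bm \<rho>" unfolding \<rho>_def by measurable
 have r0: "0 <= \<rho> w" for w by (simp add: \<rho>_def)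
 let ?s = "%w. \<Sum>k<N. indicator (ball p (d / 2 ^ k)) w * (2 ^ (k + 1) / d)^2"
 have le: "\<rho> w <= ?s w" for w
 proof (cases "d / 2 ^ N < norm (w - p) \<and> norm (w - p) < d")
  case True
  \<comment> \<open>Locates the ring of w: with m = k + 1, the distance from p lies between d / 2^(k
    + 1) and d / 2^k.\<close>
  define m where "m = (LEAST k. d / 2 ^ k <= norm (w - p))"
  have mN: "d / 2 ^ m <= norm (w - p)" "m <= N"
   unfolding m_def using True by (auto intro: LeastI[of _ N] Least_le)
  have "m \<noteq> 0" using mN(1) True by (cases m) auto
  then obtain k where k: "m = Suc k" by (cases m) auto
  then have kN: "k < N" using mN by simp
  have "\<not> d / 2 ^ k <= norm (w - p)" using not_less_Least[of k "%k. d / 2 ^ k <= norm (w - p)"] k unfolding m_def by simp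
  then have wb: "w \<in> ball p (d / 2 ^ k)" by (simp add: dist_norm norm_minus_commute)
  have pos: "0 < d / 2 ^ (k + 1)" using d by simp
  have "\<rho> w = 1 / (norm (w - p))^2" using True by (simp add: \<rho>_def)
  also have "\<dots> <= 1 / (d / 2 ^ (k + 1))^2"
   using mN(1) k pos by (intro divide_left_mono power_mono mult_pos_pos zero_less_power) auto
  also have "\<dots> = indicator (ball p (d / 2 ^ k)) w * (2 ^ (k + 1) / d)^2" using wb by (simp add: power_divide)
  also have "\<dots> <= ?s w" using kN by (intro member_le_sum) auto
  finally show ?thesis .
 qed (auto simp: \<rho>_def intro!: sum_nonneg)
 have si: "integrable lborel (%w. indicator (ball p (d / 2 ^ k)) w * (2 ^ (k + 1) / d)^2 :: real)" for k
  by (intro integrable_mult_left integrable_real_indicator) (use emeasure_bounded_finite[OF bounded_ball[of p "d / 2 ^ k"]] in auto)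
 have ss: "integrable lborel ?s" by (intro Bochner_Integration.integrable_sum si)
 have ri: "integrable lborel \<rho>"
 proof (rule Bochner_Integration.integrable_bound[OF ss])
  show "AE w in lborel. norm (\<rho> w) <= norm (?s w)"
   by (intro AE_I2) (use order_trans[OF le abs_ge_self] r0 in \<open>simp only: real_norm_def abs_of_nonneg\<close>)
 qed (use rm in simp)
 show "sint W \<rho>" unfolding set_integrable_def by (rule integrable_mult_indicator) (use W ri in auto)
 have "(LBINT w:W. \<rho> w) <= (LINT w|lborel. ?s w)" unfolding set_lebesgue_integral_def
  by (rule integral_mono[OF integrable_mult_indicator[OF _ ri] ss]) (use W r0 le in \<open>auto simp: indicator_def intro: order_trans\<close>)
 also have "\<dots> = (\<Sum>k<N. measure lborel (ball p (d / 2 ^ k)) * (2 ^ (k + 1) / d)^2)"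
  by (subst Bochner_Integration.integral_sum[OF si]) simp
 also have "\<dots> <= (\<Sum>k<N. 16)"
 proof (rule sum_mono)
  fix k
  have "measure lborel (ball p (d / 2 ^ k)) = pi * (d / 2 ^ k)^2"
   using content_ball[of "d / 2 ^ k" p] d by (simp add: unit_ball_vol_2)
  then have "measure lborel (ball p (d / 2 ^ k)) * (2 ^ (k + 1) / d)^2 = 4 * pi"
   using d by (simp add: power_divide field_simps)
  then show "measure lborel (ball p (d / 2 ^ k)) * (2 ^ (k + 1) / d)^2 <= 16" using pi_less_4 by simp
 qed
 finally show "(LBINT w:W. \<rho> w) <= 16 * real N" by simp
qed

text \<open>Length-area argument with ln |w - p|, cut off smoothly to the annulus d / 2^N < |w - p|
  < d and pulled back to the disc. It rises by at least N ln 2 - 2 with energy at most 16 N, while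
  an image of horizontal width \<epsilon> would force the rise to be at most of order sqrt N /
  \<epsilon>. This fails for large N.\<close>

lemma length_area_Re:
 assumes R: "riemann_pair W \<phi> h" and p: "p \<notin> W" and eps: "\<epsilon> > 0"
 shows "\<exists>\<eta>>0. \<forall>C x y. connected C --> C \<subseteq> W \<inter> ball p \<eta> --> x \<in> C --> y \<in> C --> \<bar>Re (h x) - Re (h y)\<bar> < \<epsilon>"
proof -
 note r = riemann_pairD[OF R]
 define r0 where "r0 = 1 - \<epsilon> / 4"
 have K: "compact (cball (0::complex) r0)" "cball (0::complex) r0 \<subseteq> ball 0 1" using eps by (auto simp: r0_def)
 have "compact (\<phi> ` cball 0 r0)"
  by (intro compact_continuous_image continuous_on_subset[OF holomorphic_on_imp_continuous_on[OF r(3)]] K)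
 then have "closed (\<phi> ` cball 0 r0)" by (rule compact_imp_closed)
 moreover have "p \<notin> \<phi> ` cball 0 r0" using p r(7) K(2) by blast
 ultimately obtain d where d: "d > 0" "\<And>z. z \<in> \<phi> ` cball 0 r0 ==> d <= dist p z" using separate_point_closed by metis
 \<comment> \<open>With \<tau> = sqrt N and D = 16 N the bound 4 \<tau> + D / \<tau> of
   \<open>length_area_bound\<close> is 20 sqrt N.\<close>
 have "\<forall>\<^sub>F N in sequentially. 20 * sqrt (real N) < (real N * ln 2 - 2) * (\<epsilon> / 2)" using eps by real_asymp
 moreover have "\<forall>\<^sub>F N in sequentially. real N * ln 2 \<ge> 2" by real_asymp
 moreover have "\<forall>\<^sub>F N in sequentially. real N > 0" by real_asymp
 ultimately have "\<forall>\<^sub>F N in sequentially. 20 * sqrt (real N) < (real N * ln 2 - 2) * (\<epsilon> / 2) \<and> real N * ln 2 \<ge> 2 \<and> real N > 0"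
  by eventually_elim auto
 then obtain N where N: "20 * sqrt (real N) < (real N * ln 2 - 2) * (\<epsilon> / 2)" "real N * ln 2 \<ge> 2" "real N > 0"
  by (auto simp: eventually_sequentially)
 define \<eta> where "\<eta> = d / 2 ^ N"
 have eta: "\<eta> > 0" using d by (simp add: \<eta>_def)
 define a b where "a = ln \<eta>" and "b = ln d"
 have ba: "b - a = real N * ln 2" using d by (simp add: a_def b_def \<eta>_def ln_div ln_realpow)
 have ab2: "a + 2 <= b" using ba N(2) by linarith
 note pt = primitive0_tent[OF ab2]
 define \<psi> where "\<psi> = primitive0 (tent a b)"
 define L where "L = (%z. ln (norm (\<phi> z - p)))"
 define v where "v = (%z. \<psi> (L z))"
 define G where "G = (%z. tent a b (L z) *\<^sub>R cnj (deriv \<phi> z / (\<phi> z - p)))"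
 have nz: "\<phi> z - p \<noteq> 0" if "z \<in> ball 0 1" for z using r(7)[OF that] p by auto
 have cphi: "continuous_on (ball 0 1) \<phi>" by (rule holomorphic_on_imp_continuous_on[OF r(3)])
 have cd: "continuous_on (ball 0 1) (deriv \<phi>)" by (intro holomorphic_on_imp_continuous_on holomorphic_deriv r) auto
 have DL: "(L has_derivative (%h. cnj (deriv \<phi> z / (\<phi> z - p)) \<bullet> h)) (at z)" if z: "z \<in> ball 0 1" for z
  unfolding L_def
 proof (rule has_derivative_ln_norm_holomorphic)
  have "(\<phi> has_field_derivative deriv \<phi> z) (at z)" by (rule holomorphic_derivI[OF r(3)]) (use z in auto)
  then show "((%z. \<phi> z - p) has_field_derivative deriv \<phi> z) (at z)" by (auto intro!: derivative_eq_intros)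
 qed (rule nz[OF z])
 have C1L: "C1_on (ball 0 1) L (%z. cnj (deriv \<phi> z / (\<phi> z - p)))"
  unfolding C1_on_def by (intro conjI ballI DL continuous_intros cphi cd) (use nz in auto)
 have C1: "C1_on (ball 0 1) v G" unfolding v_def G_def \<psi>_def
  by (rule C1_on_compose_real[OF C1L primitive0_DERIV[OF tent_facts(1,2)] tent_facts(1)])
 define \<rho> where "\<rho> = (%w. indicator {w. d / 2 ^ N < norm (w - p) \<and> norm (w - p) < d} w / (norm (w - p))^2 :: real)"
 note ae = annulus_energy[OF r(1,2) d(1), where N = N and p = p, folded \<rho>_def]
 have ae': "sint (\<phi> ` ball 0 1) \<rho>" using ae(1) r(9) by simp
 note cv = holomorphic_change_of_variables[OF open_ball r(3,10) ae']
 have Gle: "(norm (G z))^2 <= (norm (deriv \<phi> z))^2 * \<rho> (\<phi> z)" if z: "z \<in> ball 0 1" for z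
 proof (cases "a < L z \<and> L z < b")
  case True
  have pos: "0 < norm (\<phi> z - p)" using nz[OF z] by simp
  have "\<eta> < norm (\<phi> z - p)" "norm (\<phi> z - p) < d"
   using True pos eta d(1) by (auto simp: L_def a_def b_def)
  then have "\<rho> (\<phi> z) = 1 / (norm (\<phi> z - p))^2" by (simp add: \<rho>_def \<eta>_def)
  moreover have "norm (G z) <= 1 * norm (deriv \<phi> z / (\<phi> z - p))"
   unfolding G_def norm_scaleR complex_mod_cnj by (intro mult_right_mono) (use tent_facts(2) in auto)
  then have "(norm (G z))^2 <= (norm (deriv \<phi> z / (\<phi> z - p)))^2" by (intro power_mono) auto
  ultimately show ?thesis by (simp add: norm_divide power_divide)
 next
  case False
  then have "G z = 0" using tent_facts(3) by (simp add: G_def)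
  then show ?thesis by (simp add: \<rho>_def)
 qed
 have cG: "continuous_on (ball 0 1) G" using C1 by (simp add: C1_on_def)
 have Gm: "(%z. indicator (ball 0 1) z *\<^sub>R (norm (G z))\<^sup>2) \<in> borel_measurable lborel"
  using borel_measurable_continuous_on_indicator[of "ball 0 1" "%z. (norm (G z))\<^sup>2", OF _ continuous_on_power[OF continuous_on_norm[OF cG]]] by simp
 have Gi: "sint (ball 0 1) (%z. (norm (G z))\<^sup>2)"
  by (rule set_integrable_dominated[OF cv(1) Gm]) (use Gle in auto)
 have "(LBINT z:ball 0 1. (norm (G z))\<^sup>2) <= (LBINT z:ball 0 1. (norm (deriv \<phi> z))\<^sup>2 * \<rho> (\<phi> z))"
  by (rule set_integral_mono[OF Gi cv(1)]) (rule Gle)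
 also have "\<dots> = (LBINT w:W. \<rho> w)" using cv(2) r(9) by simp
 finally have GD: "(LBINT z:ball 0 1. (norm (G z))\<^sup>2) <= 16 * real N" using ae(2) by linarith
 have vA: "v z = \<psi> b" if "norm z <= 1 - \<epsilon> / 4" for z
 proof -
  have "z \<in> cball 0 r0" using that by (simp add: r0_def)
  then have "d <= norm (\<phi> z - p)" using d(2)[of "\<phi> z"] by (simp add: dist_norm norm_minus_commute)
  then have "b <= L z" unfolding b_def L_def using d(1) by (subst ln_le_cancel_iff) auto
  from pt(3)[OF this] show ?thesis by (simp only: v_def \<psi>_def)
 qed
 have main: "Re (h y) - Re (h x) < \<epsilon>" if C: "connected C" "C \<subseteq> W \<inter> ball p \<eta>" "x \<in> C" "y \<in> C" for C x y
 proof (rule ccontr)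
  assume "\<not> Re (h y) - Re (h x) < \<epsilon>"
  then have big: "Re (h y) - Re (h x) \<ge> \<epsilon>" by simp
  have ch: "continuous_on C h" using continuous_on_subset[OF holomorphic_on_imp_continuous_on[OF r(4)]] C(2) by blast
  have E: "connected (h ` C)" by (rule connected_continuous_image[OF ch C(1)])
  have E1: "h ` C \<subseteq> ball 0 1" using r(5) C(2) by blast
  have vB: "v z = \<psi> a" if zC: "z \<in> h ` C" for z
  proof -
   obtain w where w: "w \<in> C" "z = h w" using zC by blast
   then have "\<phi> z = w" "w \<in> W" using r(6) C(2) by auto
   moreover have "norm (w - p) < \<eta>" using w C(2) by (auto simp: dist_norm norm_minus_commute)
   moreover have "norm (w - p) > 0" using \<open>w \<in> W\<close> p by auto
   ultimately have "L z <= a" using eta by (simp add: L_def a_def)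
   from pt(2)[OF this] show ?thesis by (simp only: v_def \<psi>_def)
  qed
  have "\<bar>\<psi> a - \<psi> b\<bar> * (\<epsilon> / 2) <= 4 * sqrt (real N) + (16 * real N) / sqrt (real N)"
   by (rule length_area_bound[OF C1 E E1 vB vA imageI[OF C(3)] imageI[OF C(4)] big eps Gi GD]) (use N in auto)
  also have "\<dots> = 20 * sqrt (real N)" using N(3) real_div_sqrt[of "real N"] by (simp only: times_divide_eq_right[symmetric])
  also have "\<dots> < (real N * ln 2 - 2) * (\<epsilon> / 2)" by (rule N(1))
  also have "\<dots> <= \<bar>\<psi> a - \<psi> b\<bar> * (\<epsilon> / 2)"
   using pt(1) ba eps by (intro mult_right_mono) (auto simp: \<psi>_def)
  finally show False by simp
 qed
 show ?thesis
 proof (intro exI[of _ \<eta>] conjI allI impI eta)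
  fix C x y assume "connected C" "C \<subseteq> W \<inter> ball p \<eta>" "x \<in> C" "y \<in> C"
  then show "\<bar>Re (h x) - Re (h y)\<bar> < \<epsilon>" using main[of C x y] main[of C y x] by (auto simp: abs_if)
 qed
qed

text \<open>The imaginary part of h is the real part of - i h, which belongs to the Riemann pair
  obtained by rotating the disc.\<close>

lemma length_area:
 assumes R: "riemann_pair W \<phi> h" and p: "p \<notin> W" and eps: "\<epsilon> > 0"
 shows "\<exists>\<eta>>0. \<forall>C x y. connected C --> C \<subseteq> W \<inter> ball p \<eta> --> x \<in> C --> y \<in> C --> norm (h x - h y) < \<epsilon>"
proof -
 note r = riemann_pairD[OF R]
 have R2: "riemann_pair W (%z. \<phi> (\<i> * z)) (%w. - \<i> * h w)" unfolding riemann_pair_def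
 proof (intro conjI ballI)
  show "open W" "bounded W" by (rule r)+
  have "\<phi> \<circ> (%z. \<i> * z) holomorphic_on ball 0 1"
   by (rule holomorphic_on_compose_gen[OF _ r(3)]) (auto intro!: holomorphic_intros simp: norm_mult)
  then show "(%z. \<phi> (\<i> * z)) holomorphic_on ball 0 1" by (simp add: o_def)
  show "(%w. - \<i> * h w) holomorphic_on W" by (intro holomorphic_intros r)
  fix w assume w: "w \<in> W"
  show "- \<i> * h w \<in> ball 0 1" using r(5)[OF w] by (simp add: norm_mult)
  show "\<phi> (\<i> * (- \<i> * h w)) = w" using r(6)[OF w] by (simp add: mult.assoc[symmetric])
 next
  fix z :: complex assume z: "z \<in> ball 0 1"
  then have z': "\<i> * z \<in> ball 0 1" by (simp add: norm_mult)
  show "\<phi> (\<i> * z) \<in> W" by (rule r(7)[OF z'])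
  show "- \<i> * h (\<phi> (\<i> * z)) = z" using r(8)[OF z'] by (simp add: mult.assoc[symmetric])
 qed
 have e2: "\<epsilon> / 2 > 0" using eps by simp
 obtain \<eta>1 where 1: "\<eta>1 > 0" "\<And>C x y. connected C ==> C \<subseteq> W \<inter> ball p \<eta>1 ==> x \<in> C ==> y \<in> C ==> \<bar>Re (h x) - Re (h y)\<bar> < \<epsilon> / 2"
  using length_area_Re[OF R p e2] by (elim exE conjE) blast
 obtain \<eta>2 where 2: "\<eta>2 > 0" "\<And>C x y. connected C ==> C \<subseteq> W \<inter> ball p \<eta>2 ==> x \<in> C ==> y \<in> C ==> \<bar>Re (- \<i> * h x) - Re (- \<i> * h y)\<bar> < \<epsilon> / 2"
  using length_area_Re[OF R2 p e2] by (elim exE conjE) blast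
 show ?thesis
 proof (intro exI[of _ "min \<eta>1 \<eta>2"] conjI allI impI)
  fix C x y assume C: "connected C" "C \<subseteq> W \<inter> ball p (min \<eta>1 \<eta>2)" "x \<in> C" "y \<in> C"
  have "\<bar>Re (h x) - Re (h y)\<bar> < \<epsilon> / 2" by (rule 1(2)[OF C(1) _ C(3,4)]) (use C(2) in auto)
  moreover have "\<bar>Re (- \<i> * h x) - Re (- \<i> * h y)\<bar> < \<epsilon> / 2" by (rule 2(2)[OF C(1) _ C(3,4)]) (use C(2) in auto)
  ultimately show "norm (h x - h y) < \<epsilon>" using cmod_le[of "h x - h y"] by simp
 qed (use 1 2 in auto)
qed

text \<open>Near a boundary point two points of W are joined inside a small ball, so the length-area
  estimate bounds the oscillation of h there. Sequential compactness of the closure upgrades these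
  local bounds to uniform continuity.\<close>

lemma riemann_map_extends:
 assumes W: "jordan_domain W" and R: "riemann_pair W \<phi> h"
 shows "\<exists>H. continuous_on (closure W) H \<and> H ` closure W \<subseteq> cball 0 1 \<and> (\<forall>w\<in>W. H w = h w)"
proof -
 note r = riemann_pairD[OF R]
 have loc: "\<exists>\<delta>>0. \<forall>x\<in>W \<inter> ball p \<delta>. \<forall>y\<in>W \<inter> ball p \<delta>. norm (h x - h y) < \<epsilon>" if p: "p \<in> closure W" and eps: "\<epsilon> > 0" for p \<epsilon>
 proof (cases "p \<in> W")
  case True
  have "continuous_on W h" by (rule holomorphic_on_imp_continuous_on[OF r(4)])
  then obtain \<delta> where d: "\<delta> > 0" "\<And>x. x \<in> W ==> dist x p < \<delta> ==> dist (h x) (h p) < \<epsilon> / 2"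
   using True eps unfolding continuous_on_iff by (metis half_gt_zero)
  show ?thesis
  proof (intro exI[of _ \<delta>] conjI ballI d(1))
   fix x y assume "x \<in> W \<inter> ball p \<delta>" "y \<in> W \<inter> ball p \<delta>"
   then have "dist (h x) (h p) < \<epsilon> / 2" "dist (h y) (h p) < \<epsilon> / 2" using d(2) by (simp_all add: dist_commute[of p])
   then show "norm (h x - h y) < \<epsilon>" using dist_triangle2[of "h x" "h y" "h p"] by (simp add: dist_norm)
  qed
 next
  case False
  then have pf: "p \<in> frontier W" using p r(1) by (simp add: frontier_def interior_open)
  from length_area[OF R False eps] obtain \<eta> where eta: "\<eta> > 0"
   "\<forall>C x y. connected C --> C \<subseteq> W \<inter> ball p \<eta> --> x \<in> C --> y \<in> C --> norm (h x - h y) < \<epsilon>" by (elim exE conjE)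
  from jordan_domain_locally_connected_boundary[OF W pf eta(1)] obtain \<delta> where d: "\<delta> > 0"
   "\<forall>x\<in>W \<inter> ball p \<delta>. \<forall>y\<in>W \<inter> ball p \<delta>. \<exists>C. connected C \<and> C \<subseteq> W \<inter> ball p \<eta> \<and> x \<in> C \<and> y \<in> C" by (elim exE conjE)
  show ?thesis
  proof (intro exI[of _ \<delta>] conjI ballI d(1))
   fix x y assume "x \<in> W \<inter> ball p \<delta>" "y \<in> W \<inter> ball p \<delta>"
   then have "\<exists>C. connected C \<and> C \<subseteq> W \<inter> ball p \<eta> \<and> x \<in> C \<and> y \<in> C" using d(2) by blast
   then obtain C where C: "connected C" "C \<subseteq> W \<inter> ball p \<eta>" "x \<in> C" "y \<in> C" by (elim exE conjE)
   show "norm (h x - h y) < \<epsilon>" using eta(2)[rule_format, OF C] .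
  qed
 qed
 have uc: "uniformly_continuous_on W h"
 proof (rule ccontr)
  assume "\<not> uniformly_continuous_on W h"
  then obtain \<epsilon> where eps: "\<epsilon> > 0" and bad: "\<And>\<delta>. \<delta> > 0 ==> \<exists>x\<in>W. \<exists>y\<in>W. dist y x < \<delta> \<and> \<not> dist (h y) (h x) < \<epsilon>"
   unfolding uniformly_continuous_on_def by blast
  have "\<exists>xy. fst xy \<in> W \<and> snd xy \<in> W \<and> dist (snd xy) (fst xy) < 1 / real (Suc n) \<and> \<not> dist (h (snd xy)) (h (fst xy)) < \<epsilon>" for n
   using bad[of "1 / real (Suc n)"] by auto
  then have "\<forall>n. \<exists>xy. fst xy \<in> W \<and> snd xy \<in> W \<and> dist (snd xy) (fst xy) < 1 / real (Suc n) \<and> \<not> dist (h (snd xy)) (h (fst xy)) < \<epsilon>" by blast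
  from choice[OF this] obtain xy where xy: "\<forall>n. fst (xy n) \<in> W \<and> snd (xy n) \<in> W \<and> dist (snd (xy n)) (fst (xy n)) < 1 / real (Suc n) \<and> \<not> dist (h (snd (xy n))) (h (fst (xy n))) < \<epsilon>"
   by (elim exE)
  have "compact (closure W)" using r(2) by (simp add: compact_closure)
  then have "\<forall>f::nat => complex. (\<forall>n. f n \<in> closure W) --> (\<exists>l\<in>closure W. \<exists>r. strict_mono r \<and> (f \<circ> r) \<longlonglongrightarrow> l)"
   by (simp only: compact_def)
  moreover have "fst (xy n) \<in> closure W" for n
   using xy[rule_format, THEN conjunct1, of n] closure_subset[of W] by (rule rev_subsetD)
  ultimately have "\<exists>l\<in>closure W. \<exists>r. strict_mono r \<and> ((%n. fst (xy n)) \<circ> r) \<longlonglongrightarrow> l"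
   by (elim allE[where x = "%n. fst (xy n)"] impE) simp
  then obtain p s where p: "p \<in> closure W" "strict_mono s" "((%n. fst (xy n)) \<circ> s) \<longlonglongrightarrow> p"
   by (elim bexE exE conjE)
  have t0: "null_seq (%n. dist (snd (xy n)) (fst (xy n)))"
  proof (rule tendsto_sandwich[OF _ _ tendsto_const LIMSEQ_inverse_real_of_nat])
   show "\<forall>\<^sub>F n in sequentially. dist (snd (xy n)) (fst (xy n)) <= inverse (real (Suc n))"
    unfolding inverse_eq_divide by (intro always_eventually allI less_imp_le) (rule xy[rule_format, THEN conjunct2, THEN conjunct2, THEN conjunct1])
  qed simp
  then have t1: "null_seq (%n. dist (snd (xy (s n))) (fst (xy (s n))))" using LIMSEQ_subseq_LIMSEQ[OF t0 p(2)] by (simp add: o_def)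
  from loc[OF p(1) eps] obtain \<delta> where d: "\<delta> > 0" "\<forall>x\<in>W \<inter> ball p \<delta>. \<forall>y\<in>W \<inter> ball p \<delta>. norm (h x - h y) < \<epsilon>" by (elim exE conjE)
  have "\<forall>\<^sub>F n in sequentially. dist (fst (xy (s n))) p < \<delta> / 2" using tendstoD[OF p(3), of "\<delta> / 2"] d(1) by (simp add: o_def)
  moreover have "\<forall>\<^sub>F n in sequentially. dist (snd (xy (s n))) (fst (xy (s n))) < \<delta> / 2"
   using order_tendstoD(2)[OF t1, of "\<delta> / 2"] d(1) by simp
  ultimately have "\<forall>\<^sub>F n in sequentially. dist (fst (xy (s n))) p < \<delta> / 2 \<and> dist (snd (xy (s n))) (fst (xy (s n))) < \<delta> / 2"
   by (rule eventually_conj)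
  then obtain n where n: "dist (fst (xy (s n))) p < \<delta> / 2" "dist (snd (xy (s n))) (fst (xy (s n))) < \<delta> / 2"
   by (auto simp: eventually_sequentially)
  have "dist (snd (xy (s n))) p < \<delta>" using dist_triangle[of "snd (xy (s n))" p "fst (xy (s n))"] n by linarith
  then have "fst (xy (s n)) \<in> W \<inter> ball p \<delta>" "snd (xy (s n)) \<in> W \<inter> ball p \<delta>"
   using xy n(1) d(1) by (auto simp: dist_commute)
  then have "dist (h (snd (xy (s n)))) (h (fst (xy (s n)))) < \<epsilon>" using d(2) by (simp add: dist_norm)
  then show False using xy[rule_format, of "s n"] by blast
 qed
 obtain H where H: "uniformly_continuous_on (closure W) H" "\<And>w. w \<in> W ==> h w = H w"
  using uniformly_continuous_on_extension_on_closure[OF uc] by metis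
 have c: "continuous_on (closure W) H" by (rule uniformly_continuous_imp_continuous[OF H(1)])
 have "H ` closure W \<subseteq> closure (H ` W)" by (rule continuous_image_closure_subset[OF c]) simp
 also have "\<dots> \<subseteq> cball 0 1"
 proof (rule closure_minimal)
  show "H ` W \<subseteq> cball 0 1" using H(2) r(5) ball_subset_cball by fastforce
 qed simp
 finally show ?thesis using c H(2) by (intro exI[of _ H]) auto
qed

section \<open>Density of continuous functions in the Sobolev space of a Jordan domain\<close>

text \<open>Clear for continuous functions of compact support. The general case follows by density,
  because dilating by a factor of at least 1/2 multiplies L1 norms by at most 4.\<close>

lemma L1_dilation:
 fixes f :: "complex => real"
 assumes f: "integrable lborel f" and r: "\<And>n. 1/2 <= r n" "\<And>n. r n < 1" "r \<longlonglongrightarrow> 1"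
 shows "null_seq (%n. LBINT z:ball 0 1. \<bar>f (of_real (r n) * z) - f z\<bar>)"
  "sint (ball 0 1) (%z. f (of_real (r n) * z))"
proof -
 let ?B = "ball (0::complex) 1"
 have fm [measurable]: "bm f" using f by simp
 have dil: "sint ?B (%z. \<phi> (of_real (r n) * z))"
  "(LBINT z:?B. \<bar>\<phi> (of_real (r n) * z)\<bar>) <= 4 * (LINT w|lborel. \<bar>\<phi> w\<bar>)" if phi: "integrable lborel \<phi>" for \<phi> :: "complex => real" and n
 proof -
  let ?h = "%z. complex_of_real (r n) * z"
  have r0: "r n > 0" using r(1)[of n] by linarith
  have inj: "inj_on ?h ?B" using r0 by (auto simp: inj_on_def)
  have dh: "deriv ?h z = of_real (r n)" for z by (rule DERIV_imp_deriv) (auto intro!: derivative_eq_intros)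
  have op: "open (?h ` ?B)" by (rule open_mapping_thm3[OF _ open_ball inj]) (intro holomorphic_intros)
  have ia: "integrable lborel (%w. \<bar>\<phi> w\<bar>)" using phi by (rule integrable_abs)
  have i: "sint (?h ` ?B) \<psi>" if "integrable lborel \<psi>" for \<psi> :: "complex => real"
   unfolding set_integrable_def by (rule integrable_mult_indicator) (use op that in auto)
  note cv = holomorphic_change_of_variables[OF open_ball _ inj i[OF phi]]
  note cva = holomorphic_change_of_variables[OF open_ball _ inj i[OF ia]]
  have hol: "?h holomorphic_on ?B" by (intro holomorphic_intros)
  have c: "(norm (deriv ?h z))^2 = (r n)^2" for z unfolding dh by simp
  have "sint ?B (%z. (r n)\<^sup>2 * \<phi> (?h z))" using cv(1)[OF hol] unfolding c .
  then show "sint ?B (%z. \<phi> (?h z))" using r0 by simp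
  have q: "(r n)^2 \<ge> 1/4" using power_mono[OF r(1)[of n], of 2] by (simp add: power2_eq_square)
  have p: "0 <= (LBINT z:?B. \<bar>\<phi> (?h z)\<bar>)" by (simp add: set_lebesgue_integral_def integral_nonneg_AE)
  have "(LBINT z:?B. \<bar>\<phi> (?h z)\<bar>) * (1/4) <= (LBINT z:?B. \<bar>\<phi> (?h z)\<bar>) * (r n)^2" by (rule mult_left_mono[OF q p])
  also have "\<dots> = (LBINT z:?B. (r n)\<^sup>2 * \<bar>\<phi> (?h z)\<bar>)" by (simp add: mult.commute)
  also have "\<dots> = (LBINT w:?h ` ?B. \<bar>\<phi> w\<bar>)" using cva(2)[OF hol] unfolding c .
  also have "\<dots> <= (LINT w|lborel. \<bar>\<phi> w\<bar>)" unfolding set_lebesgue_integral_def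
   by (rule integral_mono[OF _ ia]) (use i[OF ia] in \<open>auto simp: set_integrable_def indicator_def\<close>)
  finally show "(LBINT z:?B. \<bar>\<phi> (?h z)\<bar>) <= 4 * (LINT w|lborel. \<bar>\<phi> w\<bar>)" by simp
 qed
 show "sint ?B (%z. f (of_real (r n) * z))" for n by (rule dil(1)[OF f])
 have sub: "sint ?B g" if "integrable lborel g" for g :: "complex => real"
  unfolding set_integrable_def by (rule integrable_mult_indicator) (use that in auto)
 show "null_seq (%n. LBINT z:?B. \<bar>f (of_real (r n) * z) - f z\<bar>)"
 proof (rule LIMSEQ_I)
  fix \<epsilon> :: real assume "\<epsilon> > 0"
  \<comment> \<open>Four eighths pay for the dilated error, one for the error itself and one for the
    continuous function.\<close>
  then have e: "\<epsilon> / 8 > 0" by simp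
  obtain \<psi> K where psi: "continuous_on UNIV \<psi>" "compact K" "\<And>x. x \<notin> K ==> \<psi> x = 0"
   and d: "(nnl (%x. norm (f x - \<psi> x))) < ennreal (\<epsilon> / 8)"
   using integrable_L1_approx[OF f] e unfolding L1_approx_def by meson
  have pi: "integrable lborel \<psi>" by (rule continuous_compact_support_integrable[OF psi])
  obtain B where B: "\<And>x. norm (\<psi> x) <= B" using continuous_compact_support_bounded[OF psi] by metis
  let ?d = "%x. f x - \<psi> x"
  have di: "integrable lborel ?d" using f pi by simp
  have "(nnl (%x. norm (f x - \<psi> x))) = ennreal (LINT x|lborel. \<bar>?d x\<bar>)"
   by (subst nn_integral_eq_integral) (use di in auto)
  then have dI: "(LINT x|lborel. \<bar>?d x\<bar>) < \<epsilon> / 8" using d by (simp add: ennreal_less_iff)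
  have "null_seq (%n. LBINT z:?B. \<bar>\<psi> (of_real (r n) * z) - \<psi> z\<bar>)"
  proof (rule set_integral_tendsto_0)
   show "sint ?B (%_. 2 * B)" by (rule set_integrable_const_bounded) auto
   show "(%z. indicator ?B z * \<bar>\<psi> (of_real (r n) * z) - \<psi> z\<bar>) \<in> borel_measurable lborel" for n
   proof -
    note borel_measurable_continuous_onI[OF psi(1), measurable]
    have "bm (%z. \<bar>\<psi> (of_real (r n) * z) - \<psi> z\<bar>)" by measurable
    then show ?thesis by (intro borel_measurable_times borel_measurable_indicator) auto
   qed
   show "\<bar>\<bar>\<psi> (of_real (r n) * z) - \<psi> z\<bar>\<bar> <= 2 * B" for n z
    using B[of z] B[of "of_real (r n) * z"] by simp
   have "null_seq (%n. \<bar>\<psi> (of_real (r n) * z) - \<psi> z\<bar>)" for z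
   proof -
    have "(%n. complex_of_real (r n) * z) \<longlonglongrightarrow> of_real 1 * z" by (intro tendsto_intros r)
    then have "(%n. \<psi> (of_real (r n) * z)) \<longlonglongrightarrow> \<psi> (of_real 1 * z)"
     by (rule continuous_on_tendsto_compose[OF psi(1)]) auto
    then show ?thesis by (intro tendsto_rabs_zero LIM_zero) simp
   qed
   then show "AE z in lborel. z \<in> ?B --> null_seq (%n. \<bar>\<psi> (of_real (r n) * z) - \<psi> z\<bar>)" by simp
  qed
  from order_tendstoD(2)[OF this e] obtain N where N: "\<And>n. n \<ge> N ==> (LBINT z:?B. \<bar>\<psi> (of_real (r n) * z) - \<psi> z\<bar>) < \<epsilon> / 8"
   by (auto simp: eventually_sequentially)
  have "norm ((LBINT z:?B. \<bar>f (of_real (r n) * z) - f z\<bar>) - 0) < \<epsilon>" if n: "n \<ge> N" for n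
  proof -
   let ?h = "%z. complex_of_real (r n) * z"
   have i1: "sint ?B (%z. \<bar>?d (?h z)\<bar>)" by (rule set_integrable_abs[OF dil(1)[OF di]])
   have i2: "sint ?B (%z. \<bar>\<psi> (?h z) - \<psi> z\<bar>)"
    by (rule set_integrable_abs[OF set_integral_diff(1)[OF dil(1)[OF pi] sub[OF pi]]])
   have i3: "sint ?B (%z. \<bar>?d z\<bar>)" by (rule set_integrable_abs[OF sub[OF di]])
   have i0: "sint ?B (%z. \<bar>f (?h z) - f z\<bar>)"
    by (rule set_integrable_abs[OF set_integral_diff(1)[OF dil(1)[OF f] sub[OF f]]])
   note i12 = set_integral_add[OF i1 i2]
   note i123 = set_integral_add[OF i12(1) i3]
   have "(LBINT z:?B. \<bar>f (?h z) - f z\<bar>) <= (LBINT z:?B. \<bar>?d (?h z)\<bar> + \<bar>\<psi> (?h z) - \<psi> z\<bar> + \<bar>?d z\<bar>)"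
    by (rule set_integral_mono[OF i0 i123(1)]) linarith
   also have "\<dots> = (LBINT z:?B. \<bar>?d (?h z)\<bar>) + (LBINT z:?B. \<bar>\<psi> (?h z) - \<psi> z\<bar>) + (LBINT z:?B. \<bar>?d z\<bar>)"
    unfolding i123(2) i12(2) ..
   also have "(LBINT z:?B. \<bar>?d z\<bar>) <= (LINT x|lborel. \<bar>?d x\<bar>)" unfolding set_lebesgue_integral_def
    by (rule integral_mono) (use i3 di in \<open>auto simp: set_integrable_def indicator_def\<close>)
   finally have "(LBINT z:?B. \<bar>f (?h z) - f z\<bar>) < \<epsilon>" using dil(2)[OF di, of n] N[OF n] dI \<open>\<epsilon> > 0\<close> by linarith
   moreover have "0 <= (LBINT z:?B. \<bar>f (?h z) - f z\<bar>)" by (simp add: set_lebesgue_integral_def integral_nonneg_AE)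
   ultimately show ?thesis by simp
  qed
  then show "\<exists>N. \<forall>n\<ge>N. norm ((LBINT z:?B. \<bar>f (of_real (r n) * z) - f z\<bar>) - 0) < \<epsilon>" by blast
 qed
qed

text \<open>The dilated function lives on the disc of radius 1/r, which contains the closed unit
  disc, so it can be mollified up to the boundary and beyond. Being conformal, the dilation leaves
  the energy unchanged.\<close>

lemma disc_smooth_approx:
 assumes v: "v \<in> Hd (ball 0 1)" and M: "\<And>z. \<bar>v z\<bar> <= M" and r: "1/2 <= r" "r < 1" and "\<eta> > 0"
 shows "\<exists>N w G. cball 0 1 \<subseteq> N \<and> C1_on N w G \<and> (LBINT z:ball 0 1. \<bar>w z - v (of_real r * z)\<bar>) <= \<eta> \<and>
   (\<forall>z\<in>N. \<bar>w z\<bar> <= M) \<and> w \<in> Hd (ball 0 1) \<and>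
   energy (ball 0 1) w <= energy (ball 0 1) v"
proof -
 let ?h = "%z. complex_of_real r * z" and ?U = "ball (0::complex) (1 / r)"
 have r0: "r > 0" using r by linarith
 have im: "?h ` ?U = ball 0 1"
 proof (intro equalityI subsetI)
  fix z :: complex assume z: "z \<in> ball 0 1"
  show "z \<in> ?h ` ?U"
   by (rule image_eqI[of _ _ "z / of_real r"]) (use z r0 in \<open>auto simp: norm_divide divide_strict_right_mono\<close>)
 qed (use r0 in \<open>auto simp: norm_mult field_simps\<close>)
 have inj: "inj_on ?h ?U" using r0 by (auto simp: inj_on_def)
 have hol: "?h holomorphic_on ?U" by (intro holomorphic_intros)
 have v': "v \<in> Hd (?h ` ?U)" using v im by simp
 let ?v = "%z. v (?h z)"
 have vH: "?v \<in> Hd ?U" by (rule Hd_conformal(1)[OF open_ball hol inj v'])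
 have vD: "energy ?U ?v = energy (ball 0 1) v"
  using Hd_conformal(2)[OF open_ball hol inj v' v'] im by simp
 note g = weak_gradient_Hd[OF open_ball vH]
 have "1 < 1 / r" using r r0 by (simp add: field_simps)
 then have K: "compact (cball (0::complex) 1)" "cball 0 1 \<subseteq> ?U" by auto
 from weak_gradient_approx[OF open_ball K g(1) \<open>\<eta> > 0\<close>] obtain N w G where N: "cball 0 1 \<subseteq> N" "C1_on N w G"
  "(LBINT x:cball 0 1. norm (w x - ?v x)) <= \<eta>"
  "\<forall>M. (\<forall>x\<in>?U. \<bar>?v x\<bar> <= M) --> (\<forall>x\<in>N. \<bar>w x\<bar> <= M)"
  "sint ?U (%x. (norm (weak_gradient ?U ?v x))^2) -->
    (LBINT x:cball 0 1. (norm (G x))\<^sup>2) <= (LBINT x:?U. (norm (weak_gradient ?U ?v x))\<^sup>2)"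
  by (elim exE conjE)
 have cG: "continuous_on (cball 0 1) G" using N(1,2) continuous_on_subset by (auto simp: C1_on_def)
 have cw: "continuous_on (cball 0 1) w" using C1_on_continuous[OF N(2)] N(1) continuous_on_subset by blast
 have sub: "sint (ball 0 1) q \<and> (LBINT x:ball 0 1. q x) <= (LBINT x:cball 0 1. q x)"
  if q: "sint (cball 0 1) q" "\<And>x. 0 <= q x" for q :: "complex => real"
 proof
  show s: "sint (ball 0 1) q" by (rule set_integrable_subset[OF q(1)]) auto
  show "(LBINT x:ball 0 1. q x) <= (LBINT x:cball 0 1. q x)" unfolding set_lebesgue_integral_def
   by (rule integral_mono) (use s q in \<open>auto simp: set_integrable_def indicator_def\<close>)
 qed
 have iK: "sint (cball 0 1) q" if "continuous_on (cball 0 1) q" for q :: "complex => real"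
  unfolding set_integrable_def by (rule borel_integrable_compact[OF K(1) that])
 have Gs: "sint (cball 0 1) (%x. (norm (G x))^2)" by (rule iK) (intro continuous_intros cG)
 have sG: "sint (ball 0 1) (%x. (norm (G x))^2)"
  "(LBINT x:ball 0 1. (norm (G x))\<^sup>2) <= (LBINT x:cball 0 1. (norm (G x))\<^sup>2)" using sub[OF Gs] by auto
 have wG: "is_weak_gradient (ball 0 1) w G"
  by (rule C1_on_weak_gradient[OF C1_on_subset[OF N(2) open_ball]]) (use N(1) in auto)
 have wH: "w \<in> Hd (ball 0 1)" by (rule HdI[OF wG sG(1)])
 have "energy (ball 0 1) w <= (LBINT x:cball 0 1. (norm (G x))\<^sup>2)"
  unfolding dirichlet_integral_self[OF open_ball wG] by (rule sG(2))
 also have "\<dots> <= energy ?U ?v"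
  unfolding dirichlet_integral_self[OF open_ball g(1)] using N(5) g(4) by blast
 finally have wD: "energy (ball 0 1) w <= energy (ball 0 1) v" unfolding vD .
 have lv: "locally_integrable ?U ?v" by (rule g(3))
 have lvK: "sint (cball 0 1) ?v" using lv K by (simp add: locally_integrable_def)
 have "sint (cball 0 1) (%x. \<bar>w x - ?v x\<bar>)"
  by (rule set_integrable_abs[OF set_integral_diff(1)[OF iK[OF cw] lvK]])
 from sub[OF this] have "(LBINT x:ball 0 1. \<bar>w x - ?v x\<bar>) <= \<eta>" using N(3) by simp
 moreover have "\<forall>z\<in>N. \<bar>w z\<bar> <= M" using N(4) M by blast
 ultimately show ?thesis using N(1,2) wH wD by blast
qed

text \<open>The approximants on the disc are continuous on its closure, and composed with the
  extension H they become continuous on the closure of W. They have bounded energy and a subsequence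
  converging almost everywhere, so \<open>clH_AE_limit\<close> applies.\<close>

lemma core_H1_dense:
 assumes W: "jordan_domain W"
 shows "H1 W = clH W (core W (H1 W))"
proof
 let ?A = "core W (H1 W)" and ?B = "ball (0::complex) 1"
 note jd = jordan_domain_bounded[OF W]
 have o: "open W" and b: "bounded W" using jd by auto
 note p = psd_H1[OF o]
 have A: "?A \<subseteq> H1 W" "lin_space ?A" "\<And>a. a \<in> ?A ==> trunc a \<in> ?A"
  using psdD(1)[OF p] trunc_H1(1)[OF o] by (auto simp: core_def lin_space_def intro!: continuous_intros)
 obtain \<phi> h where R: "riemann_pair W \<phi> h" using riemann_pair_exists[OF W] by (elim exE)
 note r = riemann_pairD[OF R]
 obtain H where H: "continuous_on (closure W) H" "H ` closure W \<subseteq> cball 0 1" "\<forall>w\<in>W. H w = h w"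
  using riemann_map_extends[OF W R] by (elim exE conjE)
 \<comment> \<open>Boundedness survives composition with the Riemann map and gives integrability on
   the disc, which square integrability on W does not. The general case is reduced to this one by
   truncation.\<close>
 have bd: "u \<in> clH W ?A" if u: "u \<in> H1 W" and M: "\<And>x. \<bar>u x\<bar> <= M" for u M
 proof -
  have uH: "u \<in> Hd W" and uL: "u \<in> L2 (refl_measure W)" using u by (auto simp: H1_iff)
  let ?v = "%z. u (\<phi> z)"
  define E where "E = energy W u"
  have uH': "u \<in> Hd (\<phi> ` ?B)" using uH r(9) by simp
  have vH: "?v \<in> Hd ?B" by (rule Hd_conformal(1)[OF open_ball r(3,10) uH'])
  have vD: "energy ?B ?v = E"
   using Hd_conformal(2)[OF open_ball r(3,10) uH' uH'] r(9) by (simp add: E_def)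
  \<comment> \<open>Dilation factors tending to 1; the shift by 2 keeps them at least 1/2.\<close>
  define rr where "rr = (%n. 1 - 1 / real (n + 2))"
  have rr: "1/2 <= rr n" "rr n < 1" for n by (auto simp: rr_def field_simps)
  have rl: "rr \<longlonglongrightarrow> 1" unfolding rr_def by real_asymp
  have "\<forall>n. \<exists>w. (\<exists>N G. cball 0 1 \<subseteq> N \<and> C1_on N w G) \<and> (LBINT z:?B. \<bar>w z - ?v (of_real (rr n) * z)\<bar>) <= 1 / 2 ^ n \<and>
   w \<in> Hd ?B \<and> energy ?B w <= E"
  proof
   fix n
   have "1 / 2 ^ n > (0::real)" by simp
   from disc_smooth_approx[where v = ?v and M = M, OF vH M rr(1)[of n] rr(2)[of n] this, unfolded vD]
   obtain N w G where "cball 0 1 \<subseteq> N" "C1_on N w G" "(LBINT z:?B. \<bar>w z - ?v (of_real (rr n) * z)\<bar>) <= 1 / 2 ^ n"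
    "w \<in> Hd ?B" "energy ?B w <= E" by (elim exE conjE)
   then show "\<exists>w. (\<exists>N G. cball 0 1 \<subseteq> N \<and> C1_on N w G) \<and> (LBINT z:?B. \<bar>w z - ?v (of_real (rr n) * z)\<bar>) <= 1 / 2 ^ n \<and>
    w \<in> Hd ?B \<and> energy ?B w <= E" by (intro exI[of _ w] conjI exI[of _ N] exI[of _ G])
  qed
  from choice[OF this] obtain w where w0: "\<forall>n. (\<exists>N G. cball 0 1 \<subseteq> N \<and> C1_on N (w n) G) \<and> (LBINT z:?B. \<bar>w n z - ?v (of_real (rr n) * z)\<bar>) <= 1 / 2 ^ n \<and>
   w n \<in> Hd ?B \<and> energy ?B (w n) <= E" by (elim exE)
  then have w: "\<exists>N G. cball 0 1 \<subseteq> N \<and> C1_on N (w n) G" "(LBINT z:?B. \<bar>w n z - ?v (of_real (rr n) * z)\<bar>) <= 1 / 2 ^ n"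
   "w n \<in> Hd ?B" "energy ?B (w n) <= E" for n by auto
  have wc: "continuous_on (cball 0 1) (w n)" for n
  proof -
   obtain N G where "cball 0 1 \<subseteq> N" "C1_on N (w n) G" using w(1)[of n] by (elim exE conjE)
   then show ?thesis using C1_on_continuous continuous_on_subset by blast
  qed
  let ?a = "%n x. w n (H x)"
  have ac: "continuous_on (closure W) (?a n)" for n by (rule continuous_on_compose2[OF wc H(1,2)])
  have wh: "w n \<in> Hd (h ` W)" for n using w(3) r(11) by simp
  have awh: "?a n x = w n (h x)" if "x \<in> W" for n x using H(3) that by simp
  have aH: "?a n \<in> Hd W" for n
   by (rule iffD2[OF Hd_cong(1)]) (erule awh, rule Hd_conformal(1)[OF o r(4,12) wh])
  have aD: "energy W (?a n) <= E" for n
  proof -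
   have "energy W (?a n) = dirichlet_integral W (?a n) (%x. w n (h x))"
    by (rule Hd_cong(3)) (erule awh)
   also have "\<dots> = energy W (%x. w n (h x))" by (rule fun_cong[OF Hd_cong(2)]) (erule awh)
   also have "\<dots> = energy ?B (w n)" using Hd_conformal(2)[OF o r(4,12) wh wh] r(11) by simp
   finally show ?thesis using w(4) by simp
  qed
  have aA: "?a n \<in> ?A" for n using aH ac continuous_bounded_L2(1)[OF o b ac] by (simp add: core_def H1_iff)
  let ?f = "%z. indicator ?B z *\<^sub>R ?v z"
  have fm: "bm ?f" by (rule locally_integrable_measurable_open[OF open_ball weak_gradient_Hd(3)[OF open_ball vH]])
  have fi: "integrable lborel ?f"
  proof (rule Bochner_Integration.integrable_bound)
   show "integrable lborel (%z. indicator ?B z *\<^sub>R M)" using set_integrable_const_bounded[of ?B M] by (simp add: set_integrable_def)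
   show "AE z in lborel. norm (?f z) <= norm (indicator ?B z *\<^sub>R M)"
    using M order_trans[OF M abs_ge_self] by (intro AE_I2) (auto simp: indicator_def)
  qed (use fm in simp)
  have ball_r: "of_real (rr n) * z \<in> ?B" if "z \<in> ?B" for n z
  proof -
   have "rr n * norm z <= 1 * norm z" using rr(2)[of n] by (intro mult_right_mono) auto
   then show ?thesis using that rr(1)[of n] by (simp add: norm_mult)
  qed
  have sv: "sint ?B ?v" using fi by (simp add: set_integrable_def)
  have svr: "sint ?B (%z. ?v (of_real (rr n) * z))" for n
  proof -
   have "sint ?B (%z. ?f (of_real (rr n) * z))" by (rule L1_dilation(2)[OF fi rr rl])
   moreover have "indicator ?B z *\<^sub>R ?f (of_real (rr n) * z) = indicator ?B z *\<^sub>R ?v (of_real (rr n) * z)" for z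
    using ball_r[of z n] by (auto simp: indicator_def)
   ultimately show ?thesis unfolding set_integrable_def by (simp only:)
  qed
  have lv: "null_seq (%n. LBINT z:?B. \<bar>?v (of_real (rr n) * z) - ?v z\<bar>)"
  proof -
   have "indicator ?B z *\<^sub>R \<bar>?f (of_real (rr n) * z) - ?f z\<bar> = indicator ?B z *\<^sub>R \<bar>?v (of_real (rr n) * z) - ?v z\<bar>" for z n
    using ball_r[of z n] by (auto simp: indicator_def)
   then show ?thesis using L1_dilation(1)[OF fi rr rl] unfolding set_lebesgue_integral_def by (simp only:)
  qed
  have sw: "sint ?B (w n)" for n
   by (rule set_integrable_subset[of _ "cball 0 1"]) (use borel_integrable_compact[OF compact_cball wc] in \<open>auto simp: set_integrable_def\<close>)
  let ?d = "%n z. indicator ?B z *\<^sub>R (w n z - ?v z)"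
  have di: "integrable lborel (?d n)" for n using set_integral_diff(1)[OF sw sv] by (simp add: set_integrable_def)
  have dle: "(LINT z|lborel. norm (?d n z)) <= 1 / 2 ^ n + (LBINT z:?B. \<bar>?v (of_real (rr n) * z) - ?v z\<bar>)" for n
  proof -
   have i1: "sint ?B (%z. \<bar>w n z - ?v (of_real (rr n) * z)\<bar>)" by (rule set_integrable_abs[OF set_integral_diff(1)[OF sw svr]])
   have i2: "sint ?B (%z. \<bar>?v (of_real (rr n) * z) - ?v z\<bar>)" by (rule set_integrable_abs[OF set_integral_diff(1)[OF svr sv]])
   have i0: "sint ?B (%z. \<bar>w n z - ?v z\<bar>)" by (rule set_integrable_abs[OF set_integral_diff(1)[OF sw sv]])
   have "(LINT z|lborel. norm (?d n z)) = (LBINT z:?B. \<bar>w n z - ?v z\<bar>)"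
    unfolding set_lebesgue_integral_def by (rule Bochner_Integration.integral_cong) (auto simp: indicator_def)
   also have "\<dots> <= (LBINT z:?B. \<bar>w n z - ?v (of_real (rr n) * z)\<bar> + \<bar>?v (of_real (rr n) * z) - ?v z\<bar>)"
    by (rule set_integral_mono[OF i0 set_integral_add(1)[OF i1 i2]]) linarith
   also have "\<dots> = (LBINT z:?B. \<bar>w n z - ?v (of_real (rr n) * z)\<bar>) + (LBINT z:?B. \<bar>?v (of_real (rr n) * z) - ?v z\<bar>)"
    by (rule set_integral_add(2)[OF i1 i2])
   finally show ?thesis using w(2)[of n] by linarith
  qed
  have "null_seq (%n. LINT z|lborel. norm (?d n z))"
  proof (rule tendsto_sandwich[OF _ _ tendsto_const])
   show "null_seq (%n. 1 / 2 ^ n + (LBINT z:?B. \<bar>?v (of_real (rr n) * z) - ?v z\<bar>))"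
    using tendsto_add[OF half_power_tendsto lv] by simp
   show "\<forall>\<^sub>F n in sequentially. (LINT z|lborel. norm (?d n z)) <= 1 / 2 ^ n + (LBINT z:?B. \<bar>?v (of_real (rr n) * z) - ?v z\<bar>)"
    by (intro always_eventually allI dle)
   show "\<forall>\<^sub>F n in sequentially. 0 <= (LINT z|lborel. norm (?d n z))" by (intro always_eventually allI integral_nonneg_AE) simp
  qed
  from tendsto_L1_AE_subseq[of lborel ?d, OF di this] obtain s where s: "strict_mono s"
   "AE z in lborel. null_seq (%n. ?d (s n) z)" by (elim exE conjE)
  have "AE z in lborel. z \<in> ?B --> (%n. w (s n) z) \<longlonglongrightarrow> ?v z"
   using s(2) by eventually_elim (auto intro: LIM_zero_cancel)
  from AE_holomorphic_inverse[where f = \<phi> and g = h and P = "%z. (%n. w (s n) z) \<longlonglongrightarrow> ?v z", OF open_ball r(3,8,9) this]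
  have "AE x in lborel. x \<in> W --> (%n. w (s n) (h x)) \<longlonglongrightarrow> u (\<phi> (h x))" .
  then have "AE x in lborel. x \<in> W --> (%n. ?a (s n) x) \<longlonglongrightarrow> u x" by eventually_elim (use awh r(6) in simp)
  then have ae: "AE x in refl_measure W. (%n. ?a (s n) x) \<longlonglongrightarrow> u x" using AE_refl[OF o] by simp
  show ?thesis by (rule clH_AE_limit[where us = "%n. ?a (s n)" and u = u and C = E, OF o b A aA aD uL ae])
 qed
 show "H1 W \<subseteq> clH W ?A"
 proof
  fix u assume u: "u \<in> H1 W"
  then have uH: "u \<in> Hd W" and uL: "u \<in> L2 (refl_measure W)" by (auto simp: H1_iff)
  have lin: "lin_space (H1 W)" using psdD(1)[OF p] by (auto simp: lin_space_def)
  have k: "(%x. clip k (u x)) \<in> clH W ?A" for k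
   by (rule bd[of _ "real k"]) (auto intro: clip_lin_trunc[OF lin trunc_H1(1)[OF o] u] clip_bounds(1))
  have kD: "energy W (%x. clip k (u x)) <= 4 * energy W u" for k by (rule Hd_clip(2)[OF o uH])
  show "u \<in> clH W ?A"
   by (rule clH_mazur(1)[where us = "%k x. clip k (u x)" and u = u and C = "4 * energy W u", OF o A(1,2) k kD uL L2_clip_tendsto[OF uL]])
 qed
 show "clH W ?A \<subseteq> H1 W" by (auto simp: clH_def)
qed

section \<open>Functions constant in one direction off a small open set\<close>

text \<open>The condition is imposed pointwise on some representative of the weak gradient, which
  makes stability under linear combinations and truncation immediate.\<close>

definition stair :: "complex set => real set => (complex => real) set" where
 "stair W G = {f \<in> core W (H1 W). \<exists>g. is_weak_gradient W f g \<and> (\<forall>x\<in>W. Re x \<notin> G --> Re (g x) = 0)}"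

lemma stair_facts:
 assumes W: "open W"
 shows "stair W G \<subseteq> H1 W" "lin_space (stair W G)" "\<And>a. a \<in> stair W G ==> continuous_on (closure W) a"
  "\<And>a. a \<in> stair W G ==> trunc a \<in> stair W G"
proof -
 show "stair W G \<subseteq> H1 W" "\<And>a. a \<in> stair W G ==> continuous_on (closure W) a" by (auto simp: stair_def core_def)
 show "lin_space (stair W G)" unfolding lin_space_def
 proof (intro ballI allI)
  fix u v a b assume u: "u \<in> stair W G" and v: "v \<in> stair W G"
  obtain g where g: "is_weak_gradient W u g" "\<forall>x\<in>W. Re x \<notin> G --> Re (g x) = 0" using u unfolding stair_def by blast
  obtain h where h: "is_weak_gradient W v h" "\<forall>x\<in>W. Re x \<notin> G --> Re (h x) = 0" using v unfolding stair_def by blast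
  have "is_weak_gradient W (%x. a * u x + b * v x) (%x. a *\<^sub>R g x + b *\<^sub>R h x)" by (rule is_weak_gradient_lincomb[OF g(1) h(1)])
  moreover have "\<forall>x\<in>W. Re x \<notin> G --> Re (a *\<^sub>R g x + b *\<^sub>R h x) = 0" using g(2) h(2) by simp
  moreover have "(%x. a * u x + b * v x) \<in> core W (H1 W)"
   using u v psdD(1)[OF psd_H1[OF W]] by (auto simp: stair_def core_def intro!: continuous_intros)
  ultimately show "(%x. a * u x + b * v x) \<in> stair W G" unfolding stair_def by blast
 qed
 fix a assume a: "a \<in> stair W G"
 obtain g where g: "is_weak_gradient W a g" "\<forall>x\<in>W. Re x \<notin> G --> Re (g x) = 0" using a unfolding stair_def by blast
 have "is_weak_gradient W (trunc a) (%x. indicator {0<..<1} (a x) *\<^sub>R g x)" by (rule weak_gradient_trunc[OF W g(1)])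
 moreover have "\<forall>x\<in>W. Re x \<notin> G --> Re (indicator {0<..<1} (a x) *\<^sub>R g x) = 0" using g(2) by simp
 moreover have "trunc a \<in> core W (H1 W)"
  using a trunc_H1(1)[OF W, of a] by (auto simp: stair_def core_def intro!: continuous_intros)
 ultimately show "trunc a \<in> stair W G" unfolding stair_def by blast
qed

text \<open>Bounded pointwise limits of \<open>C\<^sup>1\<close> functions together with their gradients are closed under
 products, without a product rule for weak gradients.\<close>

definition C1_limit :: "complex set => (nat => complex => real) => (nat => complex => complex) => real =>
  (complex => real) => (complex => complex) => bool" where
 "C1_limit W w D M f g \<longleftrightarrow> (\<forall>n. C1_on W (w n) (D n)) \<and>
   (\<forall>n. \<forall>x\<in>W. \<bar>w n x\<bar> <= M \<and> norm (D n x) <= M) \<and>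
   (\<forall>x\<in>W. (%n. w n x) \<longlonglongrightarrow> f x \<and> (%n. D n x) \<longlonglongrightarrow> g x)"

lemma C1_limit_weak_gradient:
 assumes W: "open W" "bounded W" and C: "C1_limit W w D M f g"
 shows "is_weak_gradient W f g" "f \<in> Hd W"
proof -
 have C1: "C1_on W (w n) (D n)" for n using C by (simp add: C1_limit_def)
 have b: "\<bar>w n x\<bar> <= M" "norm (D n x) <= M" if "x \<in> W" for n x using C that by (auto simp: C1_limit_def)
 have l: "(%n. w n x) \<longlonglongrightarrow> f x" "(%n. D n x) \<longlonglongrightarrow> g x" if "x \<in> W" for x using C that by (auto simp: C1_limit_def)
 have fb: "\<bar>f x\<bar> <= M" and gb: "norm (g x) <= M" if "x \<in> W" for x
  using Lim_bounded[OF tendsto_rabs[OF l(1)[OF that]], of 0 M] Lim_bounded[OF tendsto_norm[OF l(2)[OF that]], of 0 M] b[OF that] by auto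
 have fm: "bm (%x. indicator W x *\<^sub>R f x)"
 proof (rule borel_measurable_LIMSEQ_metric)
  show "bm (%x. indicator W x *\<^sub>R w n x)" for n
   by (rule borel_measurable_continuous_on_indicator[OF _ C1_on_continuous[OF C1]]) (use W in simp)
  show "(%n. indicator W x *\<^sub>R w n x) \<longlonglongrightarrow> indicator W x *\<^sub>R f x" for x
   using l(1)[of x] by (auto simp: indicator_def)
 qed
 have gm: "bm (%x. indicator W x *\<^sub>R g x)"
 proof (rule borel_measurable_LIMSEQ_metric)
  show "bm (%x. indicator W x *\<^sub>R D n x)" for n
   by (rule borel_measurable_continuous_on_indicator) (use C1 W in \<open>auto simp: C1_on_def\<close>)
  show "(%n. indicator W x *\<^sub>R D n x) \<longlonglongrightarrow> indicator W x *\<^sub>R g x" for x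
   using l(2)[of x] by (auto simp: indicator_def)
 qed
 have sq: "sint W (%x. (norm (h x))^2)"
  if hm: "bm (%x. indicator W x *\<^sub>R h x)" and hb: "\<And>x. x \<in> W ==> norm (h x) <= M" for h :: "complex => 'b::euclidean_space"
 proof (rule set_integrable_dominated)
  show "sint W (%_. M\<^sup>2)" by (rule set_integrable_const_bounded) (use W in auto)
  have "bm (%x. (norm (indicator W x *\<^sub>R h x))^2)" using hm by measurable
  then show "(%x. indicator W x *\<^sub>R (norm (h x))\<^sup>2) \<in> borel_measurable lborel" unfolding norm_sq_indicator by simp
  show "norm ((norm (h x))^2) <= M\<^sup>2" if "x \<in> W" for x using power_mono[OF hb[OF that], of 2] by simp
 qed
 have fl: "locally_integrable W f" by (rule square_integrable_locally_integrable[OF fm sq[OF fm]]) (use fb in simp)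
 have gs: "sint W (%x. (norm (g x))^2)" by (rule sq[OF gm gb])
 have gl: "locally_integrable W g" by (rule square_integrable_locally_integrable[OF gm gs])
 show wg: "is_weak_gradient W f g"
 proof (rule is_weak_gradient_dominated[where w = w and G = D, OF fl gl C1_on_weak_gradient[OF C1] locally_integrable_const _ locally_integrable_const])
  show "\<bar>w n x - f x\<bar> <= 2 * M" if "x \<in> W" for n x using b(1)[OF that, of n] fb[OF that] by linarith
  show "norm (D n x - g x) <= 2 * M" if "x \<in> W" for n x
   using norm_triangle_ineq4[of "D n x" "g x"] b(2)[OF that, of n] gb[OF that] by linarith
 qed (use l in auto)
 show "f \<in> Hd W" by (rule HdI[OF wg gs])
qed

lemma C1_on_add: "C1_on W w D ==> C1_on W v E ==> C1_on W (%x. w x + v x) (%x. D x + E x)"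
 unfolding C1_on_def inner_add_left by (auto intro!: continuous_intros has_derivative_add)

lemma C1_on_mult:
 assumes w: "C1_on W w D" and v: "C1_on W v E"
 shows "C1_on W (%x. w x * v x) (%x. w x *\<^sub>R E x + v x *\<^sub>R D x)" unfolding C1_on_def
proof (intro conjI ballI)
 show "open W" using w by (simp add: C1_on_def)
 show "continuous_on W (%x. w x *\<^sub>R E x + v x *\<^sub>R D x)"
  using C1_on_continuous[OF w] C1_on_continuous[OF v] w v by (auto simp: C1_on_def intro!: continuous_intros)
 fix x assume "x \<in> W"
 then have "(w has_derivative (%h. D x \<bullet> h)) (at x)" "(v has_derivative (%h. E x \<bullet> h)) (at x)" using w v by (auto simp: C1_on_def)
 from has_derivative_mult[OF this] show "((%x. w x * v x) has_derivative (%h. (w x *\<^sub>R E x + v x *\<^sub>R D x) \<bullet> h)) (at x)"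
  by (simp add: inner_add_left mult.commute)
qed

lemma C1_limit_add:
 assumes w: "C1_limit W w D M f g" and v: "C1_limit W v E M' f' g'"
 shows "C1_limit W (%n x. w n x + v n x) (%n x. D n x + E n x) (M + M') (%x. f x + f' x) (%x. g x + g' x)"
 unfolding C1_limit_def
proof (intro conjI allI ballI)
 show "C1_on W (%x. w n x + v n x) (%x. D n x + E n x)" for n using w v by (intro C1_on_add) (auto simp: C1_limit_def)
 fix n x assume x: "x \<in> W"
 have b: "\<bar>w n x\<bar> <= M" "norm (D n x) <= M" "\<bar>v n x\<bar> <= M'" "norm (E n x) <= M'" using w v x by (auto simp: C1_limit_def)
 show "\<bar>w n x + v n x\<bar> <= M + M'" using b by linarith
 show "norm (D n x + E n x) <= M + M'" using norm_triangle_ineq[of "D n x" "E n x"] b by linarith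
qed (use w v in \<open>auto simp: C1_limit_def intro!: tendsto_add\<close>)

lemma C1_limit_mult:
 assumes w: "C1_limit W w D M f g" and v: "C1_limit W v E M' f' g'"
 shows "C1_limit W (%n x. w n x * v n x) (%n x. w n x *\<^sub>R E n x + v n x *\<^sub>R D n x) (2 * (M * M'))
  (%x. f x * f' x) (%x. f x *\<^sub>R g' x + f' x *\<^sub>R g x)" unfolding C1_limit_def
proof (intro conjI allI ballI)
 show "C1_on W (%x. w n x * v n x) (%x. w n x *\<^sub>R E n x + v n x *\<^sub>R D n x)" for n using w v by (intro C1_on_mult) (auto simp: C1_limit_def)
 fix n x assume x: "x \<in> W"
 have b: "\<bar>w n x\<bar> <= M" "norm (D n x) <= M" "\<bar>v n x\<bar> <= M'" "norm (E n x) <= M'" using w v x by (auto simp: C1_limit_def)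
 have M: "0 <= M" "0 <= M'" using b by linarith+
 have "\<bar>w n x\<bar> * \<bar>v n x\<bar> <= M * M'" by (intro mult_mono b M abs_ge_zero)
 then show "\<bar>w n x * v n x\<bar> <= 2 * (M * M')" using mult_nonneg_nonneg[OF M] unfolding abs_mult by linarith
 have "\<bar>w n x\<bar> * norm (E n x) <= M * M'" "\<bar>v n x\<bar> * norm (D n x) <= M' * M" by (intro mult_mono b M norm_ge_zero)+
 then show "norm (w n x *\<^sub>R E n x + v n x *\<^sub>R D n x) <= 2 * (M * M')"
  using norm_triangle_ineq[of "w n x *\<^sub>R E n x" "v n x *\<^sub>R D n x"] by (simp add: mult.commute[of M'])
qed (use w v in \<open>auto simp: C1_limit_def intro!: tendsto_intros\<close>)

text \<open>Between a and b lies a rational, around which G contains a whole interval.\<close>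

lemma open_primitive_inj:
 assumes G: "open G" "- G \<noteq> {}" "\<rat> \<subseteq> G" and ab: "a < b"
 shows "open_primitive G a < open_primitive G b"
proof -
 obtain q where q: "q \<in> \<rat>" "a < q" "q < b" using Rats_dense_in_real[OF ab] by blast
 have "open (G \<inter> {a<..<b})" "q \<in> G \<inter> {a<..<b}" using G q by auto
 then obtain e where e: "e > 0" "ball q e \<subseteq> G \<inter> {a<..<b}" using open_contains_ball by blast
 have "0 < measure lborel {q - e<..<q + e}" using e(1) by simp
 also have "\<dots> <= measure lborel (G \<inter> {a..b})"
 proof (rule measure_mono_fmeasurable)
  show "{q - e<..<q + e} \<subseteq> G \<inter> {a..b}" using e(2) by (auto simp: ball_eq_greaterThanLessThan)
  show "G \<inter> {a..b} \<in> fmeasurable lborel"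
   by (rule fmeasurableI) (use G(1) emeasure_bounded_finite[OF bounded_subset[of "{a..b}" "G \<inter> {a..b}"]] in auto)
 qed simp
 also have "\<dots> = open_primitive G b - open_primitive G a" by (rule open_primitive_facts(4)[OF G(1,2), symmetric]) (use ab in simp)
 finally show ?thesis by simp
qed

text \<open>Stone-Weierstrass needs an algebra, so attention is restricted to limits in the sense of
  \<open>C1_limit\<close>. Points are separated by Im and, on horizontal lines, by the primitive of
  the indicator of G composed with Re.\<close>

lemma stair_dense:
 assumes W: "open W" "bounded W" and G: "open G" "- G \<noteq> {}" "\<rat> \<subseteq> G"
 shows "uniformly_dense (closure W) (stair W G)"
proof -
 define P where "P f \<longleftrightarrow> continuous_on (closure W) f \<and> (\<exists>w D M g. C1_limit W w D M f g \<and> (\<forall>x\<in>W. Re x \<notin> G --> Re (g x) = 0))" for f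
 have stair: "f \<in> stair W G" if f: "P f" for f
 proof -
  have c: "continuous_on (closure W) f" using f by (simp add: P_def)
  from f obtain w D M g where "C1_limit W w D M f g" "\<forall>x\<in>W. Re x \<notin> G --> Re (g x) = 0" unfolding P_def by (elim exE conjE)
  moreover from C1_limit_weak_gradient[OF W this(1)] have "f \<in> H1 W" using continuous_bounded_L2(1)[OF W c] by (simp add: H1_iff)
  ultimately show ?thesis using C1_limit_weak_gradient(1)[OF W] c unfolding stair_def core_def by blast
 qed
 obtain B where B: "\<And>x. x \<in> W ==> norm x <= B" using W(2) unfolding bounded_iff by blast
 have PRe: "P (%x. open_primitive G (Re x))" unfolding P_def
 proof (intro conjI exI)
  show "continuous_on (closure W) (%x. open_primitive G (Re x))"
   by (rule continuous_on_compose2[OF open_primitive_facts(7)[OF G(1,2)]]) (auto intro!: continuous_intros)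
  have C1Re: "C1_on W Re (%_. 1)" using W(1) by (auto simp: C1_on_def intro!: derivative_eq_intros)
  show "C1_limit W (%n x. primitive0 (open_approx G n) (Re x)) (%n x. open_approx G n (Re x) *\<^sub>R 1) (max B 1)
   (%x. open_primitive G (Re x)) (%x. indicator G (Re x) *\<^sub>R 1)" unfolding C1_limit_def
  proof (intro conjI allI ballI)
   show "C1_on W (%x. primitive0 (open_approx G n) (Re x)) (%x. open_approx G n (Re x) *\<^sub>R 1)" for n
    by (rule C1_on_compose_real[OF C1Re open_primitive_facts(1)[OF G(1,2)] open_approx_facts(1)[OF G(1,2)]])
   show "\<bar>primitive0 (open_approx G n) (Re x)\<bar> <= max B 1" if "x \<in> W" for n x
    using open_primitive_facts(2)[OF G(1,2), of n "Re x"] abs_Re_le_cmod[of x] B[OF that] by linarith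
   show "norm (open_approx G n (Re x) *\<^sub>R (1::complex)) <= max B 1" for n x
    using open_approx_facts(2,3)[OF G(1,2), of n "Re x"] by simp
   show "(%n. primitive0 (open_approx G n) (Re x)) \<longlonglongrightarrow> open_primitive G (Re x)" for x by (rule open_primitive_facts(3)[OF G(1,2)])
   show "(%n. open_approx G n (Re x) *\<^sub>R 1) \<longlonglongrightarrow> indicator G (Re x) *\<^sub>R (1::complex)" for x
    by (intro tendsto_scaleR open_approx_facts(4)[OF G(1,2)] tendsto_const)
  qed
 qed auto
 have PIm: "P Im" unfolding P_def
 proof (intro conjI exI)
  show "continuous_on (closure W) Im" by (intro continuous_intros)
  show "C1_limit W (%n. Im) (%n x. \<i>) (max B 1) Im (%_. \<i>)"
   using W(1) B order_trans[OF abs_Im_le_cmod] by (auto simp: C1_limit_def C1_on_def intro!: derivative_eq_intros) (meson max.coboundedI1)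
 qed auto
 show ?thesis unfolding uniformly_dense_def
 proof (intro allI impI)
  fix f :: "complex => real" and \<epsilon> :: real assume f: "continuous_on (closure W) f" and eps: "\<epsilon> > 0"
  have "\<exists>g. P g \<and> (\<forall>x\<in>closure W. \<bar>f x - g x\<bar> < \<epsilon>)"
  proof (rule Stone_Weierstrass_HOL[where P = P])
   show "compact (closure W)" using W(2) by (simp add: compact_closure)
   show "P (%x. c)" for c unfolding P_def
   proof (intro conjI exI)
    show "C1_limit W (%n x. c) (%n x. 0) \<bar>c\<bar> (%x. c) (%_. 0)" using W(1) by (auto simp: C1_limit_def C1_on_def)
   qed auto
   show "continuous_on (closure W) f" if "P f" for f using that by (simp add: P_def)
   show "P (%x. f x + g x)" if fg: "P f \<and> P g" for f g
   proof -
    from fg obtain w D M f' where a: "C1_limit W w D M f f'" "\<forall>x\<in>W. Re x \<notin> G --> Re (f' x) = 0" unfolding P_def by (elim exE conjE)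
    from fg obtain v E M' g' where b: "C1_limit W v E M' g g'" "\<forall>x\<in>W. Re x \<notin> G --> Re (g' x) = 0" unfolding P_def by (elim exE conjE)
    show ?thesis unfolding P_def
    proof (intro conjI exI)
     show "continuous_on (closure W) (%x. f x + g x)" using fg by (auto simp: P_def intro!: continuous_intros)
     show "\<forall>x\<in>W. Re x \<notin> G --> Re (f' x + g' x) = 0" using a(2) b(2) by simp
    qed (rule C1_limit_add[OF a(1) b(1)])
   qed
   show "P (%x. f x * g x)" if fg: "P f \<and> P g" for f g
   proof -
    from fg obtain w D M f' where a: "C1_limit W w D M f f'" "\<forall>x\<in>W. Re x \<notin> G --> Re (f' x) = 0" unfolding P_def by (elim exE conjE)
    from fg obtain v E M' g' where b: "C1_limit W v E M' g g'" "\<forall>x\<in>W. Re x \<notin> G --> Re (g' x) = 0" unfolding P_def by (elim exE conjE)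
    show ?thesis unfolding P_def
    proof (intro conjI exI)
     show "continuous_on (closure W) (%x. f x * g x)" using fg by (auto simp: P_def intro!: continuous_intros)
     show "\<forall>x\<in>W. Re x \<notin> G --> Re (f x *\<^sub>R g' x + g x *\<^sub>R f' x) = 0" using a(2) b(2) by simp
    qed (rule C1_limit_mult[OF a(1) b(1)])
   qed
   show "\<exists>f. P f \<and> f x \<noteq> f y" if xy: "x \<in> closure W \<and> y \<in> closure W \<and> x \<noteq> y" for x y
   proof (cases "Im x = Im y")
    case True
    then have "Re x < Re y \<or> Re y < Re x" using xy by (auto simp: complex_eq_iff)
    then have "open_primitive G (Re x) \<noteq> open_primitive G (Re y)"
     using open_primitive_inj[OF G, of "Re x" "Re y"] open_primitive_inj[OF G, of "Re y" "Re x"] by linarith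
    then show ?thesis using PRe by blast
   qed (use PIm in blast)
  qed (use f eps in auto)
  then show "\<exists>a\<in>stair W G. \<forall>x\<in>closure W. \<bar>f x - a x\<bar> < \<epsilon>" using stair by blast
 qed
qed

lemma small_open_superset_rationals:
 assumes "\<delta> > 0"
 shows "\<exists>G::real set. open G \<and> \<rat> \<subseteq> G \<and> - G \<noteq> {} \<and> emeasure lborel G < ennreal \<delta>"
proof -
 have c: "countable (\<rat> :: real set)" by (rule countable_rat)
 have "(\<rat> :: real set) \<in> null_sets lborel" by (rule countable_imp_null_set_lborel[OF c])
 then have s: "(\<rat> :: real set) \<in> sets lborel" "emeasure lborel (\<rat> :: real set) = 0" by auto
 obtain G where G: "open G" "(\<rat> :: real set) \<subseteq> G" "emeasure lborel (G - \<rat>) < ennreal \<delta>"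
  using outer_regular_lborel[of "\<rat> :: real set" \<delta>] s assms by auto
 have "emeasure lborel G <= emeasure lborel (G - \<rat>) + emeasure lborel (\<rat> :: real set)"
  using emeasure_subadditive[of "G - \<rat>" lborel "\<rat> :: real set"] G s by (auto simp: Un_absorb2)
 also have "\<dots> < ennreal \<delta>" using G(3) s(2) by simp
 finally have l: "emeasure lborel G < ennreal \<delta>" .
 have "G \<noteq> UNIV" using l by auto
 then show ?thesis using G l by (intro exI[of _ G]) auto
qed

text \<open>Density in the form norm is \<open>core_H1_dense\<close>; uniform density is inherited
  from the smaller space \<open>stair\<close>, for which any open proper G containing the rationals
  will do.\<close>

lemma refl_BM_regular:
 assumes W: "jordan_domain W"
 shows "regular_dirichlet_form (refl_measure W) (refl_BM_form W)"
proof -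
 note jd = jordan_domain_bounded[OF W]
 obtain G :: "real set" where G: "open G" "\<rat> \<subseteq> G" and Gn: "- G \<noteq> {}"
  using small_open_superset_rationals[OF zero_less_one] by (elim exE conjE)
 let ?A = "core W (H1 W)"
 have sub: "stair W G \<subseteq> ?A" by (auto simp: stair_def)
 have A: "?A \<subseteq> H1 W" "lin_space ?A" "\<And>a. a \<in> ?A ==> trunc a \<in> ?A" "\<And>a. a \<in> ?A ==> continuous_on (closure W) a"
  using psdD(1)[OF psd_H1[OF jd(3)]] trunc_H1(1)[OF jd(3)] by (auto simp: core_def lin_space_def intro!: continuous_intros)
 have "uniformly_dense (closure W) ?A"
  using stair_dense[OF jd(3,1) G(1) Gn G(2)] sub unfolding uniformly_dense_def by blast
 from regular_closure[OF jd(3,1) A(1,2,4,3) this]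
 show ?thesis unfolding refl_BM_form_eq core_H1_dense[OF W, symmetric] .
qed

text \<open>Take \<delta> as the width of a box inside W. An open G of smaller measure cannot cover
  the base of the box up to a null set, and Fubini's theorem turns what is left of the base into
  positive area.\<close>

lemma positive_measure_slab:
 assumes W: "open W" "W \<noteq> {}"
 shows "\<exists>\<delta>>0. \<forall>G. open G --> emeasure lborel G < ennreal \<delta> --> 0 < emeasure lborel (W \<inter> {z. Re z \<notin> G})"
proof -
 obtain c where "c \<in> W" using W by blast
 then obtain a b where ab: "c \<in> box a b" "box a b \<subseteq> W" using open_contains_box[OF W(1)] by metis
 define \<delta> where "\<delta> = Re b - Re a"
 have pos: "\<delta> > 0" "Im b - Im a > 0" using ab(1) by (auto simp: \<delta>_def box_def Basis_complex_def)
 show ?thesis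
 proof (intro exI[of _ \<delta>] conjI allI impI pos)
  fix G :: "real set" assume G: "open G" "emeasure lborel G < ennreal \<delta>"
  let ?Q = "W \<inter> {z. Re z \<notin> G}" and ?I = "{Re a<..<Re b} - G" and ?J = "{Im a<..<Im b}"
  have Qm: "?Q \<in> sets borel"
  proof -
   have "Re -` (- G) \<in> sets borel" using borel_measurable_Re[THEN measurable_sets, of "- G"] G(1) by auto
   then show ?thesis using W(1) by (auto simp: vimage_def)
  qed
  have "ennreal \<delta> = emeasure lborel {Re a<..<Re b}" using pos by (simp add: \<delta>_def)
  also have "\<dots> <= emeasure lborel (?I \<union> G)" using G(1) by (intro emeasure_mono) auto
  also have "\<dots> <= emeasure lborel ?I + emeasure lborel G" using G(1) by (intro emeasure_subadditive) auto
  finally have "emeasure lborel ?I \<noteq> 0" using G(2) by auto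
  moreover have "emeasure lborel ?J \<noteq> 0" using pos by simp
  ultimately have "0 < emeasure lborel ?I * emeasure lborel ?J" by (simp add: zero_less_iff_neq_zero)
  also have "\<dots> = (nnl (%x. \<integral>\<^sup>+y. indicator ?I x * indicator ?J y \<partial>lborel))"
  proof -
   have "?I \<in> sets lborel" using G(1) by auto
   then have "(nnl (%x. indicator ?I x * emeasure lborel ?J)) = emeasure lborel ?I * emeasure lborel ?J"
    by (subst nn_integral_multc) (auto simp: nn_integral_indicator)
   moreover have "(nnl (%y. indicator ?I x * indicator ?J y)) = indicator ?I x * emeasure lborel ?J" for x
    by (rule nn_integral_cmult_indicator) simp
   ultimately show ?thesis by simp
  qed
  also have "\<dots> <= (nnl (%x. \<integral>\<^sup>+y. indicator ?Q (Complex x y) \<partial>lborel))"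
  proof (intro nn_integral_mono)
   fix x y
   have "Complex x y \<in> ?Q" if "x \<in> ?I" "y \<in> ?J" using that ab(2) by (auto simp: box_def Basis_complex_def subset_eq)
   then show "indicator ?I x * indicator ?J y <= (indicator ?Q (Complex x y) :: ennreal)" by (auto simp: indicator_def split: if_splits)
  qed
  also have "\<dots> = emeasure lborel ?Q" using Qm by (subst nn_integral_complex_Fubini[symmetric]) auto
  finally show "0 < emeasure lborel ?Q" .
 qed
qed

text \<open>For a in \<open>stair\<close> the gradient of Re - a has first component 1 on the set Q
  of positive area q. So its energy is at least q and its squared E1 norm at least q/2, which keeps
  Re out of the closure.\<close>

lemma proper_regular_subspace_exists:
 assumes W: "jordan_domain W"
 shows "\<exists>P. proper_regular_subspace (refl_measure W) P (refl_BM_form W)"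
proof -
 note jd = jordan_domain_bounded[OF W]
 from positive_measure_slab[OF jd(3,5)] obtain \<delta>0 where d0: "\<delta>0 > 0"
  "\<forall>G. open G --> emeasure lborel G < ennreal \<delta>0 --> 0 < emeasure lborel (W \<inter> {z. Re z \<notin> G})" by (elim exE conjE)
 from small_open_superset_rationals[OF d0(1)] obtain G :: "real set"
  where G: "open G" "\<rat> \<subseteq> G" and Gn: "- G \<noteq> {}" and Gs: "emeasure lborel G < ennreal \<delta>0" by (elim exE conjE)
 let ?A = "stair W G" and ?Q = "W \<inter> {z. Re z \<notin> G}"
 note A = stair_facts[OF jd(3), where G = G]
 have reg: "regular_dirichlet_form (refl_measure W) (gen_form W (clH W ?A))"
  by (rule regular_closure[OF jd(3,1) A(1,2,3,4) stair_dense[OF jd(3,1) G(1) Gn G(2)]])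
 have Q: "0 < emeasure lborel ?Q" using d0(2) G(1) Gs by blast
 have Qm: "?Q \<in> sets borel"
 proof -
  have "Re -` (- G) \<in> sets borel" using borel_measurable_Re[THEN measurable_sets, of "- G"] G(1) by auto
  then show ?thesis using jd(3) by (auto simp: vimage_def)
 qed
 have Qb: "bounded ?Q" using jd(1) bounded_subset by blast
 define q where "q = measure lborel ?Q"
 have q: "q > 0" using Q emeasure_bounded_finite[OF Qb] by (simp add: q_def measure_def enn2real_positive_iff)
 have cRe: "continuous_on (closure W) Re" by (intro continuous_intros)
 have C1Re: "C1_on W Re (%_. 1)" using jd(3) by (auto simp: C1_on_def intro!: derivative_eq_intros)
 have wRe: "is_weak_gradient W Re (%_. 1)" by (rule C1_on_weak_gradient[OF C1Re])
 have "sint W (%_. (1::real))" by (rule set_integrable_const_bounded) (use jd in auto)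
 then have "Re \<in> Hd W" by (intro HdI[OF wRe]) simp
 then have ReH: "Re \<in> H1 W" using continuous_bounded_L2(1)[OF jd(3,1) cRe] by (simp add: H1_iff)
 have "Re \<notin> clH W ?A"
 proof
  assume "Re \<in> clH W ?A"
  moreover have "q / 2 > 0" using q by simp
  ultimately have "\<exists>a\<in>?A. E1sq W (%x. Re x - a x) < q / 2" unfolding clH_def by blast
  then obtain a where a: "a \<in> ?A" "E1sq W (%x. Re x - a x) < q / 2" by (elim bexE)
  obtain g where g: "is_weak_gradient W a g" "\<forall>x\<in>W. Re x \<notin> G --> Re (g x) = 0" using a(1) unfolding stair_def by blast
  have aH: "a \<in> H1 W" using a(1) A(1) by blast
  have dH: "(%x. Re x - a x) \<in> H1 W" by (rule psd_diff[OF psd_H1[OF jd(3)] ReH aH])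
  have wd: "is_weak_gradient W (%x. Re x - a x) (%x. 1 - g x)"
   using is_weak_gradient_lincomb[OF wRe g(1), of 1 "-1"] by simp
  have di: "sint W (%x. (norm (1 - g x))^2)"
  proof -
   have "(%x. Re x - a x) \<in> Hd W" using dH by (simp add: H1_iff)
   note wg = weak_gradient_Hd(1)[OF jd(3) this] and wi = weak_gradient_Hd(4)[OF jd(3) this]
   have ae: "AE x in lborel. x \<in> W --> weak_gradient W (%x. Re x - a x) x = 1 - g x" by (rule weak_gradient_unique[OF jd(3) wg wd])
   have m: "bm (%x. indicator W x *\<^sub>R (1 - g x))"
    by (rule locally_integrable_measurable_open[OF jd(3)]) (use wd in \<open>simp add: is_weak_gradient_def\<close>)
   have "bm (%x. (norm (indicator W x *\<^sub>R (1 - g x)))^2)" using m by measurable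
   then have m2: "(%x. indicator W x *\<^sub>R (norm (1 - g x))\<^sup>2) \<in> borel_measurable lborel" unfolding norm_sq_indicator by simp
   show ?thesis unfolding set_integrable_def
   proof (rule integrable_cong_AE_imp[OF wi[unfolded set_integrable_def] m2])
    show "AE x in lborel. indicator W x *\<^sub>R (norm (weak_gradient W (%x. Re x - a x) x))\<^sup>2 = indicator W x *\<^sub>R (norm (1 - g x))\<^sup>2"
     using ae by eventually_elim (simp add: indicator_def)
   qed
  qed
  have "q = (LINT x|lborel. indicator ?Q x)" using Qm by (simp add: q_def)
  also have "\<dots> <= (LBINT x:W. (norm (1 - g x))\<^sup>2)" unfolding set_lebesgue_integral_def
  proof (rule integral_mono)
   show "integrable lborel (indicator ?Q :: complex => real)"
    by (rule integrable_real_indicator) (use Qm emeasure_bounded_finite[OF Qb] in auto)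
   show "integrable lborel (%x. indicator W x *\<^sub>R (norm (1 - g x))\<^sup>2)" using di by (simp add: set_integrable_def)
   fix x
   have "1 <= (norm (1 - g x))^2" if "x \<in> ?Q"
   proof -
    have "1 = Re (1 - g x)" using g(2) that by simp
    also have "\<dots> <= norm (1 - g x)" by (rule complex_Re_le_cmod)
    finally show ?thesis by (simp add: one_le_power)
   qed
   then show "indicator ?Q x <= indicator W x *\<^sub>R (norm (1 - g x))\<^sup>2" by (auto simp: indicator_def)
  qed
  also have "\<dots> = energy W (%x. Re x - a x)" by (rule dirichlet_integral_self[OF jd(3) wd, symmetric])
  also have "\<dots> < q" using E1_parts(1)[OF jd(3) dH] a(2) by linarith
  finally show False by simp
 qed
 then have "clH W ?A \<noteq> H1 W" using ReH by blast
 moreover have "regular_subspace (refl_measure W) (gen_form W (clH W ?A)) (refl_BM_form W)"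
  by (rule gen_form_subspace[OF reg refl_BM_regular[OF W]]) (auto simp: clH_def)
 ultimately show ?thesis
  unfolding proper_regular_subspace_def by (intro exI[of _ "gen_form W (clH W ?A)"]) (simp add: refl_BM_form_eq)
qed

theorem proposition3p8:
  fixes U V :: "complex set" and f :: "complex \<Rightarrow> complex"
  assumes "jordan_domain U" and "jordan_domain V"
    and "biholomorphic_closure_homeo U V f"
  shows "(\<forall>PV. regular_subspace (refl_measure V) PV (refl_BM_form V) \<longrightarrow>
            (\<exists>!PU. regular_subspace (refl_measure U) PU (refl_BM_form U) \<and>
                   PV = conformal_transform U V f PU)) \<and>
         (\<forall>W. jordan_domain W \<longrightarrow>
            (\<exists>P. proper_regular_subspace (refl_measure W) P (refl_BM_form W)))"
proof (intro conjI allI impI proper_regular_subspace_exists)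
  note U = jordan_domain_bounded[OF assms(1)] and V = jordan_domain_bounded[OF assms(2)]
  obtain g where "homeomorphism (closure U) (closure V) f g" "f ` U = V" "f holomorphic_on U" "g holomorphic_on V"
    using assms(3) unfolding biholomorphic_closure_homeo_def by (elim exE conjE)
  then have c: "conf_pair U V f g" using U V by (simp add: conf_pair_def)
  fix PV assume "regular_subspace (refl_measure V) PV (refl_BM_form V)"
  from conformal_transform_unique_preimage[OF c this refl_BM_regular[OF assms(1)] refl_BM_regular[OF assms(2)]]
  show "\<exists>!PU. regular_subspace (refl_measure U) PU (refl_BM_form U) \<and> PV = conformal_transform U V f PU" .
qed

end
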